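(* Let $\mathcal T$ be a regular rooted tree with generation levels $t_0,\dots,t_{N_{\mathcal T}}$ and branching numbers $b_0,\dots,b_{N_{\mathcal T}}$, and let $m_\infty=b_0b_1\cdots b_{N_{\mathcal T}}$. For $\mathrm X\in\{\mathrm D,\mathrm N\}$ let $\lambda_1^{\mathrm X}\le\lambda_2^{\mathrm X}\le\dots$ be the eigenvalues, repeated according to multiplicity, of the realisation $\mathcal A^{\mathrm X}$ of the Ornstein–Uhlenbeck operator on $L^2_\mu(\mathcal T)$, and let $\lambda_n^{\mathrm X,(k)}$ be the eigenvalues in increasing order of the reduced operators $\mathfrak A_k^{\mathrm X}$ on $L^2_\nu([t_k,\infty))$ (see context). For each $n\in\mathbb N$, the Dirichlet eigenvalues satisfy $$\lambda_n^{\mathrm D,(0)}\le\lambda^{\mathrm D}_{m_\infty(n-1)+1}\le\cdots\le\lambda^{\mathrm D}_{m_\infty n}\le\lambda_n^{\mathrm D,(N_{\mathcal T})}$$ and the Neumann eigenvalues satisfy $$\lambda_n^{\mathrm N,(0)}\le\lambda^{\mathrm N}_{m_\infty(n-1)+1}\le\cdots\le\lambda^{\mathrm N}_{m_\infty n}\le\lambda_n^{\mathrm D,(N_{\mathcal T})}.$$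
   Context: Regular rooted tree. Let $\widetilde{\mathcal T}$ be a compact rooted metric tree (finite tree, edges of finite positive length) with vertex set $\mathsf V$, root $\mathsf o$, and nonempty set $\mathsf L\subset\mathsf V\setminus\{\mathsf o\}$ of leaves (degree-one vertices other than the root); $\mathcal T$ is obtained by attaching to each vertex of $\mathsf L$ a finite non-zero number of half-lines. $|x|$ is the path distance of $x\in\mathcal T$ to $\mathsf o$; edges are oriented and parametrised by arc length away from the root, with $f'$ the weak derivative in this coordinate. $\mathcal T$ is regular if there are $N_{\mathcal T}\in\mathbb N$, levels $0=t_0<t_1<\dots<t_{N_{\mathcal T}}$ and positive integers $b_0,\dots,b_{N_{\mathcal T}}$ such that: $\mathsf V=\bigsqcup_{k=0}^{N_{\mathcal T}}\mathsf V_k$ with $\mathsf V_k=\{\mathsf v\in\mathsf V:|\mathsf v|=t_k\}$; every $\mathsf v\in\mathsf V_k$ has exactly $b_k$ outgoing edges (edges emanating away from the root); and $\mathsf V_{N_{\mathcal T}}=\mathsf L$ (so each such vertex carries $b_{N_{\mathcal T}}$ half-lines). $m_\infty$ is the total number of half-lines. Let $g_{\mathcal T}(t)=\#\{x\in\mathcal T:|x|=t\}$. Operators on the tree. $G(t)=\frac2{\sqrt\pi}e^{-t^2}$, $\mu(\mathrm dx)=G(|x|)\,\mathrm dx$ on $\mathcal T$. $H^1_\mu(\mathcal T)$: continuous functions on $\mathcal T$ lying in $H^1_\mu(\mathsf e)$ on each edge $\mathsf e$; $H^1_{0,\mu}(\mathcal T)$: those vanishing at $\mathsf o$. $\mathcal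 A^{\mathrm D}$ (resp. $\mathcal A^{\mathrm N}$) is the self-adjoint operator on $L^2_\mu(\mathcal T)$ associated with the closed form $\frac12\int_{\mathcal T}f'\,\overline{h'}\,\mathrm d\mu$ on $H^1_{0,\mu}(\mathcal T)$ (resp. $H^1_\mu(\mathcal T)$). Equivalently: $-\frac12f''+|x|f'$ on edges with $f$ edgewise in $H^2_\mu$, continuous at vertices, zero sum of derivatives pointing away from the vertex at every vertex $\ne\mathsf o$, and at $\mathsf o$ the condition $f(\mathsf o)=0$ (resp. the same zero-sum condition). Both have compact resolvent. Reduced operators. $\nu(\mathrm dt)=g_{\mathcal T}(t)G(t)\,\mathrm dt$ on $[0,\infty)$. For $k\in\{0,\dots,N_{\mathcal T}\}$, $\mathfrak A_k^{\mathrm D}$ (resp. $\mathfrak A_k^{\mathrm N}$) is the self-adjoint operator on $L^2_\nu([t_k,\infty))$ associated with the closed form $\frac12\int_{t_k}^\infty\varphi'\,\overline{\psi'}\,\mathrm d\nu$ on $H^1_{0,\nu}([t_k,\infty))=\{\varphi\in H^1_\nu([t_k,\infty)):\varphi(t_k)=0\}$ (resp. $H^1_\nu([t_k,\infty))$). *)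

theory Defs
  imports
    "HOL-Analysis.Analysis"
    "Graph_Theory.Digraph"
    "Graph_Theory.Arc_Walk"
    "Graph_Theory.Weighted_Graph"
begin

section \<open>Square-integrable functions and operators associated with forms\<close>

text \<open>Elements of \<open>L\<^sup>2(M)\<close> are represented by functions; equality in \<open>L\<^sup>2(M)\<close> is equality
  almost everywhere, and linear independence and spanning below are understood in that sense.\<close>

definition L2_set :: "'a measure \<Rightarrow> ('a \<Rightarrow> complex) set" where
  "L2_set M = {u \<in> borel_measurable M. integrable M (\<lambda>x. (cmod (u x))\<^sup>2)}"

definition L2_inner :: "'a measure \<Rightarrow> ('a \<Rightarrow> complex) \<Rightarrow> ('a \<Rightarrow> complex) \<Rightarrow> complex" where
  "L2_inner M u v = (LINT x|M. u x * cnj (v x))"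

text \<open>The graph of the operator on \<open>L\<^sup>2(M)\<close> associated with the form \<open>a\<close> with domain \<open>D\<close>.\<close>

definition form_operator ::
  "'a measure \<Rightarrow> ('a \<Rightarrow> complex) set \<Rightarrow> (('a \<Rightarrow> complex) \<Rightarrow> ('a \<Rightarrow> complex) \<Rightarrow> complex)
    \<Rightarrow> ('a \<Rightarrow> complex) rel" where
  "form_operator M D a =
     {(f, u). f \<in> D \<and> u \<in> L2_set M \<and> (\<forall>h\<in>D. a f h = L2_inner M u h)}"

definition eigenspace :: "('a \<Rightarrow> complex) rel \<Rightarrow> complex \<Rightarrow> ('a \<Rightarrow> complex) set" where
  "eigenspace A z = {f. (f, \<lambda>x. z * f x) \<in> A}"

definition has_L2_dim :: "'a measure \<Rightarrow> ('a \<Rightarrow> complex) set \<Rightarrow> nat \<Rightarrow> bool" where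
  "has_L2_dim M E d \<longleftrightarrow>
     (\<exists>e. (\<forall>i<d. e i \<in> E) \<and>
          (\<forall>c. (AE x in M. (\<Sum>i<d. c i * e i x) = 0) \<longrightarrow> (\<forall>i<d. c i = 0)) \<and>
          (\<forall>f\<in>E. \<exists>c. AE x in M. f x = (\<Sum>i<d. c i * e i x)))"

text \<open>\<open>lam 1 \<le> lam 2 \<le> \<dots>\<close> lists all eigenvalues of \<open>A\<close>, each repeated according to its
  multiplicity; the value \<open>lam 0\<close> is irrelevant.\<close>

definition eigenvalue_sequence ::
  "'a measure \<Rightarrow> ('a \<Rightarrow> complex) rel \<Rightarrow> (nat \<Rightarrow> real) \<Rightarrow> bool" where
  "eigenvalue_sequence M A lam \<longleftrightarrow>
     mono_on {1..} lam \<and>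
     (\<forall>z. finite {n. 1 \<le> n \<and> complex_of_real (lam n) = z} \<and>
          has_L2_dim M (eigenspace A z) (card {n. 1 \<le> n \<and> complex_of_real (lam n) = z}))"


section \<open>Weighted Sobolev spaces on intervals\<close>

definition C1_test_function :: "real set \<Rightarrow> (real \<Rightarrow> real) \<Rightarrow> bool" where
  "C1_test_function S \<phi> \<longleftrightarrow>
     (\<forall>x. \<phi> differentiable (at x)) \<and> continuous_on UNIV (deriv \<phi>) \<and>
     compact (closure {x. \<phi> x \<noteq> 0}) \<and> closure {x. \<phi> x \<noteq> 0} \<subseteq> S"

definition is_weak_deriv ::
  "real set \<Rightarrow> (real \<Rightarrow> complex) \<Rightarrow> (real \<Rightarrow> complex) \<Rightarrow> bool" where
  "is_weak_deriv S f w \<longleftrightarrow>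
     (\<forall>K. compact K \<and> K \<subseteq> S \<longrightarrow> set_integrable lborel K f \<and> set_integrable lborel K w) \<and>
     (\<forall>\<phi>. C1_test_function S \<phi> \<longrightarrow>
        (LINT x:S|lborel. f x * complex_of_real (deriv \<phi> x)) =
        - (LINT x:S|lborel. w x * complex_of_real (\<phi> x)))"

text \<open>In the following, \<open>K\<close> is a measure on a closed interval \<open>space K\<close> that has a density
  bounded below by a positive constant on compact subsets.  An element of \<open>H\<^sup>1\<close> is represented by its
  continuous representative on \<open>space K\<close>, so that its boundary values are its ordinary values.\<close>

definition H1 :: "real measure \<Rightarrow> (real \<Rightarrow> complex) set" where
  "H1 K = {f \<in> L2_set K. continuous_on (space K) f \<and>
                (\<exists>w \<in> L2_set K. is_weak_deriv (interior (space K)) f w)}"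

text \<open>The choice is unique up to null sets, so it is immaterial in integrals.\<close>

definition weak_deriv :: "real measure \<Rightarrow> (real \<Rightarrow> complex) \<Rightarrow> real \<Rightarrow> complex" where
  "weak_deriv K f = (SOME w. is_weak_deriv (interior (space K)) f w)"


section \<open>Rooted metric trees with half-lines\<close>

text \<open>\<open>graph\<close> is the underlying finite rooted tree, with its edges oriented away from \<open>root\<close>, and
  \<open>len\<close> its edge lengths.  \<open>rays\<close> indexes the half-lines, the half-line \<open>h\<close> being attached at
  \<open>foot h\<close>.\<close>

record ('v, 'e, 'h) tree_data =
  graph :: "('v, 'e) pre_digraph"
  root :: 'v
  len :: "'e \<Rightarrow> real"
  rays :: "'h set"
  foot :: "'h \<Rightarrow> 'v"

definition leaves :: "('v, 'e, 'h) tree_data \<Rightarrow> 'v set" where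
  "leaves T = {v \<in> verts (graph T).
     v \<noteq> root T \<and> in_degree (graph T) v + out_degree (graph T) v = 1}"

definition rooted_metric_tree :: "('v, 'e, 'h) tree_data \<Rightarrow> bool" where
  "rooted_metric_tree T \<longleftrightarrow>
     fin_digraph (graph T) \<and> root T \<in> verts (graph T) \<and>
     (\<forall>v \<in> verts (graph T). \<exists>!p. pre_digraph.awalk (graph T) (root T) p v) \<and>
     (\<forall>e \<in> arcs (graph T). 0 < len T e) \<and>
     leaves T \<noteq> {} \<and> finite (rays T) \<and> foot T ` rays T = leaves T"

text \<open>Path distance of a vertex to the root.\<close>

definition depth :: "('v, 'e, 'h) tree_data \<Rightarrow> 'v \<Rightarrow> real" where
  "depth T v = wf_digraph.awalk_cost (len T)
     (THE p. pre_digraph.awalk (graph T) (root T) p v)"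

text \<open>The edges of the tree with half-lines: \<open>Inl\<close> marks the edges of finite length and \<open>Inr\<close> the
  half-lines.\<close>

definition edges :: "('v, 'e, 'h) tree_data \<Rightarrow> ('e + 'h) set" where
  "edges T = arcs (graph T) <+> rays T"

fun start :: "('v, 'e, 'h) tree_data \<Rightarrow> 'e + 'h \<Rightarrow> 'v" where
  "start T (Inl e) = tail (graph T) e"
| "start T (Inr h) = foot T h"

text \<open>Every edge is parametrised by the distance to the root, which differs from the arc length
  from its initial vertex by a constant.\<close>

fun edge_dom :: "('v, 'e, 'h) tree_data \<Rightarrow> 'e + 'h \<Rightarrow> real set" where
  "edge_dom T (Inl e) = {depth T (tail (graph T) e) .. depth T (tail (graph T) e) + len T e}"
| "edge_dom T (Inr h) = {depth T (foot T h) ..}"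

datatype ('v, 'c) point = Vertex 'v | Inner 'c real

fun edge_point :: "('v, 'e, 'h) tree_data \<Rightarrow> 'e + 'h \<Rightarrow> real \<Rightarrow> ('v, 'e + 'h) point" where
  "edge_point T (Inl e) s =
     (if s = depth T (tail (graph T) e) then Vertex (tail (graph T) e)
      else if s = depth T (tail (graph T) e) + len T e then Vertex (head (graph T) e)
      else Inner (Inl e) s)"
| "edge_point T (Inr h) s =
     (if s = depth T (foot T h) then Vertex (foot T h) else Inner (Inr h) s)"

definition points :: "('v, 'e, 'h) tree_data \<Rightarrow> ('v, 'e + 'h) point set" where
  "points T = Vertex ` verts (graph T) \<union>
     {Inner c s | c s. c \<in> edges T \<and> s \<in> interior (edge_dom T c)}"

fun root_dist :: "('v, 'e, 'h) tree_data \<Rightarrow> ('v, 'e + 'h) point \<Rightarrow> real" where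
  "root_dist T (Vertex v) = depth T v"
| "root_dist T (Inner c s) = s"

definition growth :: "('v, 'e, 'h) tree_data \<Rightarrow> real \<Rightarrow> nat" where
  "growth T s = card {x \<in> points T. root_dist T x = s}"

text \<open>The levels \<open>t k\<close> are defined by distances only, so an edge may jump over a level whose
  vertices lie on other branches.  The number of half-lines is then at most \<open>b 0 * \<dots> * b N\<close>, and
  equality holds if all edges join consecutive levels.  That the two numbers agree is stated
  separately where it is used.\<close>

definition regular_tree ::
  "('v, 'e, 'h) tree_data \<Rightarrow> nat \<Rightarrow> (nat \<Rightarrow> real) \<Rightarrow> (nat \<Rightarrow> nat) \<Rightarrow> bool" where
  "regular_tree T N t b \<longleftrightarrow>
     rooted_metric_tree T \<and>
     t 0 = 0 \<and> (\<forall>k<N. t k < t (Suc k)) \<and> (\<forall>k\<le>N. 0 < b k) \<and>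
     verts (graph T) = (\<Union>k\<le>N. {v \<in> verts (graph T). depth T v = t k}) \<and>
     (\<forall>k\<le>N. \<forall>v \<in> verts (graph T). depth T v = t k \<longrightarrow>
        card {c \<in> edges T. start T c = v} = b k) \<and>
     {v \<in> verts (graph T). depth T v = t N} = leaves T"


section \<open>The Ornstein--Uhlenbeck operators on the tree\<close>

definition gauss :: "real \<Rightarrow> real" where
  "gauss s = 2 / sqrt pi * exp (- s\<^sup>2)"

text \<open>The length measure on the tree: the sum of the one-dimensional Lebesgue measures of the
  edges.\<close>

definition tree_length :: "('v, 'e, 'h) tree_data \<Rightarrow> ('v, 'e + 'h) point measure" where
  "tree_length T = measure_of (points T)
     {B. B \<subseteq> points T \<and> (\<forall>c \<in> edges T. {s \<in> edge_dom T c. edge_point T c s \<in> B} \<in> sets lborel)}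
     (\<lambda>B. \<Sum>c \<in> edges T. emeasure lborel {s \<in> edge_dom T c. edge_point T c s \<in> B})"

definition tree_mu :: "('v, 'e, 'h) tree_data \<Rightarrow> ('v, 'e + 'h) point measure" where
  "tree_mu T = density (tree_length T) (\<lambda>x. ennreal (gauss (root_dist T x)))"

definition edge_mu :: "('v, 'e, 'h) tree_data \<Rightarrow> 'e + 'h \<Rightarrow> real measure" where
  "edge_mu T c = density (restrict_space lborel (edge_dom T c)) (\<lambda>s. ennreal (gauss s))"

text \<open>A function on the tree has one value at each vertex, so continuity on all closed edges is
  continuity on the tree.\<close>

definition tree_H1 :: "('v, 'e, 'h) tree_data \<Rightarrow> (('v, 'e + 'h) point \<Rightarrow> complex) set" where
  "tree_H1 T = {f. \<forall>c \<in> edges T. (\<lambda>s. f (edge_point T c s)) \<in> H1 (edge_mu T c)}"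

definition tree_H1_0 :: "('v, 'e, 'h) tree_data \<Rightarrow> (('v, 'e + 'h) point \<Rightarrow> complex) set" where
  "tree_H1_0 T = {f \<in> tree_H1 T. f (Vertex (root T)) = 0}"

text \<open>The value at the vertices, which form a null set, is immaterial.\<close>

fun tree_deriv :: "('v, 'e, 'h) tree_data \<Rightarrow> (('v, 'e + 'h) point \<Rightarrow> complex)
    \<Rightarrow> ('v, 'e + 'h) point \<Rightarrow> complex" where
  "tree_deriv T f (Vertex v) = 0"
| "tree_deriv T f (Inner c s) = weak_deriv (edge_mu T c) (\<lambda>r. f (edge_point T c r)) s"

definition tree_form :: "('v, 'e, 'h) tree_data \<Rightarrow> (('v, 'e + 'h) point \<Rightarrow> complex)
    \<Rightarrow> (('v, 'e + 'h) point \<Rightarrow> complex) \<Rightarrow> complex" where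
  "tree_form T f h = 1 / 2 * (LINT x|tree_mu T. tree_deriv T f x * cnj (tree_deriv T h x))"

definition OU_D :: "('v, 'e, 'h) tree_data \<Rightarrow> (('v, 'e + 'h) point \<Rightarrow> complex) rel" where
  "OU_D T = form_operator (tree_mu T) (tree_H1_0 T) (tree_form T)"

definition OU_N :: "('v, 'e, 'h) tree_data \<Rightarrow> (('v, 'e + 'h) point \<Rightarrow> complex) rel" where
  "OU_N T = form_operator (tree_mu T) (tree_H1 T) (tree_form T)"


section \<open>The reduced operators\<close>

definition nu :: "('v, 'e, 'h) tree_data \<Rightarrow> real measure" where
  "nu T = density (restrict_space lborel {0..}) (\<lambda>s. ennreal (real (growth T s) * gauss s))"

definition nu_from :: "('v, 'e, 'h) tree_data \<Rightarrow> real \<Rightarrow> real measure" where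
  "nu_from T a = restrict_space (nu T) {a..}"

definition reduced_form :: "('v, 'e, 'h) tree_data \<Rightarrow> real \<Rightarrow> (real \<Rightarrow> complex)
    \<Rightarrow> (real \<Rightarrow> complex) \<Rightarrow> complex" where
  "reduced_form T a \<phi> \<psi> = 1 / 2 *
     (LINT s|nu_from T a. weak_deriv (nu_from T a) \<phi> s * cnj (weak_deriv (nu_from T a) \<psi> s))"

definition reduced_D :: "('v, 'e, 'h) tree_data \<Rightarrow> real \<Rightarrow> (real \<Rightarrow> complex) rel" where
  "reduced_D T a =
     form_operator (nu_from T a) {\<phi> \<in> H1 (nu_from T a). \<phi> a = 0} (reduced_form T a)"

definition reduced_N :: "('v, 'e, 'h) tree_data \<Rightarrow> real \<Rightarrow> (real \<Rightarrow> complex) rel" where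
  "reduced_N T a = form_operator (nu_from T a) (H1 (nu_from T a)) (reduced_form T a)"

end

theory Submission
  imports
    Defs
    "HOL-Complex_Analysis.Great_Picard"
    "HOL-Real_Asymp.Real_Asymp"
begin

text \<open>
  The proof brackets the operator on the tree between copies of the reduced operators, without
  decomposing it.  Restricting a function \<open>f\<close> on the tree to the \<open>m\<close> paths from the root to the
  half-lines yields \<open>m\<close> functions on \<open>[0, \<infinity>)\<close>.  A point at distance \<open>s\<close> lies on as many of
  these paths as there are half-lines below it, and by regularity this number times the growth at
  \<open>s\<close> is \<open>m\<close>; hence, up to the factor \<open>m\<close>, the restriction preserves norms and forms, and the
  lower bound follows by counting dimensions.  For the upper bound, the first \<open>n\<close> eigenfunctions
  of the reduced Dirichlet operator at the last level, placed on single half-lines, span a trial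
  space of dimension \<open>m n\<close>.

  Both steps need the variational principle, hence compactness.  A bounded sequence in a Gaussian
  Sobolev space is locally equicontinuous, so that a subsequence converges pointwise; the bound
  \<open>\<integral> x |f x - f \<alpha>|\<^sup>2 exp (-x\<^sup>2) dx \<le> \<integral> |f'|\<^sup>2 exp (-x\<^sup>2) dx\<close> over \<open>[\<alpha>, \<infinity>)\<close>, \<open>\<alpha> \<ge> 1\<close>,
  controls the tails.  A minimiser of the Rayleigh quotient on the complement of finitely many
  eigenfunctions is then again an eigenfunction.
\<close>

section \<open>Semi-inner products and eigenvalues of forms\<close>

text \<open>Existence of the eigenvalue sequences is assumed, so no spectral theorem is proved: the
  hypotheses say that the listed eigenfunctions exhaust every eigenspace. A function violating the
  variational inequality for \<Lambda> while orthogonal to the listed eigenfunctions below \<Lambda>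
  would yield a further eigenfunction below \<Lambda>, which exhaustion forbids; compactness serves
  only this step.

  Elements of L2 are functions and not classes, so inner products are only semidefinite. The
  abstract layer is phrased for semi-inner products and tolerates null vectors throughout.

  The indices in the claim come from counting. The first \<open>m * (n - 1) + 1\<close>
  eigenfunctions on the tree face at most \<open>n - 1\<close> orthogonality conditions on each of
  the \<open>m\<close> paths, so a nontrivial combination satisfies them all; dually,
  \<open>m * n\<close> trial functions face at most \<open>m * n - 1\<close> conditions. Neither map
  between the tree and the intervals has to be onto, since each inequality needs an embedding in one
  direction only, and the common factor \<open>m\<close> cancels in the Rayleigh quotients.\<close>

locale semi_inner =
  fixes V :: "('a \<Rightarrow> complex) set" and B :: "('a \<Rightarrow> complex) \<Rightarrow> ('a \<Rightarrow> complex) \<Rightarrow> complex"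
  assumes zero: "(\<lambda>x. 0) \<in> V"
    and add: "f \<in> V \<Longrightarrow> g \<in> V \<Longrightarrow> (\<lambda>x. f x + g x) \<in> V"
    and scale: "f \<in> V \<Longrightarrow> (\<lambda>x. c * f x) \<in> V"
    and B_add: "f \<in> V \<Longrightarrow> g \<in> V \<Longrightarrow> h \<in> V \<Longrightarrow> B (\<lambda>x. f x + g x) h = B f h + B g h"
    and B_scale: "f \<in> V \<Longrightarrow> h \<in> V \<Longrightarrow> B (\<lambda>x. c * f x) h = c * B f h"
    and B_sym: "f \<in> V \<Longrightarrow> g \<in> V \<Longrightarrow> B g f = cnj (B f g)"
    and B_nonneg: "f \<in> V \<Longrightarrow> 0 \<le> Re (B f f)"
begin

abbreviation nsq :: "('a \<Rightarrow> complex) \<Rightarrow> real" where "nsq f \<equiv> Re (B f f)"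

lemma diff: "f \<in> V \<Longrightarrow> g \<in> V \<Longrightarrow> (\<lambda>x. f x - g x) \<in> V"
  using add[OF _ scale[of g "-1"], of f] by simp

lemma B_self: "f \<in> V \<Longrightarrow> B f f = of_real (nsq f)"
  using B_sym[of f f] by (simp add: complex_eq_iff)

lemma B_add_right: "f \<in> V \<Longrightarrow> g \<in> V \<Longrightarrow> h \<in> V \<Longrightarrow> B h (\<lambda>x. f x + g x) = B h f + B h g"
  using B_sym[of "\<lambda>x. f x + g x" h] B_sym[of f h] B_sym[of g h] by (simp add: B_add add)

lemma B_scale_right: "f \<in> V \<Longrightarrow> h \<in> V \<Longrightarrow> B h (\<lambda>x. c * f x) = cnj c * B h f"
  using B_sym[of "\<lambda>x. c * f x" h] B_sym[of f h] by (simp add: B_scale scale)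

lemma B_diff: "f \<in> V \<Longrightarrow> g \<in> V \<Longrightarrow> h \<in> V \<Longrightarrow> B (\<lambda>x. f x - g x) h = B f h - B g h"
  using B_add[of f "\<lambda>x. (-1) * g x" h] B_scale[of g h "-1"] scale[of g "-1"] by simp

lemma B_diff_right: "f \<in> V \<Longrightarrow> g \<in> V \<Longrightarrow> h \<in> V \<Longrightarrow> B h (\<lambda>x. f x - g x) = B h f - B h g"
  using B_add_right[of f "\<lambda>x. (-1) * g x" h] B_scale_right[of g h "-1"] scale[of g "-1"] by simp

lemma sum_mem: "(\<And>i. i \<in> I \<Longrightarrow> f i \<in> V) \<Longrightarrow> (\<lambda>x. \<Sum>i\<in>I. f i x) \<in> V"
  by (induction I rule: infinite_finite_induct) (auto intro: zero add)

lemma B_zero: "h \<in> V \<Longrightarrow> B (\<lambda>x. 0) h = 0"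
  using B_scale[OF zero, of h 0] by simp

lemma B_sum: "h \<in> V \<Longrightarrow> (\<And>i. i \<in> I \<Longrightarrow> f i \<in> V) \<Longrightarrow> B (\<lambda>x. \<Sum>i\<in>I. f i x) h = (\<Sum>i\<in>I. B (f i) h)"
  by (induction I rule: infinite_finite_induct) (auto simp: B_zero B_add sum_mem)

lemma B_sum_right:
  assumes "h \<in> V" "\<And>i. i \<in> I \<Longrightarrow> f i \<in> V"
  shows "B h (\<lambda>x. \<Sum>i\<in>I. f i x) = (\<Sum>i\<in>I. B h (f i))"
proof -
  have "B h (\<lambda>x. \<Sum>i\<in>I. f i x) = cnj (B (\<lambda>x. \<Sum>i\<in>I. f i x) h)"
    using assms by (intro B_sym sum_mem)
  also have "\<dots> = (\<Sum>i\<in>I. cnj (B (f i) h))"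
    using assms by (simp add: B_sum)
  also have "\<dots> = (\<Sum>i\<in>I. B h (f i))"
    using assms by (intro sum.cong refl) (metis B_sym)
  finally show ?thesis .
qed

lemma nsq_add:
  assumes "f \<in> V" "g \<in> V"
  shows "nsq (\<lambda>x. f x + g x) = nsq f + 2 * Re (B f g) + nsq g"
  using assms B_sym[of f g] by (simp add: B_add B_add_right add)

lemma nsq_diff:
  assumes "f \<in> V" "g \<in> V"
  shows "nsq (\<lambda>x. f x - g x) = nsq f - 2 * Re (B f g) + nsq g"
  using assms B_sym[of f g] by (simp add: B_diff B_diff_right diff)

lemma nsq_scale:
  assumes "f \<in> V"
  shows "nsq (\<lambda>x. c * f x) = (cmod c)\<^sup>2 * nsq f"
proof -
  have "B (\<lambda>x. c * f x) (\<lambda>x. c * f x) = c * cnj c * B f f"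
    using assms by (simp add: B_scale scale B_scale_right)
  also have "\<dots> = of_real ((cmod c)\<^sup>2 * nsq f)"
    by (subst B_self[OF assms]) (simp only: complex_norm_square of_real_mult)
  finally show ?thesis by simp
qed

lemma Cauchy_Schwarz:
  assumes f: "f \<in> V" and g: "g \<in> V"
  shows "(cmod (B f g))\<^sup>2 \<le> nsq f * nsq g"
proof -
  \<comment> \<open>The form of f - s B(f,g) g. The factor \<open>B f g\<close> makes the cross term
    real, and \<open>s\<close> stays free because two values are needed: 1 / \<open>nsq g\<close> in
    general, and a large one when \<open>g\<close> is a null vector.\<close>
  have key: "0 \<le> nsq f - 2 * s * (cmod (B f g))\<^sup>2 + s\<^sup>2 * (cmod (B f g))\<^sup>2 * nsq g" for s :: real
  proof -
    let ?c = "of_real s * B f g"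
    have sc: "nsq (\<lambda>x. ?c * g x) = (cmod ?c)\<^sup>2 * nsq g"
      using g by (rule nsq_scale)
    have sd: "nsq (\<lambda>x. f x - ?c * g x) = nsq f - 2 * Re (B f (\<lambda>x. ?c * g x)) + nsq (\<lambda>x. ?c * g x)"
      using f g by (intro nsq_diff scale)
    have sr: "B f (\<lambda>x. ?c * g x) = cnj ?c * B f g"
      using f g by (intro B_scale_right)
    have "0 \<le> nsq (\<lambda>x. f x - ?c * g x)"
      using f g by (intro B_nonneg diff scale)
    also have "\<dots> = nsq f - 2 * Re (cnj ?c * B f g) + (cmod ?c)\<^sup>2 * nsq g"
      by (simp only: sd sr sc)
    also have "Re (cnj ?c * B f g) = s * (cmod (B f g))\<^sup>2"
      by (simp add: cmod_power2) (simp add: algebra_simps power2_eq_square)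
    finally show ?thesis
      by (simp add: norm_mult power_mult_distrib algebra_simps)
  qed
  show ?thesis
  proof (cases "nsq g = 0")
    case True
    have "(cmod (B f g))\<^sup>2 \<le> 0"
    proof (rule ccontr)
      assume "\<not> (cmod (B f g))\<^sup>2 \<le> 0"
      then have "0 < (cmod (B f g))\<^sup>2" by simp
      then show False
        using key[of "(nsq f + 1) / (cmod (B f g))\<^sup>2"] True B_nonneg[OF f] by simp
    qed
    then show ?thesis using True by simp
  next
    case False
    then have "0 < nsq g" using B_nonneg[OF g] by simp
    then show ?thesis
      using key[of "1 / nsq g"] by (simp add: field_simps power2_eq_square)
  qed
qed

text \<open>Lets \<open>projection\<close> cope with null vectors; applied to the shifted form
  \<open>a - \<kappa> ip\<close> at a minimiser of the Rayleigh quotient, it is the Euler-Lagrange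
  equation.\<close>

lemma B_eq_0:
  assumes "f \<in> V" "g \<in> V" "nsq f = 0"
  shows "B f g = 0"
  using Cauchy_Schwarz[OF assms(1,2)] assms(3) by simp

lemma nsq_diff_le:
  assumes "f \<in> V" "g \<in> V"
  shows "nsq (\<lambda>x. f x - g x) \<le> 2 * nsq f + 2 * nsq g"
  using nsq_add[OF assms] nsq_diff[OF assms] B_nonneg[OF add[OF assms]] by linarith

lemma nsq_continuous:
  assumes f: "\<And>n. f n \<in> V" and g: "g \<in> V" and lim: "(\<lambda>n. nsq (\<lambda>x. f n x - g x)) \<longlonglongrightarrow> 0"
  shows "(\<lambda>n. nsq (f n)) \<longlonglongrightarrow> nsq g" and "h \<in> V \<Longrightarrow> (\<lambda>n. B (f n) h) \<longlonglongrightarrow> B g h"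
proof -
  have *: "(\<lambda>n. B (f n) h) \<longlonglongrightarrow> B g h" if h: "h \<in> V" for h
  proof -
    have "(\<lambda>n. B (\<lambda>x. f n x - g x) h) \<longlonglongrightarrow> 0"
    proof (rule Lim_null_comparison)
      show "\<forall>\<^sub>F n in sequentially. norm (B (\<lambda>x. f n x - g x) h) \<le> sqrt (nsq (\<lambda>x. f n x - g x) * nsq h)"
        using Cauchy_Schwarz[OF diff[OF f g] h] by (simp add: real_le_rsqrt)
      show "(\<lambda>n. sqrt (nsq (\<lambda>x. f n x - g x) * nsq h)) \<longlonglongrightarrow> 0"
        using tendsto_real_sqrt[OF tendsto_mult_left_zero[OF lim]] by simp
    qed
    then have "(\<lambda>n. B (f n) h - B g h) \<longlonglongrightarrow> 0"
      using f g h by (simp add: B_diff)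
    then show ?thesis by (simp add: LIM_zero_iff)
  qed
  show "h \<in> V \<Longrightarrow> (\<lambda>n. B (f n) h) \<longlonglongrightarrow> B g h" by (rule *)
  have "(\<lambda>n. nsq (\<lambda>x. f n x - g x) + 2 * Re (B (f n) g) - nsq g) \<longlonglongrightarrow> 0 + 2 * Re (B g g) - nsq g"
    by (intro tendsto_intros lim * g)
  then show "(\<lambda>n. nsq (f n)) \<longlonglongrightarrow> nsq g"
    using f g by (simp add: nsq_diff)
qed

text \<open>Gram--Schmidt for possibly dependent families: no normalisation, so that null vectors
  among the \<open>e i\<close> do no harm.\<close>

lemma projection:
  assumes "finite I" "\<And>i. i \<in> I \<Longrightarrow> e i \<in> V" "h \<in> V"
  shows "\<exists>c. \<forall>i\<in>I. B (\<lambda>x. h x - (\<Sum>j\<in>I. c j * e j x)) (e i) = 0"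
  using assms
proof (induction I arbitrary: h rule: finite_induct)
  case empty
  then show ?case by simp
next
  case (insert k I)
  have sumV: "(\<lambda>x. \<Sum>j\<in>I. c j * e j x) \<in> V" for c
    using insert.prems by (intro sum_mem scale) auto
  obtain c where c: "\<And>i. i \<in> I \<Longrightarrow> B (\<lambda>x. h x - (\<Sum>j\<in>I. c j * e j x)) (e i) = 0"
    using insert.IH[of h] insert.prems by blast
  obtain d where d: "\<And>i. i \<in> I \<Longrightarrow> B (\<lambda>x. e k x - (\<Sum>j\<in>I. d j * e j x)) (e i) = 0"
    using insert.IH[of "e k"] insert.prems by blast
  define h' where "h' = (\<lambda>x. h x - (\<Sum>j\<in>I. c j * e j x))"
  define u where "u = (\<lambda>x. e k x - (\<Sum>j\<in>I. d j * e j x))"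
  have V: "h' \<in> V" "u \<in> V" "e k \<in> V"
    unfolding h'_def u_def using insert.prems by (auto intro!: diff sumV)
  \<comment> \<open>If \<open>u\<close> is a null vector, the value of \<open>s\<close> is
    immaterial, as \<open>B h' u\<close> vanishes already by Cauchy-Schwarz.\<close>
  define s where "s = B h' u / B u u"
  define c' where "c' = (\<lambda>j. if j = k then s else c j - s * d j)"
  have eq: "(\<lambda>x. h x - (\<Sum>j\<in>insert k I. c' j * e j x)) = (\<lambda>x. h' x - s * u x)"
  proof
    fix x
    have "(\<Sum>j\<in>I. c' j * e j x) = (\<Sum>j\<in>I. c j * e j x - s * (d j * e j x))"
      using insert.hyps by (intro sum.cong) (auto simp: c'_def algebra_simps)
    then show "h x - (\<Sum>j\<in>insert k I. c' j * e j x) = h' x - s * u x"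
      using insert.hyps by (simp add: h'_def u_def c'_def sum_subtractf sum_distrib_left algebra_simps)
  qed
  have I0: "B (\<lambda>x. h' x - s * u x) (e i) = 0" if "i \<in> I" for i
    using that c[of i] d[of i] V insert.prems
    by (simp add: B_diff B_scale scale h'_def[symmetric] u_def[symmetric])
  have u0: "B (\<lambda>x. h' x - s * u x) u = 0"
  proof (cases "B u u = 0")
    case True
    then have "B u h' = 0" using V by (intro B_eq_0) auto
    then have "B h' u = 0" using B_sym[of u h'] V by simp
    then show ?thesis using V True by (simp add: B_diff B_scale scale)
  next
    case False
    then have "s * B u u = B h' u" by (simp add: s_def)
    then show ?thesis using V by (simp add: B_diff B_scale scale)
  qed
  have ek: "e k = (\<lambda>x. u x + (\<Sum>j\<in>I. d j * e j x))"
    by (simp add: u_def)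
  have W: "(\<lambda>x. h' x - s * u x) \<in> V" using V by (intro diff scale)
  have "B (\<lambda>x. h' x - s * u x) (e k)
      = B (\<lambda>x. h' x - s * u x) u + (\<Sum>j\<in>I. cnj (d j) * B (\<lambda>x. h' x - s * u x) (e j))"
    using insert.prems V W
    by (subst ek) (simp add: B_add_right sumV B_sum_right B_scale_right scale)
  then have "B (\<lambda>x. h' x - s * u x) (e k) = 0"
    by (simp add: u0 I0)
  then show ?case
    by (intro exI[of _ c']) (auto simp only: eq I0 insert_iff)
qed

end

section \<open>Square-integrable functions as a semi-inner product space\<close>

lemma borel_measurable_cnj:
  "f \<in> borel_measurable M \<Longrightarrow> (\<lambda>x. cnj (f x)) \<in> borel_measurable M"
  by (rule borel_measurable_continuous_on[where f = cnj]) (intro continuous_intros)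

lemma L2_mult_integrable:
  assumes "u \<in> L2_set M" "v \<in> L2_set M"
  shows "integrable M (\<lambda>x. u x * cnj (v x))"
proof (rule Bochner_Integration.integrable_bound)
  show "integrable M (\<lambda>x. (cmod (u x))\<^sup>2 + (cmod (v x))\<^sup>2)"
    using assms by (auto simp: L2_set_def)
  show "(\<lambda>x. u x * cnj (v x)) \<in> borel_measurable M"
    using assms by (intro borel_measurable_times borel_measurable_cnj) (auto simp: L2_set_def)
  show "AE x in M. norm (u x * cnj (v x)) \<le> norm ((cmod (u x))\<^sup>2 + (cmod (v x))\<^sup>2)"
  proof (rule AE_I2)
    fix x
    have "2 * cmod (u x) * cmod (v x) \<le> (cmod (u x))\<^sup>2 + (cmod (v x))\<^sup>2"
      by (rule sum_squares_bound)
    moreover have "0 \<le> cmod (u x) * cmod (v x)" by simp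
    ultimately have "cmod (u x) * cmod (v x) \<le> (cmod (u x))\<^sup>2 + (cmod (v x))\<^sup>2" by linarith
    then show "norm (u x * cnj (v x)) \<le> norm ((cmod (u x))\<^sup>2 + (cmod (v x))\<^sup>2)"
      by (simp add: norm_mult)
  qed
qed

lemma L2_set_add:
  assumes "u \<in> L2_set M" "v \<in> L2_set M"
  shows "(\<lambda>x. u x + v x) \<in> L2_set M"
proof -
  have "integrable M (\<lambda>x. (cmod (u x + v x))\<^sup>2)"
  proof (rule Bochner_Integration.integrable_bound)
    show "integrable M (\<lambda>x. 2 * (cmod (u x))\<^sup>2 + 2 * (cmod (v x))\<^sup>2)"
      using assms by (auto simp: L2_set_def)
    show "(\<lambda>x. (cmod (u x + v x))\<^sup>2) \<in> borel_measurable M"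
      using assms by (auto simp: L2_set_def)
    show "AE x in M. norm ((cmod (u x + v x))\<^sup>2) \<le> norm (2 * (cmod (u x))\<^sup>2 + 2 * (cmod (v x))\<^sup>2)"
    proof (rule AE_I2)
      fix x
      have "(cmod (u x + v x))\<^sup>2 \<le> (cmod (u x) + cmod (v x))\<^sup>2"
        by (intro power_mono norm_triangle_ineq) auto
      moreover have "0 \<le> (cmod (u x) - cmod (v x))\<^sup>2" by simp
      ultimately show "norm ((cmod (u x + v x))\<^sup>2) \<le> norm (2 * (cmod (u x))\<^sup>2 + 2 * (cmod (v x))\<^sup>2)"
        by (simp add: power2_sum power2_diff)
    qed
  qed
  then show ?thesis using assms by (auto simp: L2_set_def)
qed

lemma L2_set_scale: "u \<in> L2_set M \<Longrightarrow> (\<lambda>x. c * u x) \<in> L2_set M"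
  by (auto simp: L2_set_def norm_mult power_mult_distrib)

lemma L2_inner_self: "L2_inner M f f = of_real (LINT x|M. (cmod (f x))\<^sup>2)"
  unfolding L2_inner_def integral_complex_of_real[symmetric]
  by (intro Bochner_Integration.integral_cong refl) (rule complex_norm_square[symmetric])

interpretation L2: semi_inner "L2_set M" "L2_inner M" for M :: "'a measure"
proof
  show "(\<lambda>x. 0) \<in> L2_set M" by (simp add: L2_set_def)
  fix f g h :: "'a \<Rightarrow> complex" and c :: complex
  assume f: "f \<in> L2_set M"
  show "(\<lambda>x. c * f x) \<in> L2_set M" using f by (rule L2_set_scale)
  show "0 \<le> Re (L2_inner M f f)" by (simp add: L2_inner_self)
  assume g: "g \<in> L2_set M"
  show "(\<lambda>x. f x + g x) \<in> L2_set M" using f g by (rule L2_set_add)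
  show "L2_inner M g f = cnj (L2_inner M f g)"
    unfolding L2_inner_def by (simp add: mult.commute Bochner_Integration.integral_cnj[symmetric] del: Bochner_Integration.integral_cnj)
  show "L2_inner M (\<lambda>x. c * f x) g = c * L2_inner M f g"
    unfolding L2_inner_def by (simp add: mult.assoc)
  assume h: "h \<in> L2_set M"
  show "L2_inner M (\<lambda>x. f x + g x) h = L2_inner M f h + L2_inner M g h"
    unfolding L2_inner_def
    by (subst Bochner_Integration.integral_add[symmetric])
      (auto simp: algebra_simps intro!: L2_mult_integrable f g h)
qed

lemma L2_nsq_eq_0_iff:
  assumes "f \<in> L2_set M"
  shows "L2.nsq M f = 0 \<longleftrightarrow> (AE x in M. f x = 0)"
  using assms by (auto simp: L2_inner_self L2_set_def integral_nonneg_eq_0_iff_AE)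

lemma L2_inner_cong_AE:
  assumes "f \<in> L2_set M" "g \<in> L2_set M" "h \<in> L2_set M" "AE x in M. f x = g x"
  shows "L2_inner M f h = L2_inner M g h"
  unfolding L2_inner_def using assms(4)
  by (intro integral_cong_AE borel_measurable_integrable L2_mult_integrable assms) auto

text \<open>What the variational principle needs of a form: a compact embedding of its domain and
  closedness. In \<open>closed\<close> the sequence is only bounded in L2 and Cauchy for the form,
  and the limit is reached along a subsequence; this is what selection of a pointwise convergent
  subsequence delivers, and it suffices for a minimising sequence.\<close>

locale compact_form = semi_inner D a
  for M :: "'a measure" and D :: "('a \<Rightarrow> complex) set"
    and a :: "('a \<Rightarrow> complex) \<Rightarrow> ('a \<Rightarrow> complex) \<Rightarrow> complex" +
  assumes D_L2: "D \<subseteq> L2_set M"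
    and compact: "\<And>f C. (\<And>n::nat. f n \<in> D) \<Longrightarrow> (\<And>n. Re (a (f n) (f n)) \<le> C) \<Longrightarrow> (\<And>n. L2.nsq M (f n) \<le> C)
      \<Longrightarrow> \<exists>r. strict_mono (r :: nat \<Rightarrow> nat) \<and>
          (\<forall>\<epsilon>>0. \<exists>n0. \<forall>i\<ge>n0. \<forall>j\<ge>n0. L2.nsq M (\<lambda>x. f (r i) x - f (r j) x) < \<epsilon>)"
    and closed: "\<And>f C. (\<And>n::nat. f n \<in> D) \<Longrightarrow> (\<And>n. Re (a (f n) (f n)) \<le> C) \<Longrightarrow> (\<And>n. L2.nsq M (f n) \<le> C)
      \<Longrightarrow> (\<forall>\<epsilon>>0. \<exists>n0. \<forall>i\<ge>n0. \<forall>j\<ge>n0. Re (a (\<lambda>x. f i x - f j x) (\<lambda>x. f i x - f j x)) < \<epsilon>)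
      \<Longrightarrow> \<exists>r g. strict_mono (r :: nat \<Rightarrow> nat) \<and> g \<in> D \<and>
          (\<lambda>n. L2.nsq M (\<lambda>x. f (r n) x - g x)) \<longlonglongrightarrow> 0 \<and>
          (\<lambda>n. Re (a (\<lambda>x. f (r n) x - g x) (\<lambda>x. f (r n) x - g x))) \<longlonglongrightarrow> 0"
begin

abbreviation ip where "ip \<equiv> L2_inner M"

abbreviation A where "A \<equiv> form_operator M D a"

lemma eigenspace_iff: "f \<in> eigenspace A z \<longleftrightarrow> f \<in> D \<and> (\<forall>h\<in>D. a f h = z * ip f h)"
  using D_L2 by (auto simp: eigenspace_def form_operator_def L2.B_scale L2.scale subset_iff)

lemma eigenspaces_orthogonal:
  assumes "f \<in> eigenspace A (of_real y)" "g \<in> eigenspace A (of_real z)" "y \<noteq> z"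
  shows "ip f g = 0"
proof -
  have D: "f \<in> D" "g \<in> D" using assms by (auto simp: eigenspace_iff)
  have "of_real y * ip f g = a f g" using assms D by (simp add: eigenspace_iff)
  also have "\<dots> = cnj (a g f)" using D by (intro B_sym)
  also have "\<dots> = of_real z * cnj (ip g f)" using assms D by (simp add: eigenspace_iff)
  also have "cnj (ip g f) = ip f g" using D D_L2 by (intro L2.B_sym[symmetric]) auto
  finally show ?thesis using assms by simp
qed

text \<open>The minimiser of the Rayleigh quotient on the complement of the \<open>e i\<close> is an eigenfunction:
  \<open>a - \<kappa> ip\<close> is a semi-inner product there, and the minimiser is a null vector of it.\<close>

lemma minimiser:
  assumes I: "finite I" and e: "\<And>i. i \<in> I \<Longrightarrow> e i \<in> eigenspace A (of_real (l i))"
    and f: "f \<in> D" "\<And>i. i \<in> I \<Longrightarrow> ip f (e i) = 0" and less: "nsq f < \<Lambda> * L2.nsq M f"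
  obtains g \<kappa> where "\<kappa> < \<Lambda>" "g \<in> eigenspace A (of_real \<kappa>)" "L2.nsq M g = 1"
    "\<And>i. i \<in> I \<Longrightarrow> ip g (e i) = 0"
proof -
  have eD: "e i \<in> D" if "i \<in> I" for i using e[OF that] by (simp add: eigenspace_iff)
  have L: "h \<in> L2_set M" if "h \<in> D" for h using that D_L2 by auto
  define V where "V = {h \<in> D. \<forall>i\<in>I. ip h (e i) = 0}"
  have VD: "V \<subseteq> D" by (auto simp: V_def)
  have V_add: "(\<lambda>x. g x + h x) \<in> V" if "g \<in> V" "h \<in> V" for g h
    using that eD by (auto simp: V_def L2.B_add L add)
  have V_scale: "(\<lambda>x. c * g x) \<in> V" if "g \<in> V" for g c
    using that eD by (auto simp: V_def L2.B_scale L scale)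
  have V_zero: "(\<lambda>x. 0) \<in> V" using eD by (auto simp: V_def L2.B_zero L zero)
  have V_diff: "(\<lambda>x. g x - h x) \<in> V" if "g \<in> V" "h \<in> V" for g h
    using V_add[OF that(1) V_scale[OF that(2), of "-1"]] by simp
  define S where "S = {nsq h |h. h \<in> V \<and> L2.nsq M h = 1}"
  define \<kappa> where "\<kappa> = Inf S"
  have bdd: "bdd_below S" unfolding S_def using VD B_nonneg by (intro bdd_belowI[of _ 0]) auto
  have low: "\<kappa> * L2.nsq M h \<le> nsq h" if h: "h \<in> V" for h
  proof (cases "L2.nsq M h = 0")
    case True
    then show ?thesis using B_nonneg VD h by auto
  next
    case False
    then have pos: "0 < L2.nsq M h" using L2.B_nonneg[of h] L h VD by force
    let ?c = "of_real (1 / sqrt (L2.nsq M h)) :: complex"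
    have c2: "(cmod ?c)\<^sup>2 = 1 / L2.nsq M h" using pos by (simp add: norm_divide power_divide)
    have "L2.nsq M (\<lambda>x. ?c * h x) = 1"
      using h VD L pos by (subst L2.nsq_scale) (auto simp only: c2, simp)
    then have "nsq (\<lambda>x. ?c * h x) \<in> S" unfolding S_def using V_scale[OF h] by blast
    then have "\<kappa> \<le> nsq (\<lambda>x. ?c * h x)" unfolding \<kappa>_def using bdd by (rule cInf_lower)
    also have "\<dots> = nsq h / L2.nsq M h"
      using h VD by (subst nsq_scale) (auto simp only: c2, simp)
    finally show ?thesis using pos by (simp add: field_simps)
  qed
  have fV: "f \<in> V" using f by (simp add: V_def)
  have fpos: "0 < L2.nsq M f"
    using less L2.B_nonneg[OF L[OF f(1)]] B_nonneg[OF f(1)] by (cases "L2.nsq M f = 0") auto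
  have "\<kappa> * L2.nsq M f < \<Lambda> * L2.nsq M f" using low[OF fV] less by linarith
  then have \<kappa>: "\<kappa> < \<Lambda>" using fpos by simp
  have Sne: "S \<noteq> {}"
  proof -
    let ?c = "of_real (1 / sqrt (L2.nsq M f)) :: complex"
    have c2: "(cmod ?c)\<^sup>2 = 1 / L2.nsq M f" using fpos by (simp add: norm_divide power_divide)
    have "L2.nsq M (\<lambda>x. ?c * f x) = 1"
      using L[OF f(1)] fpos by (subst L2.nsq_scale) (auto simp only: c2, simp)
    then show ?thesis unfolding S_def using V_scale[OF fV] by blast
  qed
  have "\<exists>h. h \<in> V \<and> L2.nsq M h = 1 \<and> nsq h < \<kappa> + 1 / real (Suc n)" for n
  proof -
    have "\<kappa> < \<kappa> + 1 / real (Suc n)" by simp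
    then obtain s where "s \<in> S" "s < \<kappa> + 1 / real (Suc n)"
      unfolding \<kappa>_def using cInf_less_iff[OF Sne bdd] by blast
    then show ?thesis by (auto simp: S_def)
  qed
  then obtain h where h: "\<And>n. h n \<in> V" "\<And>n. L2.nsq M (h n) = 1"
    "\<And>n. nsq (h n) < \<kappa> + 1 / real (Suc n)" by metis
  have hD: "h n \<in> D" for n using h VD by auto
  \<comment> \<open>A single constant has to bound both the form values and the squared norms, which
    are 1.\<close>
  have hb: "nsq (h n) \<le> max 1 (\<kappa> + 1)" for n
  proof -
    have "1 / real (Suc n) \<le> 1" by simp
    then show ?thesis using h(3)[of n] by linarith
  qed
  obtain r where r: "strict_mono (r :: nat \<Rightarrow> nat)"
    "\<And>\<epsilon>. \<epsilon> > 0 \<Longrightarrow> \<exists>n0. \<forall>i\<ge>n0. \<forall>j\<ge>n0. L2.nsq M (\<lambda>x. h (r i) x - h (r j) x) < \<epsilon>"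
    using compact[of h "max 1 (\<kappa> + 1)"] hD hb h(2) by auto
  \<comment> \<open>A minimising sequence that is Cauchy in L2 is Cauchy for the form: the
    parallelogram identity expresses the form of a difference through that of the sum, and the sum
    lies in \<open>V\<close>, where \<open>low\<close> bounds the form from below. The four copies
    of \<kappa> cancel.\<close>
  have Cauchy: "\<exists>n0. \<forall>i\<ge>n0. \<forall>j\<ge>n0. nsq (\<lambda>x. h (r i) x - h (r j) x) < \<epsilon>" if "\<epsilon> > 0" for \<epsilon> :: real
  proof -
    obtain n1 where n1: "\<And>i j. i \<ge> n1 \<Longrightarrow> j \<ge> n1 \<Longrightarrow>
        L2.nsq M (\<lambda>x. h (r i) x - h (r j) x) < \<epsilon> / (2 * (\<bar>\<kappa>\<bar> + 1))"
      using r(2)[of "\<epsilon> / (2 * (\<bar>\<kappa>\<bar> + 1))"] \<open>\<epsilon> > 0\<close> by (auto simp: add_nonneg_pos)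
    obtain n2 where n2: "1 / real (Suc n2) < \<epsilon> / 8"
      using \<open>\<epsilon> > 0\<close> nat_approx_posE[of "\<epsilon> / 8"] by auto
    have "nsq (\<lambda>x. h (r i) x - h (r j) x) < \<epsilon>" if ij: "i \<ge> max n1 n2" "j \<ge> max n1 n2" for i j
    proof -
      have s: "1 / real (Suc (r k)) < \<epsilon> / 8" if "k \<ge> n2" for k
      proof -
        have "n2 \<le> r k" using that seq_suble[OF r(1), of k] by simp
        then have "1 / real (Suc (r k)) \<le> 1 / real (Suc n2)" by (simp add: frac_le)
        then show ?thesis using n2 by linarith
      qed
      have 1: "nsq (h (r i)) < \<kappa> + \<epsilon> / 8" "nsq (h (r j)) < \<kappa> + \<epsilon> / 8"
        using h(3)[of "r i"] h(3)[of "r j"] s[of i] s[of j] ij by auto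
      have 2: "\<kappa> * L2.nsq M (\<lambda>x. h (r i) x + h (r j) x) \<le> nsq (\<lambda>x. h (r i) x + h (r j) x)"
        by (intro low V_add h)
      have 3: "L2.nsq M (\<lambda>x. h (r i) x + h (r j) x) = 4 - L2.nsq M (\<lambda>x. h (r i) x - h (r j) x)"
        using L2.nsq_add[OF L[OF hD] L[OF hD], of "r i" "r j"]
          L2.nsq_diff[OF L[OF hD] L[OF hD], of "r i" "r j"] h(2) by simp
      have 4: "nsq (\<lambda>x. h (r i) x - h (r j) x)
          = 2 * nsq (h (r i)) + 2 * nsq (h (r j)) - nsq (\<lambda>x. h (r i) x + h (r j) x)"
        using nsq_add[OF hD hD, of "r i" "r j"] nsq_diff[OF hD hD, of "r i" "r j"] by simp
      have 5: "\<kappa> * L2.nsq M (\<lambda>x. h (r i) x - h (r j) x) \<le> \<epsilon> / 2"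
      proof -
        let ?d = "L2.nsq M (\<lambda>x. h (r i) x - h (r j) x)"
        have d0: "0 \<le> ?d" by (intro L2.B_nonneg L2.diff L hD)
        have "?d \<le> \<epsilon> / (2 * (\<bar>\<kappa>\<bar> + 1))" using n1[of i j] ij by simp
        then have "(\<bar>\<kappa>\<bar> + 1) * ?d \<le> \<epsilon> / 2" by (simp add: field_simps)
        moreover have "\<kappa> * ?d \<le> (\<bar>\<kappa>\<bar> + 1) * ?d" using d0 by (intro mult_right_mono) auto
        ultimately show ?thesis by linarith
      qed
      have "\<kappa> * (4 - L2.nsq M (\<lambda>x. h (r i) x - h (r j) x)) \<le> nsq (\<lambda>x. h (r i) x + h (r j) x)"
        using 2 3 by simp
      then show ?thesis using 1 4 5 by (simp add: right_diff_distrib)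
    qed
    then show ?thesis by blast
  qed
  obtain r' g where g: "strict_mono (r' :: nat \<Rightarrow> nat)" "g \<in> D"
    "(\<lambda>n. L2.nsq M (\<lambda>x. h (r (r' n)) x - g x)) \<longlonglongrightarrow> 0"
    "(\<lambda>n. nsq (\<lambda>x. h (r (r' n)) x - g x)) \<longlonglongrightarrow> 0"
    using closed[of "\<lambda>n. h (r n)" "max 1 (\<kappa> + 1)"] hD hb h(2) Cauchy by auto
  let ?h = "\<lambda>n. h (r (r' n))"
  have g1: "L2.nsq M g = 1"
    using L2.nsq_continuous(1)[OF L[OF hD] L[OF g(2)] g(3)] h(2)
    by (simp add: LIMSEQ_const_iff)
  have ge: "ip g (e i) = 0" if "i \<in> I" for i
    using L2.nsq_continuous(2)[OF L[OF hD] L[OF g(2)] g(3), of "e i"] h(1) that L[OF eD[OF that]]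
    by (simp add: V_def LIMSEQ_const_iff)
  have gV: "g \<in> V" using g(2) ge by (simp add: V_def)
  have "nsq g \<le> \<kappa>"
  proof (rule LIMSEQ_le)
    show "(\<lambda>n. nsq (?h n)) \<longlonglongrightarrow> nsq g"
      using nsq_continuous(1)[OF hD g(2,4)] .
    have "(\<lambda>n. 1 / real (Suc n)) \<longlonglongrightarrow> 0"
      using LIMSEQ_inverse_real_of_nat by (simp add: inverse_eq_divide)
    then have "((\<lambda>n. 1 / real (Suc n)) \<circ> (r \<circ> r')) \<longlonglongrightarrow> 0"
      using strict_mono_o[OF r(1) g(1)] by (rule LIMSEQ_subseq_LIMSEQ)
    then show "(\<lambda>n. \<kappa> + 1 / real (Suc (r (r' n)))) \<longlonglongrightarrow> \<kappa>"
      using tendsto_add[OF tendsto_const, of _ 0 sequentially \<kappa>] by (simp add: comp_def)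
    show "\<exists>n0. \<forall>n\<ge>n0. nsq (?h n) \<le> \<kappa> + 1 / real (Suc (r (r' n)))"
      using h(3) by (auto intro: less_imp_le)
  qed
  with low[OF gV] g1 have ag: "nsq g = \<kappa>" by simp
  let ?b = "\<lambda>u v. a u v - of_real \<kappa> * ip u v"
  have "semi_inner V ?b"
  proof
    fix u v assume u: "u \<in> V" and v: "v \<in> V"
    show "?b v u = cnj (?b u v)" 
    proof -
      have "a v u = cnj (a u v)" "ip v u = cnj (ip u v)"
        using u v VD L by (auto intro!: B_sym L2.B_sym)
      then show ?thesis by (simp only: complex_cnj_diff complex_cnj_mult complex_cnj_complex_of_real)
    qed
  next
    fix u assume "u \<in> V"
    then show "0 \<le> Re (?b u u)" using low[of u] by simp
  qed (use VD L in \<open>auto simp: V_zero V_add V_scale B_add B_scale L2.B_add L2.B_scale algebra_simps subset_iff\<close>)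
  then interpret b: semi_inner V ?b .
  \<comment> \<open>The eigenvalue equation must be tested on all of \<open>D\<close>, but
    \<open>g\<close> is a null vector only for the shifted form on \<open>V\<close>. So
    \<open>u\<close> is split into its projection \<open>v\<close> onto the \<open>e i\<close> and a
    remainder in \<open>V\<close>; against \<open>v\<close> both sides vanish, since
    \<open>g\<close> is orthogonal to the eigenfunctions \<open>e i\<close> and the form is
    symmetric.\<close>
  have eig: "a g u = of_real \<kappa> * ip g u" if u: "u \<in> D" for u
  proof -
    have "\<exists>c. \<forall>i\<in>I. ip (\<lambda>x. u x - (\<Sum>j\<in>I. c j * e j x)) (e i) = 0"
      by (rule L2.projection[OF I L[OF eD] L[OF u]])
    then obtain c where c: "\<And>i. i \<in> I \<Longrightarrow> ip (\<lambda>x. u x - (\<Sum>j\<in>I. c j * e j x)) (e i) = 0"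
      by auto
    define v where "v = (\<lambda>x. \<Sum>j\<in>I. c j * e j x)"
    have vD: "v \<in> D" unfolding v_def by (intro sum_mem scale eD)
    have w: "(\<lambda>x. u x - v x) \<in> V"
      using c diff[OF u vD] by (simp add: V_def v_def)
    have "a g g = of_real \<kappa>" "ip g g = 1"
      using B_self[OF g(2)] L2.B_self[OF L[OF g(2)]] by (simp_all only: ag g1 of_real_1)
    then have "?b g g = 0" by simp
    then have "?b g (\<lambda>x. u x - v x) = 0" using b.B_eq_0[OF gV w] by simp
    moreover have "a g v = 0" "ip g v = 0"
    proof -
      have "a g (e j) = 0" if "j \<in> I" for j
      proof -
        have "a g (e j) = cnj (a (e j) g)" using eD that g(2) by (intro B_sym) auto
        also have "a (e j) g = of_real (l j) * ip (e j) g"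
          using e[OF that] g(2) by (simp add: eigenspace_iff)
        also have "ip (e j) g = cnj (ip g (e j))" using eD that g(2) L by (intro L2.B_sym) auto
        finally show ?thesis using ge[OF that] by simp
      qed
      then show "a g v = 0"
        unfolding v_def using g(2) eD by (simp add: B_sum_right B_scale_right scale)
      show "ip g v = 0"
        unfolding v_def using L[OF g(2)] L[OF eD] ge by (simp add: L2.B_sum_right L2.B_scale_right L2.scale)
    qed
    ultimately show ?thesis
      using u vD g(2) L by (simp add: B_diff_right L2.B_diff_right)
  qed
  show ?thesis
    using that[OF \<kappa> _ g1 ge] eig g(2) by (simp add: eigenspace_iff)
qed

end

section \<open>Eigenvalue sequences and the variational principle\<close>

lemma eigenvalue_sequenceD:
  assumes "eigenvalue_sequence M A lam"
  shows "finite {i. 1 \<le> i \<and> lam i = z}"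
    and "has_L2_dim M (eigenspace A (complex_of_real z)) (card {i. 1 \<le> i \<and> lam i = z})"
proof -
  have "(\<lambda>i. complex_of_real (lam i) = complex_of_real z) = (\<lambda>i. lam i = z)" by auto
  moreover have "finite {n. 1 \<le> n \<and> complex_of_real (lam n) = complex_of_real z}"
    "has_L2_dim M (eigenspace A (complex_of_real z)) (card {n. 1 \<le> n \<and> complex_of_real (lam n) = complex_of_real z})"
    using assms unfolding eigenvalue_sequence_def by blast+
  ultimately show "finite {i. 1 \<le> i \<and> lam i = z}"
    "has_L2_dim M (eigenspace A (complex_of_real z)) (card {i. 1 \<le> i \<and> lam i = z})"
    by (simp_all only: of_real_eq_iff)
qed

text \<open>One basis is chosen for each eigenspace and relabelled by the positions at which its
  eigenvalue stands in the sequence, so that \<open>e i\<close> belongs to \<open>lam i\<close>.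
  Independence is obtained inside each eigenspace only; across eigenvalues it follows later from
  orthogonality.\<close>

lemma eigenvalue_basis:
  assumes "eigenvalue_sequence M A lam"
  obtains e where "\<And>i. 1 \<le> i \<Longrightarrow> e i \<in> eigenspace A (complex_of_real (lam i))"
    "\<And>z f. f \<in> eigenspace A (complex_of_real z) \<Longrightarrow>
      \<exists>c. AE x in M. f x = (\<Sum>i\<in>{i. 1 \<le> i \<and> lam i = z}. c i * e i x)"
    "\<And>z c i. AE x in M. (\<Sum>i\<in>{i. 1 \<le> i \<and> lam i = z}. c i * e i x) = 0 \<Longrightarrow> 1 \<le> i \<Longrightarrow> lam i = z \<Longrightarrow> c i = 0"
proof -
  define S where "S z = {i. 1 \<le> i \<and> lam i = z}" for z
  have fin: "finite (S z)" and dim: "has_L2_dim M (eigenspace A (complex_of_real z)) (card (S z))" for z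
    unfolding S_def by (rule eigenvalue_sequenceD[OF assms])+
  have "\<forall>z. \<exists>E. (\<forall>i<card (S z). E i \<in> eigenspace A (complex_of_real z)) \<and>
      (\<forall>c. (AE x in M. (\<Sum>i<card (S z). c i * E i x) = 0) \<longrightarrow> (\<forall>i<card (S z). c i = 0)) \<and>
      (\<forall>f\<in>eigenspace A (complex_of_real z). \<exists>c. AE x in M. f x = (\<Sum>i<card (S z). c i * E i x))"
    using dim unfolding has_L2_dim_def by (rule allI)
  from choice[OF this] obtain E where
    E': "\<forall>z. (\<forall>i<card (S z). E z i \<in> eigenspace A (complex_of_real z)) \<and>
      (\<forall>c. (AE x in M. (\<Sum>i<card (S z). c i * E z i x) = 0) \<longrightarrow> (\<forall>i<card (S z). c i = 0)) \<and>
      (\<forall>f\<in>eigenspace A (complex_of_real z). \<exists>c. AE x in M. f x = (\<Sum>i<card (S z). c i * E z i x))" ..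
  have E: "\<And>z i. i < card (S z) \<Longrightarrow> E z i \<in> eigenspace A (complex_of_real z)"
    "\<And>z c i. AE x in M. (\<Sum>i<card (S z). c i * E z i x) = 0 \<Longrightarrow> i < card (S z) \<Longrightarrow> c i = 0"
    "\<And>z f. f \<in> eigenspace A (complex_of_real z) \<Longrightarrow> \<exists>c. AE x in M. f x = (\<Sum>i<card (S z). c i * E z i x)"
    using E' by simp_all
  have "\<forall>z. \<exists>\<beta>. bij_betw \<beta> (S z) {..<card (S z)}"
    using ex_bij_betw_finite_nat[OF fin] by (simp add: atLeast0LessThan)
  from choice[OF this] obtain \<beta> where \<beta>: "\<And>z. bij_betw (\<beta> z) (S z) {..<card (S z)}" by auto
  define e where "e i = E (lam i) (\<beta> (lam i) i)" for i
  have sum: "(\<Sum>i\<in>S z. c (\<beta> z i) * e i x) = (\<Sum>k<card (S z). c k * E z k x)" for z c x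
  proof -
    have "(\<Sum>i\<in>S z. c (\<beta> z i) * e i x) = (\<Sum>i\<in>S z. c (\<beta> z i) * E z (\<beta> z i) x)"
      by (intro sum.cong) (auto simp: e_def S_def)
    also have "\<dots> = (\<Sum>k<card (S z). c k * E z k x)"
      by (rule sum.reindex_bij_betw[OF \<beta>])
    finally show ?thesis .
  qed
  show ?thesis
  proof
    fix i :: nat assume "1 \<le> i"
    then have "\<beta> (lam i) i < card (S (lam i))"
      using bij_betwE[OF \<beta>[of "lam i"]] by (auto simp: S_def)
    then show "e i \<in> eigenspace A (complex_of_real (lam i))"
      unfolding e_def by (rule E)
  next
    fix z f assume "f \<in> eigenspace A (complex_of_real z)"
    then obtain c where "AE x in M. f x = (\<Sum>i<card (S z). c i * E z i x)" using E(3) by blast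
    then have "AE x in M. f x = (\<Sum>i\<in>S z. c (\<beta> z i) * e i x)" by (simp only: sum)
    then show "\<exists>c. AE x in M. f x = (\<Sum>i\<in>{i. 1 \<le> i \<and> lam i = z}. c i * e i x)"
      unfolding S_def by (rule exI[of _ "\<lambda>i. c (\<beta> z i)"])
  next
    fix z c i
    assume *: "AE x in M. (\<Sum>i\<in>{i. 1 \<le> i \<and> lam i = z}. c i * e i x) = 0" and i: "1 \<le> i" "lam i = z"
    define d where "d k = c (inv_into (S z) (\<beta> z) k)" for k
    have d: "d (\<beta> z j) = c j" if "j \<in> S z" for j
      using bij_betw_imp_inj_on[OF \<beta>] that by (simp add: d_def)
    have "(\<Sum>j\<in>S z. c j * e j x) = (\<Sum>k<card (S z). d k * E z k x)" for x
      unfolding sum[of d z x, symmetric] by (intro sum.cong) (auto simp: d)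
    with * have "AE x in M. (\<Sum>k<card (S z). d k * E z k x) = 0"
      unfolding S_def by simp
    then have "d k = 0" if "k < card (S z)" for k
      using that by (rule E(2))
    moreover have "i \<in> S z" using i by (simp add: S_def)
    ultimately show "c i = 0" using d[of i] bij_betwE[OF \<beta>[of z]] by force
  qed
qed

context compact_form
begin

lemma eigenspace_sum:
  assumes "\<And>i. i \<in> I \<Longrightarrow> e i \<in> eigenspace A z"
  shows "(\<lambda>x. \<Sum>i\<in>I. c i * e i x) \<in> eigenspace A z"
proof -
  have D: "e i \<in> D" "e i \<in> L2_set M" if "i \<in> I" for i
    using assms[OF that] D_L2 by (auto simp: eigenspace_iff)
  have "a (\<lambda>x. \<Sum>i\<in>I. c i * e i x) h = z * ip (\<lambda>x. \<Sum>i\<in>I. c i * e i x) h" if h: "h \<in> D" for h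
  proof -
    have "a (\<lambda>x. \<Sum>i\<in>I. c i * e i x) h = (\<Sum>i\<in>I. c i * a (e i) h)"
      using h D by (simp add: B_sum B_scale scale)
    also have "\<dots> = (\<Sum>i\<in>I. z * (c i * ip (e i) h))"
      using h assms by (intro sum.cong) (auto simp: eigenspace_iff)
    also have "\<dots> = z * (\<Sum>i\<in>I. c i * ip (e i) h)" by (simp add: sum_distrib_left)
    also have "(\<Sum>i\<in>I. c i * ip (e i) h) = ip (\<lambda>x. \<Sum>i\<in>I. c i * e i x) h"
      using h D D_L2 by (subst L2.B_sum) (auto simp: L2.B_scale L2.scale)
    finally show ?thesis .
  qed
  then show ?thesis using D by (auto simp: eigenspace_iff intro!: sum_mem scale)
qed

text \<open>Both halves of the min-max principle without orthonormalisation. Grouping a combination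
  by eigenvalue, as in \<open>u I c z\<close>, diagonalises norm and form, because distinct
  eigenspaces are orthogonal. If the last inequality failed, \<open>minimiser\<close> would give a
  normalised eigenfunction for some \<kappa> < \<Lambda> orthogonal to a family that spans its own
  eigenspace.\<close>

lemma variational:
  assumes "eigenvalue_sequence M A lam"
  obtains e where
    "\<And>i. 1 \<le> i \<Longrightarrow> e i \<in> D"
    "\<And>I c \<Lambda>. finite I \<Longrightarrow> (\<And>i. i \<in> I \<Longrightarrow> 1 \<le> i \<and> lam i \<le> \<Lambda>) \<Longrightarrow>
      nsq (\<lambda>x. \<Sum>i\<in>I. c i * e i x) \<le> \<Lambda> * L2.nsq M (\<lambda>x. \<Sum>i\<in>I. c i * e i x)"
    "\<And>I c k. finite I \<Longrightarrow> (\<And>i. i \<in> I \<Longrightarrow> 1 \<le> i) \<Longrightarrow> k \<in> I \<Longrightarrow> c k \<noteq> 0 \<Longrightarrow>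
      0 < L2.nsq M (\<lambda>x. \<Sum>i\<in>I. c i * e i x)"
    "\<And>f \<Lambda>. finite {i. 1 \<le> i \<and> lam i < \<Lambda>} \<Longrightarrow> f \<in> D \<Longrightarrow>
      (\<And>i. 1 \<le> i \<Longrightarrow> lam i < \<Lambda> \<Longrightarrow> ip f (e i) = 0) \<Longrightarrow> \<Lambda> * L2.nsq M f \<le> nsq f"
proof -
  obtain e where e: "\<And>i. 1 \<le> i \<Longrightarrow> e i \<in> eigenspace A (complex_of_real (lam i))"
    and span: "\<And>z f. f \<in> eigenspace A (complex_of_real z) \<Longrightarrow>
      \<exists>c. AE x in M. f x = (\<Sum>i\<in>{i. 1 \<le> i \<and> lam i = z}. c i * e i x)"
    and indep: "\<And>z c i. AE x in M. (\<Sum>i\<in>{i. 1 \<le> i \<and> lam i = z}. c i * e i x) = 0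
      \<Longrightarrow> 1 \<le> i \<Longrightarrow> lam i = z \<Longrightarrow> c i = 0"
    using eigenvalue_basis[OF assms] by blast
  have eD: "e i \<in> D" "e i \<in> L2_set M" if "1 \<le> i" for i
    using e[OF that] D_L2 by (auto simp: eigenspace_iff)
  have fin: "finite {i. 1 \<le> i \<and> lam i = z}" for z
    by (rule eigenvalue_sequenceD[OF assms])
  define u where "u I c z = (\<lambda>x. \<Sum>i\<in>{i\<in>I. lam i = z}. c i * e i x)" for I c z
  have u_eig: "u I c z \<in> eigenspace A (complex_of_real z)" if "\<And>i. i \<in> I \<Longrightarrow> 1 \<le> i" for I c z
    unfolding u_def using e that by (intro eigenspace_sum) auto
  have uD: "u I c z \<in> D" "u I c z \<in> L2_set M" if "\<And>i. i \<in> I \<Longrightarrow> 1 \<le> i" for I c z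
    using u_eig[OF that] D_L2 by (auto simp: eigenspace_iff)
  have u_sum: "(\<lambda>x. \<Sum>i\<in>I. c i * e i x) = (\<lambda>x. \<Sum>z\<in>lam ` I. u I c z x)" if "finite I" for I c
    unfolding u_def by (intro ext sum.image_gen that)
  have ip_sum: "ip (\<lambda>x. \<Sum>i\<in>I. c i * e i x) (\<lambda>x. \<Sum>i\<in>I. c i * e i x) = (\<Sum>z\<in>lam ` I. ip (u I c z) (u I c z))"
    and a_sum: "a (\<lambda>x. \<Sum>i\<in>I. c i * e i x) (\<lambda>x. \<Sum>i\<in>I. c i * e i x)
      = (\<Sum>z\<in>lam ` I. of_real z * ip (u I c z) (u I c z))"
    if I: "finite I" "\<And>i. i \<in> I \<Longrightarrow> 1 \<le> i" for I c
  proof -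
    let ?f = "\<lambda>x. \<Sum>i\<in>I. c i * e i x"
    have orth: "ip (u I c y) (u I c z) = (if y = z then ip (u I c z) (u I c z) else 0)" for y z
      using eigenspaces_orthogonal[OF u_eig u_eig, of I I y z c c] I by auto
    have fD: "?f \<in> D" "?f \<in> L2_set M"
      using eD I by (auto intro!: sum_mem scale L2.sum_mem L2.scale)
    have ipz: "ip (u I c z) ?f = ip (u I c z) (u I c z)" if "z \<in> lam ` I" for z
    proof -
      have "ip (u I c z) ?f = (\<Sum>y\<in>lam ` I. ip (u I c z) (u I c y))"
        using uD I by (simp add: u_sum L2.B_sum_right)
      also have "\<dots> = (\<Sum>y\<in>lam ` I. if z = y then ip (u I c y) (u I c y) else 0)"
        by (intro sum.cong refl orth)
      also have "\<dots> = ip (u I c z) (u I c z)" using that I by simp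
      finally show ?thesis .
    qed
    have "ip ?f ?f = (\<Sum>z\<in>lam ` I. ip (u I c z) ?f)"
      using uD I fD(2) by (subst u_sum) (simp_all add: L2.B_sum)
    then show "ip ?f ?f = (\<Sum>z\<in>lam ` I. ip (u I c z) (u I c z))" by (simp add: ipz)
    have "a ?f ?f = (\<Sum>z\<in>lam ` I. a (u I c z) ?f)"
      using uD I fD(1) by (subst u_sum) (simp_all add: B_sum)
    also have "\<dots> = (\<Sum>z\<in>lam ` I. of_real z * ip (u I c z) ?f)"
      using u_eig[OF I(2), of I c] fD by (intro sum.cong) (auto simp: eigenspace_iff)
    finally show "a ?f ?f = (\<Sum>z\<in>lam ` I. of_real z * ip (u I c z) (u I c z))" by (simp add: ipz)
  qed
  show ?thesis
  proof (rule that[of e])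
    show "e i \<in> D" if "1 \<le> i" for i using eD that by auto
  next
    fix I c \<Lambda> assume I: "finite I" "\<And>i. i \<in> I \<Longrightarrow> 1 \<le> i \<and> lam i \<le> \<Lambda>"
    have "z * L2.nsq M (u I c z) \<le> \<Lambda> * L2.nsq M (u I c z)" if "z \<in> lam ` I" for z
      using that I by (intro mult_right_mono L2.B_nonneg uD) auto
    then show "nsq (\<lambda>x. \<Sum>i\<in>I. c i * e i x) \<le> \<Lambda> * L2.nsq M (\<lambda>x. \<Sum>i\<in>I. c i * e i x)"
      using I by (simp add: ip_sum a_sum sum_distrib_left) (intro sum_mono, auto)
  next
    fix I :: "nat set" and c :: "nat \<Rightarrow> complex" and k
    assume I: "finite I" "\<And>i. i \<in> I \<Longrightarrow> 1 \<le> i" "k \<in> I" "c k \<noteq> 0"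
    \<comment> \<open>One nonzero group suffices, the groups being orthogonal. Independence is known
      for all indices with eigenvalue \<open>lam k\<close>, so \<open>c\<close> is continued by 0
      outside \<open>I\<close>.\<close>
    have "\<not> (AE x in M. u I c (lam k) x = 0)"
    proof
      assume *: "AE x in M. u I c (lam k) x = 0"
      have "u I c (lam k) x = (\<Sum>i\<in>{i. 1 \<le> i \<and> lam i = lam k}. (if i \<in> I then c i else 0) * e i x)" for x
        unfolding u_def using fin I by (intro sum.mono_neutral_cong_left) auto
      with * have "(if k \<in> I then c k else 0) = 0"
        using indep[of "\<lambda>i. if i \<in> I then c i else 0" "lam k" k] I by simp
      then show False using I by simp
    qed
    then have "L2.nsq M (u I c (lam k)) \<noteq> 0" using L2_nsq_eq_0_iff uD I by blast
    then have "0 < L2.nsq M (u I c (lam k))" using L2.B_nonneg[OF uD(2)[OF I(2), of I c "lam k"]] I by fastforce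
    also have "\<dots> \<le> (\<Sum>z\<in>lam ` I. L2.nsq M (u I c z))"
      using I uD by (intro member_le_sum) (auto intro!: L2.B_nonneg)
    finally show "0 < L2.nsq M (\<lambda>x. \<Sum>i\<in>I. c i * e i x)" using I by (simp add: ip_sum)
  next
    fix f \<Lambda> assume fin\<Lambda>: "finite {i. 1 \<le> i \<and> lam i < \<Lambda>}" and f: "f \<in> D"
      and orth: "\<And>i. 1 \<le> i \<Longrightarrow> lam i < \<Lambda> \<Longrightarrow> ip f (e i) = 0"
    show "\<Lambda> * L2.nsq M f \<le> nsq f"
    proof (rule ccontr)
      assume "\<not> ?thesis"
      then have "nsq f < \<Lambda> * L2.nsq M f" by simp
      then obtain g \<kappa> where g: "\<kappa> < \<Lambda>" "g \<in> eigenspace A (of_real \<kappa>)" "L2.nsq M g = 1"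
        and orth': "\<And>i. i \<in> {i. 1 \<le> i \<and> lam i < \<Lambda>} \<Longrightarrow> ip g (e i) = 0"
        by (rule minimiser[OF fin\<Lambda>, of e lam f \<Lambda>, rotated 3]) (use e f orth in auto)
      obtain c where c: "AE x in M. g x = (\<Sum>i\<in>{i. 1 \<le> i \<and> lam i = \<kappa>}. c i * e i x)"
        using span[OF g(2)] by blast
      let ?s = "\<lambda>x. \<Sum>i\<in>{i. 1 \<le> i \<and> lam i = \<kappa>}. c i * e i x"
      have gL: "g \<in> L2_set M" using g(2) D_L2 by (auto simp: eigenspace_iff)
      have sL: "?s \<in> L2_set M" using eD by (intro L2.sum_mem L2.scale) auto
      have "ip (e i) g = 0" if "1 \<le> i" "lam i = \<kappa>" for i
        using orth'[of i] L2.B_sym[OF gL eD(2)[OF that(1)]] that g(1) by simp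
      then have "ip ?s g = 0"
        using gL eD by (subst L2.B_sum) (auto simp: L2.B_scale L2.scale)
      then have "ip g g = 0" using L2_inner_cong_AE[OF gL sL gL c] by simp
      then show False using g(3) by simp
    qed
  qed
qed

end

text \<open>Gaussian elimination: an unknown that occurs in the new equation is eliminated from the
  others and recovered at the end as \<open>ck\<close>. The index sets are arbitrary since in each
  application one of them consists of pairs of a half-line and an eigenfunction number.\<close>

lemma underdetermined_system:
  fixes A :: "'i \<Rightarrow> 'j \<Rightarrow> complex"
  assumes "finite I" "finite J" "card I < card J"
  shows "\<exists>c. (\<exists>j\<in>J. c j \<noteq> 0) \<and> (\<forall>i\<in>I. (\<Sum>j\<in>J. c j * A i j) = 0)"
  using assms
proof (induction I arbitrary: J A rule: finite_induct)
  case empty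
  then have "J \<noteq> {}" by auto
  then show ?case by (intro exI[of _ "\<lambda>_. 1"]) auto
next
  case (insert i I)
  show ?case
  proof (cases "\<forall>j\<in>J. A i j = 0")
    case True
    have "card I < card J" using insert.prems(2) insert.hyps by simp
    then obtain c where "\<exists>j\<in>J. c j \<noteq> 0" "\<forall>i\<in>I. (\<Sum>j\<in>J. c j * A i j) = 0"
      using insert.IH[of J A] insert.prems(1) by auto
    then show ?thesis using True by (intro exI[of _ c]) auto
  next
    case False
    then obtain k where k: "k \<in> J" "A i k \<noteq> 0" by auto
    define J' where "J' = J - {k}"
    have J': "finite J'" "card I < card J'" "J = insert k J'" "k \<notin> J'"
      using insert k by (auto simp: J'_def)
    define A' where "A' l j = A l j - A i j / A i k * A l k" for l j
    obtain c where c: "\<exists>j\<in>J'. c j \<noteq> 0" "\<And>l. l \<in> I \<Longrightarrow> (\<Sum>j\<in>J'. c j * A' l j) = 0"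
      using insert.IH[of J' A'] J' by auto
    define ck where "ck = - (\<Sum>j\<in>J'. c j * A i j) / A i k"
    define c' where "c' = c(k := ck)"
    have sum: "(\<Sum>j\<in>J. c' j * A l j) = ck * A l k + (\<Sum>j\<in>J'. c j * A l j)" for l
    proof -
      have "(\<Sum>j\<in>J'. c' j * A l j) = (\<Sum>j\<in>J'. c j * A l j)"
        using J' by (intro sum.cong) (auto simp: c'_def)
      then show ?thesis using J' by (simp add: c'_def)
    qed
    have "(\<Sum>j\<in>J. c' j * A l j) = 0" if "l \<in> insert i I" for l
    proof (cases "l = i")
      case True
      then show ?thesis using k by (simp add: sum ck_def)
    next
      case False
      then have "0 = (\<Sum>j\<in>J'. c j * A' l j)" using c that by simp
      also have "\<dots> = (\<Sum>j\<in>J'. c j * A l j) - (\<Sum>j\<in>J'. c j * A i j) / A i k * A l k"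
        by (simp add: A'_def right_diff_distrib sum_subtractf sum_distrib_right sum_divide_distrib mult.assoc)
      finally show ?thesis by (simp add: sum ck_def)
    qed
    moreover have "\<exists>j\<in>J. c' j \<noteq> 0" using c(1) J' by (auto simp: c'_def)
    ultimately show ?thesis by blast
  qed
qed

section \<open>Weak derivatives and primitives\<close>

text \<open>Absolute continuity in integral form. It replaces \<open>is_weak_deriv\<close> in all
  later arguments because it makes sense on a closed interval, end points included, and passes to
  pointwise limits and to concatenated edges without test functions.\<close>

definition primitive :: "real set \<Rightarrow> (real \<Rightarrow> complex) \<Rightarrow> (real \<Rightarrow> complex) \<Rightarrow> bool" where
  "primitive S f w \<longleftrightarrow> (\<forall>x\<in>S. \<forall>y\<in>S. x \<le> y \<longrightarrow>
     set_integrable lborel {x..y} w \<and> f y - f x = (LINT s:{x..y}|lborel. w s))"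

lemma is_interval_Icc_subset: "is_interval S \<Longrightarrow> x \<in> S \<Longrightarrow> y \<in> S \<Longrightarrow> {x..y} \<subseteq> S" for S :: "real set"
  unfolding is_interval_1 by (meson atLeastAtMost_iff subsetI)

lemma set_integral_combine:
  fixes w :: "real \<Rightarrow> complex"
  assumes "x \<le> y" "y \<le> z" "set_integrable lborel {x..z} w"
  shows "(LINT s:{x..z}|lborel. w s) = (LINT s:{x..y}|lborel. w s) + (LINT s:{y..z}|lborel. w s)"
proof -
  have "set_integrable lborel {x..y} w" "set_integrable lborel {y..z} w"
    using assms by (auto intro: set_integrable_subset)
  then show ?thesis
    using assms Henstock_Kurzweil_Integration.integral_combine[of x y z w]
    by (simp add: set_borel_integral_eq_integral)
qed

lemma primitive_continuous:
  assumes "is_interval S" "primitive S f w"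
  shows "continuous_on S f"
  unfolding continuous_on_eq_continuous_within
proof -
  show "\<forall>x\<in>S. continuous (at x within S) f"
  proof
    fix x assume x: "x \<in> S"
    have *: "continuous_on {u..v} f" if uv: "u \<in> S" "v \<in> S" "u \<le> v" for u v
    proof -
      have int: "set_integrable lborel {u..v} w" using assms(2) uv by (auto simp: primitive_def)
      have "continuous_on {u..v} (\<lambda>y. f u + integral {u..y} w)"
        using set_borel_integral_eq_integral(1)[OF int]
        by (intro continuous_intros indefinite_integral_continuous_1)
      moreover have "f u + integral {u..y} w = f y" if "y \<in> {u..v}" for y
      proof -
        have yS: "y \<in> S" using is_interval_Icc_subset[OF assms(1) uv(1,2)] that by blast
        then have "f y - f u = (LINT s:{u..y}|lborel. w s)" "set_integrable lborel {u..y} w"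
          using assms(2) uv that by (auto simp: primitive_def)
        then show ?thesis by (simp add: set_borel_integral_eq_integral algebra_simps)
      qed
      ultimately show ?thesis by (rule continuous_on_eq)
    qed
    \<comment> \<open>\<open>u\<close> lies strictly left of \<open>x\<close> unless
      \<open>x\<close> is the left end of \<open>S\<close>, and \<open>v\<close> likewise on the
      right; hence \<open>{u..v}\<close> is a neighbourhood of \<open>x\<close> relative to
      \<open>S\<close>.\<close>
    obtain u where u: "u \<in> S" "u \<le> x" "\<And>z. z \<in> S \<Longrightarrow> u = x \<Longrightarrow> x \<le> z"
      by (cases "\<exists>z\<in>S. z < x") (use x in \<open>auto simp: not_less intro: less_imp_le\<close>)
    obtain v where v: "v \<in> S" "x \<le> v" "\<And>z. z \<in> S \<Longrightarrow> v = x \<Longrightarrow> z \<le> x"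
      by (cases "\<exists>z\<in>S. x < z") (use x in \<open>auto simp: not_less intro: less_imp_le\<close>)
    have cont: "continuous (at x within {u..v}) f"
      using *[OF u(1) v(1)] u v by (auto simp: continuous_on_eq_continuous_within)
    have ev: "\<forall>\<^sub>F y in nhds x. y \<in> S \<longrightarrow> y \<in> {u..v}"
    proof -
      have "\<forall>\<^sub>F y in nhds x. y \<in> S \<longrightarrow> u \<le> y"
      proof (cases "u = x")
        case True then show ?thesis using u(3) by auto
      next
        case False
        then have "\<forall>\<^sub>F y in nhds x. u < y" using u(2) by (intro order_tendstoD(1)[OF filterlim_ident]) auto
        then show ?thesis by eventually_elim auto
      qed
      moreover have "\<forall>\<^sub>F y in nhds x. y \<in> S \<longrightarrow> y \<le> v"
      proof (cases "v = x")
        case True then show ?thesis using v(3) by auto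
      next
        case False
        then have "\<forall>\<^sub>F y in nhds x. y < v" using v(2) by (intro order_tendstoD(2)[OF filterlim_ident]) auto
        then show ?thesis by eventually_elim auto
      qed
      ultimately show ?thesis by eventually_elim auto
    qed
    have sub: "{u..v} \<subseteq> S" by (rule is_interval_Icc_subset[OF assms(1) u(1) v(1)])
    have "at x within S = at x within {u..v}"
      unfolding at_within_def
    proof (rule antisym)
      show "inf (nhds x) (principal (S - {x})) \<le> inf (nhds x) (principal ({u..v} - {x}))"
        using ev by (auto simp: le_inf_iff le_principal eventually_inf_principal elim: eventually_mono)
      show "inf (nhds x) (principal ({u..v} - {x})) \<le> inf (nhds x) (principal (S - {x}))"
        using sub by (intro inf_mono order_refl) auto
    qed
    then show "continuous (at x within S) f" using cont by simp
  qed
qed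

section \<open>Test functions and integration by parts\<close>

lemma C1_test_functionD:
  assumes "C1_test_function S \<phi>"
  shows "(\<phi> has_real_derivative deriv \<phi> x) (at x)" "continuous_on UNIV (deriv \<phi>)"
    "compact (closure {x. \<phi> x \<noteq> 0})" "closure {x. \<phi> x \<noteq> 0} \<subseteq> S"
  using assms unfolding C1_test_function_def by (auto simp: DERIV_deriv_iff_real_differentiable)

text \<open>The support is compact and \<open>S\<close> open, so there is room on both sides of it.
  Then \<phi> vanishes at \<alpha> and \<beta>, and integration by parts over
  \<open>{\<alpha>..\<beta>}\<close> has no boundary terms.\<close>

lemma C1_test_function_interval:
  assumes S: "open S" "is_interval S" "S \<noteq> {}" and \<phi>: "C1_test_function S \<phi>"
  obtains \<alpha> \<beta> where "\<alpha> \<in> S" "\<beta> \<in> S" "\<alpha> \<le> \<beta>" "\<And>x. x \<notin> {\<alpha><..<\<beta>} \<Longrightarrow> \<phi> x = 0 \<and> deriv \<phi> x = 0"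
proof -
  let ?T = "closure {x. \<phi> x \<noteq> 0}"
  note \<phi>D = C1_test_functionD[OF \<phi>]
  have out: "\<phi> x = 0 \<and> deriv \<phi> x = 0" if "x \<notin> ?T" for x
  proof
    show "\<phi> x = 0" using that closure_subset[of "{x. \<phi> x \<noteq> 0}"] by auto
    have "((\<lambda>_. 0) has_real_derivative 0) (at x)" by simp
    moreover have "\<forall>\<^sub>F y in nhds x. 0 = \<phi> y"
      using that closure_subset[of "{x. \<phi> x \<noteq> 0}"]
      by (intro eventually_nhds_in_open[of "- ?T" x, THEN eventually_mono]) auto
    ultimately have "(\<phi> has_real_derivative 0) (at x)"
      using DERIV_cong_ev[OF refl, of "\<lambda>_. 0" \<phi> x 0 0] by auto
    then show "deriv \<phi> x = 0" by (rule DERIV_imp_deriv)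
  qed
  show ?thesis
  proof (cases "?T = {}")
    case True
    obtain z where "z \<in> S" using S(3) by auto
    then show ?thesis using that[of z z] out True by auto
  next
    case False
    obtain p where p: "p \<in> ?T" "\<And>x. x \<in> ?T \<Longrightarrow> p \<le> x"
      using compact_attains_inf[OF \<phi>D(3) False] by blast
    obtain q where q: "q \<in> ?T" "\<And>x. x \<in> ?T \<Longrightarrow> x \<le> q"
      using compact_attains_sup[OF \<phi>D(3) False] by blast
    have "p \<in> S" "q \<in> S" using p q \<phi>D(4) by auto
    obtain d1 where d1: "d1 > 0" "cball p d1 \<subseteq> S" using S(1) \<open>p \<in> S\<close> open_contains_cball by blast
    obtain d2 where d2: "d2 > 0" "cball q d2 \<subseteq> S" using S(1) \<open>q \<in> S\<close> open_contains_cball by blast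
    have "p \<le> q" using p q by auto
    show ?thesis
    proof (rule that[of "p - d1" "q + d2"])
      show "p - d1 \<in> S" "q + d2 \<in> S" using d1 d2 by (auto simp: subset_iff dist_real_def)
      show "p - d1 \<le> q + d2" using d1(1) d2(1) \<open>p \<le> q\<close> by simp
      fix x assume "x \<notin> {p - d1<..<q + d2}"
      then have "x \<notin> ?T" using p(2)[of x] q(2)[of x] d1(1) d2(1) by force
      then show "\<phi> x = 0 \<and> deriv \<phi> x = 0" by (rule out)
    qed
  qed
qed

lemma set_integral_FTC:
  assumes "\<And>s. (\<phi> has_real_derivative \<phi>' s) (at s)" "continuous_on UNIV \<phi>'" "x \<le> y"
  shows "set_integrable lborel {x..y} \<phi>'" "(LINT s:{x..y}|lborel. \<phi>' s) = \<phi> y - \<phi> x"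
proof -
  show int: "set_integrable lborel {x..y} \<phi>'"
    by (intro borel_integrable_atLeastAtMost' continuous_on_subset[OF assms(2)]) auto
  have "(\<phi>' has_integral (\<phi> y - \<phi> x)) {x..y}"
    using assms(1) by (intro fundamental_theorem_of_calculus assms(3))
      (auto simp: has_real_derivative_iff_has_vector_derivative intro: has_vector_derivative_at_within)
  then show "(LINT s:{x..y}|lborel. \<phi>' s) = \<phi> y - \<phi> x"
    using set_borel_integral_eq_integral(2)[OF int] by (simp add: integral_unique)
qed

text \<open>Fubini on the triangle r \<le> s: for fixed r, integrating \<open>\<phi>'\<close> over
  \<open>{r..\<beta>}\<close> leaves - \<phi> r since \<phi> vanishes at \<beta>. As
  \<open>w\<close> is merely integrable, its primitive need not be differentiable, and the
  fundamental theorem is applied to \<phi> alone.\<close>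

lemma set_integral_by_parts:
  fixes w :: "real \<Rightarrow> complex"
  assumes \<phi>: "\<And>s. (\<phi> has_real_derivative \<phi>' s) (at s)" "continuous_on UNIV \<phi>'" "\<phi> \<beta> = 0"
    and w: "set_integrable lborel {\<alpha>..\<beta>} w"
  shows "(LINT s:{\<alpha>..\<beta>}|lborel. (LINT r:{\<alpha>..s}|lborel. w r) * of_real (\<phi>' s))
    = - (LINT r:{\<alpha>..\<beta>}|lborel. w r * of_real (\<phi> r))"
proof -
  define W where "W r = indicator {\<alpha>..\<beta>} r *\<^sub>R w r" for r
  define P where "P s = indicator {\<alpha>..\<beta>} s * \<phi>' s" for s
  define F where "F r s = (indicator {p. fst p \<le> snd p} (r, s) * P s) *\<^sub>R W r" for r s :: real
  have \<phi>'_meas [measurable]: "\<phi>' \<in> borel_measurable borel"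
    using \<phi>(2) by (rule borel_measurable_continuous_onI)
  have W: "integrable lborel W" using w by (simp add: set_integrable_def W_def[abs_def])
  then have W_meas [measurable]: "W \<in> borel_measurable borel" by auto
  have P_meas [measurable]: "P \<in> borel_measurable borel" unfolding P_def[abs_def] by measurable
  have P: "integrable lborel P"
    using borel_integrable_atLeastAtMost'[OF continuous_on_subset[OF \<phi>(2)], of \<alpha> \<beta>]
    by (simp add: set_integrable_def P_def[abs_def])
  have "{p \<in> space (borel \<Otimes>\<^sub>M borel). fst p \<le> (snd p :: real)} \<in> sets (borel \<Otimes>\<^sub>M borel)" by measurable
  then have leset: "{p. fst p \<le> (snd p :: real)} \<in> sets (borel \<Otimes>\<^sub>M borel)"
    by (simp add: space_pair_measure)
  have F_meas: "case_prod F \<in> borel_measurable (lborel \<Otimes>\<^sub>M lborel)"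
    unfolding F_def[abs_def] using leset by measurable
  have Fb: "norm (F r s) \<le> \<bar>P s\<bar> * norm (W r)" for r s
    by (auto simp: F_def split: split_indicator)
  have P_abs: "integrable lborel (\<lambda>s. \<bar>P s\<bar> * norm (W r))" for r
    using P by (intro integrable_mult_left) (auto intro: integrable_abs)
  have Fr_meas: "F r \<in> borel_measurable borel" for r
    using measurable_Pair2[OF F_meas, of r] by (simp add: comp_def)
  have F_int: "integrable lborel (F r)" for r
    using Fr_meas by (intro Bochner_Integration.integrable_bound[OF P_abs[of r]]) (auto simp: Fb abs_mult)
  have "integrable (lborel \<Otimes>\<^sub>M lborel) (case_prod F)"
  proof (rule lborel_pair.Fubini_integrable[OF F_meas])
    show "AE r in lborel. integrable lborel (\<lambda>s. case_prod F (r, s))" using F_int by simp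
    have m: "(\<lambda>r. \<integral>s. norm (case_prod F (r, s)) \<partial>lborel) \<in> borel_measurable lborel"
      using F_meas by measurable
    show "integrable lborel (\<lambda>r. \<integral>s. norm (case_prod F (r, s)) \<partial>lborel)"
    proof (rule Bochner_Integration.integrable_bound[OF _ m])
      show "integrable lborel (\<lambda>r. (\<integral>s. \<bar>P s\<bar> \<partial>lborel) * norm (W r))" using W by auto
      have "(\<integral>s. norm (F r s) \<partial>lborel) \<le> (\<integral>s. \<bar>P s\<bar> * norm (W r) \<partial>lborel)" for r
        using F_int P_abs Fb by (intro integral_mono) auto
      then show "AE r in lborel. norm (\<integral>s. norm (case_prod F (r, s)) \<partial>lborel)
          \<le> norm ((\<integral>s. \<bar>P s\<bar> \<partial>lborel) * norm (W r))"
        by (auto simp: abs_mult)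
    qed
  qed
  then have eq: "(\<integral>s. (\<integral>r. F r s \<partial>lborel) \<partial>lborel) = (\<integral>r. (\<integral>s. F r s \<partial>lborel) \<partial>lborel)"
    by (rule lborel_pair.Fubini_integral)
  have L: "(\<integral>r. F r s \<partial>lborel) = indicator {\<alpha>..\<beta>} s *\<^sub>R ((LINT r:{\<alpha>..s}|lborel. w r) * of_real (\<phi>' s))" for s
  proof (cases "s \<in> {\<alpha>..\<beta>}")
    case True
    have "F r s = \<phi>' s *\<^sub>R (indicator {\<alpha>..s} r *\<^sub>R w r)" for r
      using True by (auto simp: F_def P_def W_def split: split_indicator)
    then show ?thesis using True
      by (simp add: set_lebesgue_integral_def scaleR_conv_of_real mult.commute)
  next
    case False
    then show ?thesis by (simp add: F_def P_def)
  qed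
  have R: "(\<integral>s. F r s \<partial>lborel) = indicator {\<alpha>..\<beta>} r *\<^sub>R (- (w r * of_real (\<phi> r)))" for r
  proof (cases "r \<in> {\<alpha>..\<beta>}")
    case True
    have "F r s = (indicator {r..\<beta>} s * \<phi>' s) *\<^sub>R w r" for s
      using True by (auto simp: F_def P_def W_def split: split_indicator)
    moreover have "integrable lborel (\<lambda>s. indicator {r..\<beta>} s * \<phi>' s)"
      using set_integral_FTC(1)[OF \<phi>(1,2), of r \<beta>] True by (simp add: set_integrable_def)
    ultimately have "(\<integral>s. F r s \<partial>lborel) = (LINT s:{r..\<beta>}|lborel. \<phi>' s) *\<^sub>R w r"
      by (simp add: set_lebesgue_integral_def)
    also have "(LINT s:{r..\<beta>}|lborel. \<phi>' s) = - \<phi> r"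
      using set_integral_FTC(2)[OF \<phi>(1,2), of r \<beta>] True \<phi>(3) by simp
    finally show ?thesis using True by (simp add: scaleR_conv_of_real mult.commute)
  next
    case False
    then show ?thesis by (simp add: F_def W_def)
  qed
  show ?thesis using eq unfolding L R by (simp add: set_lebesgue_integral_def)
qed

lemma primitive_imp_weak_deriv:
  assumes S: "open S" "is_interval S" and prim: "primitive S f w"
  shows "is_weak_deriv S f w"
  unfolding is_weak_deriv_def
proof (intro conjI allI impI)
  fix K assume K: "compact K \<and> K \<subseteq> S"
  show "set_integrable lborel K f"
    unfolding set_integrable_def
    using K primitive_continuous[OF S(2) prim] by (intro borel_integrable_compact) (auto intro: continuous_on_subset)
  show "set_integrable lborel K w"
  proof (cases "K = {}")
    case True
    then show ?thesis by (simp add: set_integrable_def)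
  next
    case False
    obtain p where p: "p \<in> K" "\<And>x. x \<in> K \<Longrightarrow> p \<le> x"
      using compact_attains_inf[of K] K False by blast
    obtain q where q: "q \<in> K" "\<And>x. x \<in> K \<Longrightarrow> x \<le> q"
      using compact_attains_sup[of K] K False by blast
    have "p \<le> q" "p \<in> S" "q \<in> S" using K p q by auto
    then have "set_integrable lborel {p..q} w"
      using prim by (auto simp: primitive_def)
    then show ?thesis
      by (rule set_integrable_subset) (use K p q in \<open>auto intro: borel_compact\<close>)
  qed
next
  fix \<phi> assume \<phi>: "C1_test_function S \<phi>"
  note \<phi>D = C1_test_functionD[OF \<phi>]
  show "(LINT x:S|lborel. f x * complex_of_real (deriv \<phi> x)) = - (LINT x:S|lborel. w x * complex_of_real (\<phi> x))"
  proof (cases "S = {}")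
    case False
    obtain \<alpha> \<beta> where \<alpha>\<beta>: "\<alpha> \<in> S" "\<beta> \<in> S" "\<alpha> \<le> \<beta>"
      "\<And>x. x \<notin> {\<alpha><..<\<beta>} \<Longrightarrow> \<phi> x = 0 \<and> deriv \<phi> x = 0"
      using C1_test_function_interval[OF S False \<phi>] by blast
    have sub: "{\<alpha>..\<beta>} \<subseteq> S" by (rule is_interval_Icc_subset[OF S(2) \<alpha>\<beta>(1,2)])
    have w: "set_integrable lborel {\<alpha>..\<beta>} w" using prim \<alpha>\<beta> by (auto simp: primitive_def)
    \<comment> \<open>On \<open>{\<alpha>..\<beta>}\<close> the function \<open>f\<close> is the
      constant \<open>f \<alpha>\<close> plus the integral of \<open>w\<close>. The constant drops
      out because \<open>deriv \<phi>\<close> integrates to 0.\<close>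
    have i1: "indicator S x *\<^sub>R (f x * of_real (deriv \<phi> x)) =
        of_real (indicator {\<alpha>..\<beta>} x * deriv \<phi> x) * f \<alpha>
        + indicator {\<alpha>..\<beta>} x *\<^sub>R ((LINT r:{\<alpha>..x}|lborel. w r) * of_real (deriv \<phi> x))" for x
    proof (cases "x \<in> {\<alpha>..\<beta>}")
      case True
      have "f x = f \<alpha> + (LINT r:{\<alpha>..x}|lborel. w r)"
      proof -
        have "x \<in> S" "\<alpha> \<le> x" using True sub by auto
        then have "f x - f \<alpha> = (LINT r:{\<alpha>..x}|lborel. w r)"
          using prim \<alpha>\<beta>(1) unfolding primitive_def by blast
        then show ?thesis by (simp add: algebra_simps)
      qed
      then show ?thesis using True sub by (auto simp: algebra_simps)
    next
      case False
      then show ?thesis using \<alpha>\<beta>(4)[of x] by auto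
    qed
    have i2: "indicator S x *\<^sub>R (w x * of_real (\<phi> x)) = indicator {\<alpha>..\<beta>} x *\<^sub>R (w x * of_real (\<phi> x))" for x
      using \<alpha>\<beta>(4)[of x] sub by (auto split: split_indicator)
    have 1: "integrable lborel (\<lambda>x. of_real (indicator {\<alpha>..\<beta>} x * deriv \<phi> x) * f \<alpha>)"
      by (rule integrable_mult_left[OF integrable_of_real])
        (use set_integral_FTC(1)[OF \<phi>D(1,2) \<alpha>\<beta>(3)] in \<open>simp add: set_integrable_def\<close>)
    have 10: "(\<integral>x. of_real (indicator {\<alpha>..\<beta>} x * deriv \<phi> x) * f \<alpha> \<partial>lborel) = 0"
    proof -
      have "(\<integral>x. indicator {\<alpha>..\<beta>} x * deriv \<phi> x \<partial>lborel) = 0"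
        using set_integral_FTC(2)[OF \<phi>D(1,2) \<alpha>\<beta>(3)] \<alpha>\<beta>(4)[of \<alpha>] \<alpha>\<beta>(4)[of \<beta>]
        by (simp add: set_lebesgue_integral_def)
      then show ?thesis by (simp del: of_real_mult)
    qed
    have 2: "integrable lborel (\<lambda>x. indicator {\<alpha>..\<beta>} x *\<^sub>R ((LINT r:{\<alpha>..x}|lborel. w r) * of_real (deriv \<phi> x)))"
    proof (rule borel_integrable_compact)
      have "continuous_on {\<alpha>..\<beta>} (\<lambda>x. LINT r:{\<alpha>..x}|lborel. w r) \<longleftrightarrow> continuous_on {\<alpha>..\<beta>} (\<lambda>x. integral {\<alpha>..x} w)"
        by (intro continuous_on_cong refl set_borel_integral_eq_integral(2) set_integrable_subset[OF w]) auto
      then have "continuous_on {\<alpha>..\<beta>} (\<lambda>x. LINT r:{\<alpha>..x}|lborel. w r)"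
        using indefinite_integral_continuous_1[OF set_borel_integral_eq_integral(1)[OF w]] by simp
      then show "continuous_on {\<alpha>..\<beta>} (\<lambda>x. (LINT r:{\<alpha>..x}|lborel. w r) * of_real (deriv \<phi> x))"
        by (intro continuous_intros continuous_on_subset[OF \<phi>D(2)]) auto
    qed simp
    have "(LINT x:S|lborel. f x * of_real (deriv \<phi> x)) =
        (LINT s:{\<alpha>..\<beta>}|lborel. (LINT r:{\<alpha>..s}|lborel. w r) * of_real (deriv \<phi> s))"
      unfolding set_lebesgue_integral_def i1 Bochner_Integration.integral_add[OF 1 2[unfolded set_lebesgue_integral_def]] 10 by simp
    also have "\<dots> = - (LINT r:{\<alpha>..\<beta>}|lborel. w r * of_real (\<phi> r))"
      using \<alpha>\<beta>(4)[of \<beta>] by (intro set_integral_by_parts[OF \<phi>D(1,2) _ w]) auto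
    also have "(LINT r:{\<alpha>..\<beta>}|lborel. w r * of_real (\<phi> r)) = (LINT x:S|lborel. w x * of_real (\<phi> x))"
      unfolding set_lebesgue_integral_def i2 ..
    finally show ?thesis .
  qed (simp add: set_lebesgue_integral_def)
qed


text \<open>The test function is made from \<open>h\<close> itself: \<psi> = (h - m) \<theta>, where
  the bump \<theta> is positive exactly on the open interval and \<open>m\<close> is the
  \<theta>-weighted mean of \<open>h\<close>. This choice of \<open>m\<close> gives \<psi> integral
  0, so that its primitive \<phi> vanishes on both sides of the interval. Testing with it yields
  that (h - m)^2 \<theta> has integral 0, whence \<open>h = m\<close>.\<close>

lemma du_Bois_Reymond:
  fixes h :: "real \<Rightarrow> real"
  assumes "x < y" and h: "continuous_on {x..y} h"
    and test: "\<And>\<phi> \<psi>. (\<And>s. (\<phi> has_real_derivative \<psi> s) (at s)) \<Longrightarrow> continuous_on UNIV \<psi> \<Longrightarrow>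
      (\<And>s. s \<notin> {x<..<y} \<Longrightarrow> \<phi> s = 0 \<and> \<psi> s = 0) \<Longrightarrow> integral {x..y} (\<lambda>s. h s * \<psi> s) = 0"
  shows "h y = h x"
proof -
  define \<theta> where "\<theta> s = max 0 ((s - x) * (y - s))" for s
  \<comment> \<open>Constant continuation of \<open>h\<close>, so that \<psi> is continuous on the
    whole line.\<close>
  define H where "H s = h (max x (min y s))" for s
  have \<theta>: "continuous_on A \<theta>" for A unfolding \<theta>_def by (intro continuous_intros)
  have H: "continuous_on UNIV H"
    unfolding H_def using \<open>x < y\<close> by (intro continuous_on_compose2[OF h] continuous_intros) auto
  have HA: "continuous_on A H" for A by (rule continuous_on_subset[OF H]) auto
  define m where "m = integral {x..y} (\<lambda>s. H s * \<theta> s) / integral {x..y} \<theta>"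
  have \<theta>pos: "integral {x..y} \<theta> \<noteq> 0"
  proof
    assume "integral {x..y} \<theta> = 0"
    moreover have "0 \<le> \<theta> s" for s by (simp add: \<theta>_def)
    ultimately have "\<forall>s\<in>{x..y}. \<theta> s = 0"
      using integral_eq_0_iff[OF \<theta> \<open>x < y\<close>] by blast
    then have "\<theta> ((x + y) / 2) = 0" using \<open>x < y\<close> by simp
    moreover have "0 < ((x + y) / 2 - x) * (y - (x + y) / 2)"
      using \<open>x < y\<close> by (intro mult_pos_pos) (auto simp: field_simps)
    ultimately show False by (simp add: \<theta>_def)
  qed
  define \<psi> where "\<psi> s = (H s - m) * \<theta> s" for s
  have \<psi>: "continuous_on A \<psi>" for A unfolding \<psi>_def by (intro continuous_intros HA \<theta>)
  have \<psi>0: "\<psi> s = 0" if "s \<notin> {x<..<y}" for s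
  proof -
    have "(s - x) * (y - s) \<le> 0"
      using that \<open>x < y\<close> by (cases "s \<le> x") (auto intro: mult_nonpos_nonneg mult_nonneg_nonpos)
    then show ?thesis by (simp add: \<psi>_def \<theta>_def)
  qed
  have "\<exists>F. \<forall>s::real. - \<infinity> < ereal s \<longrightarrow> ereal s < \<infinity> \<longrightarrow> (F has_vector_derivative \<psi> s) (at s)"
    using \<psi>[of UNIV] by (intro einterval_antiderivative) (auto simp: continuous_on_eq_continuous_at)
  then obtain F where F: "(F has_real_derivative \<psi> s) (at s)" for s
    by (auto simp: has_real_derivative_iff_has_vector_derivative)
  define \<phi> where "\<phi> s = F s - F x" for s
  have \<phi>: "(\<phi> has_real_derivative \<psi> s) (at s)" for s
    unfolding \<phi>_def using F[of s] by (auto intro!: derivative_eq_intros)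
  have ftc: "integral {u..v} \<psi> = \<phi> v - \<phi> u" if "u \<le> v" for u v
    using that \<phi> by (intro integral_unique fundamental_theorem_of_calculus)
      (auto simp: has_real_derivative_iff_has_vector_derivative intro: has_vector_derivative_at_within)
  have int: "(\<lambda>s. H s * \<theta> s) integrable_on {x..y}" "\<theta> integrable_on {x..y}"
    by (intro integrable_continuous_real continuous_intros HA \<theta>)+
  have "integral {x..y} \<psi> = integral {x..y} (\<lambda>s. H s * \<theta> s) - m * integral {x..y} \<theta>"
    unfolding \<psi>_def left_diff_distrib using int
    by (subst Henstock_Kurzweil_Integration.integral_diff) (auto intro: integrable_on_mult_right)
  then have \<psi>int: "integral {x..y} \<psi> = 0" using \<theta>pos by (simp add: m_def)
  have \<phi>0: "\<phi> s = 0" if "s \<notin> {x<..<y}" for s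
  proof (cases "s \<le> x")
    case True
    have "integral {s..x} \<psi> = 0"
      by (intro integral_unique has_integral_is_0) (auto simp: \<psi>0)
    then show ?thesis using ftc[OF True] by (simp add: \<phi>_def)
  next
    case False
    then have ys: "y \<le> s" using that by auto
    have "integral {y..s} \<psi> = 0"
      by (intro integral_unique has_integral_is_0) (auto simp: \<psi>0)
    then show ?thesis using ftc[OF ys] ftc[of x y] \<psi>int \<open>x < y\<close> by (simp add: \<phi>_def)
  qed
  have "integral {x..y} (\<lambda>s. h s * \<psi> s) = 0"
    by (rule test[OF \<phi> \<psi>]) (use \<phi>0 \<psi>0 in auto)
  moreover have "integral {x..y} (\<lambda>s. h s * \<psi> s) = integral {x..y} (\<lambda>s. H s * \<psi> s)"
    by (intro integral_cong) (auto simp: H_def)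
  moreover have "integral {x..y} (\<lambda>s. (H s - m) * \<psi> s)
      = integral {x..y} (\<lambda>s. H s * \<psi> s) - m * integral {x..y} \<psi>"
    unfolding left_diff_distrib
    by (subst Henstock_Kurzweil_Integration.integral_diff)
      (auto intro!: integrable_on_mult_right integrable_continuous_real continuous_intros HA \<psi>)
  ultimately have "integral {x..y} (\<lambda>s. (H s - m) * \<psi> s) = 0" using \<psi>int by simp
  moreover have "(H s - m) * \<psi> s = (H s - m)\<^sup>2 * \<theta> s" for s
    by (simp add: \<psi>_def power2_eq_square)
  ultimately have "\<forall>s\<in>{x..y}. (H s - m)\<^sup>2 * \<theta> s = 0"
    using \<open>x < y\<close> by (subst integral_eq_0_iff[symmetric]) (auto intro!: continuous_intros HA \<theta> simp: \<theta>_def)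
  then have *: "h s = m" if "s \<in> {x<..<y}" for s
    using that by (auto simp: H_def \<theta>_def max_def mult_le_0_iff)
  have "h s = m" if "s \<in> {x..y}" for s
    using continuous_constant_on_closure[of "{x<..<y}" h m s] h * that \<open>x < y\<close> by simp
  then show ?thesis using \<open>x < y\<close> by simp
qed

lemma set_integral_point [simp]: "(LINT s:{x}|lborel. w s) = 0" for w :: "real \<Rightarrow> complex"
proof -
  have "AE s in lborel. indicator {x} s *\<^sub>R w s = 0"
    using AE_lborel_singleton[of x] by eventually_elim auto
  then show ?thesis unfolding set_lebesgue_integral_def by (rule integral_eq_zero_AE)
qed

lemma continuous_on_set_integral:
  fixes w :: "real \<Rightarrow> complex"
  assumes w: "set_integrable lborel {x..y} w"
  shows "continuous_on {x..y} (\<lambda>s. LINT r:{x..s}|lborel. w r)"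
proof -
  have "continuous_on {x..y} (\<lambda>s. LINT r:{x..s}|lborel. w r) \<longleftrightarrow> continuous_on {x..y} (\<lambda>s. integral {x..s} w)"
    by (intro continuous_on_cong refl set_borel_integral_eq_integral(2) set_integrable_subset[OF w]) auto
  then show ?thesis
    using indefinite_integral_continuous_1[OF set_borel_integral_eq_integral(1)[OF w]] by simp
qed

text \<open>Subtracting the integral of \<open>w\<close> from \<open>f\<close> leaves a continuous
  function with weak derivative 0, whose real and imaginary parts are constant by du Bois-Reymond.
  Test functions supported in \<open>{x..y}\<close> suffice.\<close>

lemma weak_deriv_imp_primitive:
  assumes S: "is_interval S" and f: "continuous_on S f" and wd: "is_weak_deriv S f w"
  shows "primitive S f w"
  unfolding primitive_def
proof (intro ballI impI)
  fix x y assume xy: "x \<in> S" "y \<in> S" "x \<le> y"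
  have sub: "{x..y} \<subseteq> S" by (rule is_interval_Icc_subset[OF S xy(1,2)])
  have w: "set_integrable lborel {x..y} w" using wd sub by (auto simp: is_weak_deriv_def)
  have "f y - f x = (LINT s:{x..y}|lborel. w s)"
  proof (cases "x = y")
    case False
    then have less: "x < y" using xy by simp
    define g where "g s = f s - (LINT r:{x..s}|lborel. w r)" for s
    have g: "continuous_on {x..y} g"
      unfolding g_def by (intro continuous_intros continuous_on_set_integral w continuous_on_subset[OF f] sub)
    have test: "(LINT s:{x..y}|lborel. g s * of_real (\<psi> s)) = 0"
      if d: "\<And>s. (\<phi> has_real_derivative \<psi> s) (at s)" and c: "continuous_on UNIV \<psi>"
        and z: "\<And>s. s \<notin> {x<..<y} \<Longrightarrow> \<phi> s = 0 \<and> \<psi> s = 0" for \<phi> \<psi>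
    proof -
      have der: "deriv \<phi> = \<psi>" using DERIV_imp_deriv[OF d] by auto
      have supp: "closure {s. \<phi> s \<noteq> 0} \<subseteq> {x..y}"
      proof (rule closure_minimal)
        show "{s. \<phi> s \<noteq> 0} \<subseteq> {x..y}"
        proof
          fix s assume "s \<in> {s. \<phi> s \<noteq> 0}"
          then have "s \<in> {x<..<y}" using z[of s] by blast
          then show "s \<in> {x..y}" by simp
        qed
      qed simp
      then have "compact (closure {s. \<phi> s \<noteq> 0})"
        by (metis compact_Icc closed_closure compact_Int_closed inf.absorb_iff2)
      then have "C1_test_function S \<phi>"
        using d c supp sub by (auto simp: C1_test_function_def der real_differentiable_def)
      then have "(LINT s:S|lborel. f s * of_real (\<psi> s)) = - (LINT s:S|lborel. w s * of_real (\<phi> s))"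
        using wd der unfolding is_weak_deriv_def by metis
      moreover have "indicator S s *\<^sub>R (f s * of_real (\<psi> s)) = indicator {x..y} s *\<^sub>R (f s * of_real (\<psi> s))"
        "indicator S s *\<^sub>R (w s * of_real (\<phi> s)) = indicator {x..y} s *\<^sub>R (w s * of_real (\<phi> s))" for s
        using z[of s] sub by (auto split: split_indicator)
      ultimately have 1: "(LINT s:{x..y}|lborel. f s * of_real (\<psi> s)) = - (LINT s:{x..y}|lborel. w s * of_real (\<phi> s))"
        unfolding set_lebesgue_integral_def by (simp only:)
      have 2: "(LINT s:{x..y}|lborel. (LINT r:{x..s}|lborel. w r) * of_real (\<psi> s))
          = - (LINT s:{x..y}|lborel. w s * of_real (\<phi> s))"
        using z[of y] by (intro set_integral_by_parts[OF d c _ w]) auto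
      have "(LINT s:{x..y}|lborel. g s * of_real (\<psi> s)) = (LINT s:{x..y}|lborel. f s * of_real (\<psi> s))
          - (LINT s:{x..y}|lborel. (LINT r:{x..s}|lborel. w r) * of_real (\<psi> s))"
        unfolding g_def left_diff_distrib
        by (intro set_integral_diff(2) borel_integrable_atLeastAtMost' continuous_intros
            continuous_on_set_integral w continuous_on_subset[OF f sub] continuous_on_subset[OF c]) auto
      then show ?thesis using 1 2 by simp
    qed
    have testi: "integral {x..y} (\<lambda>s. g s * of_real (\<psi> s)) = 0" "(\<lambda>s. g s * of_real (\<psi> s)) integrable_on {x..y}"
      if d: "\<And>s. (\<phi> has_real_derivative \<psi> s) (at s)" and c: "continuous_on UNIV \<psi>"
        and z: "\<And>s. s \<notin> {x<..<y} \<Longrightarrow> \<phi> s = 0 \<and> \<psi> s = 0" for \<phi> \<psi>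
    proof -
      have "set_integrable lborel {x..y} (\<lambda>s. g s * of_real (\<psi> s))"
        by (intro borel_integrable_atLeastAtMost' continuous_intros g continuous_on_subset[OF c]) auto
      then show "integral {x..y} (\<lambda>s. g s * of_real (\<psi> s)) = 0" "(\<lambda>s. g s * of_real (\<psi> s)) integrable_on {x..y}"
        using test[OF d c z] by (simp_all add: set_borel_integral_eq_integral)
    qed
    have "Re (g y) = Re (g x)"
    proof (rule du_Bois_Reymond[OF less])
      show "continuous_on {x..y} (\<lambda>s. Re (g s))" by (intro continuous_intros g)
      fix \<phi> \<psi> :: "real \<Rightarrow> real"
      assume *: "\<And>s. (\<phi> has_real_derivative \<psi> s) (at s)" "continuous_on UNIV \<psi>"
        "\<And>s. s \<notin> {x<..<y} \<Longrightarrow> \<phi> s = 0 \<and> \<psi> s = 0"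
      from integral_linear[OF testi(2)[OF *] bounded_linear_Re] testi(1)[OF *]
      show "integral {x..y} (\<lambda>s. Re (g s) * \<psi> s) = 0" by (simp add: comp_def)
    qed
    moreover have "Im (g y) = Im (g x)"
    proof (rule du_Bois_Reymond[OF less])
      show "continuous_on {x..y} (\<lambda>s. Im (g s))" by (intro continuous_intros g)
      fix \<phi> \<psi> :: "real \<Rightarrow> real"
      assume *: "\<And>s. (\<phi> has_real_derivative \<psi> s) (at s)" "continuous_on UNIV \<psi>"
        "\<And>s. s \<notin> {x<..<y} \<Longrightarrow> \<phi> s = 0 \<and> \<psi> s = 0"
      from integral_linear[OF testi(2)[OF *] bounded_linear_Im] testi(1)[OF *]
      show "integral {x..y} (\<lambda>s. Im (g s) * \<psi> s) = 0" by (simp add: comp_def)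
    qed
    ultimately have "g y = g x" by (simp add: complex_eq_iff)
    then show ?thesis by (simp add: g_def algebra_simps)
  qed simp
  with w show "set_integrable lborel {x..y} w \<and> f y - f x = (LINT s:{x..y}|lborel. w s)" by blast
qed

text \<open>The Borel sets over which \<open>g\<close>, cut off outside \<open>{x..y}\<close>,
  integrates to 0 form a Dynkin system. It contains the generators \<open>{..c}\<close>, which are
  closed under intersection, and hence every Borel set.\<close>

lemma AE_zero_if_intervals:
  fixes g :: "real \<Rightarrow> complex"
  assumes g: "set_integrable lborel {x..y} g"
    and zero: "\<And>u v. x \<le> u \<Longrightarrow> u \<le> v \<Longrightarrow> v \<le> y \<Longrightarrow> (LINT s:{u..v}|lborel. g s) = 0"
  shows "AE s in lborel. s \<in> {x..y} \<longrightarrow> g s = 0"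
proof -
  let ?g = "\<lambda>s. indicator {x..y} s *\<^sub>R g s"
  have int: "integrable lborel ?g" using g by (simp add: set_integrable_def)
  have sint: "set_integrable lborel A ?g" if "A \<in> sets borel" for A
    unfolding set_integrable_def by (rule integrable_mult_indicator[OF _ int]) (use that in simp)
  have all: "(LINT s|lborel. ?g s) = 0"
  proof (cases "x \<le> y")
    case True
    then show ?thesis using zero[of x y] by (simp add: set_lebesgue_integral_def)
  qed simp
  have "A \<in> sets borel \<and> (LINT s:A|lborel. ?g s) = 0" if "A \<in> sigma_sets UNIV (range (\<lambda>c::real. {..c}))" for A
  proof (rule sigma_sets_induct_disjoint[OF _ _ that])
    show "Int_stable (range (\<lambda>c::real. {..c}))" by (auto simp: Int_stable_def)
    show "range (\<lambda>c::real. {..c}) \<subseteq> Pow UNIV" by auto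
    fix A :: "real set" assume "A \<in> range (\<lambda>c. {..c})"
    then obtain c where A: "A = {..c}" by auto
    have "indicator A s *\<^sub>R ?g s = indicator {x..min c y} s *\<^sub>R g s" for s
      by (auto simp: A split: split_indicator)
    then have "(LINT s:A|lborel. ?g s) = (LINT s:{x..min c y}|lborel. g s)"
      by (simp only: set_lebesgue_integral_def)
    also have "\<dots> = 0"
    proof (cases "x \<le> min c y")
      case True
      then show ?thesis by (intro zero) auto
    next
      case False
      then have "{x..min c y} = {}" by auto
      then show ?thesis by (simp add: set_lebesgue_integral_def)
    qed
    finally show "A \<in> sets borel \<and> (LINT s:A|lborel. ?g s) = 0" by (simp add: A)
  next
    show "{} \<in> sets borel \<and> (LINT s:{}|lborel. ?g s) = 0" by (simp add: set_lebesgue_integral_def)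
  next
    fix A assume A: "A \<in> sets borel \<and> (LINT s:A|lborel. ?g s) = 0"
    then have "- A \<in> sets borel" by (simp add: borel_comp)
    have "(LINT s:A \<union> - A|lborel. ?g s) = (LINT s:A|lborel. ?g s) + (LINT s:- A|lborel. ?g s)"
      using A \<open>- A \<in> sets borel\<close> by (intro set_integral_Un sint) auto
    then have "(LINT s:- A|lborel. ?g s) = 0"
      using A all by (simp add: set_lebesgue_integral_def)
    then show "UNIV - A \<in> sets borel \<and> (LINT s:UNIV - A|lborel. ?g s) = 0"
      using \<open>- A \<in> sets borel\<close> by (simp add: Compl_eq_Diff_UNIV)
  next
    fix A :: "nat \<Rightarrow> real set"
    assume disj: "disjoint_family A" and A: "\<And>i. A i \<in> sets borel \<and> (LINT s:A i|lborel. ?g s) = 0"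
    have "(LINT s:(\<Union>i. A i)|lborel. ?g s) = (\<Sum>i. (LINT s:A i|lborel. ?g s))"
      using A disj by (intro lebesgue_integral_countable_add sint) (auto simp: disjoint_family_on_def)
    then show "(\<Union>i. A i) \<in> sets borel \<and> (LINT s:(\<Union>i. A i)|lborel. ?g s) = 0"
      using A by auto
  qed
  moreover have "sets borel = sigma_sets UNIV (range (\<lambda>c::real. {..c}))"
    unfolding borel_eq_atMost by (rule sets_measure_of) auto
  ultimately have "AE s in lborel. ?g s = 0"
    by (intro sigma_finite_measure.density_zero[OF sigma_finite_lborel] int) auto
  then show ?thesis by eventually_elim (auto split: split_indicator_asm)
qed

text \<open>The exceptional null set depends on the compact interval considered. Intervals with
  rational end points in \<open>S\<close> are countably many and cover the open set
  \<open>S\<close>.\<close>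

lemma primitive_unique:
  assumes S: "open S" "is_interval S" and p: "primitive S f w1" "primitive S f w2"
  shows "AE s in lborel. s \<in> S \<longrightarrow> w1 s = w2 s"
proof -
  have "AE s in lborel. \<forall>(p, q)\<in>(\<rat> \<inter> S) \<times> (\<rat> \<inter> S). s \<in> {p..q} \<longrightarrow> w1 s - w2 s = 0"
  proof (subst AE_ball_countable)
    show "countable ((\<rat> \<inter> S) \<times> (\<rat> \<inter> S))" using countable_rat by auto
    show "\<forall>y\<in>(\<rat> \<inter> S) \<times> (\<rat> \<inter> S). AE s in lborel. case y of (p, q) \<Rightarrow> s \<in> {p..q} \<longrightarrow> w1 s - w2 s = 0"
    proof safe
      fix x y assume xy: "x \<in> S" "y \<in> S"
      have sub: "{x..y} \<subseteq> S" by (rule is_interval_Icc_subset[OF S(2) xy])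
      show "AE s in lborel. s \<in> {x..y} \<longrightarrow> w1 s - w2 s = 0"
      proof (cases "x \<le> y")
        case True
        show ?thesis
        proof (rule AE_zero_if_intervals)
          show "set_integrable lborel {x..y} (\<lambda>s. w1 s - w2 s)"
            using p xy True by (intro set_integral_diff) (auto simp: primitive_def)
          fix u v assume uv: "x \<le> u" "u \<le> v" "v \<le> y"
          then have "u \<in> S" "v \<in> S" using sub by auto
          then show "(LINT s:{u..v}|lborel. w1 s - w2 s) = 0"
            using p uv by (subst set_integral_diff(2)) (auto simp: primitive_def)
        qed
      qed simp
    qed
  qed
  then show ?thesis
  proof eventually_elim
    case (elim s)
    show "s \<in> S \<longrightarrow> w1 s = w2 s"
    proof
      assume "s \<in> S"
      then obtain d where d: "d > 0" "ball s d \<subseteq> S" using S(1) open_contains_ball by blast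
      obtain p where p: "p \<in> \<rat>" "s - d < p" "p < s" using Rats_dense_in_real[of "s - d" s] d by auto
      obtain q where q: "q \<in> \<rat>" "s < q" "q < s + d" using Rats_dense_in_real[of s "s + d"] d by auto
      have "p \<in> S" "q \<in> S" using d p q by (auto simp: subset_iff dist_real_def)
      then have "s \<in> {p..q} \<longrightarrow> w1 s - w2 s = 0" using bspec[OF elim, of "(p, q)"] p q by simp
      then show "w1 s = w2 s" using p q by simp
    qed
  qed
qed

text \<open>Weak derivatives are blind to the boundary, but vertex values and Dirichlet conditions
  live there. The function \<open>f\<close> minus the integral of \<open>w\<close> is constant
  inside and continuous up to the end points, hence constant on the closed interval.\<close>

lemma primitive_from_interior:
  assumes S: "is_interval S" and f: "continuous_on S f" and p: "primitive (interior S) f w"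
    and w: "\<And>x y. x \<in> S \<Longrightarrow> y \<in> S \<Longrightarrow> set_integrable lborel {x..y} w"
  shows "primitive S f w"
  unfolding primitive_def
proof (intro ballI impI conjI w)
  fix x y assume xy: "x \<in> S" "y \<in> S" "x \<le> y"
  have sub: "{x..y} \<subseteq> S" by (rule is_interval_Icc_subset[OF S xy(1,2)])
  show "f y - f x = (LINT s:{x..y}|lborel. w s)"
  proof (cases "x = y")
    case False
    then have less: "x < y" using xy by simp
    define g where "g s = f s - (LINT r:{x..s}|lborel. w r)" for s
    have g: "continuous_on {x..y} g"
      unfolding g_def by (intro continuous_intros continuous_on_set_integral w xy continuous_on_subset[OF f] sub)
    have int: "{x<..<y} \<subseteq> interior S"
      using sub by (intro interior_maximal) auto
    have le: "g u = g v" if uv: "u \<in> {x<..<y}" "v \<in> {x<..<y}" "u \<le> v" for u v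
    proof -
      have "u \<in> interior S" "v \<in> interior S" using int uv by blast+
      then have "f v - f u = (LINT s:{u..v}|lborel. w s)"
        using p \<open>u \<le> v\<close> unfolding primitive_def by blast
      moreover have "v \<in> S" using sub uv(2) by auto
      then have "(LINT s:{x..v}|lborel. w s) = (LINT s:{x..u}|lborel. w s) + (LINT s:{u..v}|lborel. w s)"
        using uv xy by (intro set_integral_combine w) auto
      ultimately show ?thesis by (simp add: g_def algebra_simps)
    qed
    let ?m = "g ((x + y) / 2)"
    have mid: "(x + y) / 2 \<in> {x<..<y}" using less by auto
    have const: "g s = ?m" if "s \<in> {x<..<y}" for s
    proof (cases "s \<le> (x + y) / 2")
      case True
      then show ?thesis by (rule le[OF that mid])
    next
      case False
      then show ?thesis by (intro le[OF mid that, symmetric]) simp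
    qed
    have m: "g s = ?m" if "s \<in> {x..y}" for s
    proof (rule continuous_constant_on_closure[OF _ const])
      show "continuous_on (closure {x<..<y}) g" using g less by simp
      show "s \<in> closure {x<..<y}" using that less by simp
    qed
    have "g y = ?m" "g x = ?m" by (rule m, use less in simp)+
    then have "g y = g x" by (simp only:)
    then show ?thesis by (simp add: g_def algebra_simps)
  qed simp
qed auto

section \<open>Weighted Sobolev spaces\<close>

lemma L2_nn_integral:
  assumes "f \<in> L2_set M"
  shows "(\<integral>\<^sup>+x. ennreal ((cmod (f x))\<^sup>2) \<partial>M) = ennreal (L2.nsq M f)"
  using assms by (subst nn_integral_eq_integral) (auto simp: L2_set_def L2_inner_self)

lemma L2_setI:
  assumes f: "f \<in> borel_measurable M" and le: "(\<integral>\<^sup>+x. ennreal ((cmod (f x))\<^sup>2) \<partial>M) \<le> ennreal B" and "0 \<le> B"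
  shows "f \<in> L2_set M" "L2.nsq M f \<le> B"
proof -
  have "(\<integral>\<^sup>+x. ennreal ((cmod (f x))\<^sup>2) \<partial>M) < \<infinity>" using le by (simp add: order_le_less_trans)
  then show "f \<in> L2_set M"
    using f by (auto simp: L2_set_def integrable_iff_bounded)
  then show "L2.nsq M f \<le> B"
    using le \<open>0 \<le> B\<close> by (simp add: L2_nn_integral)
qed

text \<open>Riesz-Fischer. Along \<open>r\<close> consecutive differences have squared norm at most
  8^-k, so the integrals of 4^k |\<open>\<Delta> k\<close>|^2 are summable and almost everywhere
  |\<open>\<Delta> k\<close>| is of order 2^-k, which gives a pointwise limit \<open>u\<close>.
  Fatou's lemma along \<open>r\<close>, with the other index fixed, then controls the distance of
  the whole sequence to \<open>u\<close>.\<close>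

lemma L2_complete:
  assumes w: "\<And>n::nat. w n \<in> L2_set M"
    and Cauchy: "\<And>\<epsilon>. 0 < \<epsilon> \<Longrightarrow> \<exists>n0. \<forall>i\<ge>n0. \<forall>j\<ge>n0. L2.nsq M (\<lambda>x. w i x - w j x) < \<epsilon>"
  obtains u where "u \<in> L2_set M" "(\<lambda>n. L2.nsq M (\<lambda>x. w n x - u x)) \<longlonglongrightarrow> 0"
proof -
  have meas [measurable]: "w n \<in> borel_measurable M" for n using w by (auto simp: L2_set_def)
  have "\<forall>k. \<exists>n0. \<forall>i\<ge>n0. \<forall>j\<ge>n0. L2.nsq M (\<lambda>x. w i x - w j x) < (1 / 8) ^ k"
    using Cauchy by simp
  then obtain N where N: "\<And>k i j. i \<ge> N k \<Longrightarrow> j \<ge> N k \<Longrightarrow> L2.nsq M (\<lambda>x. w i x - w j x) < (1 / 8) ^ k"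
    by metis
  \<comment> \<open>The sum puts \<open>r\<close> above \<open>N k\<close> both at \<open>k\<close>
    and at \<open>Suc k\<close>, so both terms of \<open>\<Delta> k\<close> fall under
    \<open>N\<close>; the summand \<open>k\<close> makes \<open>r\<close> tend to infinity.\<close>
  define r where "r k = k + (\<Sum>i\<le>k. N i)" for k
  have rN: "N k \<le> r k" "N k \<le> r (Suc k)" for k
  proof -
    have "N k \<le> (\<Sum>i\<le>k. N i)" by (intro member_le_sum) auto
    then show "N k \<le> r k" "N k \<le> r (Suc k)" by (auto simp: r_def)
  qed
  have r_ge: "k \<le> r k" for k by (simp add: r_def)
  define \<Delta> where "\<Delta> k x = w (r (Suc k)) x - w (r k) x" for k x
  have \<Delta>: "\<Delta> k \<in> L2_set M" "L2.nsq M (\<Delta> k) \<le> (1 / 8) ^ k" for k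
    unfolding \<Delta>_def using N[of k "r (Suc k)" "r k"] rN[of k] by (auto intro!: L2.diff w less_imp_le)
  have [measurable]: "\<Delta> k \<in> borel_measurable M" for k using \<Delta> by (auto simp: L2_set_def)
  have "(\<integral>\<^sup>+x. (\<Sum>k. ennreal (4 ^ k * (cmod (\<Delta> k x))\<^sup>2)) \<partial>M) = (\<Sum>k. (\<integral>\<^sup>+x. ennreal (4 ^ k * (cmod (\<Delta> k x))\<^sup>2) \<partial>M))"
    by (intro nn_integral_suminf) measurable
  also have "\<dots> \<le> (\<Sum>k. ennreal ((1 / 2) ^ k))"
  proof (intro suminf_le summableI)
    fix k
    have "(\<integral>\<^sup>+x. ennreal (4 ^ k * (cmod (\<Delta> k x))\<^sup>2) \<partial>M) = ennreal (4 ^ k) * ennreal (L2.nsq M (\<Delta> k))"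
      using \<Delta>(1) by (simp add: ennreal_mult nn_integral_cmult L2_nn_integral)
    also have "\<dots> \<le> ennreal (4 ^ k) * ennreal ((1 / 8) ^ k)"
      using \<Delta>(2) by (intro mult_left_mono ennreal_leI) auto
    also have "\<dots> = ennreal ((1 / 2) ^ k)"
      by (simp add: ennreal_mult[symmetric] power_mult_distrib[symmetric])
    finally show "(\<integral>\<^sup>+x. ennreal (4 ^ k * (cmod (\<Delta> k x))\<^sup>2) \<partial>M) \<le> ennreal ((1 / 2) ^ k)" .
  qed
  also have "\<dots> = ennreal (\<Sum>k. (1 / 2) ^ k)" by (intro suminf_ennreal2) (auto simp: summable_geometric)
  finally have "(\<integral>\<^sup>+x. (\<Sum>k. ennreal (4 ^ k * (cmod (\<Delta> k x))\<^sup>2)) \<partial>M) \<noteq> \<infinity>"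
    by (auto simp: top_unique)
  then have "AE x in M. (\<Sum>k. ennreal (4 ^ k * (cmod (\<Delta> k x))\<^sup>2)) \<noteq> \<infinity>"
    by (intro nn_integral_PInf_AE) auto
  then have conv: "AE x in M. convergent (\<lambda>k. w (r k) x)"
  proof eventually_elim
    case (elim x)
    define S where "S = enn2real (\<Sum>k. ennreal (4 ^ k * (cmod (\<Delta> k x))\<^sup>2))"
    have S: "ennreal S = (\<Sum>k. ennreal (4 ^ k * (cmod (\<Delta> k x))\<^sup>2))"
      unfolding S_def using elim by (intro ennreal_enn2real) (simp add: less_top)
    have S0: "0 \<le> S" by (simp add: S_def)
    have bound: "cmod (\<Delta> k x) \<le> sqrt S * (1 / 2) ^ k" for k
    proof -
      have "(\<Sum>i\<in>{k}. ennreal (4 ^ i * (cmod (\<Delta> i x))\<^sup>2)) \<le> ennreal S"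
        unfolding S by (intro sum_le_suminf summableI) auto
      then have "4 ^ k * (cmod (\<Delta> k x))\<^sup>2 \<le> S" using S0 by simp
      then have "(2 ^ k * cmod (\<Delta> k x))\<^sup>2 \<le> S"
        by (simp add: power_mult_distrib power_mult[symmetric] mult.commute[of k 2] power_mult)
      then have "2 ^ k * cmod (\<Delta> k x) \<le> sqrt S" by (rule real_le_rsqrt)
      then show ?thesis by (simp add: field_simps power_divide)
    qed
    have "summable (\<lambda>k. \<Delta> k x)"
      by (rule summable_comparison_test'[of "\<lambda>k. sqrt S * (1 / 2) ^ k" 0])
        (use bound in \<open>auto intro!: summable_mult summable_geometric\<close>)
    then have "convergent (\<lambda>n. \<Sum>k<n. \<Delta> k x)" by (simp add: summable_iff_convergent)
    moreover have "(\<Sum>k<n. \<Delta> k x) = w (r n) x - w (r 0) x" for n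
      unfolding \<Delta>_def by (rule sum_lessThan_telescope)
    ultimately have "convergent (\<lambda>n. w (r n) x - w (r 0) x + w (r 0) x)"
      by (intro convergent_add convergent_const) simp
    then show ?case by simp
  qed
  define u where "u x = lim (\<lambda>k. w (r k) x)" for x
  have u_meas [measurable]: "u \<in> borel_measurable M"
    unfolding u_def[abs_def] by (rule borel_measurable_lim_metric) measurable
  have key: "\<exists>n0. \<forall>n\<ge>n0. (\<integral>\<^sup>+x. ennreal ((cmod (w n x - u x))\<^sup>2) \<partial>M) \<le> ennreal \<epsilon>" if "0 < \<epsilon>" for \<epsilon>
  proof -
    obtain n0 where n0: "\<And>i j. i \<ge> n0 \<Longrightarrow> j \<ge> n0 \<Longrightarrow> L2.nsq M (\<lambda>x. w i x - w j x) < \<epsilon>"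
      using Cauchy[OF \<open>0 < \<epsilon>\<close>] by blast
    have "(\<integral>\<^sup>+x. ennreal ((cmod (w n x - u x))\<^sup>2) \<partial>M) \<le> ennreal \<epsilon>" if n: "n \<ge> n0" for n
    proof -
      have "(\<integral>\<^sup>+x. ennreal ((cmod (w n x - u x))\<^sup>2) \<partial>M)
          = (\<integral>\<^sup>+x. liminf (\<lambda>k. ennreal ((cmod (w n x - w (r k) x))\<^sup>2)) \<partial>M)"
      proof (rule nn_integral_cong_AE)
        show "AE x in M. ennreal ((cmod (w n x - u x))\<^sup>2) = liminf (\<lambda>k. ennreal ((cmod (w n x - w (r k) x))\<^sup>2))"
          using conv
        proof eventually_elim
          case (elim x)
          then have "(\<lambda>k. w (r k) x) \<longlonglongrightarrow> u x" by (simp add: u_def convergent_LIMSEQ_iff)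
          then have "(\<lambda>k. ennreal ((cmod (w n x - w (r k) x))\<^sup>2)) \<longlonglongrightarrow> ennreal ((cmod (w n x - u x))\<^sup>2)"
            by (intro tendsto_intros)
          then show ?case by (rule lim_imp_Liminf[OF trivial_limit_sequentially, symmetric])
        qed
      qed
      also have "\<dots> \<le> liminf (\<lambda>k. (\<integral>\<^sup>+x. ennreal ((cmod (w n x - w (r k) x))\<^sup>2) \<partial>M))"
        by (intro nn_integral_liminf) measurable
      also have "\<dots> \<le> liminf (\<lambda>k. ennreal \<epsilon>)"
      proof (rule Liminf_mono)
        show "\<forall>\<^sub>F k in sequentially. (\<integral>\<^sup>+x. ennreal ((cmod (w n x - w (r k) x))\<^sup>2) \<partial>M) \<le> ennreal \<epsilon>"
          using eventually_ge_at_top[of n0]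
        proof eventually_elim
          case (elim k)
          have "r k \<ge> n0" using elim r_ge[of k] by linarith
          then have "L2.nsq M (\<lambda>x. w n x - w (r k) x) \<le> \<epsilon>" using n0[OF n] by (simp add: less_imp_le)
          then show ?case using L2_nn_integral[OF L2.diff[OF w w], of n "r k"] by (simp add: ennreal_leI)
        qed
      qed
      also have "\<dots> = ennreal \<epsilon>" by (simp add: Liminf_const)
      finally show ?thesis .
    qed
    then show ?thesis by blast
  qed
  have wu: "(\<lambda>x. w n x - u x) \<in> L2_set M \<and> L2.nsq M (\<lambda>x. w n x - u x) \<le> \<epsilon>"
    if "(\<integral>\<^sup>+x. ennreal ((cmod (w n x - u x))\<^sup>2) \<partial>M) \<le> ennreal \<epsilon>" "0 < \<epsilon>" for n \<epsilon>
    using L2_setI[of "\<lambda>x. w n x - u x" M \<epsilon>] that by simp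
  obtain n1 where "(\<integral>\<^sup>+x. ennreal ((cmod (w n1 x - u x))\<^sup>2) \<partial>M) \<le> ennreal 1" using key[of 1] by auto
  then have "(\<lambda>x. w n1 x - u x) \<in> L2_set M" using wu[of n1 1] by auto
  from L2.diff[OF w[of n1] this]
  have uL: "u \<in> L2_set M" by simp
  have "(\<lambda>n. L2.nsq M (\<lambda>x. w n x - u x)) \<longlonglongrightarrow> 0"
  proof (rule LIMSEQ_I)
    fix e :: real assume e: "0 < e"
    obtain n0 where n0: "\<And>n. n \<ge> n0 \<Longrightarrow> (\<integral>\<^sup>+x. ennreal ((cmod (w n x - u x))\<^sup>2) \<partial>M) \<le> ennreal (e / 2)"
      using key[of "e / 2"] e by auto
    have "norm (L2.nsq M (\<lambda>x. w n x - u x) - 0) < e" if "n \<ge> n0" for n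
      using wu[OF n0[OF that]] L2.B_nonneg[of "\<lambda>x. w n x - u x" M] e by auto
    then show "\<exists>n0. \<forall>n\<ge>n0. norm (L2.nsq M (\<lambda>x. w n x - u x) - 0) < e" by blast
  qed
  with uL show ?thesis by (rule that)
qed

lemma primitive_add:
  assumes f: "primitive S f w" and g: "primitive S g v"
  shows "primitive S (\<lambda>x. f x + g x) (\<lambda>x. w x + v x)"
  unfolding primitive_def
proof (intro ballI impI)
  fix x y assume xy: "x \<in> S" "y \<in> S" "x \<le> y"
  have f': "set_integrable lborel {x..y} w" "f y - f x = (LINT s:{x..y}|lborel. w s)"
    using f xy by (auto simp: primitive_def)
  have g': "set_integrable lborel {x..y} v" "g y - g x = (LINT s:{x..y}|lborel. v s)"
    using g xy by (auto simp: primitive_def)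
  have "f y + g y - (f x + g x) = (f y - f x) + (g y - g x)" by simp
  also have "\<dots> = (LINT s:{x..y}|lborel. w s + v s)"
    unfolding f'(2) g'(2) by (rule set_integral_add(2)[OF f'(1) g'(1), symmetric])
  finally show "set_integrable lborel {x..y} (\<lambda>x. w x + v x) \<and>
      f y + g y - (f x + g x) = (LINT s:{x..y}|lborel. w s + v s)"
    using set_integral_add(1)[OF f'(1) g'(1)] by blast
qed

section \<open>Intervals with weights comparable to the Gaussian\<close>

lemma gauss_pos: "0 < gauss x"
  by (simp add: gauss_def)

lemma gauss_measurable [measurable]: "gauss \<in> borel_measurable borel"
  unfolding gauss_def[abs_def] by measurable

lemma gauss_antimono: "0 \<le> x \<Longrightarrow> x \<le> y \<Longrightarrow> gauss y \<le> gauss x"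
  by (auto simp: gauss_def intro!: mult_left_mono power_mono divide_right_mono)

definition weighted :: "real set \<Rightarrow> (real \<Rightarrow> real) \<Rightarrow> real measure" where
  "weighted I \<rho> = density (restrict_space lborel I) (\<lambda>s. ennreal (\<rho> s))"

text \<open>One locale for the edges, with weight \<open>gauss\<close>, and for the reduced
  problems, with weight growth times \<open>gauss\<close>. The lower comparison has constant 1
  because the growth is at least 1, and \<open>C\<close> absorbs its maximum. The condition
  \<open>0 \<le> a\<close> makes the Gaussian decreasing on \<open>I\<close>, so on
  \<open>{x..y}\<close> the weight is at least \<open>gauss y\<close>.\<close>

locale weighted_interval =
  fixes I :: "real set" and a :: real and \<rho> :: "real \<Rightarrow> real" and C :: real
  assumes I: "I = {a..} \<or> (\<exists>b>a. I = {a..b})" and a0: "0 \<le> a"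
    and \<rho>_meas [measurable]: "\<rho> \<in> borel_measurable borel"
    and \<rho>_low: "\<And>x. x \<in> I \<Longrightarrow> gauss x \<le> \<rho> x" and \<rho>_up: "\<And>x. x \<in> I \<Longrightarrow> \<rho> x \<le> C * gauss x"
begin

abbreviation K where "K \<equiv> weighted I \<rho>"

lemma I_borel [measurable, simp]: "I \<in> sets borel" using I by auto

lemma I_interval: "is_interval I"
  using I by (auto simp: is_interval_cc is_interval_ci)

lemma I_ge: "x \<in> I \<Longrightarrow> a \<le> x" using I by auto

lemma I_ge0: "x \<in> I \<Longrightarrow> 0 \<le> x" using I_ge a0 by force

lemma a_in: "a \<in> I" using I by auto

lemma I_sub: "x \<in> I \<Longrightarrow> y \<in> I \<Longrightarrow> {x..y} \<subseteq> I"
  by (rule is_interval_Icc_subset[OF I_interval])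

lemma I_initial: "x \<in> I \<Longrightarrow> {a..x} \<subseteq> I"
  by (rule I_sub[OF a_in])

lemma right_end: obtains \<delta> where "0 < \<delta>" "{a..a + \<delta>} \<subseteq> I"
proof (cases "I = {a..}")
  case True
  then show ?thesis using that[of 1] by auto
next
  case False
  then obtain b where "a < b" "I = {a..b}" using I by auto
  then show ?thesis using that[of "b - a"] by auto
qed

lemma countable_boundary: "countable (I - interior I)"
proof (cases "I = {a..}")
  case True
  then have "I - interior I \<subseteq> {a}" by (auto simp: interior_real_atLeast)
  then show ?thesis by (rule countable_subset) simp
next
  case False
  then obtain b where "I = {a..b}" using I by auto
  then have "I - interior I \<subseteq> {a, b}" by (auto simp: interior_atLeastAtMost_real)
  then show ?thesis by (rule countable_subset) simp
qed

lemma interior_interval: "is_interval (interior I)"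
  using I_interval by (simp add: is_interval_convex_1 convex_interior)

lemma \<rho>_pos: "x \<in> I \<Longrightarrow> 0 < \<rho> x"
  using \<rho>_low gauss_pos by (rule less_le_trans[rotated])

lemma space_K [simp]: "space K = I"
  by (simp add: weighted_def space_restrict_space)

lemma sets_K: "sets K = sets (restrict_space lborel I)"
  by (simp add: weighted_def)

lemma borel_measurable_K: "borel_measurable K = borel_measurable (restrict_space lborel I)"
  by (rule measurable_cong_sets) (auto simp: sets_K)

lemma measurable_K_iff:
  fixes f :: "real \<Rightarrow> 'b::real_normed_vector"
  shows "f \<in> borel_measurable K \<longleftrightarrow> (\<lambda>x. indicator I x *\<^sub>R f x) \<in> borel_measurable borel"
  unfolding borel_measurable_K by (subst borel_measurable_restrict_space_iff) auto

lemma \<rho>_measurable_K: "\<rho> \<in> borel_measurable (restrict_space lborel I)"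
  by (intro measurable_restrict_space1) simp

lemma AE_nonneg: "AE x in restrict_space lborel I. 0 \<le> \<rho> x"
  by (rule AE_I2) (auto simp: space_restrict_space intro: less_imp_le \<rho>_pos)

lemma integrable_K_iff:
  fixes f :: "real \<Rightarrow> 'b::{banach, second_countable_topology}"
  assumes "f \<in> borel_measurable K"
  shows "integrable K f \<longleftrightarrow> integrable lborel (\<lambda>x. indicator I x *\<^sub>R (\<rho> x *\<^sub>R f x))"
  using assms unfolding weighted_def
  by (subst integrable_density) (auto simp: AE_nonneg \<rho>_measurable_K integrable_restrict_space)

lemma integral_K:
  fixes f :: "real \<Rightarrow> 'b::{banach, second_countable_topology}"
  assumes "f \<in> borel_measurable K"
  shows "integral\<^sup>L K f = (\<integral>x. indicator I x *\<^sub>R (\<rho> x *\<^sub>R f x) \<partial>lborel)"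
  using assms unfolding weighted_def
  by (subst integral_density) (auto simp: AE_nonneg \<rho>_measurable_K integral_restrict_space)

lemma nn_integral_K:
  assumes "f \<in> borel_measurable K"
  shows "(\<integral>\<^sup>+x. f x \<partial>K) = (\<integral>\<^sup>+x. ennreal (\<rho> x) * f x * indicator I x \<partial>lborel)"
  using assms unfolding weighted_def
  by (subst nn_integral_density)
    (auto simp: nn_integral_restrict_space intro!: measurable_compose[OF \<rho>_measurable_K measurable_ennreal])

lemma AE_K_iff: "(AE x in K. P x) \<longleftrightarrow> (AE x in lborel. x \<in> I \<longrightarrow> P x)"
  unfolding weighted_def
  by (subst AE_density)
    (auto simp: AE_restrict_space_iff \<rho>_pos elim: eventually_mono
      intro!: measurable_compose[OF \<rho>_measurable_K measurable_ennreal])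

lemma AE_interior: "AE x in lborel. x \<in> I \<longrightarrow> x \<in> interior I"
proof -
  have "I - interior I \<in> null_sets lborel" using countable_boundary by (rule countable_imp_null_set_lborel)
  then show ?thesis using AE_not_in by (force elim: eventually_mono)
qed

lemma L2_set_integrable:
  assumes w: "w \<in> L2_set K" and xy: "x \<in> I" "y \<in> I"
  shows "set_integrable lborel {x..y} w"
  unfolding set_integrable_def
proof (rule Bochner_Integration.integrable_bound)
  \<comment> \<open>An integrable majorant from |w| \<le> 1 + |w|^2 and the lower bound
    \<open>gauss y\<close> of the weight on \<open>{x..y}\<close>.\<close>
  let ?h = "\<lambda>s. indicator {x..y} s + (1 / gauss y) * (indicator I s *\<^sub>R (\<rho> s *\<^sub>R (cmod (w s))\<^sup>2))"
  have "integrable K (\<lambda>s. (cmod (w s))\<^sup>2)" using w by (simp add: L2_set_def)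
  then have "integrable lborel (\<lambda>s. indicator I s *\<^sub>R (\<rho> s *\<^sub>R (cmod (w s))\<^sup>2))"
    using integrable_K_iff[OF borel_measurable_integrable] by blast
  moreover have "integrable lborel (indicator {x..y} :: real \<Rightarrow> real)"
    by (rule integrable_real_indicator) (auto simp: emeasure_lborel_Icc_eq)
  ultimately show "integrable lborel ?h" by (intro Bochner_Integration.integrable_add integrable_mult_right)
  have "(\<lambda>s. indicator I s *\<^sub>R w s) \<in> borel_measurable borel"
    using w by (simp only: L2_set_def mem_Collect_eq measurable_K_iff)
  then have "(\<lambda>s. indicator {x..y} s *\<^sub>R (indicator I s *\<^sub>R w s)) \<in> borel_measurable lborel"
  proof -
    assume *: "(\<lambda>s. indicator I s *\<^sub>R w s) \<in> borel_measurable borel"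
    show ?thesis by (rule borel_measurable_scaleR) (use * in simp_all)
  qed
  moreover have "indicator {x..y} s *\<^sub>R (indicator I s *\<^sub>R w s) = indicator {x..y} s *\<^sub>R w s" for s
    using I_sub[OF xy] by (auto split: split_indicator)
  ultimately show "(\<lambda>s. indicator {x..y} s *\<^sub>R w s) \<in> borel_measurable lborel" by (simp only:)
  show "AE s in lborel. norm (indicator {x..y} s *\<^sub>R w s) \<le> norm (?h s)"
  proof (rule AE_I2)
    fix s
    show "norm (indicator {x..y} s *\<^sub>R w s) \<le> norm (?h s)"
    proof (cases "s \<in> {x..y}")
      case True
      then have sI: "s \<in> I" using I_sub[OF xy] by auto
      have "gauss y \<le> \<rho> s"
        using gauss_antimono[of s y] \<rho>_low[OF sI] I_ge0[OF sI] True by auto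
      then have "(cmod (w s))\<^sup>2 \<le> (1 / gauss y) * (\<rho> s * (cmod (w s))\<^sup>2)"
        using gauss_pos[of y] by (simp add: field_simps mult_right_mono)
      moreover have "cmod (w s) \<le> 1 + (cmod (w s))\<^sup>2"
        using sum_squares_bound[of 1 "cmod (w s)"] norm_ge_zero[of "w s"] by (simp del: norm_ge_zero)
      ultimately show ?thesis using True sI by simp
    qed simp
  qed
qed

text \<open>The weight \<open>k = 1\<close> gives the oscillation bound, \<open>k s = s * exp (s\<^sup>2 / 2)\<close> the tail bound.\<close>

lemma weighted_Cauchy_Schwarz:
  assumes w: "w \<in> L2_set K" and xy: "x \<in> I" "y \<in> I"
    and k [measurable]: "k \<in> borel_measurable borel" and kpos: "\<And>s. s \<in> {x..y} \<Longrightarrow> 0 < k s"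
  shows "ennreal ((cmod (LINT s:{x..y}|lborel. w s))\<^sup>2) \<le>
    (\<integral>\<^sup>+s. ennreal ((cmod (w s))\<^sup>2 / k s) * indicator {x..y} s \<partial>lborel) *
    (\<integral>\<^sup>+s. ennreal (k s) * indicator {x..y} s \<partial>lborel)"
proof -
  let ?w = "\<lambda>s. indicator {x..y} s *\<^sub>R w s"
  have int: "integrable lborel ?w" using L2_set_integrable[OF w xy] by (simp add: set_integrable_def)
  then have [measurable]: "?w \<in> borel_measurable borel" by auto
  have "ennreal (cmod (LINT s:{x..y}|lborel. w s)) \<le> (\<integral>\<^sup>+s. ennreal (cmod (?w s)) \<partial>lborel)"
    unfolding set_lebesgue_integral_def by (rule integral_norm_bound_ennreal[OF int])
  also have "\<dots> = (\<integral>\<^sup>+s. ennreal (cmod (?w s) / sqrt (k s)) * ennreal (indicator {x..y} s * sqrt (k s)) \<partial>lborel)"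
  proof (intro nn_integral_cong)
    fix s
    show "ennreal (cmod (?w s)) = ennreal (cmod (?w s) / sqrt (k s)) * ennreal (indicator {x..y} s * sqrt (k s))"
      using kpos[of s] by (auto simp: ennreal_mult[symmetric] less_imp_le split: split_indicator)
  qed
  finally have "(ennreal (cmod (LINT s:{x..y}|lborel. w s)))\<^sup>2 \<le> \<dots>\<^sup>2"
    by (intro power_mono) auto
  also have "\<dots> \<le> (\<integral>\<^sup>+s. (ennreal (cmod (?w s) / sqrt (k s)))\<^sup>2 \<partial>lborel) *
      (\<integral>\<^sup>+s. (ennreal (indicator {x..y} s * sqrt (k s)))\<^sup>2 \<partial>lborel)"
    by (intro Cauchy_Schwarz_nn_integral) measurable
  also have "(\<integral>\<^sup>+s. (ennreal (cmod (?w s) / sqrt (k s)))\<^sup>2 \<partial>lborel)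
      = (\<integral>\<^sup>+s. ennreal ((cmod (w s))\<^sup>2 / k s) * indicator {x..y} s \<partial>lborel)"
    using kpos by (intro nn_integral_cong) (auto simp: ennreal_power power_divide less_imp_le split: split_indicator)
  also have "(\<integral>\<^sup>+s. (ennreal (indicator {x..y} s * sqrt (k s)))\<^sup>2 \<partial>lborel)
      = (\<integral>\<^sup>+s. ennreal (k s) * indicator {x..y} s \<partial>lborel)"
    using kpos by (intro nn_integral_cong) (auto simp: ennreal_power less_imp_le split: split_indicator)
  finally show ?thesis by (simp add: ennreal_power)
qed

lemma set_integral_bound:
  assumes w: "w \<in> L2_set K" and xy: "x \<in> I" "y \<in> I" "x \<le> y"
  shows "(cmod (LINT s:{x..y}|lborel. w s))\<^sup>2 \<le> (y - x) / gauss y * L2.nsq K w"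
proof -
  have wm: "w \<in> borel_measurable K" using w by (simp add: L2_set_def)
  have "(\<integral>\<^sup>+s. ennreal ((cmod (w s))\<^sup>2 / 1) * indicator {x..y} s \<partial>lborel)
      \<le> (\<integral>\<^sup>+s. ennreal (1 / gauss y) * (ennreal (\<rho> s) * ennreal ((cmod (w s))\<^sup>2) * indicator I s) \<partial>lborel)"
  proof (intro nn_integral_mono)
    fix s
    show "ennreal ((cmod (w s))\<^sup>2 / 1) * indicator {x..y} s
      \<le> ennreal (1 / gauss y) * (ennreal (\<rho> s) * ennreal ((cmod (w s))\<^sup>2) * indicator I s)"
    proof (cases "s \<in> {x..y}")
      case True
      then have sI: "s \<in> I" using I_sub[OF xy(1,2)] by auto
      have "gauss y \<le> \<rho> s"
        using gauss_antimono[of s y] \<rho>_low[OF sI] I_ge0[OF sI] True by auto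
      then have "(cmod (w s))\<^sup>2 \<le> (1 / gauss y) * (\<rho> s * (cmod (w s))\<^sup>2)"
        using gauss_pos[of y] by (simp add: field_simps mult_right_mono)
      then show ?thesis
        using True sI \<rho>_pos[OF sI] gauss_pos[of y] by (simp add: ennreal_mult[symmetric] ennreal_leI)
    qed simp
  qed
  also have "\<dots> = ennreal (1 / gauss y) * (\<integral>\<^sup>+s. ennreal (\<rho> s) * ennreal ((cmod (w s))\<^sup>2) * indicator I s \<partial>lborel)"
  proof (rule nn_integral_cmult)
    have "(\<lambda>s. ennreal (\<rho> s) * ennreal ((cmod (indicator I s *\<^sub>R w s))\<^sup>2)) \<in> borel_measurable lborel"
      using wm[unfolded measurable_K_iff] by measurable
    moreover have "ennreal (\<rho> s) * ennreal ((cmod (indicator I s *\<^sub>R w s))\<^sup>2)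
        = ennreal (\<rho> s) * ennreal ((cmod (w s))\<^sup>2) * indicator I s" for s
      by (auto split: split_indicator)
    ultimately show "(\<lambda>s. ennreal (\<rho> s) * ennreal ((cmod (w s))\<^sup>2) * indicator I s) \<in> borel_measurable lborel" by simp
  qed
  also have "(\<integral>\<^sup>+s. ennreal (\<rho> s) * ennreal ((cmod (w s))\<^sup>2) * indicator I s \<partial>lborel) = ennreal (L2.nsq K w)"
    unfolding L2_nn_integral[OF w, symmetric] using wm by (subst nn_integral_K) auto
  finally have b1: "(\<integral>\<^sup>+s. ennreal ((cmod (w s))\<^sup>2 / 1) * indicator {x..y} s \<partial>lborel)
      \<le> ennreal (1 / gauss y) * ennreal (L2.nsq K w)" .
  have b2: "(\<integral>\<^sup>+s. ennreal 1 * indicator {x..y} s \<partial>lborel) = ennreal (y - x)"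
    using xy(3) by simp
  have cs: "ennreal ((cmod (LINT s:{x..y}|lborel. w s))\<^sup>2)
      \<le> (\<integral>\<^sup>+s. ennreal ((cmod (w s))\<^sup>2 / 1) * indicator {x..y} s \<partial>lborel) *
        (\<integral>\<^sup>+s. ennreal 1 * indicator {x..y} s \<partial>lborel)"
    by (rule weighted_Cauchy_Schwarz[OF w xy(1,2)]) auto
  have "ennreal ((cmod (LINT s:{x..y}|lborel. w s))\<^sup>2)
      \<le> ennreal (1 / gauss y) * ennreal (L2.nsq K w) * ennreal (y - x)"
    using order_trans[OF cs mult_right_mono[OF b1 zero_le]] unfolding b2 .
  also have "\<dots> = ennreal ((y - x) / gauss y * L2.nsq K w)"
    using xy(3) gauss_pos[of y] L2.B_nonneg[OF w] by (simp add: ennreal_mult[symmetric] mult.commute)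
  finally show ?thesis
    using xy(3) gauss_pos[of y] L2.B_nonneg[OF w] by (subst (asm) ennreal_le_iff) auto
qed

subsection \<open>The space \<open>H1\<close>\<close>

text \<open>Together with \<open>H1_D\<close> this trades weak derivatives on the interior for
  primitives on the closed interval. Since \<open>weak_deriv\<close> is an arbitrary choice, it can
  agree with \<open>w\<close> only almost everywhere.\<close>

lemma H1_I:
  assumes f: "f \<in> L2_set K" and w: "w \<in> L2_set K" and p: "primitive I f w"
  shows "f \<in> H1 K" "AE x in K. weak_deriv K f x = w x"
proof -
  have pint: "primitive (interior I) f w"
    using p interior_subset[of I] unfolding primitive_def by blast
  have wd: "is_weak_deriv (interior I) f w"
    by (intro primitive_imp_weak_deriv pint open_interior interior_interval)
  have cont: "continuous_on I f" by (rule primitive_continuous[OF I_interval p])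
  show "f \<in> H1 K" using f w wd cont by (auto simp: H1_def)
  have "is_weak_deriv (interior (space K)) f (weak_deriv K f)"
    unfolding weak_deriv_def by (rule someI[of _ w]) (simp add: wd)
  then have "primitive (interior I) f (weak_deriv K f)"
    using cont interior_subset[of I] by (intro weak_deriv_imp_primitive interior_interval) (auto intro: continuous_on_subset)
  from primitive_unique[OF open_interior interior_interval this pint]
  show "AE x in K. weak_deriv K f x = w x"
    unfolding AE_K_iff using AE_interior by eventually_elim auto
qed

lemma H1_D:
  assumes f: "f \<in> H1 K"
  shows "f \<in> L2_set K" "weak_deriv K f \<in> L2_set K" "primitive I f (weak_deriv K f)"
proof -
  let ?w = "weak_deriv K f"
  show fL: "f \<in> L2_set K" using f by (simp add: H1_def)
  obtain w where w: "w \<in> L2_set K" "is_weak_deriv (interior I) f w" and cont: "continuous_on I f"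
    using f by (auto simp: H1_def)
  have wd: "is_weak_deriv (interior I) f ?w"
    unfolding weak_deriv_def by (rule someI2[of _ w]) (simp_all add: w)
  have cint: "continuous_on (interior I) f" using cont interior_subset by (rule continuous_on_subset)
  have pw: "primitive (interior I) f w" "primitive (interior I) f ?w"
    using w(2) wd cint by (auto intro!: weak_deriv_imp_primitive interior_interval)
  \<comment> \<open>The chosen \<open>weak_deriv\<close> comes with integrability on compact subsets
    of the interior only. Its measurability on all of \<open>I\<close> follows by exhausting the
    interior and adding the at most two boundary points.\<close>
  obtain c where c: "\<And>n. compact (c n)" "\<And>n. c n \<subseteq> interior I" "\<And>n. c n \<subseteq> interior (c (Suc n))"
    "\<Union>(range c) = interior I" "\<And>L. \<lbrakk>compact L; L \<subseteq> interior I\<rbrakk> \<Longrightarrow> \<exists>N. \<forall>n\<ge>N. L \<subseteq> c n"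
    using open_Union_compact_subsets[OF open_interior, of I] by metis
  have "(\<lambda>x. indicator (interior I) x *\<^sub>R ?w x) \<in> borel_measurable lborel"
  proof (rule borel_measurable_LIMSEQ_metric)
    show "(\<lambda>x. indicator (c n) x *\<^sub>R ?w x) \<in> borel_measurable lborel" for n
    proof -
      have "set_integrable lborel (c n) ?w" using wd c(1,2)[of n] by (simp add: is_weak_deriv_def)
      then show ?thesis unfolding set_integrable_def by (rule borel_measurable_integrable)
    qed
    fix x
    show "(\<lambda>n. indicator (c n) x *\<^sub>R ?w x) \<longlonglongrightarrow> indicator (interior I) x *\<^sub>R ?w x"
    proof (cases "x \<in> interior I")
      case True
      then obtain N where "\<And>n. n \<ge> N \<Longrightarrow> x \<in> c n" using c(5)[of "{x}"] by auto
      then have "\<forall>\<^sub>F n in sequentially. indicator (c n) x *\<^sub>R ?w x = indicator (interior I) x *\<^sub>R ?w x"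
        using True unfolding eventually_sequentially by (intro exI[of _ N]) simp
      then show ?thesis by (rule tendsto_eventually)
    next
      case False
      then have "x \<notin> c n" for n using c(2)[of n] by auto
      then show ?thesis using False by simp
    qed
  qed
  then have "(\<lambda>x. indicator I x *\<^sub>R ?w x) \<in> borel_measurable lborel"
    by (rule measurable_discrete_difference[OF _ countable_boundary])
      (use interior_subset[of I] in \<open>auto split: split_indicator\<close>)
  then have meas: "?w \<in> borel_measurable K" by (simp add: measurable_K_iff)
  have ae: "AE x in K. ?w x = w x"
    unfolding AE_K_iff using AE_interior primitive_unique[OF open_interior interior_interval pw(2,1)]
    by eventually_elim auto
  then have "integrable K (\<lambda>x. (cmod (?w x))\<^sup>2) \<longleftrightarrow> integrable K (\<lambda>x. (cmod (w x))\<^sup>2)"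
    using meas w(1) by (intro integrable_cong_AE) (auto simp: L2_set_def)
  then show wL: "?w \<in> L2_set K" using meas w(1) by (auto simp: L2_set_def)
  show "primitive I f ?w"
    by (rule primitive_from_interior[OF I_interval cont pw(2) L2_set_integrable[OF wL]])
qed

lemma H1_add:
  assumes f: "f \<in> H1 K" and g: "g \<in> H1 K"
  shows "(\<lambda>x. f x + g x) \<in> H1 K" "AE x in K. weak_deriv K (\<lambda>x. f x + g x) x = weak_deriv K f x + weak_deriv K g x"
proof -
  note fD = H1_D[OF f] and gD = H1_D[OF g]
  have "primitive I (\<lambda>x. f x + g x) (\<lambda>x. weak_deriv K f x + weak_deriv K g x)"
    by (rule primitive_add[OF fD(3) gD(3)])
  then show "(\<lambda>x. f x + g x) \<in> H1 K"
    "AE x in K. weak_deriv K (\<lambda>x. f x + g x) x = weak_deriv K f x + weak_deriv K g x"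
    using H1_I[of "\<lambda>x. f x + g x" "\<lambda>x. weak_deriv K f x + weak_deriv K g x"] fD gD
    by (auto intro: L2.add)
qed

lemma H1_scale:
  assumes f: "f \<in> H1 K"
  shows "(\<lambda>x. c * f x) \<in> H1 K" "AE x in K. weak_deriv K (\<lambda>x. c * f x) x = c * weak_deriv K f x"
proof -
  note fD = H1_D[OF f]
  have "primitive I (\<lambda>x. c * f x) (\<lambda>x. c * weak_deriv K f x)"
    using fD(3) unfolding primitive_def by (auto simp: right_diff_distrib[symmetric])
  then show "(\<lambda>x. c * f x) \<in> H1 K" "AE x in K. weak_deriv K (\<lambda>x. c * f x) x = c * weak_deriv K f x"
    using H1_I[of "\<lambda>x. c * f x" "\<lambda>x. c * weak_deriv K f x"] fD by (auto intro: L2.scale)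
qed

lemma H1_zero: "(\<lambda>x. 0) \<in> H1 K"
  by (rule H1_I[of _ "\<lambda>x. 0"]) (auto simp: L2.zero primitive_def set_integrable_def)

lemma H1_diff:
  assumes f: "f \<in> H1 K" and g: "g \<in> H1 K"
  shows "(\<lambda>x. f x - g x) \<in> H1 K" "AE x in K. weak_deriv K (\<lambda>x. f x - g x) x = weak_deriv K f x - weak_deriv K g x"
proof -
  have 1: "(\<lambda>x. f x - g x) = (\<lambda>x. f x + (- 1) * g x)" by auto
  show "(\<lambda>x. f x - g x) \<in> H1 K"
    unfolding 1 by (intro H1_add H1_scale f g)
  show "AE x in K. weak_deriv K (\<lambda>x. f x - g x) x = weak_deriv K f x - weak_deriv K g x"
    unfolding 1 using H1_add(2)[OF f H1_scale(1)[OF g, of "- 1"]] H1_scale(2)[OF g, of "- 1"]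
    by eventually_elim simp
qed

lemma H1_oscillation:
  assumes f: "f \<in> H1 K" and xy: "x \<in> I" "y \<in> I" "x \<le> R" "y \<le> R"
  shows "(cmod (f y - f x))\<^sup>2 \<le> \<bar>y - x\<bar> / gauss R * L2.nsq K (weak_deriv K f)"
proof -
  have *: "(cmod (f v - f u))\<^sup>2 \<le> \<bar>v - u\<bar> / gauss R * L2.nsq K (weak_deriv K f)"
    if uv: "u \<in> I" "v \<in> I" "u \<le> v" "v \<le> R" for u v
  proof -
    have "f v - f u = (LINT s:{u..v}|lborel. weak_deriv K f s)"
      using H1_D(3)[OF f] uv unfolding primitive_def by blast
    then have "(cmod (f v - f u))\<^sup>2 \<le> (v - u) / gauss v * L2.nsq K (weak_deriv K f)"
      using set_integral_bound[OF H1_D(2)[OF f] uv(1-3)] by simp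
    also have "\<dots> \<le> \<bar>v - u\<bar> / gauss R * L2.nsq K (weak_deriv K f)"
      using uv gauss_antimono[of v R] I_ge0[OF uv(2)] gauss_pos
      by (intro mult_right_mono frac_le L2.B_nonneg H1_D(2)[OF f]) auto
    finally show ?thesis .
  qed
  show ?thesis
    using *[of x y] *[of y x] xy by (cases "x \<le> y") (auto simp: norm_minus_commute)
qed

subsection \<open>Compactness and completeness\<close>

text \<open>Trace estimate. The value at \<open>a\<close> is compared with nearby values by the
  oscillation bound and averaged over \<open>{a..a + \<delta>}\<close>; integrating
  \<open>?G\<close> |f a|^2 \<le> 2 \<rho> |f s|^2 + 2 \<delta> B over this interval produces the
  constant.\<close>

lemma H1_start_bound:
  "\<exists>A\<ge>0. \<forall>f B. f \<in> H1 K \<longrightarrow> L2.nsq K f \<le> B \<longrightarrow> L2.nsq K (weak_deriv K f) \<le> B \<longrightarrow> (cmod (f a))\<^sup>2 \<le> A * B"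
proof -
  obtain \<delta> where \<delta>: "0 < \<delta>" "{a..a + \<delta>} \<subseteq> I" by (rule right_end)
  let ?G = "gauss (a + \<delta>)"
  have G: "0 < ?G" by (rule gauss_pos)
  show ?thesis
  proof (intro exI[of _ "(2 + 2 * \<delta>\<^sup>2) / (\<delta> * ?G)"] conjI allI impI)
    show "0 \<le> (2 + 2 * \<delta>\<^sup>2) / (\<delta> * ?G)" using \<delta> G by simp
    fix f B
    assume f: "f \<in> H1 K" and B: "L2.nsq K f \<le> B" "L2.nsq K (weak_deriv K f) \<le> B"
    note fD = H1_D[OF f]
    have B0: "0 \<le> B" using L2.B_nonneg[OF fD(1)] B(1) by linarith
    have fint: "integrable K (\<lambda>s. (cmod (f s))\<^sup>2)" using fD(1) by (simp add: L2_set_def)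
    note fm = borel_measurable_integrable[OF fint]
    have i1: "integrable lborel (\<lambda>s. indicator I s *\<^sub>R (\<rho> s *\<^sub>R (cmod (f s))\<^sup>2))"
      using fint integrable_K_iff[OF fm] by blast
    have ind: "integrable lborel (indicator {a..a + \<delta>} :: real \<Rightarrow> real)"
      by (rule integrable_real_indicator) (auto simp: emeasure_lborel_Icc_eq)
    have "(\<integral>s. (?G * (cmod (f a))\<^sup>2) * indicator {a..a + \<delta>} s \<partial>lborel)
        \<le> (\<integral>s. 2 * (indicator I s *\<^sub>R (\<rho> s *\<^sub>R (cmod (f s))\<^sup>2)) + (2 * \<delta> * B) * indicator {a..a + \<delta>} s \<partial>lborel)"
    proof (rule integral_mono)
      fix s
      show "(?G * (cmod (f a))\<^sup>2) * indicator {a..a + \<delta>} s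
          \<le> 2 * (indicator I s *\<^sub>R (\<rho> s *\<^sub>R (cmod (f s))\<^sup>2)) + (2 * \<delta> * B) * indicator {a..a + \<delta>} s"
      proof (cases "s \<in> {a..a + \<delta>}")
        case True
        then have sI: "s \<in> I" using \<delta> by auto
        have "(cmod (f a - f s))\<^sup>2 \<le> \<bar>a - s\<bar> / ?G * L2.nsq K (weak_deriv K f)"
          using True \<delta> by (intro H1_oscillation f sI a_in) auto
        also have "\<dots> \<le> \<delta> / ?G * B"
          using True G B(2) B0 L2.B_nonneg[OF fD(2)] by (intro mult_mono divide_right_mono) auto
        finally have "(cmod (f a - f s))\<^sup>2 \<le> \<delta> / ?G * B" .
        moreover have "(cmod (f a))\<^sup>2 \<le> 2 * (cmod (f s))\<^sup>2 + 2 * (cmod (f a - f s))\<^sup>2"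
        proof -
          have "cmod (f a) \<le> cmod (f s) + cmod (f a - f s)"
            using norm_triangle_ineq[of "f s" "f a - f s"] by simp
          then have "(cmod (f a))\<^sup>2 \<le> (cmod (f s) + cmod (f a - f s))\<^sup>2" by (intro power_mono) auto
          also have "\<dots> \<le> 2 * (cmod (f s))\<^sup>2 + 2 * (cmod (f a - f s))\<^sup>2"
            using sum_squares_bound[of "cmod (f s)" "cmod (f a - f s)"] by (simp add: power2_sum)
          finally show ?thesis .
        qed
        ultimately have "(cmod (f a))\<^sup>2 \<le> 2 * (cmod (f s))\<^sup>2 + 2 * (\<delta> / ?G * B)" by linarith
        then have "?G * (cmod (f a))\<^sup>2 \<le> ?G * (2 * (cmod (f s))\<^sup>2 + 2 * (\<delta> / ?G * B))"
          using G by (intro mult_left_mono) auto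
        also have "\<dots> = 2 * (?G * (cmod (f s))\<^sup>2) + 2 * \<delta> * B" using G by (simp add: field_simps)
        also have "\<dots> \<le> 2 * (\<rho> s * (cmod (f s))\<^sup>2) + 2 * \<delta> * B"
        proof -
          have "?G \<le> \<rho> s"
            using gauss_antimono[of s "a + \<delta>"] \<rho>_low[OF sI] I_ge0[OF sI] True by auto
          then have "?G * (cmod (f s))\<^sup>2 \<le> \<rho> s * (cmod (f s))\<^sup>2" by (rule mult_right_mono) simp
          then show ?thesis by linarith
        qed
        finally show ?thesis using True sI by simp
      next
        case False
        then show ?thesis using \<rho>_pos[of s] by (auto simp: less_imp_le split: split_indicator)
      qed
    qed (intro Bochner_Integration.integrable_add integrable_mult_right ind i1)+
    also have "\<dots> = 2 * L2.nsq K f + 2 * \<delta> * B * \<delta>"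
    proof -
      have "L2.nsq K f = (\<integral>s. indicator I s *\<^sub>R (\<rho> s *\<^sub>R (cmod (f s))\<^sup>2) \<partial>lborel)"
        unfolding L2_inner_self integral_K[OF fm] by simp
      then show ?thesis
        using \<delta>(1) by (subst Bochner_Integration.integral_add) (use i1 ind in \<open>auto intro!: integrable_mult_right\<close>)
    qed
    also have "(\<integral>s. (?G * (cmod (f a))\<^sup>2) * indicator {a..a + \<delta>} s \<partial>lborel) = \<delta> * ?G * (cmod (f a))\<^sup>2"
      using \<delta>(1) by simp
    finally have "\<delta> * ?G * (cmod (f a))\<^sup>2 \<le> 2 * B + 2 * \<delta> * B * \<delta>" using B(1) by linarith
    also have "\<dots> = (2 + 2 * \<delta>\<^sup>2) * B" by (simp add: power2_eq_square algebra_simps)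
    finally show "(cmod (f a))\<^sup>2 \<le> (2 + 2 * \<delta>\<^sup>2) / (\<delta> * ?G) * B"
      using \<delta>(1) G by (simp add: field_simps)
  qed
qed

lemma cmod_add_sq_le: "(cmod (u + v))\<^sup>2 \<le> 2 * (cmod u)\<^sup>2 + 2 * (cmod v)\<^sup>2"
proof -
  have "(cmod (u + v))\<^sup>2 \<le> (cmod u + cmod v)\<^sup>2" by (intro power_mono norm_triangle_ineq) auto
  also have "\<dots> \<le> 2 * (cmod u)\<^sup>2 + 2 * (cmod v)\<^sup>2"
    using sum_squares_bound[of "cmod u" "cmod v"] by (simp add: power2_sum)
  finally show ?thesis .
qed

text \<open>The bound is uniform in \<open>f\<close>. With \<open>H1_oscillation\<close> it provides
  the boundedness and the equicontinuity behind the selection of a pointwise convergent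
  subsequence.\<close>

lemma H1_pointwise_bound:
  "\<exists>b. (\<forall>R. 0 \<le> b R) \<and> (\<forall>f B x R. f \<in> H1 K \<longrightarrow> L2.nsq K f \<le> B \<longrightarrow> L2.nsq K (weak_deriv K f) \<le> B
      \<longrightarrow> x \<in> I \<longrightarrow> x \<le> R \<longrightarrow> (cmod (f x))\<^sup>2 \<le> b R * B)"
proof -
  obtain A where A: "0 \<le> A" "\<And>f B. f \<in> H1 K \<Longrightarrow> L2.nsq K f \<le> B \<Longrightarrow> L2.nsq K (weak_deriv K f) \<le> B
    \<Longrightarrow> (cmod (f a))\<^sup>2 \<le> A * B" using H1_start_bound by blast
  define q where "q R = \<bar>R\<bar> / gauss R" for R
  have q: "0 \<le> q R" for R using gauss_pos[of R] by (simp add: q_def)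
  show ?thesis
  proof (intro exI[of _ "\<lambda>R. 2 * A + 2 * q R"] conjI allI impI)
    show "0 \<le> 2 * A + 2 * q R" for R using A(1) q[of R] by simp
    fix f B x R
    assume f: "f \<in> H1 K" "L2.nsq K f \<le> B" "L2.nsq K (weak_deriv K f) \<le> B" and x: "x \<in> I" "x \<le> R"
    have "(cmod (f x - f a))\<^sup>2 \<le> \<bar>x - a\<bar> / gauss R * L2.nsq K (weak_deriv K f)"
      using x I_ge[OF x(1)] by (intro H1_oscillation f(1) a_in) auto
    also have "\<dots> \<le> q R * B"
      unfolding q_def
      using x I_ge[OF x(1)] a0 gauss_pos[of R] f(3) L2.B_nonneg[OF H1_D(2)[OF f(1)]]
      by (intro mult_mono divide_right_mono) auto
    finally have "(cmod (f x - f a))\<^sup>2 \<le> q R * B" .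
    moreover have "(cmod (f x))\<^sup>2 \<le> 2 * (cmod (f a))\<^sup>2 + 2 * (cmod (f x - f a))\<^sup>2"
      using cmod_add_sq_le[of "f a" "f x - f a"] by simp
    moreover have "(2 * A + 2 * q R) * B = 2 * (A * B) + 2 * (q R * B)" by (simp add: algebra_simps)
    ultimately show "(cmod (f x))\<^sup>2 \<le> (2 * A + 2 * q R) * B"
      using A(2)[OF f] by linarith
  qed
qed

lemma nn_integral_exp_weight: "(\<integral>\<^sup>+s. ennreal (s * exp (s\<^sup>2 / 2)) * indicator {x..y} s \<partial>lborel) = ennreal (exp (y\<^sup>2 / 2) - exp (x\<^sup>2 / 2))"
  if "0 \<le> x" "x \<le> y" for x y :: real
  using that by (intro nn_integral_FTC_Icc) (auto intro!: derivative_eq_intros)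

lemma nn_integral_exp_tail: "(\<integral>\<^sup>+s. ennreal (s * exp (- s\<^sup>2 / 2)) * indicator {x..} s \<partial>lborel) = ennreal (exp (- x\<^sup>2 / 2))"
  if "0 \<le> x" for x :: real
proof -
  have "((\<lambda>s::real. - exp (- s\<^sup>2 / 2)) \<longlongrightarrow> 0) at_top" by real_asymp
  then have "(\<integral>\<^sup>+s. ennreal (s * exp (- s\<^sup>2 / 2)) * indicator {x..} s \<partial>lborel) = 0 - (- exp (- x\<^sup>2 / 2))"
  proof (rule nn_integral_FTC_atLeast[rotated 3])
    fix s assume "x \<le> s"
    show "((\<lambda>s. - exp (- s\<^sup>2 / 2)) has_real_derivative s * exp (- s\<^sup>2 / 2)) (at s)"
      by (auto intro!: derivative_eq_intros)
    show "0 \<le> s * exp (- s\<^sup>2 / 2)" using that \<open>x \<le> s\<close> by simp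
  qed measurable
  then show ?thesis by simp
qed

text \<open>The weight k(s) = s exp(s^2/2) has an explicit integral, at most exp(x^2/2) over
  \<open>{\<alpha>..x}\<close>, and this uses up half of the Gaussian. After the integrals are
  exchanged, the other half with the factor x integrates over x \<ge> s to exp(-s^2/2). Divided by
  k(s) this is exp(-s^2)/s, which 1 \<le> \<alpha> bounds by exp(-s^2).\<close>

lemma H1_tail:
  assumes f: "f \<in> H1 K" and \<alpha>: "1 \<le> \<alpha>" "\<alpha> \<in> I" and unb: "I = {a..}"
  shows "(\<integral>\<^sup>+x. ennreal (x * gauss x * (cmod (f x - f \<alpha>))\<^sup>2) * indicator {\<alpha>..} x \<partial>lborel)
    \<le> ennreal (L2.nsq K (weak_deriv K f))"
proof -
  let ?w = "weak_deriv K f"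
  note fD = H1_D[OF f]
  define k where "k s = s * exp (s\<^sup>2 / 2)" for s :: real
  define W where "W s = ennreal ((cmod (indicator I s *\<^sub>R ?w s))\<^sup>2 / k s)" for s
  have wm: "(\<lambda>s. indicator I s *\<^sub>R ?w s) \<in> borel_measurable borel"
    using fD(2) by (simp only: L2_set_def mem_Collect_eq measurable_K_iff)
  have [measurable]: "k \<in> borel_measurable borel" unfolding k_def[abs_def] by measurable
  have [measurable]: "W \<in> borel_measurable borel" unfolding W_def[abs_def] using wm by measurable
  have sub: "{\<alpha>..} \<subseteq> I" using \<alpha> unb by auto
  have pw: "ennreal (x * gauss x * (cmod (f x - f \<alpha>))\<^sup>2)
      \<le> (\<integral>\<^sup>+s. ennreal (2 / sqrt pi) * (W s * (ennreal (x * exp (- x\<^sup>2 / 2)) * (indicator {\<alpha>..} s * indicator {s..} x))) \<partial>lborel)"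
    if x: "x \<ge> \<alpha>" for x
  proof -
    have xI: "x \<in> I" using x sub by auto
    have x0: "0 \<le> x" using x \<alpha> by simp
    have "f x - f \<alpha> = (LINT s:{\<alpha>..x}|lborel. ?w s)" using fD(3) \<alpha>(2) xI x unfolding primitive_def by blast
    then have e1: "ennreal ((cmod (f x - f \<alpha>))\<^sup>2) \<le> (\<integral>\<^sup>+s. ennreal ((cmod (?w s))\<^sup>2 / k s) * indicator {\<alpha>..x} s \<partial>lborel) *
        (\<integral>\<^sup>+s. ennreal (k s) * indicator {\<alpha>..x} s \<partial>lborel)"
      using \<alpha>(1) by (simp only:) (intro weighted_Cauchy_Schwarz fD(2) \<alpha>(2) xI, auto simp: k_def)
    have e2: "(\<integral>\<^sup>+s. ennreal (k s) * indicator {\<alpha>..x} s \<partial>lborel) \<le> ennreal (exp (x\<^sup>2 / 2))"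
      unfolding k_def using \<alpha>(1) x by (subst nn_integral_exp_weight) (auto intro: ennreal_leI)
    have e3: "(\<integral>\<^sup>+s. ennreal ((cmod (?w s))\<^sup>2 / k s) * indicator {\<alpha>..x} s \<partial>lborel)
        = (\<integral>\<^sup>+s. W s * indicator {\<alpha>..x} s \<partial>lborel)"
      using sub by (intro nn_integral_cong) (auto simp: W_def split: split_indicator)
    have le: "ennreal ((cmod (f x - f \<alpha>))\<^sup>2) \<le> (\<integral>\<^sup>+s. W s * indicator {\<alpha>..x} s \<partial>lborel) * ennreal (exp (x\<^sup>2 / 2))"
      using order_trans[OF e1 mult_left_mono[OF e2 zero_le]] unfolding e3 .
    have "ennreal (x * gauss x * (cmod (f x - f \<alpha>))\<^sup>2) = ennreal (x * gauss x) * ennreal ((cmod (f x - f \<alpha>))\<^sup>2)"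
      using x0 gauss_pos[of x] by (simp add: ennreal_mult)
    also have "\<dots> \<le> ennreal (x * gauss x) * ((\<integral>\<^sup>+s. W s * indicator {\<alpha>..x} s \<partial>lborel) * ennreal (exp (x\<^sup>2 / 2)))"
      using le by (rule mult_left_mono) simp
    also have "\<dots> = ennreal (x * gauss x * exp (x\<^sup>2 / 2)) * (\<integral>\<^sup>+s. W s * indicator {\<alpha>..x} s \<partial>lborel)"
      using x0 gauss_pos[of x] by (simp add: ennreal_mult mult.commute mult.left_commute)
    also have "x * gauss x * exp (x\<^sup>2 / 2) = 2 / sqrt pi * (x * exp (- x\<^sup>2 / 2))"
      by (simp add: gauss_def exp_add[symmetric])
    also have "ennreal (2 / sqrt pi * (x * exp (- x\<^sup>2 / 2))) * (\<integral>\<^sup>+s. W s * indicator {\<alpha>..x} s \<partial>lborel)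
        = (\<integral>\<^sup>+s. ennreal (2 / sqrt pi * (x * exp (- x\<^sup>2 / 2))) * (W s * indicator {\<alpha>..x} s) \<partial>lborel)"
      by (intro nn_integral_cmult[symmetric]) measurable
    also have "\<dots> = (\<integral>\<^sup>+s. ennreal (2 / sqrt pi) * (W s * (ennreal (x * exp (- x\<^sup>2 / 2)) * (indicator {\<alpha>..} s * indicator {s..} x))) \<partial>lborel)"
    proof (intro nn_integral_cong)
      fix s
      have "ennreal (2 / sqrt pi * (x * exp (- x\<^sup>2 / 2))) = ennreal (2 / sqrt pi) * ennreal (x * exp (- x\<^sup>2 / 2))"
        using x0 by (intro ennreal_mult) auto
      then show "ennreal (2 / sqrt pi * (x * exp (- x\<^sup>2 / 2))) * (W s * indicator {\<alpha>..x} s)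
        = ennreal (2 / sqrt pi) * (W s * (ennreal (x * exp (- x\<^sup>2 / 2)) * (indicator {\<alpha>..} s * indicator {s..} x)))"
        by (auto simp: mult_ac split: split_indicator)
    qed
    finally show ?thesis .
  qed
  have meas: "{p. fst p \<le> (snd p :: real)} \<in> sets (borel \<Otimes>\<^sub>M borel)"
  proof -
    have "{p \<in> space (borel \<Otimes>\<^sub>M borel). fst p \<le> (snd p :: real)} \<in> sets (borel \<Otimes>\<^sub>M borel)" by measurable
    then show ?thesis by (simp add: space_pair_measure)
  qed
  have ind: "(indicator {s..} x :: ennreal) = indicator {p. fst p \<le> snd p} (s, x)" for s x :: real
    by (auto split: split_indicator)
  have "(\<integral>\<^sup>+x. ennreal (x * gauss x * (cmod (f x - f \<alpha>))\<^sup>2) * indicator {\<alpha>..} x \<partial>lborel)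
      \<le> (\<integral>\<^sup>+x. (\<integral>\<^sup>+s. ennreal (2 / sqrt pi) * (W s * (ennreal (x * exp (- x\<^sup>2 / 2)) * (indicator {\<alpha>..} s * indicator {s..} x))) \<partial>lborel) \<partial>lborel)"
  proof (intro nn_integral_mono)
    fix x
    show "ennreal (x * gauss x * (cmod (f x - f \<alpha>))\<^sup>2) * indicator {\<alpha>..} x
      \<le> (\<integral>\<^sup>+s. ennreal (2 / sqrt pi) * (W s * (ennreal (x * exp (- x\<^sup>2 / 2)) * (indicator {\<alpha>..} s * indicator {s..} x))) \<partial>lborel)"
    proof (cases "x \<ge> \<alpha>")
      case True
      then have "indicator {\<alpha>..} x = (1::ennreal)" by simp
      then show ?thesis using pw[OF True] by (simp only: mult_1_right)
    qed simp
  qed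
  also have "\<dots> = (\<integral>\<^sup>+s. (\<integral>\<^sup>+x. ennreal (2 / sqrt pi) * (W s * (ennreal (x * exp (- x\<^sup>2 / 2)) * (indicator {\<alpha>..} s * indicator {s..} x))) \<partial>lborel) \<partial>lborel)"
    unfolding ind by (rule lborel_pair.Fubini') (use meas in measurable)
  also have "\<dots> = (\<integral>\<^sup>+s. ennreal (2 / sqrt pi) * W s * indicator {\<alpha>..} s * ennreal (exp (- s\<^sup>2 / 2)) \<partial>lborel)"
  proof (intro nn_integral_cong)
    fix s :: real
    show "(\<integral>\<^sup>+x. ennreal (2 / sqrt pi) * (W s * (ennreal (x * exp (- x\<^sup>2 / 2)) * (indicator {\<alpha>..} s * indicator {s..} x))) \<partial>lborel)
      = ennreal (2 / sqrt pi) * W s * indicator {\<alpha>..} s * ennreal (exp (- s\<^sup>2 / 2))"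
    proof (cases "s \<ge> \<alpha>")
      case True
      then have s0: "0 \<le> s" using \<alpha>(1) by simp
      have "(\<integral>\<^sup>+x. ennreal (2 / sqrt pi) * (W s * (ennreal (x * exp (- x\<^sup>2 / 2)) * (indicator {\<alpha>..} s * indicator {s..} x))) \<partial>lborel)
        = (\<integral>\<^sup>+x. (ennreal (2 / sqrt pi) * W s) * (ennreal (x * exp (- x\<^sup>2 / 2)) * indicator {s..} x) \<partial>lborel)"
        using True by (intro nn_integral_cong) (simp add: mult_ac)
      also have "\<dots> = (ennreal (2 / sqrt pi) * W s) * ennreal (exp (- s\<^sup>2 / 2))"
        by (subst nn_integral_cmult) (use nn_integral_exp_tail[OF s0] in simp_all)
      finally show ?thesis using True by simp
    qed simp
  qed
  also have "\<dots> \<le> (\<integral>\<^sup>+s. ennreal (\<rho> s) * ennreal ((cmod (?w s))\<^sup>2) * indicator I s \<partial>lborel)"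
  proof (intro nn_integral_mono)
    fix s
    show "ennreal (2 / sqrt pi) * W s * indicator {\<alpha>..} s * ennreal (exp (- s\<^sup>2 / 2))
        \<le> ennreal (\<rho> s) * ennreal ((cmod (?w s))\<^sup>2) * indicator I s"
    proof (cases "s \<ge> \<alpha>")
      case True
      then have s: "1 \<le> s" "s \<in> I" using \<alpha>(1) sub by auto
      have "2 / sqrt pi * ((cmod (?w s))\<^sup>2 / k s) * exp (- s\<^sup>2 / 2) = gauss s / s * (cmod (?w s))\<^sup>2"
      proof -
        have "exp (- s\<^sup>2 / 2) / exp (s\<^sup>2 / 2) = exp (- s\<^sup>2)" by (simp add: exp_diff[symmetric])
        then have "exp (- s\<^sup>2 / 2) = exp (- s\<^sup>2) * exp (s\<^sup>2 / 2)" by (simp add: field_simps)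
        then show ?thesis using s(1) by (simp add: gauss_def k_def)
      qed
      also have "\<dots> \<le> \<rho> s * (cmod (?w s))\<^sup>2"
      proof (intro mult_right_mono)
        have "gauss s / s \<le> gauss s" using s(1) gauss_pos[of s] by (simp add: divide_le_eq)
        also have "\<dots> \<le> \<rho> s" by (rule \<rho>_low[OF s(2)])
        finally show "gauss s / s \<le> \<rho> s" .
      qed simp
      finally have "ennreal (2 / sqrt pi * ((cmod (?w s))\<^sup>2 / k s) * exp (- s\<^sup>2 / 2)) \<le> ennreal (\<rho> s * (cmod (?w s))\<^sup>2)"
        by (rule ennreal_leI)
      moreover have em: "ennreal (c * q * e) = ennreal c * ennreal q * ennreal e" if "0 \<le> c" "0 \<le> q" "0 \<le> e" for c q e
        using that by (simp add: ennreal_mult)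
      have "ennreal (2 / sqrt pi * ((cmod (?w s))\<^sup>2 / k s) * exp (- s\<^sup>2 / 2))
          = ennreal (2 / sqrt pi) * ennreal ((cmod (?w s))\<^sup>2 / k s) * ennreal (exp (- s\<^sup>2 / 2))"
        by (rule em) (use s(1) in \<open>auto simp: k_def\<close>)
      moreover have "W s = ennreal ((cmod (?w s))\<^sup>2 / k s)" using s(2) by (simp add: W_def)
      ultimately show ?thesis
        using True s \<rho>_pos[OF s(2)] by (simp only: ennreal_mult indicator_simps atLeast_iff mult_1_right less_imp_le zero_le_power2)
    qed simp
  qed
  also have "\<dots> = ennreal (L2.nsq K ?w)"
    unfolding L2_nn_integral[OF fD(2), symmetric] using fD(2) by (subst nn_integral_K) (auto simp: L2_set_def)
  finally show ?thesis .
qed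

text \<open>A uniform first moment, which keeps mass from escaping to infinity. On a bounded
  interval the factor x is bounded. On a half-line it is bounded below \<alpha>, while beyond
  \<alpha> the function is written as f - f(\<alpha>), covered by \<open>H1_tail\<close>, plus a
  constant, covered by the first moment of the Gaussian.\<close>

lemma H1_weight:
  "\<exists>D\<ge>0. \<forall>f B. f \<in> H1 K \<longrightarrow> L2.nsq K f \<le> B \<longrightarrow> L2.nsq K (weak_deriv K f) \<le> B \<longrightarrow>
     (\<integral>\<^sup>+x. ennreal (x * (cmod (f x))\<^sup>2) \<partial>K) \<le> ennreal (D * B)"
proof (cases "I = {a..}")
  case False
  then obtain b where b: "a < b" "I = {a..b}" using I by auto
  show ?thesis
  proof (intro exI[of _ b] conjI allI impI)
    show "0 \<le> b" using b a0 by simp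
    fix f B assume f: "f \<in> H1 K" "L2.nsq K f \<le> B" "L2.nsq K (weak_deriv K f) \<le> B"
    have fL: "f \<in> L2_set K" by (rule H1_D(1)[OF f(1)])
    then have [measurable]: "f \<in> borel_measurable K" by (simp add: L2_set_def)
    have "(\<integral>\<^sup>+x. ennreal (x * (cmod (f x))\<^sup>2) \<partial>K) \<le> (\<integral>\<^sup>+x. ennreal b * ennreal ((cmod (f x))\<^sup>2) \<partial>K)"
    proof (rule nn_integral_mono)
      fix x assume "x \<in> space K"
      then have "x \<in> I" by simp
      then have "x \<le> b" using b by simp
      then have "x * (cmod (f x))\<^sup>2 \<le> b * (cmod (f x))\<^sup>2" by (rule mult_right_mono) simp
      then show "ennreal (x * (cmod (f x))\<^sup>2) \<le> ennreal b * ennreal ((cmod (f x))\<^sup>2)"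
        using b a0 by (simp add: ennreal_mult[symmetric] ennreal_leI)
    qed
    also have "\<dots> = ennreal b * ennreal (L2.nsq K f)"
      unfolding L2_nn_integral[OF fL, symmetric] by (rule nn_integral_cmult) measurable
    also have "\<dots> \<le> ennreal (b * B)"
      using b a0 f(2) L2.B_nonneg[OF fL] by (simp add: ennreal_mult[symmetric] ennreal_leI mult_left_mono)
    finally show "(\<integral>\<^sup>+x. ennreal (x * (cmod (f x))\<^sup>2) \<partial>K) \<le> ennreal (b * B)" .
  qed
next
  case True
  obtain b where b: "\<And>R. 0 \<le> b R" "\<And>f B x R. f \<in> H1 K \<Longrightarrow> L2.nsq K f \<le> B \<Longrightarrow> L2.nsq K (weak_deriv K f) \<le> B
      \<Longrightarrow> x \<in> I \<Longrightarrow> x \<le> R \<Longrightarrow> (cmod (f x))\<^sup>2 \<le> b R * B"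
    using H1_pointwise_bound by blast
  define \<alpha> where "\<alpha> = a + 1"
  have \<alpha>: "1 \<le> \<alpha>" "\<alpha> \<in> I" using a0 True by (auto simp: \<alpha>_def)
  have "0 < C * gauss a" using \<rho>_low[OF a_in] \<rho>_up[OF a_in] gauss_pos[of a] by linarith
  then have C: "0 \<le> C" using gauss_pos[of a] by (simp add: zero_less_mult_iff)
  have moment: "(\<integral>\<^sup>+x. ennreal (x * gauss x) * indicator {\<alpha>..} x \<partial>lborel) \<le> ennreal 2"
  proof -
    have "(\<integral>\<^sup>+x. ennreal (x * gauss x) * indicator {\<alpha>..} x \<partial>lborel)
        \<le> (\<integral>\<^sup>+x. ennreal 2 * (ennreal (x * exp (- x\<^sup>2 / 2)) * indicator {\<alpha>..} x) \<partial>lborel)"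
    proof (intro nn_integral_mono)
      fix x
      show "ennreal (x * gauss x) * indicator {\<alpha>..} x \<le> ennreal 2 * (ennreal (x * exp (- x\<^sup>2 / 2)) * indicator {\<alpha>..} x)"
      proof (cases "x \<ge> \<alpha>")
        case x: True
        have "1 \<le> sqrt pi" using pi_ge_two by simp
        then have "2 / sqrt pi \<le> 2" by (simp add: divide_le_eq)
        then have "gauss x \<le> 2 * exp (- x\<^sup>2 / 2)"
          unfolding gauss_def by (intro mult_mono) auto
        then have "x * gauss x \<le> 2 * (x * exp (- x\<^sup>2 / 2))"
          using mult_left_mono[of "gauss x" "2 * exp (- x\<^sup>2 / 2)" x] x \<alpha>(1) by simp
        then have "ennreal (x * gauss x) \<le> ennreal (2 * (x * exp (- x\<^sup>2 / 2)))" by (rule ennreal_leI)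
        also have "\<dots> = ennreal 2 * ennreal (x * exp (- x\<^sup>2 / 2))"
          using x \<alpha>(1) by (intro ennreal_mult) auto
        finally show ?thesis using x by (simp only: indicator_simps atLeast_iff mult_1_right)
      qed simp
    qed
    also have "\<dots> = ennreal 2 * ennreal (exp (- \<alpha>\<^sup>2 / 2))"
      using \<alpha>(1) by (subst nn_integral_cmult, measurable) (subst nn_integral_exp_tail, auto)
    also have "\<dots> \<le> ennreal 2 * ennreal 1" by (intro mult_left_mono ennreal_leI) auto
    finally show ?thesis by simp
  qed
  show ?thesis
  \<comment> \<open>\<alpha> accounts for the points below \<alpha>, \<open>2 * C\<close> for the
    difference f - f(\<alpha>), and \<open>4 * C * b \<alpha>\<close> for the constant:
    \<open>2 * C\<close> times |f \<alpha>|^2 \<le> \<open>b \<alpha> * B\<close> times the bound 2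
    in \<open>moment\<close>.\<close>
  proof (intro exI[of _ "\<alpha> + (2 * C + 4 * C * b \<alpha>)"] conjI allI impI)
    show "0 \<le> \<alpha> + (2 * C + 4 * C * b \<alpha>)" using \<alpha>(1) C b(1)[of \<alpha>] by simp
    fix f B assume f: "f \<in> H1 K" "L2.nsq K f \<le> B" "L2.nsq K (weak_deriv K f) \<le> B"
    have fL: "f \<in> L2_set K" by (rule H1_D(1)[OF f(1)])
    have B0: "0 \<le> B" using L2.B_nonneg[OF fL] f(2) by linarith
    define F where "F x = indicator I x *\<^sub>R f x" for x
    have [measurable]: "F \<in> borel_measurable borel"
      using fL by (simp only: L2_set_def mem_Collect_eq measurable_K_iff F_def[abs_def])
    have F: "F x = f x" if "x \<in> I" for x using that by (simp add: F_def)
    have fm: "f \<in> borel_measurable K" using fL by (simp add: L2_set_def)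
    have f\<alpha>: "(cmod (f \<alpha>))\<^sup>2 \<le> b \<alpha> * B" using b(2)[OF f \<alpha>(2)] by simp
    have "(\<integral>\<^sup>+x. ennreal (x * (cmod (f x))\<^sup>2) \<partial>K)
        = (\<integral>\<^sup>+x. ennreal (\<rho> x) * ennreal (x * (cmod (f x))\<^sup>2) * indicator I x \<partial>lborel)"
    proof (rule nn_integral_K)
      have "(\<lambda>x. x) \<in> borel_measurable K" unfolding borel_measurable_K by (rule measurable_restrict_space1) simp
      then show "(\<lambda>x. ennreal (x * (cmod (f x))\<^sup>2)) \<in> borel_measurable K" using fm by measurable
    qed
    also have "\<dots> \<le> (\<integral>\<^sup>+x. ennreal \<alpha> * (ennreal (\<rho> x) * ennreal ((cmod (F x))\<^sup>2) * indicator I x) +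
        (ennreal (2 * C) * (ennreal (x * gauss x * (cmod (F x - f \<alpha>))\<^sup>2) * indicator {\<alpha>..} x) +
         ennreal (2 * C * (cmod (f \<alpha>))\<^sup>2) * (ennreal (x * gauss x) * indicator {\<alpha>..} x)) \<partial>lborel)"
    proof (intro nn_integral_mono)
      fix x
      show "ennreal (\<rho> x) * ennreal (x * (cmod (f x))\<^sup>2) * indicator I x
        \<le> ennreal \<alpha> * (ennreal (\<rho> x) * ennreal ((cmod (F x))\<^sup>2) * indicator I x) +
        (ennreal (2 * C) * (ennreal (x * gauss x * (cmod (F x - f \<alpha>))\<^sup>2) * indicator {\<alpha>..} x) +
         ennreal (2 * C * (cmod (f \<alpha>))\<^sup>2) * (ennreal (x * gauss x) * indicator {\<alpha>..} x))"
      proof (cases "x \<in> I")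
        case xI: True
        have x0: "0 \<le> x" by (rule I_ge0[OF xI])
        have r0: "0 \<le> \<rho> x" using \<rho>_pos[OF xI] by simp
        show ?thesis
        proof (cases "x \<ge> \<alpha>")
          case x\<alpha>: True
          have "\<rho> x * (x * (cmod (f x))\<^sup>2) \<le> (C * gauss x) * (x * (cmod (f x))\<^sup>2)"
            using \<rho>_up[OF xI] x0 by (intro mult_right_mono) auto
          also have "\<dots> = C * (x * gauss x) * (cmod (f x))\<^sup>2" by simp
          also have "\<dots> \<le> C * (x * gauss x) * (2 * (cmod (f x - f \<alpha>))\<^sup>2 + 2 * (cmod (f \<alpha>))\<^sup>2)"
            using cmod_add_sq_le[of "f x - f \<alpha>" "f \<alpha>"] C x0 gauss_pos[of x] by (intro mult_left_mono) auto
          also have "\<dots> = 2 * C * (x * gauss x * (cmod (f x - f \<alpha>))\<^sup>2) + 2 * C * (cmod (f \<alpha>))\<^sup>2 * (x * gauss x)"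
            by (simp add: algebra_simps)
          finally have "ennreal (\<rho> x * (x * (cmod (f x))\<^sup>2))
              \<le> ennreal (2 * C * (x * gauss x * (cmod (f x - f \<alpha>))\<^sup>2) + 2 * C * (cmod (f \<alpha>))\<^sup>2 * (x * gauss x))"
            by (rule ennreal_leI)
          also have "\<dots> = ennreal (2 * C) * ennreal (x * gauss x * (cmod (f x - f \<alpha>))\<^sup>2)
              + ennreal (2 * C * (cmod (f \<alpha>))\<^sup>2) * ennreal (x * gauss x)"
            using C x0 gauss_pos[of x] by (simp add: ennreal_mult[symmetric] ennreal_plus[symmetric] del: ennreal_plus)
          finally have "ennreal (\<rho> x) * ennreal (x * (cmod (f x))\<^sup>2) \<le> \<dots>"
            using r0 x0 by (simp add: ennreal_mult)
          then show ?thesis using xI x\<alpha> F[OF xI] by (auto intro: add_increasing)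
        next
          case False
          have "\<rho> x * (x * (cmod (f x))\<^sup>2) \<le> \<alpha> * (\<rho> x * (cmod (f x))\<^sup>2)"
            using False r0 mult_right_mono[of x \<alpha> "\<rho> x * (cmod (f x))\<^sup>2"] by (simp add: algebra_simps)
          then have "ennreal (\<rho> x * (x * (cmod (f x))\<^sup>2)) \<le> ennreal (\<alpha> * (\<rho> x * (cmod (f x))\<^sup>2))"
            by (rule ennreal_leI)
          then show ?thesis using False xI r0 x0 \<alpha>(1) F[OF xI] by (simp add: ennreal_mult)
        qed
      next
        case False
        then show ?thesis by simp
      qed
    qed
    also have "\<dots> = ennreal \<alpha> * (\<integral>\<^sup>+x. ennreal (\<rho> x) * ennreal ((cmod (F x))\<^sup>2) * indicator I x \<partial>lborel) +
        (ennreal (2 * C) * (\<integral>\<^sup>+x. ennreal (x * gauss x * (cmod (F x - f \<alpha>))\<^sup>2) * indicator {\<alpha>..} x \<partial>lborel) +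
         ennreal (2 * C * (cmod (f \<alpha>))\<^sup>2) * (\<integral>\<^sup>+x. ennreal (x * gauss x) * indicator {\<alpha>..} x \<partial>lborel))"
      by (simp add: nn_integral_add nn_integral_cmult)
    also have "(\<integral>\<^sup>+x. ennreal (\<rho> x) * ennreal ((cmod (F x))\<^sup>2) * indicator I x \<partial>lborel) = ennreal (L2.nsq K f)"
      unfolding L2_nn_integral[OF fL, symmetric] using fm
      by (subst nn_integral_K) (auto intro!: nn_integral_cong simp: F split: split_indicator)
    also have "(\<integral>\<^sup>+x. ennreal (x * gauss x * (cmod (F x - f \<alpha>))\<^sup>2) * indicator {\<alpha>..} x \<partial>lborel)
        = (\<integral>\<^sup>+x. ennreal (x * gauss x * (cmod (f x - f \<alpha>))\<^sup>2) * indicator {\<alpha>..} x \<partial>lborel)"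
      using \<alpha>(2) True by (intro nn_integral_cong) (auto simp: F split: split_indicator)
    also have "ennreal \<alpha> * ennreal (L2.nsq K f) + (ennreal (2 * C) * \<dots> +
         ennreal (2 * C * (cmod (f \<alpha>))\<^sup>2) * (\<integral>\<^sup>+x. ennreal (x * gauss x) * indicator {\<alpha>..} x \<partial>lborel))
      \<le> ennreal \<alpha> * ennreal B + (ennreal (2 * C) * ennreal B + ennreal (2 * C * (b \<alpha> * B)) * ennreal 2)"
    proof (intro add_mono mult_left_mono mult_mono)
      show "(\<integral>\<^sup>+x. ennreal (x * gauss x * (cmod (f x - f \<alpha>))\<^sup>2) * indicator {\<alpha>..} x \<partial>lborel) \<le> ennreal B"
        using H1_tail[OF f(1) \<alpha> True] f(3) by (auto intro: order_trans ennreal_leI)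
    qed (use f f\<alpha> C moment in \<open>auto intro!: ennreal_leI mult_left_mono\<close>)
    also have "\<dots> = ennreal ((\<alpha> + (2 * C + 4 * C * b \<alpha>)) * B)"
    proof -
      have "(\<alpha> + (2 * C + 4 * C * b \<alpha>)) * B = \<alpha> * B + (2 * C * B + 2 * C * (b \<alpha> * B) * 2)"
        by (simp add: algebra_simps)
      moreover have "0 \<le> \<alpha>" using \<alpha>(1) by simp
      ultimately show ?thesis
        using C B0 b(1)[of \<alpha>]
        by (simp only: ennreal_plus ennreal_mult mult_nonneg_nonneg add_nonneg_nonneg zero_le_numeral)
    qed
    finally show "(\<integral>\<^sup>+x. ennreal (x * (cmod (f x))\<^sup>2) \<partial>K) \<le> ennreal ((\<alpha> + (2 * C + 4 * C * b \<alpha>)) * B)" .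
  qed
qed

lemma I_rational:
  assumes x: "x \<in> I" and d: "0 < d"
  obtains q where "q \<in> \<rat>" "q \<in> I" "\<bar>x - q\<bar> < d"
proof -
  obtain \<delta> where \<delta>: "0 < \<delta>" "{a..a + \<delta>} \<subseteq> I" by (rule right_end)
  show ?thesis
  proof (cases "x = a")
    case True
    obtain q where "q \<in> \<rat>" "a < q" "q < a + min \<delta> d"
      using Rats_dense_in_real[of a "a + min \<delta> d"] \<delta> d by auto
    moreover have "q \<in> I" using \<delta>(2) calculation by auto
    ultimately show ?thesis using that[of q] True by auto
  next
    case False
    then have "a < x" using I_ge[OF x] by simp
    obtain q where q: "q \<in> \<rat>" "max a (x - d) < q" "q < x"
      using Rats_dense_in_real[of "max a (x - d)" x] \<open>a < x\<close> d by auto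
    have "q \<in> I" using I_initial[OF x] q by auto
    then show ?thesis using that[of q] q by auto
  qed
qed

lemma nsq_cong_AE:
  assumes "f \<in> L2_set K" "g \<in> L2_set K" "AE x in K. f x = g x"
  shows "L2.nsq K f = L2.nsq K g"
  unfolding L2_inner_self using assms
  by (auto simp: L2_set_def intro!: integral_cong_AE elim: eventually_mono)

lemma nsq_weak_deriv_diff:
  assumes "f \<in> H1 K" "g \<in> H1 K"
  shows "L2.nsq K (weak_deriv K (\<lambda>x. f x - g x)) = L2.nsq K (\<lambda>x. weak_deriv K f x - weak_deriv K g x)"
  by (intro nsq_cong_AE H1_D H1_diff L2.diff assms)

lemma H1_compact:
  assumes f: "\<And>n::nat. f n \<in> H1 K" and B: "\<And>n. L2.nsq K (f n) \<le> B" "\<And>n. L2.nsq K (weak_deriv K (f n)) \<le> B"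
  shows "\<exists>r g. strict_mono (r :: nat \<Rightarrow> nat) \<and> g \<in> L2_set K \<and> (\<forall>x\<in>I. (\<lambda>n. f (r n) x) \<longlonglongrightarrow> g x) \<and>
    (\<lambda>n. L2.nsq K (\<lambda>x. f (r n) x - g x)) \<longlonglongrightarrow> 0"
proof -
  have fL: "f n \<in> L2_set K" for n by (rule H1_D(1)[OF f])
  have B0: "0 \<le> B" using L2.B_nonneg[OF fL[of 0]] B(1)[of 0] by linarith
  obtain b where b0: "\<And>R. 0 \<le> b R" and b: "\<And>f B x R. f \<in> H1 K \<Longrightarrow> L2.nsq K f \<le> B \<Longrightarrow> L2.nsq K (weak_deriv K f) \<le> B
      \<Longrightarrow> x \<in> I \<Longrightarrow> x \<le> R \<Longrightarrow> (cmod (f x))\<^sup>2 \<le> b R * B"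
    using H1_pointwise_bound by blast
  obtain D where D: "0 \<le> D" "\<And>f B. f \<in> H1 K \<Longrightarrow> L2.nsq K f \<le> B \<Longrightarrow> L2.nsq K (weak_deriv K f) \<le> B \<Longrightarrow>
     (\<integral>\<^sup>+x. ennreal (x * (cmod (f x))\<^sup>2) \<partial>K) \<le> ennreal (D * B)"
    using H1_weight by blast
  have bf: "(cmod (f n x))\<^sup>2 \<le> b R * B" if "x \<in> I" "x \<le> R" for n x R
    by (rule b[OF f B that])
  \<comment> \<open>A pointwise normalisation: the selection principle wants one bound for all
    points, whereas the available bound grows with x. The summand 1 makes division possible.\<close>
  define c where "c x = sqrt (b x * B) + 1" for x
  have c: "0 < c x" for x using b0[of x] B0 by (simp add: c_def add_nonneg_pos)
  have cf: "cmod (f n x) \<le> c x" if "x \<in> I" for n x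
    using real_le_rsqrt[OF bf[OF that order_refl, of n]] by (simp add: c_def)
  obtain r where r: "strict_mono (r :: nat \<Rightarrow> nat)"
    and r_conv: "\<And>x. x \<in> \<rat> \<inter> I \<Longrightarrow> \<exists>l. (\<lambda>n. f (r n) x / of_real (c x)) \<longlonglongrightarrow> l"
  proof (rule function_convergent_subsequence[of "\<rat> \<inter> I" "\<lambda>n x. f n x / of_real (c x)" 1])
    show "countable (\<rat> \<inter> I)" using countable_rat by auto
    show "norm (f n x / of_real (c x)) \<le> 1" if "x \<in> \<rat> \<inter> I" for n x
      using cf[of x n] c[of x] that by (simp add: norm_divide divide_le_eq)
  qed blast
  have conv_rat: "convergent (\<lambda>n. f (r n) q)" if "q \<in> \<rat>" "q \<in> I" for q
  proof -
    obtain l where "(\<lambda>n. f (r n) q / of_real (c q)) \<longlonglongrightarrow> l" using r_conv[of q] \<open>q \<in> \<rat>\<close> \<open>q \<in> I\<close> by auto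
    then have "(\<lambda>n. f (r n) q / of_real (c q) * of_real (c q)) \<longlonglongrightarrow> l * of_real (c q)" by (intro tendsto_intros)
    then show ?thesis using c[of q] by (auto simp: convergent_def)
  qed
  have conv: "convergent (\<lambda>n. f (r n) x)" if x: "x \<in> I" for x
  proof (rule Cauchy_convergent, rule metric_CauchyI)
    fix e :: real assume e: "0 < e"
    let ?G = "gauss (x + 1)"
    have G: "0 < ?G" by (rule gauss_pos)
    define d where "d = min 1 ((e / 3)\<^sup>2 * ?G / (B + 1))"
    have d: "0 < d" using e G B0 by (simp add: d_def)
    obtain q where q: "q \<in> \<rat>" "q \<in> I" "\<bar>x - q\<bar> < d" by (rule I_rational[OF x d])
    have near: "cmod (f n x - f n q) < e / 3" for n
    proof -
      have "d \<le> 1" by (simp add: d_def)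
      then have "q \<le> x + 1" using q(3) by linarith
      then have "(cmod (f n x - f n q))\<^sup>2 \<le> \<bar>x - q\<bar> / ?G * L2.nsq K (weak_deriv K (f n))"
        by (intro H1_oscillation f x q) auto
      also have "\<dots> \<le> \<bar>x - q\<bar> / ?G * (B + 1)"
        using B(2)[of n] G by (intro mult_left_mono) auto
      also have "\<dots> < (e / 3)\<^sup>2"
      proof -
        have "\<bar>x - q\<bar> < (e / 3)\<^sup>2 * ?G / (B + 1)" using q(3) by (simp add: d_def)
        then have "\<bar>x - q\<bar> * (B + 1) < (e / 3)\<^sup>2 * ?G" using B0 by (simp add: less_divide_eq)
        then have "\<bar>x - q\<bar> * (B + 1) / ?G < (e / 3)\<^sup>2" using G by (simp add: divide_less_eq)
        then show ?thesis by simp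
      qed
      finally show ?thesis by (rule power2_less_imp_less) (use e in simp)
    qed
    obtain M where M: "\<And>m n. m \<ge> M \<Longrightarrow> n \<ge> M \<Longrightarrow> dist (f (r m) q) (f (r n) q) < e / 3"
      using metric_CauchyD[OF convergent_Cauchy[OF conv_rat[OF q(1,2)]], of "e / 3"] e by auto
    have "dist (f (r m) x) (f (r n) x) < e" if "m \<ge> M" "n \<ge> M" for m n
    proof -
      have "dist (f (r m) x) (f (r n) x) \<le> dist (f (r m) x) (f (r m) q) + dist (f (r m) q) (f (r n) q) + dist (f (r n) q) (f (r n) x)"
        using dist_triangle[of "f (r m) x" "f (r n) x" "f (r m) q"] dist_triangle[of "f (r m) q" "f (r n) x" "f (r n) q"] by linarith
      then show ?thesis using near[of "r m"] near[of "r n"] M[OF that] by (simp add: dist_norm norm_minus_commute)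
    qed
    then show "\<exists>M. \<forall>m\<ge>M. \<forall>n\<ge>M. dist (f (r m) x) (f (r n) x) < e" by blast
  qed
  define g where "g x = lim (\<lambda>n. f (r n) x)" for x
  have g: "(\<lambda>n. f (r n) x) \<longlonglongrightarrow> g x" if "x \<in> I" for x
    using conv[OF that] by (simp add: g_def convergent_LIMSEQ_iff)
  have fm [measurable]: "f n \<in> borel_measurable K" for n using fL by (simp add: L2_set_def)
  have gm [measurable]: "g \<in> borel_measurable K"
    by (rule borel_measurable_LIMSEQ_metric[of "\<lambda>n. f (r n)"]) (use fm g in auto)
  have gL: "g \<in> L2_set K"
  proof (rule L2_setI)
    have "(\<integral>\<^sup>+x. ennreal ((cmod (g x))\<^sup>2) \<partial>K) = (\<integral>\<^sup>+x. liminf (\<lambda>n. ennreal ((cmod (f (r n) x))\<^sup>2)) \<partial>K)"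
    proof (rule nn_integral_cong)
      fix x assume "x \<in> space K"
      then have "(\<lambda>n. ennreal ((cmod (f (r n) x))\<^sup>2)) \<longlonglongrightarrow> ennreal ((cmod (g x))\<^sup>2)"
        using g by (intro tendsto_intros) simp
      then show "ennreal ((cmod (g x))\<^sup>2) = liminf (\<lambda>n. ennreal ((cmod (f (r n) x))\<^sup>2))"
        by (rule lim_imp_Liminf[OF trivial_limit_sequentially, symmetric])
    qed
    also have "\<dots> \<le> liminf (\<lambda>n. (\<integral>\<^sup>+x. ennreal ((cmod (f (r n) x))\<^sup>2) \<partial>K))"
      by (rule nn_integral_liminf) measurable
    also have "\<dots> \<le> liminf (\<lambda>n. ennreal B)"
      using L2_nn_integral[OF fL] B(1) by (intro Liminf_mono always_eventually) (simp add: ennreal_leI)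
    finally show "(\<integral>\<^sup>+x. ennreal ((cmod (g x))\<^sup>2) \<partial>K) \<le> ennreal B" by (simp add: Liminf_const)
  qed (use gm B0 in auto)
  define u where "u n x = f (r n) x - g x" for n x
  have uL: "u n \<in> L2_set K" for n unfolding u_def[abs_def] by (intro L2.diff fL gL)
  have um [measurable]: "u n \<in> borel_measurable K" for n using uL by (simp add: L2_set_def)
  have idm [measurable]: "(\<lambda>x. x) \<in> borel_measurable K"
    unfolding borel_measurable_K by (rule measurable_restrict_space1) simp
  have u0: "(\<lambda>n. u n x) \<longlonglongrightarrow> 0" if "x \<in> I" for x
    unfolding u_def using g[OF that] by (simp add: LIM_zero_iff)
  have ub: "(cmod (u n x))\<^sup>2 \<le> 4 * (b R * B)" if "x \<in> I" "x \<le> R" for n x R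
  proof -
    have "(\<lambda>n. (cmod (f (r n) x))\<^sup>2) \<longlonglongrightarrow> (cmod (g x))\<^sup>2" using g[OF that(1)] by (intro tendsto_intros)
    then have "(cmod (g x))\<^sup>2 \<le> b R * B" by (rule LIMSEQ_le_const2) (use bf[OF that] in auto)
    then show ?thesis
      using cmod_add_sq_le[of "f (r n) x" "- g x"] bf[OF that, of "r n"] by (simp add: u_def)
  qed
  \<comment> \<open>Fatou in the second index, because \<open>g\<close> is not yet known to lie in
    \<open>H1\<close> and the moment bound applies to differences of the sequence only. Their
    squared norms are at most \<open>4 * B\<close>.\<close>
  have u_weight: "(\<integral>\<^sup>+x. ennreal (x * (cmod (u n x))\<^sup>2) \<partial>K) \<le> ennreal (D * (4 * B))" for n
  proof -
    have "(\<integral>\<^sup>+x. ennreal (x * (cmod (u n x))\<^sup>2) \<partial>K)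
        = (\<integral>\<^sup>+x. liminf (\<lambda>m. ennreal (x * (cmod (f (r n) x - f (r m) x))\<^sup>2)) \<partial>K)"
    proof (rule nn_integral_cong)
      fix x assume "x \<in> space K"
      then have "(\<lambda>m. ennreal (x * (cmod (f (r n) x - f (r m) x))\<^sup>2)) \<longlonglongrightarrow> ennreal (x * (cmod (u n x))\<^sup>2)"
        unfolding u_def using g by (intro tendsto_intros) simp
      then show "ennreal (x * (cmod (u n x))\<^sup>2) = liminf (\<lambda>m. ennreal (x * (cmod (f (r n) x - f (r m) x))\<^sup>2))"
        by (rule lim_imp_Liminf[OF trivial_limit_sequentially, symmetric])
    qed
    also have "\<dots> \<le> liminf (\<lambda>m. (\<integral>\<^sup>+x. ennreal (x * (cmod (f (r n) x - f (r m) x))\<^sup>2) \<partial>K))"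
      by (rule nn_integral_liminf) measurable
    also have "\<dots> \<le> liminf (\<lambda>m. ennreal (D * (4 * B)))"
    proof (intro Liminf_mono always_eventually allI D(2))
      fix m
      show "(\<lambda>x. f (r n) x - f (r m) x) \<in> H1 K" by (intro H1_diff f)
      show "L2.nsq K (\<lambda>x. f (r n) x - f (r m) x) \<le> 4 * B"
        using L2.nsq_diff_le[OF fL fL, of "r n" "r m"] B(1)[of "r n"] B(1)[of "r m"] by linarith
      show "L2.nsq K (weak_deriv K (\<lambda>x. f (r n) x - f (r m) x)) \<le> 4 * B"
        unfolding nsq_weak_deriv_diff[OF f f]
        using L2.nsq_diff_le[OF H1_D(2)[OF f] H1_D(2)[OF f], of "r n" "r m"] B(2)[of "r n"] B(2)[of "r m"] by linarith
    qed
    finally show ?thesis by (simp add: Liminf_const)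
  qed
  have int_weight: "integrable K (\<lambda>x. x * (cmod (u n x))\<^sup>2)" "(\<integral>x. x * (cmod (u n x))\<^sup>2 \<partial>K) \<le> D * (4 * B)" for n
  proof -
    have nonneg: "AE x in K. 0 \<le> x * (cmod (u n x))\<^sup>2"
      by (rule AE_I2) (use I_ge0 in auto)
    have fin: "(\<integral>\<^sup>+x. ennreal (x * (cmod (u n x))\<^sup>2) \<partial>K) < \<infinity>" using u_weight[of n] by (simp add: order_le_less_trans)
    show i: "integrable K (\<lambda>x. x * (cmod (u n x))\<^sup>2)"
      by (rule integrableI_nonneg[OF _ nonneg fin]) measurable
    show "(\<integral>x. x * (cmod (u n x))\<^sup>2 \<partial>K) \<le> D * (4 * B)"
      using u_weight[of n] D(1) B0 unfolding nn_integral_eq_integral[OF i nonneg] by simp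
  qed
  have "(\<lambda>n. L2.nsq K (u n)) \<longlonglongrightarrow> 0"
  proof (rule LIMSEQ_I)
    fix e :: real assume e: "0 < e"
    \<comment> \<open>Beyond \<open>R\<close> the squared norm is at most 1 / R times the moment,
      which this choice makes less than e / 2; on the bounded remainder dominated convergence
      applies.\<close>
    define R where "R = 2 * (D * (4 * B)) / e + 1"
    have R: "0 < R" using D(1) B0 e by (simp add: R_def add_nonneg_pos)
    have "D * (4 * B) / R < e / 2"
    proof -
      have "2 * (D * (4 * B)) < e * R" using e by (simp add: R_def field_simps)
      then show ?thesis using R by (simp add: field_simps)
    qed
    have ind_int: "integrable K (\<lambda>x. 4 * (b R * B) * indicator {..R} x)"
    proof (rule integrable_mult_right)
      have "(\<lambda>x::real. indicator {..R} x :: real) \<in> borel_measurable K"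
        unfolding borel_measurable_K by (rule measurable_restrict_space1) simp
      then show "integrable K (indicator {..R} :: real \<Rightarrow> real)"
      proof (subst integrable_K_iff)
        show "integrable lborel (\<lambda>x. indicator I x *\<^sub>R (\<rho> x *\<^sub>R (indicator {..R} x :: real)))"
        proof (rule Bochner_Integration.integrable_bound)
          show "integrable lborel (\<lambda>x. (\<bar>C\<bar> * gauss a) * indicator {a..R} x)"
            by (intro integrable_mult_right integrable_real_indicator) (auto simp: emeasure_lborel_Icc_eq)
          show "AE x in lborel. norm (indicator I x *\<^sub>R (\<rho> x *\<^sub>R (indicator {..R} x :: real)))
              \<le> norm ((\<bar>C\<bar> * gauss a) * indicator {a..R} x :: real)"
          proof (rule AE_I2)
            fix x
            show "norm (indicator I x *\<^sub>R (\<rho> x *\<^sub>R (indicator {..R} x :: real)))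
              \<le> norm ((\<bar>C\<bar> * gauss a) * indicator {a..R} x :: real)"
            proof (cases "x \<in> I \<and> x \<le> R")
              case True
              then have x: "x \<in> I" "x \<in> {a..R}" using I_ge by auto
              have "\<rho> x \<le> C * gauss x" by (rule \<rho>_up[OF x(1)])
              also have "\<dots> \<le> \<bar>C\<bar> * gauss a"
                using gauss_antimono[OF a0, of x] x gauss_pos[of x] by (intro mult_mono) auto
              finally show ?thesis using x \<rho>_pos[OF x(1)] gauss_pos[of a] by simp
            qed auto
          qed
        qed simp
      qed
    qed
    have loc: "(\<lambda>n. \<integral>x. indicator {..R} x * (cmod (u n x))\<^sup>2 \<partial>K) \<longlonglongrightarrow> (\<integral>x. 0 \<partial>K)"
    proof (rule integral_dominated_convergence[OF _ _ ind_int])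
      have im: "(\<lambda>x::real. indicator {..R} x :: real) \<in> borel_measurable K"
        unfolding borel_measurable_K by (rule measurable_restrict_space1) simp
      show "(\<lambda>x. indicator {..R} x * (cmod (u n x))\<^sup>2) \<in> borel_measurable K" for n
        using im um by measurable
      show "AE x in K. (\<lambda>n. indicator {..R} x * (cmod (u n x))\<^sup>2) \<longlonglongrightarrow> 0"
      proof (rule AE_I2)
        fix x assume "x \<in> space K"
        then have "(\<lambda>n. indicator {..R} x * (cmod (u n x))\<^sup>2) \<longlonglongrightarrow> indicator {..R} x * (cmod 0)\<^sup>2"
          using u0[of x] by (intro tendsto_intros) simp
        then show "(\<lambda>n. indicator {..R} x * (cmod (u n x))\<^sup>2) \<longlonglongrightarrow> 0" by simp
      qed
      show "AE x in K. norm (indicator {..R} x * (cmod (u n x))\<^sup>2) \<le> 4 * (b R * B) * indicator {..R} x" for n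
        by (rule AE_I2) (use ub[of _ R n] in \<open>auto split: split_indicator\<close>)
    qed simp
    then obtain n0 where n0: "\<And>n. n \<ge> n0 \<Longrightarrow> \<bar>\<integral>x. indicator {..R} x * (cmod (u n x))\<^sup>2 \<partial>K\<bar> < e / 2"
      using LIMSEQ_D[OF loc, of "e / 2"] e by auto
    have "norm (L2.nsq K (u n) - 0) < e" if n: "n \<ge> n0" for n
    proof -
      have i1: "integrable K (\<lambda>x. (cmod (u n x))\<^sup>2)" using uL by (simp add: L2_set_def)
      have im: "(\<lambda>x::real. indicator {..R} x :: real) \<in> borel_measurable K"
        unfolding borel_measurable_K by (rule measurable_restrict_space1) simp
      have i2: "integrable K (\<lambda>x. indicator {..R} x * (cmod (u n x))\<^sup>2)"
        using im by (intro Bochner_Integration.integrable_bound[OF i1]) (auto split: split_indicator)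
      have "(\<integral>x. (cmod (u n x))\<^sup>2 \<partial>K) \<le> (\<integral>x. indicator {..R} x * (cmod (u n x))\<^sup>2 + (1 / R) * (x * (cmod (u n x))\<^sup>2) \<partial>K)"
      proof (rule integral_mono[OF i1])
        show "integrable K (\<lambda>x. indicator {..R} x * (cmod (u n x))\<^sup>2 + (1 / R) * (x * (cmod (u n x))\<^sup>2))"
          by (intro Bochner_Integration.integrable_add integrable_mult_right i2 int_weight)
        fix x assume "x \<in> space K"
        then have x0: "0 \<le> x" using I_ge0 by simp
        show "(cmod (u n x))\<^sup>2 \<le> indicator {..R} x * (cmod (u n x))\<^sup>2 + (1 / R) * (x * (cmod (u n x))\<^sup>2)"
        proof (cases "x \<le> R")
          case True
          then show ?thesis using x0 R by simp
        next
          case False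
          then have "R * (cmod (u n x))\<^sup>2 \<le> x * (cmod (u n x))\<^sup>2" by (intro mult_right_mono) auto
          then show ?thesis using False R by (simp add: field_simps)
        qed
      qed
      also have "\<dots> = (\<integral>x. indicator {..R} x * (cmod (u n x))\<^sup>2 \<partial>K) + (1 / R) * (\<integral>x. x * (cmod (u n x))\<^sup>2 \<partial>K)"
        by (subst Bochner_Integration.integral_add) (auto intro: i2 int_weight)
      also have "\<dots> < e / 2 + e / 2"
      proof (rule add_strict_mono)
        show "(\<integral>x. indicator {..R} x * (cmod (u n x))\<^sup>2 \<partial>K) < e / 2" using n0[OF n] by linarith
        have "(1 / R) * (\<integral>x. x * (cmod (u n x))\<^sup>2 \<partial>K) \<le> (1 / R) * (D * (4 * B))"
          using R int_weight(2)[of n] by (intro mult_left_mono) auto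
        then show "(1 / R) * (\<integral>x. x * (cmod (u n x))\<^sup>2 \<partial>K) < e / 2" using \<open>D * (4 * B) / R < e / 2\<close> by (simp only: times_divide_eq_left mult_1_left)
      qed
      finally show ?thesis using L2.B_nonneg[OF uL[of n]] by (simp add: L2_inner_self)
    qed
    then show "\<exists>n0. \<forall>n\<ge>n0. norm (L2.nsq K (u n) - 0) < e" by blast
  qed
  then show ?thesis using r gL g unfolding u_def by blast
qed

text \<open>Convergence at every point carries the increments of \<open>f n\<close> to those of
  \<open>g\<close>, while L2 convergence of the derivatives carries their integrals over bounded
  intervals. The relation between function and primitive therefore passes to the limit, and the
  limit \<open>w\<close> is a derivative of \<open>g\<close>.\<close>

lemma H1_closed:
  assumes f: "\<And>n::nat. f n \<in> H1 K" and g: "\<And>x. x \<in> I \<Longrightarrow> (\<lambda>n. f n x) \<longlonglongrightarrow> g x" and gL: "g \<in> L2_set K"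
    and Cauchy: "\<And>\<epsilon>. 0 < \<epsilon> \<Longrightarrow> \<exists>n0. \<forall>i\<ge>n0. \<forall>j\<ge>n0. L2.nsq K (weak_deriv K (\<lambda>x. f i x - f j x)) < \<epsilon>"
  shows "g \<in> H1 K" "(\<lambda>n. L2.nsq K (weak_deriv K (\<lambda>x. f n x - g x))) \<longlonglongrightarrow> 0"
proof -
  let ?w = "\<lambda>n. weak_deriv K (f n)"
  have wL: "?w n \<in> L2_set K" for n by (rule H1_D(2)[OF f])
  obtain w where w: "w \<in> L2_set K" "(\<lambda>n. L2.nsq K (\<lambda>x. ?w n x - w x)) \<longlonglongrightarrow> 0"
    by (rule L2_complete[of ?w K]) (use wL Cauchy in \<open>simp_all add: nsq_weak_deriv_diff[OF f f]\<close>)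
  have prim: "primitive I g w"
    unfolding primitive_def
  proof (intro ballI impI conjI L2_set_integrable w)
    fix x y assume xy: "x \<in> I" "y \<in> I" "x \<le> y"
    have "(\<lambda>n. LINT s:{x..y}|lborel. ?w n s - w s) \<longlonglongrightarrow> 0"
    proof (rule Lim_null_comparison)
      have "cmod (LINT s:{x..y}|lborel. ?w n s - w s) \<le> sqrt ((y - x) / gauss y * L2.nsq K (\<lambda>s. ?w n s - w s))" for n
        by (intro real_le_rsqrt set_integral_bound xy L2.diff wL w)
      then show "\<forall>\<^sub>F n in sequentially. norm (LINT s:{x..y}|lborel. ?w n s - w s)
          \<le> sqrt ((y - x) / gauss y * L2.nsq K (\<lambda>s. ?w n s - w s))" by simp
      show "(\<lambda>n. sqrt ((y - x) / gauss y * L2.nsq K (\<lambda>s. ?w n s - w s))) \<longlonglongrightarrow> 0"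
        using tendsto_real_sqrt[OF tendsto_mult_right_zero[OF w(2), of "(y - x) / gauss y"]] by simp
    qed
    moreover have "(LINT s:{x..y}|lborel. ?w n s - w s) = (f n y - f n x) - (LINT s:{x..y}|lborel. w s)" for n
    proof -
      have "f n y - f n x = (LINT s:{x..y}|lborel. ?w n s)" using H1_D(3)[OF f] xy unfolding primitive_def by blast
      then show ?thesis
        using set_integral_diff(2)[OF L2_set_integrable[OF wL xy(1,2)] L2_set_integrable[OF w(1) xy(1,2)]] by simp
    qed
    ultimately have "(\<lambda>n. (f n y - f n x) - (LINT s:{x..y}|lborel. w s)) \<longlonglongrightarrow> 0" by simp
    then have "(\<lambda>n. f n y - f n x) \<longlonglongrightarrow> (LINT s:{x..y}|lborel. w s)" by (simp add: LIM_zero_iff)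
    moreover have "(\<lambda>n. f n y - f n x) \<longlonglongrightarrow> g y - g x" using g xy by (intro tendsto_intros) auto
    ultimately show "g y - g x = (LINT s:{x..y}|lborel. w s)" by (rule LIMSEQ_unique[rotated])
  qed
  show gH: "g \<in> H1 K" by (rule H1_I(1)[OF gL w(1) prim])
  have "L2.nsq K (weak_deriv K (\<lambda>x. f n x - g x)) = L2.nsq K (\<lambda>x. ?w n x - w x)" for n
  proof (rule nsq_cong_AE)
    show "weak_deriv K (\<lambda>x. f n x - g x) \<in> L2_set K" by (intro H1_D H1_diff f gH)
    show "(\<lambda>x. ?w n x - w x) \<in> L2_set K" by (intro L2.diff wL w)
    show "AE x in K. weak_deriv K (\<lambda>x. f n x - g x) x = ?w n x - w x"
      using H1_diff(2)[OF f gH, of n] H1_I(2)[OF gL w(1) prim] by eventually_elim simp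
  qed
  then show "(\<lambda>n. L2.nsq K (weak_deriv K (\<lambda>x. f n x - g x))) \<longlonglongrightarrow> 0" using w(2) by simp
qed

end

section \<open>Forms on networks of weighted intervals\<close>

text \<open>Additivity over the pieces is available for nonnegative integrands; a complex one is
  reduced to the positive and negative parts of its real and imaginary parts, whose integrals are
  finite.\<close>

lemma integral_eq_sum_if_nn_integral_eq_sum:
  fixes f :: "'a \<Rightarrow> complex"
  assumes E: "finite E" and f: "f \<in> borel_measurable M"
    and nn: "\<And>u. u \<in> borel_measurable M \<Longrightarrow> (\<integral>\<^sup>+x. u x \<partial>M) = (\<Sum>c\<in>E. \<integral>\<^sup>+s. u (q c s) \<partial>W c)"
    and int: "\<And>c. c \<in> E \<Longrightarrow> integrable (W c) (\<lambda>s. f (q c s))"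
  shows "integrable M f" "integral\<^sup>L M f = (\<Sum>c\<in>E. integral\<^sup>L (W c) (\<lambda>s. f (q c s)))"
proof -
  have "(\<integral>\<^sup>+x. ennreal (norm (f x)) \<partial>M) = (\<Sum>c\<in>E. \<integral>\<^sup>+s. ennreal (norm (f (q c s))) \<partial>W c)"
    using f by (intro nn) measurable
  also have "\<dots> < \<infinity>"
    using E int by (auto simp: integrable_iff_bounded)
  finally show fint: "integrable M f" using f by (simp add: integrable_iff_bounded)
  have real: "integral\<^sup>L M g = (\<Sum>c\<in>E. integral\<^sup>L (W c) (\<lambda>s. g (q c s)))"
    if g: "integrable M g" and gc: "\<And>c. c \<in> E \<Longrightarrow> integrable (W c) (\<lambda>s. g (q c s))" for g :: "'a \<Rightarrow> real"
  proof -
    have fin: "(\<integral>\<^sup>+s. ennreal (g (q c s)) \<partial>W c) < \<infinity>" "(\<integral>\<^sup>+s. ennreal (- g (q c s)) \<partial>W c) < \<infinity>" if "c \<in> E" for c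
      using real_integrable_def[of "W c" "\<lambda>s. g (q c s)"] gc[OF that] by (auto simp: less_top)
    have [measurable]: "g \<in> borel_measurable M" using g by auto
    have e: "enn2real (\<Sum>c\<in>E. h c) = (\<Sum>c\<in>E. enn2real (h c))" if "\<And>c. c \<in> E \<Longrightarrow> h c < \<infinity>" for h
      using E that by (induction E rule: finite_induct) (auto simp: enn2real_plus)
    have "integral\<^sup>L M g = enn2real (\<integral>\<^sup>+x. ennreal (g x) \<partial>M) - enn2real (\<integral>\<^sup>+x. ennreal (- g x) \<partial>M)"
      by (rule real_lebesgue_integral_def[OF g])
    also have "(\<integral>\<^sup>+x. ennreal (g x) \<partial>M) = (\<Sum>c\<in>E. \<integral>\<^sup>+s. ennreal (g (q c s)) \<partial>W c)"
      by (rule nn) measurable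
    also have "(\<integral>\<^sup>+x. ennreal (- g x) \<partial>M) = (\<Sum>c\<in>E. \<integral>\<^sup>+s. ennreal (- g (q c s)) \<partial>W c)"
      by (rule nn) measurable
    also have "enn2real (\<Sum>c\<in>E. \<integral>\<^sup>+s. ennreal (g (q c s)) \<partial>W c) - enn2real (\<Sum>c\<in>E. \<integral>\<^sup>+s. ennreal (- g (q c s)) \<partial>W c)
        = (\<Sum>c\<in>E. enn2real (\<integral>\<^sup>+s. ennreal (g (q c s)) \<partial>W c) - enn2real (\<integral>\<^sup>+s. ennreal (- g (q c s)) \<partial>W c))"
      using fin by (simp add: e sum_subtractf)
    also have "\<dots> = (\<Sum>c\<in>E. integral\<^sup>L (W c) (\<lambda>s. g (q c s)))"
      using gc by (intro sum.cong refl real_lebesgue_integral_def[symmetric])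
    finally show ?thesis .
  qed
  show "integral\<^sup>L M f = (\<Sum>c\<in>E. integral\<^sup>L (W c) (\<lambda>s. f (q c s)))"
  proof (rule complex_eqI)
    have "Re (integral\<^sup>L M f) = (\<Sum>c\<in>E. integral\<^sup>L (W c) (\<lambda>s. Re (f (q c s))))"
      using fint int by (subst integral_Re[OF fint, symmetric]) (intro real integrable_Re)
    then show "Re (integral\<^sup>L M f) = Re (\<Sum>c\<in>E. integral\<^sup>L (W c) (\<lambda>s. f (q c s)))"
      using int by (simp add: integral_Re)
    have "Im (integral\<^sup>L M f) = (\<Sum>c\<in>E. integral\<^sup>L (W c) (\<lambda>s. Im (f (q c s))))"
      using fint int by (subst integral_Im[OF fint, symmetric]) (intro real integrable_Im)
    then show "Im (integral\<^sup>L M f) = Im (\<Sum>c\<in>E. integral\<^sup>L (W c) (\<lambda>s. f (q c s)))"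
      using int by (simp add: integral_Im)
  qed
qed

lemma L2_set_cong:
  assumes "\<And>x. x \<in> space M \<Longrightarrow> f x = g x"
  shows "f \<in> L2_set M \<longleftrightarrow> g \<in> L2_set M"
proof -
  have "f \<in> borel_measurable M \<longleftrightarrow> g \<in> borel_measurable M"
    by (rule measurable_cong) (rule assms)
  moreover have "integrable M (\<lambda>x. (cmod (f x))\<^sup>2) \<longleftrightarrow> integrable M (\<lambda>x. (cmod (g x))\<^sup>2)"
    by (rule Bochner_Integration.integrable_cong) (simp_all add: assms)
  ultimately show ?thesis by (simp add: L2_set_def)
qed

lemma L2_inner_cong: "(\<And>x. x \<in> space M \<Longrightarrow> f x = f' x) \<Longrightarrow> (\<And>x. x \<in> space M \<Longrightarrow> g x = g' x) \<Longrightarrow>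
  L2_inner M f g = L2_inner M f' g'"
  unfolding L2_inner_def by (simp cong: Bochner_Integration.integral_cong)

text \<open>\<open>q c\<close> maps the interval \<open>J c\<close> to the edge \<open>c\<close>; the functions in the form domain vanish on
  \<open>Z\<close>.  The tree is such a network, and so is a reduced operator, with a single edge.\<close>

locale network =
  fixes M :: "'x measure" and D :: "('x \<Rightarrow> complex) set" and a :: "('x \<Rightarrow> complex) \<Rightarrow> ('x \<Rightarrow> complex) \<Rightarrow> complex"
    and E :: "'c set" and J :: "'c \<Rightarrow> real set" and l :: "'c \<Rightarrow> real" and \<rho> :: "'c \<Rightarrow> real \<Rightarrow> real" and C :: real
    and q :: "'c \<Rightarrow> real \<Rightarrow> 'x" and Z :: "'x set"
  assumes E: "finite E"
    and J: "\<And>c. c \<in> E \<Longrightarrow> weighted_interval (J c) (l c) (\<rho> c) C"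
    and meas_iff: "\<And>f :: 'x \<Rightarrow> complex. f \<in> borel_measurable M \<longleftrightarrow>
      (\<forall>c\<in>E. (\<lambda>s. f (q c s)) \<in> borel_measurable (weighted (J c) (\<rho> c)))"
    and nn_sum: "\<And>u. u \<in> borel_measurable M \<Longrightarrow>
      (\<integral>\<^sup>+x. u x \<partial>M) = (\<Sum>c\<in>E. \<integral>\<^sup>+s. u (q c s) \<partial>weighted (J c) (\<rho> c))"
    and Z: "\<And>z. z \<in> Z \<Longrightarrow> \<exists>c\<in>E. \<exists>s\<in>J c. z = q c s"
    and D: "D = {f. (\<forall>c\<in>E. (\<lambda>s. f (q c s)) \<in> H1 (weighted (J c) (\<rho> c))) \<and> (\<forall>z\<in>Z. f z = 0)}"
    and a: "\<And>f h. f \<in> D \<Longrightarrow> h \<in> D \<Longrightarrow> a f h = 1 / 2 * (\<Sum>c\<in>E. L2_inner (weighted (J c) (\<rho> c))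
      (weak_deriv (weighted (J c) (\<rho> c)) (\<lambda>s. f (q c s))) (weak_deriv (weighted (J c) (\<rho> c)) (\<lambda>s. h (q c s))))"
begin

abbreviation W where "W c \<equiv> weighted (J c) (\<rho> c)"

abbreviation (input) pull where "pull c f \<equiv> (\<lambda>s. f (q c s))"

abbreviation (input) dpull where "dpull c f \<equiv> weak_deriv (W c) (pull c f)"

lemma L2_set_iff: "f \<in> L2_set M \<longleftrightarrow> (\<forall>c\<in>E. pull c f \<in> L2_set (W c))"
proof -
  have nn: "(\<integral>\<^sup>+x. ennreal ((cmod (f x))\<^sup>2) \<partial>M) = (\<Sum>c\<in>E. \<integral>\<^sup>+s. ennreal ((cmod (f (q c s)))\<^sup>2) \<partial>W c)"
    if "f \<in> borel_measurable M"
    using that by (intro nn_sum) measurable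
  show ?thesis
  proof (cases "f \<in> borel_measurable M")
    case True
    then have m: "pull c f \<in> borel_measurable (W c)" if "c \<in> E" for c using that meas_iff by blast
    have "f \<in> L2_set M \<longleftrightarrow> (\<integral>\<^sup>+x. ennreal ((cmod (f x))\<^sup>2) \<partial>M) < \<infinity>"
      using True by (auto simp: L2_set_def integrable_iff_bounded)
    also have "\<dots> \<longleftrightarrow> (\<forall>c\<in>E. (\<integral>\<^sup>+s. ennreal ((cmod (f (q c s)))\<^sup>2) \<partial>W c) < \<infinity>)"
      using E by (simp add: nn[OF True])
    also have "\<dots> \<longleftrightarrow> (\<forall>c\<in>E. pull c f \<in> L2_set (W c))"
      using m by (auto simp: L2_set_def integrable_iff_bounded)
    finally show ?thesis .
  next
    case False
    then show ?thesis using meas_iff by (auto simp: L2_set_def)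
  qed
qed

lemma L2_inner_sum:
  assumes "f \<in> L2_set M" "h \<in> L2_set M"
  shows "L2_inner M f h = (\<Sum>c\<in>E. L2_inner (W c) (pull c f) (pull c h))"
  unfolding L2_inner_def
proof (rule integral_eq_sum_if_nn_integral_eq_sum(2)[OF E])
  show "(\<lambda>x. f x * cnj (h x)) \<in> borel_measurable M"
    by (intro borel_measurable_integrable L2_mult_integrable assms)
  show "integrable (W c) (\<lambda>s. f (q c s) * cnj (h (q c s)))" if "c \<in> E" for c
    using assms that L2_set_iff by (intro L2_mult_integrable) auto
qed (rule nn_sum)

lemma nsq_sum: "f \<in> L2_set M \<Longrightarrow> L2.nsq M f = (\<Sum>c\<in>E. L2.nsq (W c) (pull c f))"
  by (simp add: L2_inner_sum)

lemma D_D: "f \<in> D \<Longrightarrow> c \<in> E \<Longrightarrow> pull c f \<in> H1 (W c)"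
  by (auto simp: D)

lemma dpull_L2: "f \<in> D \<Longrightarrow> c \<in> E \<Longrightarrow> dpull c f \<in> L2_set (W c)"
  using weighted_interval.H1_D(2)[OF J D_D] by blast

lemma D_subset: "D \<subseteq> L2_set M"
  using weighted_interval.H1_D(1)[OF J D_D] by (auto simp: L2_set_iff)

lemma nsq_a: "f \<in> D \<Longrightarrow> Re (a f f) = 1 / 2 * (\<Sum>c\<in>E. L2.nsq (W c) (dpull c f))"
  by (simp add: a)

lemma space_W: "c \<in> E \<Longrightarrow> space (W c) = J c"
  using weighted_interval.space_K[OF J] .

lemma D_add: "f \<in> D \<Longrightarrow> g \<in> D \<Longrightarrow> (\<lambda>x. f x + g x) \<in> D"
  using weighted_interval.H1_add(1)[OF J] by (auto simp: D)

lemma D_scale: "f \<in> D \<Longrightarrow> (\<lambda>x. c * f x) \<in> D"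
  using weighted_interval.H1_scale(1)[OF J] by (auto simp: D)

lemma D_zero: "(\<lambda>x. 0) \<in> D"
  using weighted_interval.H1_zero[OF J] by (auto simp: D)

lemma semi_inner_a: "semi_inner D a"
proof
  show "(\<lambda>x. 0) \<in> D" by (rule D_zero)
  fix f g h k
  assume f: "f \<in> D"
  show "(\<lambda>x. k * f x) \<in> D" using f by (rule D_scale)
  show "0 \<le> Re (a f f)"
    using f dpull_L2 by (auto simp: nsq_a intro!: sum_nonneg L2.B_nonneg)
  assume g: "g \<in> D"
  show "(\<lambda>x. f x + g x) \<in> D" using f g by (rule D_add)
  have "L2_inner (W c) (dpull c g) (dpull c f) = cnj (L2_inner (W c) (dpull c f) (dpull c g))" if "c \<in> E" for c
    using f g that by (intro L2.B_sym dpull_L2)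
  then show "a g f = cnj (a f g)" using f g by (simp add: a)
  have "L2_inner (W c) (dpull c (\<lambda>x. k * f x)) (dpull c g) = k * L2_inner (W c) (dpull c f) (dpull c g)"
    if c: "c \<in> E" for c
  proof -
    have "L2_inner (W c) (dpull c (\<lambda>x. k * f x)) (dpull c g) = L2_inner (W c) (\<lambda>s. k * dpull c f s) (dpull c g)"
      using f g c weighted_interval.H1_scale(2)[OF J[OF c] D_D[OF f c], of k]
      by (intro L2_inner_cong_AE dpull_L2 L2.scale D_scale)
    then show ?thesis using f g c by (simp add: L2.B_scale dpull_L2)
  qed
  then show "a (\<lambda>x. k * f x) g = k * a f g"
    using f g by (simp add: a D_scale sum_distrib_left)
  assume h: "h \<in> D"
  have "L2_inner (W c) (dpull c (\<lambda>x. f x + g x)) (dpull c h)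
      = L2_inner (W c) (dpull c f) (dpull c h) + L2_inner (W c) (dpull c g) (dpull c h)" if c: "c \<in> E" for c
  proof -
    have "L2_inner (W c) (dpull c (\<lambda>x. f x + g x)) (dpull c h) = L2_inner (W c) (\<lambda>s. dpull c f s + dpull c g s) (dpull c h)"
      using f g h c weighted_interval.H1_add(2)[OF J[OF c] D_D[OF f c] D_D[OF g c]]
      by (intro L2_inner_cong_AE dpull_L2 L2.add D_add)
    then show ?thesis using f g h c by (simp add: L2.B_add dpull_L2)
  qed
  then show "a (\<lambda>x. f x + g x) h = a f h + a g h"
    using f g h by (simp add: a D_add sum.distrib distrib_left)
qed

lemma nsq_pull_le: "f \<in> L2_set M \<Longrightarrow> c \<in> E \<Longrightarrow> L2.nsq (W c) (pull c f) \<le> L2.nsq M f"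
  unfolding nsq_sum using E L2_set_iff by (intro member_le_sum) (auto intro: L2.B_nonneg)

lemma nsq_dpull_le: "f \<in> D \<Longrightarrow> c \<in> E \<Longrightarrow> L2.nsq (W c) (dpull c f) \<le> 2 * Re (a f f)"
  unfolding nsq_a using E dpull_L2 by simp (intro member_le_sum, auto intro: L2.B_nonneg)

lemma subsequence:
  assumes f: "\<And>n::nat. f n \<in> D" and B: "\<And>n. Re (a (f n) (f n)) \<le> B" "\<And>n. L2.nsq M (f n) \<le> B"
  shows "\<exists>r G. strict_mono (r :: nat \<Rightarrow> nat) \<and> G \<in> L2_set M \<and>
    (\<forall>c\<in>E. \<forall>s\<in>J c. (\<lambda>n. f (r n) (q c s)) \<longlonglongrightarrow> G (q c s)) \<and>
    (\<lambda>n. L2.nsq M (\<lambda>x. f (r n) x - G x)) \<longlonglongrightarrow> 0"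
proof -
  have fL: "f n \<in> L2_set M" for n using f D_subset by auto
  have B0: "0 \<le> B" using L2.B_nonneg[OF fL[of 0]] B(2)[of 0] by linarith
  \<comment> \<open>The factor 2 offsets the 1 / 2 in the form; one constant is used for functions
    and derivatives alike.\<close>
  have bound: "L2.nsq (W c) (pull c (f n)) \<le> 2 * B" "L2.nsq (W c) (dpull c (f n)) \<le> 2 * B" if "c \<in> E" for c n
    using nsq_pull_le[OF fL that, of n] nsq_dpull_le[OF f that, of n] B(1)[of n] B(2)[of n] B0 by linarith+
  have "\<exists>r. strict_mono (r :: nat \<Rightarrow> nat) \<and> (\<forall>c\<in>F. \<exists>g\<in>L2_set (W c). (\<forall>s\<in>J c. (\<lambda>n. f (r n) (q c s)) \<longlonglongrightarrow> g s) \<and>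
    (\<lambda>n. L2.nsq (W c) (\<lambda>s. f (r n) (q c s) - g s)) \<longlonglongrightarrow> 0)" if "finite F" "F \<subseteq> E" for F
    using that
  proof (induction F rule: finite_induct)
    case empty
    show ?case by (intro exI[of _ "\<lambda>n. n"]) (simp add: strict_mono_def)
  next
    case (insert c F)
    then obtain r where r: "strict_mono (r :: nat \<Rightarrow> nat)" and
      conv: "\<And>c. c \<in> F \<Longrightarrow> \<exists>g\<in>L2_set (W c). (\<forall>s\<in>J c. (\<lambda>n. f (r n) (q c s)) \<longlonglongrightarrow> g s) \<and>
        (\<lambda>n. L2.nsq (W c) (\<lambda>s. f (r n) (q c s) - g s)) \<longlonglongrightarrow> 0" by auto
    have c: "c \<in> E" using insert by auto
    obtain r' g where r': "strict_mono (r' :: nat \<Rightarrow> nat)" and g: "g \<in> L2_set (W c)"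
      "\<forall>s\<in>J c. (\<lambda>n. pull c (f (r (r' n))) s) \<longlonglongrightarrow> g s"
      "(\<lambda>n. L2.nsq (W c) (\<lambda>s. pull c (f (r (r' n))) s - g s)) \<longlonglongrightarrow> 0"
      using weighted_interval.H1_compact[OF J[OF c], of "\<lambda>n. pull c (f (r n))" "2 * B"] D_D[OF f c] bound[OF c] by blast
    show ?case
    proof (intro exI[of _ "\<lambda>n. r (r' n)"] conjI ballI)
      show "strict_mono (\<lambda>n. r (r' n))" using strict_mono_o[OF r r'] by (simp add: comp_def)
      fix d assume "d \<in> insert c F"
      then consider "d = c" | "d \<in> F" by auto
      then show "\<exists>g\<in>L2_set (W d). (\<forall>s\<in>J d. (\<lambda>n. f (r (r' n)) (q d s)) \<longlonglongrightarrow> g s) \<and>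
        (\<lambda>n. L2.nsq (W d) (\<lambda>s. f (r (r' n)) (q d s) - g s)) \<longlonglongrightarrow> 0"
      proof cases
        case 1
        then show ?thesis using g by blast
      next
        case 2
        obtain k where k: "k \<in> L2_set (W d)" "\<And>s. s \<in> J d \<Longrightarrow> (\<lambda>n. f (r n) (q d s)) \<longlonglongrightarrow> k s"
          "(\<lambda>n. L2.nsq (W d) (\<lambda>s. f (r n) (q d s) - k s)) \<longlonglongrightarrow> 0" using conv[OF 2] by blast
        show ?thesis
          using k(1) LIMSEQ_subseq_LIMSEQ[OF k(2) r'] LIMSEQ_subseq_LIMSEQ[OF k(3) r']
          by (auto simp: comp_def intro!: bexI[of _ k])
      qed
    qed
  qed
  from this[OF E order_refl] obtain r where r: "strict_mono (r :: nat \<Rightarrow> nat)" and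
    conv: "\<And>c. c \<in> E \<Longrightarrow> \<exists>g\<in>L2_set (W c). (\<forall>s\<in>J c. (\<lambda>n. f (r n) (q c s)) \<longlonglongrightarrow> g s) \<and>
      (\<lambda>n. L2.nsq (W c) (\<lambda>s. f (r n) (q c s) - g s)) \<longlonglongrightarrow> 0" by auto
  \<comment> \<open>The limit is taken on the network itself and not assembled from the edgewise
    limits, so it automatically has a single value at a vertex shared by several edges.\<close>
  define G where "G x = lim (\<lambda>n. f (r n) x)" for x
  have G: "pull c G \<in> L2_set (W c) \<and> (\<forall>s\<in>J c. (\<lambda>n. f (r n) (q c s)) \<longlonglongrightarrow> G (q c s)) \<and>
      (\<lambda>n. L2.nsq (W c) (\<lambda>s. f (r n) (q c s) - G (q c s))) \<longlonglongrightarrow> 0" if c: "c \<in> E" for c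
  proof -
    obtain g where g: "g \<in> L2_set (W c)" "\<And>s. s \<in> J c \<Longrightarrow> (\<lambda>n. f (r n) (q c s)) \<longlonglongrightarrow> g s"
      "(\<lambda>n. L2.nsq (W c) (\<lambda>s. f (r n) (q c s) - g s)) \<longlonglongrightarrow> 0" using conv[OF c] by blast
    have eq: "G (q c s) = g s" if "s \<in> space (W c)" for s
      using limI[OF g(2)[of s]] that by (simp add: G_def space_W[OF c])
    have "pull c G \<in> L2_set (W c)" using L2_set_cong[of "W c" "pull c G" g] eq g(1) by simp
    moreover have "(\<lambda>n. f (r n) (q c s)) \<longlonglongrightarrow> G (q c s)" if "s \<in> J c" for s
      using g(2)[OF that] eq[of s] that by (simp add: space_W[OF c])
    moreover have "L2.nsq (W c) (\<lambda>s. f (r n) (q c s) - G (q c s)) = L2.nsq (W c) (\<lambda>s. f (r n) (q c s) - g s)" for n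
      by (intro arg_cong[where f = Re] L2_inner_cong) (simp_all add: eq)
    ultimately show ?thesis using g(3) by simp
  qed
  have GL: "G \<in> L2_set M" using G L2_set_iff by auto
  have "(\<lambda>n. \<Sum>c\<in>E. L2.nsq (W c) (\<lambda>s. f (r n) (q c s) - G (q c s))) \<longlonglongrightarrow> (\<Sum>c\<in>E. 0)"
    using G by (intro tendsto_sum) auto
  then have "(\<lambda>n. L2.nsq M (\<lambda>x. f (r n) x - G x)) \<longlonglongrightarrow> 0"
    using nsq_sum[OF L2.diff[OF fL GL]] by simp
  then show ?thesis using r GL G by blast
qed

lemma compact_form: "compact_form M D a"
proof -
  interpret a: semi_inner D a by (rule semi_inner_a)
  show ?thesis
  proof
    show "D \<subseteq> L2_set M" by (rule D_subset)
  next
    fix f :: "nat \<Rightarrow> 'x \<Rightarrow> complex" and B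
    assume f: "\<And>n. f n \<in> D" "\<And>n. Re (a (f n) (f n)) \<le> B" "\<And>n. L2.nsq M (f n) \<le> B"
    have fL: "f n \<in> L2_set M" for n using f D_subset by auto
    obtain r G where r: "strict_mono (r :: nat \<Rightarrow> nat)" and G: "G \<in> L2_set M"
      "(\<lambda>n. L2.nsq M (\<lambda>x. f (r n) x - G x)) \<longlonglongrightarrow> 0"
      using subsequence[of f B, OF f] by blast
    have "\<exists>n0. \<forall>i\<ge>n0. \<forall>j\<ge>n0. L2.nsq M (\<lambda>x. f (r i) x - f (r j) x) < \<epsilon>" if \<epsilon>: "0 < \<epsilon>" for \<epsilon>
    proof -
      obtain n0 where n0: "\<And>n. n \<ge> n0 \<Longrightarrow> \<bar>L2.nsq M (\<lambda>x. f (r n) x - G x)\<bar> < \<epsilon> / 4"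
        using LIMSEQ_D[OF G(2), of "\<epsilon> / 4"] \<epsilon> by auto
      have "L2.nsq M (\<lambda>x. f (r i) x - f (r j) x) < \<epsilon>" if ij: "i \<ge> n0" "j \<ge> n0" for i j
        using L2.nsq_diff_le[OF L2.diff[OF fL G(1)] L2.diff[OF fL G(1)], of "r i" "r j"] n0[OF ij(1)] n0[OF ij(2)]
        by simp
      then show ?thesis by blast
    qed
    then show "\<exists>r. strict_mono (r :: nat \<Rightarrow> nat) \<and> (\<forall>\<epsilon>>0. \<exists>n0. \<forall>i\<ge>n0. \<forall>j\<ge>n0. L2.nsq M (\<lambda>x. f (r i) x - f (r j) x) < \<epsilon>)"
      using r by blast
  next
    fix f :: "nat \<Rightarrow> 'x \<Rightarrow> complex" and B
    assume f: "\<And>n. f n \<in> D" "\<And>n. Re (a (f n) (f n)) \<le> B" "\<And>n. L2.nsq M (f n) \<le> B"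
      and Cauchy: "\<forall>\<epsilon>>0. \<exists>n0. \<forall>i\<ge>n0. \<forall>j\<ge>n0. Re (a (\<lambda>x. f i x - f j x) (\<lambda>x. f i x - f j x)) < \<epsilon>"
    obtain r G where r: "strict_mono (r :: nat \<Rightarrow> nat)" and G: "G \<in> L2_set M"
      "\<And>c s. c \<in> E \<Longrightarrow> s \<in> J c \<Longrightarrow> (\<lambda>n. f (r n) (q c s)) \<longlonglongrightarrow> G (q c s)"
      "(\<lambda>n. L2.nsq M (\<lambda>x. f (r n) x - G x)) \<longlonglongrightarrow> 0"
      using subsequence[of f B, OF f] by blast
    have cl: "pull c G \<in> H1 (W c)" "(\<lambda>n. L2.nsq (W c) (weak_deriv (W c) (\<lambda>s. f (r n) (q c s) - G (q c s)))) \<longlonglongrightarrow> 0"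
      if c: "c \<in> E" for c
    proof -
      have Cc: "\<exists>n0. \<forall>i\<ge>n0. \<forall>j\<ge>n0. L2.nsq (W c) (weak_deriv (W c) (\<lambda>s. f (r i) (q c s) - f (r j) (q c s))) < \<epsilon>"
        if \<epsilon>: "0 < \<epsilon>" for \<epsilon>
      proof -
        obtain n0 where n0: "\<And>i j. i \<ge> n0 \<Longrightarrow> j \<ge> n0 \<Longrightarrow> Re (a (\<lambda>x. f i x - f j x) (\<lambda>x. f i x - f j x)) < \<epsilon> / 2"
          using Cauchy \<epsilon> by (meson half_gt_zero)
        have "L2.nsq (W c) (weak_deriv (W c) (\<lambda>s. f (r i) (q c s) - f (r j) (q c s))) < \<epsilon>" if "i \<ge> n0" "j \<ge> n0" for i j
          using nsq_dpull_le[OF a.diff[OF f(1) f(1)] c, of "r i" "r j"] n0[of "r i" "r j"]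
            seq_suble[OF r, of i] seq_suble[OF r, of j] that by simp
        then show ?thesis by blast
      qed
      have GL: "pull c G \<in> L2_set (W c)" using G(1) c L2_set_iff by blast
      show "pull c G \<in> H1 (W c)" "(\<lambda>n. L2.nsq (W c) (weak_deriv (W c) (\<lambda>s. f (r n) (q c s) - G (q c s)))) \<longlonglongrightarrow> 0"
        using weighted_interval.H1_closed[OF J[OF c], of "\<lambda>n. pull c (f (r n))" "pull c G"] D_D[OF f(1) c] G(2)[OF c] GL Cc
        by blast+
    qed
    \<comment> \<open>Boundary conditions survive because convergence is pointwise and every point
      of \<open>Z\<close> lies on some closed edge.\<close>
    have "G z = 0" if "z \<in> Z" for z
    proof -
      from Z[OF that] obtain c s where "c \<in> E" "s \<in> J c" "z = q c s" by blast
      then have "(\<lambda>n. f (r n) z) \<longlonglongrightarrow> G z" using G(2) by blast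
      moreover have "f (r n) z = 0" for n using f(1) that by (simp add: D)
      ultimately show ?thesis by (simp add: LIMSEQ_const_iff)
    qed
    then have GD: "G \<in> D" using cl(1) by (simp add: D)
    have "(\<lambda>n. 1 / 2 * (\<Sum>c\<in>E. L2.nsq (W c) (weak_deriv (W c) (\<lambda>s. f (r n) (q c s) - G (q c s))))) \<longlonglongrightarrow> 1 / 2 * (\<Sum>c\<in>E. 0)"
      using cl(2) by (intro tendsto_intros)
    then have "(\<lambda>n. Re (a (\<lambda>x. f (r n) x - G x) (\<lambda>x. f (r n) x - G x))) \<longlonglongrightarrow> 0"
      by (simp only: nsq_a[OF a.diff[OF f(1) GD]] sum.neutral_const mult_zero_right)
    then show "\<exists>r g. strict_mono (r :: nat \<Rightarrow> nat) \<and> g \<in> D \<and> (\<lambda>n. L2.nsq M (\<lambda>x. f (r n) x - g x)) \<longlonglongrightarrow> 0 \<and>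
      (\<lambda>n. Re (a (\<lambda>x. f (r n) x - g x) (\<lambda>x. f (r n) x - g x))) \<longlonglongrightarrow> 0"
      using r GD G(3) by blast
  qed
qed

end

section \<open>Regular trees\<close>

locale reg_tree =
  fixes T :: "('v, 'e, 'h) tree_data" and N :: nat and t :: "nat \<Rightarrow> real" and b :: "nat \<Rightarrow> nat" and m :: nat
  assumes regular: "regular_tree T N t b"
    and m_card: "m = card (rays T)" and m_prod: "m = (\<Prod>k\<le>N. b k)"
begin

definition path :: "'v \<Rightarrow> 'e list" where
  "path v = (THE p. pre_digraph.awalk (graph T) (root T) p v)"

text \<open>The half-open edges along a path are disjoint; they differ from the edges by null sets.\<close>

fun hdom :: "'e + 'h \<Rightarrow> real set" where
  "hdom (Inl e) = {depth T (tail (graph T) e)..<depth T (tail (graph T) e) + len T e}"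
| "hdom (Inr h) = {depth T (foot T h)..}"

definition way :: "'v \<Rightarrow> ('e + 'h) set" where
  "way v = Inl ` set (path v)"

definition ray_way :: "'h \<Rightarrow> ('e + 'h) set" where
  "ray_way h = insert (Inr h) (way (foot T h))"

definition below :: "'e + 'h \<Rightarrow> 'h set" where
  "below c = {h \<in> rays T. c \<in> ray_way h}"

definition below_vertex :: "'v \<Rightarrow> 'h set" where
  "below_vertex v = {h \<in> rays T. \<exists>p. path (foot T h) = path v @ p}"

section \<open>Paths, depths and levels\<close>

lemma rooted: "rooted_metric_tree T"
  using regular by (simp add: regular_tree_def)

sublocale G: fin_digraph "graph T"
  using rooted by (simp add: rooted_metric_tree_def)

lemma root_in: "root T \<in> verts (graph T)"
  using rooted unfolding rooted_metric_tree_def by (elim conjE)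

lemma len_pos: "e \<in> arcs (graph T) \<Longrightarrow> 0 < len T e"
proof -
  have "\<forall>e\<in>arcs (graph T). 0 < len T e"
    using rooted unfolding rooted_metric_tree_def by (elim conjE)
  then show "e \<in> arcs (graph T) \<Longrightarrow> 0 < len T e" by simp
qed

lemma finite_rays: "finite (rays T)"
  using rooted unfolding rooted_metric_tree_def by (elim conjE)

lemma foot_leaves: "foot T ` rays T = leaves T"
  using rooted unfolding rooted_metric_tree_def by (elim conjE)

lemma leaves_ne: "leaves T \<noteq> {}"
  using rooted unfolding rooted_metric_tree_def by (elim conjE)

lemma awalk_path: "v \<in> verts (graph T) \<Longrightarrow> G.awalk (root T) (path v) v"
  unfolding path_def by (rule theI') (use rooted in \<open>simp add: rooted_metric_tree_def\<close>)

lemma path_eq: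
  assumes "G.awalk (root T) p v"
  shows "path v = p"
proof -
  have "v \<in> verts (graph T)" using assms by (rule G.awalk_last_in_verts)
  then have "\<exists>!p. G.awalk (root T) p v" using rooted by (simp add: rooted_metric_tree_def)
  then show ?thesis unfolding path_def using assms by (rule the1_equality)
qed

lemma depth_path: "depth T v = sum_list (map (len T) (path v))"
  by (simp add: depth_def path_def G.awalk_cost_def)

lemma path_root: "path (root T) = []"
  by (rule path_eq) (simp add: G.awalk_Nil_iff root_in)

lemma path_head: "e \<in> arcs (graph T) \<Longrightarrow> path (head (graph T) e) = path (tail (graph T) e) @ [e]"
  by (rule path_eq, rule G.awalk_appendI[OF awalk_path]) (auto simp: G.awalk_simps)

lemma depth_root: "depth T (root T) = 0"
  by (simp add: depth_path path_root)

lemma depth_head: "e \<in> arcs (graph T) \<Longrightarrow> depth T (head (graph T) e) = depth T (tail (graph T) e) + len T e"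
  by (simp add: depth_path path_head)

lemma path_snoc:
  assumes v: "v \<in> verts (graph T)" and p: "path v = p @ e # r"
  shows "e \<in> arcs (graph T)" "p = path (tail (graph T) e)" "path v = path (head (graph T) e) @ r"
proof -
  have w: "G.awalk (root T) (p @ e # r) v" using awalk_path[OF v] p by simp
  then have e: "G.awalk (root T) p (tail (graph T) e)" "e \<in> arcs (graph T)"
    by (auto simp: G.awalk_simps)
  then show "e \<in> arcs (graph T)" "p = path (tail (graph T) e)" using path_eq by auto
  then show "path v = path (head (graph T) e) @ r" using p by (simp add: path_head)
qed

lemma vertex_induct [consumes 1, case_names root arc]:
  assumes "v \<in> verts (graph T)" "P (root T)"
    and arc: "\<And>e. e \<in> arcs (graph T) \<Longrightarrow> P (tail (graph T) e) \<Longrightarrow> P (head (graph T) e)"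
  shows "P v"
  using assms(1)
proof (induction "length (path v)" arbitrary: v rule: less_induct)
  case less
  show ?case
  proof (cases "path v" rule: rev_cases)
    case Nil
    then have "v = root T" using awalk_path[OF less.prems] by (simp add: G.awalk_Nil_iff)
    then show ?thesis using assms(2) by simp
  next
    case (snoc p e)
    have e: "e \<in> arcs (graph T)" "p = path (tail (graph T) e)" using path_snoc[OF less.prems, of p e "[]"] snoc by auto
    have "G.awalk (root T) (path v) (head (graph T) e)"
      using awalk_path[of "head (graph T) e"] e snoc by (simp add: path_head)
    then have v: "v = head (graph T) e"
      using G.awalk_ends_eqD awalk_path[OF less.prems] snoc G.awalk_ends by blast
    have "P (tail (graph T) e)" using e snoc by (intro less.hyps) auto
    then show ?thesis using arc[OF e(1)] v by simp
  qed
qed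

lemma path_inj:
  assumes "u \<in> verts (graph T)" "v \<in> verts (graph T)" "path u = path v"
  shows "u = v"
  using awalk_path[OF assms(1)] awalk_path[OF assms(2)] assms(3) G.awalk_ends by metis

lemma depth_nonneg: "v \<in> verts (graph T) \<Longrightarrow> 0 \<le> depth T v"
  by (induction rule: vertex_induct) (auto simp: depth_root depth_head less_imp_le[OF len_pos])

lemma finite_edges: "finite (edges T)"
  by (simp add: edges_def finite_rays)

lemma rays_ne: "rays T \<noteq> {}" using foot_leaves leaves_ne by auto

lemma m_pos: "0 < m" using m_card finite_rays rays_ne by (simp add: card_gt_0_iff)

lemma foot_in: "h \<in> rays T \<Longrightarrow> foot T h \<in> verts (graph T)"
  using foot_leaves by (auto simp: leaves_def)

lemma start_in: "c \<in> edges T \<Longrightarrow> start T c \<in> verts (graph T)"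
  by (auto simp: edges_def foot_in)

lemma level: "v \<in> verts (graph T) \<Longrightarrow> \<exists>k\<le>N. depth T v = t k"
proof -
  have "verts (graph T) = (\<Union>k\<le>N. {v \<in> verts (graph T). depth T v = t k})"
    using regular unfolding regular_tree_def by blast
  then show "v \<in> verts (graph T) \<Longrightarrow> \<exists>k\<le>N. depth T v = t k" by blast
qed

lemma t_less: "i < j \<Longrightarrow> j \<le> N \<Longrightarrow> t i < t j"
proof (induction j)
  case (Suc j)
  then have "t j < t (Suc j)" using regular unfolding regular_tree_def by auto
  then show ?case using Suc by (cases "i = j") auto
qed simp

lemma t_eq_iff: "i \<le> N \<Longrightarrow> j \<le> N \<Longrightarrow> t i = t j \<longleftrightarrow> i = j"
  using t_less[of i j] t_less[of j i] by (cases i j rule: linorder_cases) auto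

lemma t_0: "t 0 = 0" using regular by (simp add: regular_tree_def)

lemma t_nonneg: "i \<le> N \<Longrightarrow> 0 \<le> t i"
  using t_less[of 0 i] t_0 by (cases "i = 0") auto

lemma t_le_N: "i \<le> N \<Longrightarrow> t i \<le> t N"
  using t_less[of i N] by (cases "i = N") auto

lemma b_pos: "k \<le> N \<Longrightarrow> 0 < b k"
  using regular by (simp add: regular_tree_def)

lemma card_out: "k \<le> N \<Longrightarrow> v \<in> verts (graph T) \<Longrightarrow> depth T v = t k \<Longrightarrow> card {c \<in> edges T. start T c = v} = b k"
  using regular by (simp add: regular_tree_def)

lemma depth_foot: "h \<in> rays T \<Longrightarrow> depth T (foot T h) = t N"
proof -
  assume "h \<in> rays T"
  moreover have "{v \<in> verts (graph T). depth T v = t N} = leaves T"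
    using regular by (simp add: regular_tree_def)
  ultimately show ?thesis using foot_leaves by blast
qed

subsection \<open>Edges along a path\<close>

lemma way_root: "way (root T) = {}" by (simp add: way_def path_root)

lemma way_head: "e \<in> arcs (graph T) \<Longrightarrow> way (head (graph T) e) = insert (Inl e) (way (tail (graph T) e))"
  by (auto simp: way_def path_head)

lemma way_arcs: "v \<in> verts (graph T) \<Longrightarrow> way v \<subseteq> Inl ` arcs (graph T)"
  by (induction rule: vertex_induct) (auto simp: way_root way_head)

lemma finite_way: "finite (way v)" by (simp add: way_def)

lemma ray_way_edges: "h \<in> rays T \<Longrightarrow> ray_way h \<subseteq> edges T"
  using way_arcs[OF foot_in] by (auto simp: ray_way_def edges_def)

lemma finite_ray_way: "finite (ray_way h)" by (simp add: ray_way_def finite_way)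

lemma way_hdom: "v \<in> verts (graph T) \<Longrightarrow> c \<in> way v \<Longrightarrow> hdom c \<noteq> {} \<and> hdom c \<subseteq> {0..<depth T v}"
proof (induction arbitrary: c rule: vertex_induct)
  case root
  then show ?case by (simp add: way_root)
next
  case (arc e)
  have e: "e \<in> arcs (graph T)" by (rule arc.hyps)
  have d: "depth T (tail (graph T) e) < depth T (head (graph T) e)" "0 \<le> depth T (tail (graph T) e)"
    using depth_head[OF e] len_pos[OF e] depth_nonneg e by auto
  consider "c = Inl e" | "c \<in> way (tail (graph T) e)" using arc.prems way_head[OF e] by auto
  then show ?case
  proof cases
    case 1
    then show ?thesis using d depth_head[OF e] len_pos[OF e] by auto
  next
    case 2
    then have "hdom c \<noteq> {} \<and> hdom c \<subseteq> {0..<depth T (tail (graph T) e)}" by (rule arc.IH)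
    then show ?thesis using d by force
  qed
qed

lemma arc_notin_way: "e \<in> arcs (graph T) \<Longrightarrow> Inl e \<notin> way (tail (graph T) e)"
  using way_hdom[of "tail (graph T) e" "Inl e"] len_pos[of e] by fastforce

lemma way_tiling:
  assumes "v \<in> verts (graph T)"
  shows "(\<Sum>c\<in>way v. indicator (hdom c) s) = (indicator {0..<depth T v} s :: 'r::semiring_1)"
  using assms
proof (induction rule: vertex_induct)
  case root
  then show ?case by (simp add: way_root depth_root)
next
  case (arc e)
  have "0 \<le> depth T (tail (graph T) e)" using depth_nonneg arc by simp
  then show ?case
    using arc len_pos[of e] by (auto simp: way_head finite_way arc_notin_way depth_head split: split_indicator)
qed

text \<open>A path meets every distance exactly once. This carries both the counting of half-lines
  and the definition of functions along a path by sums over its edges.\<close>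

lemma ray_tiling:
  assumes "h \<in> rays T"
  shows "(\<Sum>c\<in>ray_way h. indicator (hdom c) s) = (indicator {0..} s :: 'r::semiring_1)"
proof -
  have "Inr h \<notin> way (foot T h)" by (auto simp: way_def)
  then show ?thesis
    using way_tiling[OF foot_in[OF assms], of s] depth_nonneg[OF foot_in[OF assms]]
    by (auto simp: ray_way_def finite_way split: split_indicator)
qed

subsection \<open>Half-lines below an edge\<close>

lemma below_vertex_root: "below_vertex (root T) = rays T"
  by (simp add: below_vertex_def path_root)

lemma below_Inr: "h \<in> rays T \<Longrightarrow> below (Inr h) = {h}"
  by (auto simp: below_def ray_way_def way_def)

lemma below_Inl: "below (Inl e) = {h \<in> rays T. e \<in> set (path (foot T h))}"
  by (auto simp: below_def ray_way_def way_def)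

lemma below_Inl_eq: "e \<in> arcs (graph T) \<Longrightarrow> below (Inl e) = below_vertex (head (graph T) e)"
proof (intro equalityI subsetI)
  fix h assume e: "e \<in> arcs (graph T)"
  {
    assume "h \<in> below (Inl e)"
    then have h: "h \<in> rays T" and "e \<in> set (path (foot T h))" by (auto simp: below_Inl)
    then obtain p r where "path (foot T h) = p @ e # r" by (meson split_list)
    from path_snoc(3)[OF foot_in[OF h] this] h show "h \<in> below_vertex (head (graph T) e)"
      by (auto simp: below_vertex_def)
  }
  assume "h \<in> below_vertex (head (graph T) e)"
  then show "h \<in> below (Inl e)" using e by (auto simp: below_Inl below_vertex_def path_head)
qed

text \<open>The first arc after \<open>v\<close> on the path to a half-line decides to which edge it
  belongs; if there is no such arc, the half-line itself starts at \<open>v\<close>.\<close>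

lemma below_start: "v \<in> verts (graph T) \<Longrightarrow> below_vertex v = (\<Union>c\<in>{c \<in> edges T. start T c = v}. below c)"
proof (intro equalityI subsetI)
  fix h assume v: "v \<in> verts (graph T)"
  {
    assume "h \<in> below_vertex v"
    then obtain p where h: "h \<in> rays T" and p: "path (foot T h) = path v @ p" by (auto simp: below_vertex_def)
    show "h \<in> (\<Union>c\<in>{c \<in> edges T. start T c = v}. below c)"
    proof (cases p)
      case Nil
      then have "foot T h = v" using p path_inj foot_in[OF h] v by simp
      then show ?thesis using h by (auto simp: edges_def below_Inr intro!: exI[of _ "Inr h"])
    next
      case (Cons e r)
      have e: "e \<in> arcs (graph T)" "path v = path (tail (graph T) e)"
        using path_snoc[OF foot_in[OF h], of "path v" e r] p Cons by auto
      then have "tail (graph T) e = v" using path_inj v by simp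
      moreover have "h \<in> below (Inl e)" using p Cons h by (simp add: below_Inl)
      ultimately show ?thesis using e by (auto simp: edges_def intro!: exI[of _ "Inl e"])
    qed
  }
  assume "h \<in> (\<Union>c\<in>{c \<in> edges T. start T c = v}. below c)"
  then obtain c where c: "c \<in> edges T" "start T c = v" "h \<in> below c" by blast
  show "h \<in> below_vertex v"
  proof (cases c)
    case (Inl e)
    then have e: "e \<in> arcs (graph T)" using c by (auto simp: edges_def)
    then have "h \<in> below_vertex (head (graph T) e)" using c Inl below_Inl_eq by simp
    then show ?thesis using c Inl e by (auto simp: below_vertex_def path_head)
  next
    case (Inr h')
    then have h': "h' \<in> rays T" using c by (auto simp: edges_def)
    then have "h = h'" using c(3) Inr by (simp add: below_Inr)
    then show ?thesis using h' c(2) Inr by (simp add: below_vertex_def)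
  qed
qed

text \<open>Both half-open edges contain the depth of their common start. A half-line with both
  edges on its path would cover this distance twice, against \<open>ray_tiling\<close>.\<close>

lemma below_disjoint:
  assumes "c \<in> edges T" "d \<in> edges T" "start T c = start T d" "c \<noteq> d"
  shows "below c \<inter> below d = {}"
proof (rule ccontr)
  assume "below c \<inter> below d \<noteq> {}"
  then obtain h where h: "h \<in> below c" "h \<in> below d" by blast
  then have hr: "h \<in> rays T" "c \<in> ray_way h" "d \<in> ray_way h" by (auto simp: below_def)
  have hd: "depth T (start T x) \<in> hdom x" if "x \<in> edges T" for x
    using that len_pos by (cases x) (auto simp: edges_def)
  let ?s = "depth T (start T c)"
  have "(2::nat) = (\<Sum>x\<in>{c, d}. indicator (hdom x) ?s)"
    using hd[OF assms(1)] hd[OF assms(2)] assms(3,4) by simp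
  also have "\<dots> \<le> (\<Sum>x\<in>ray_way h. indicator (hdom x) ?s)"
    using hr finite_ray_way by (intro sum_mono2) auto
  also have "\<dots> \<le> 1" by (subst ray_tiling[OF hr(1)]) (simp split: split_indicator)
  finally show False by simp
qed

lemma finite_below: "finite (below c)" "finite (below_vertex v)"
  using finite_rays by (auto simp: below_def below_vertex_def)

lemma card_below_vertex:
  assumes "v \<in> verts (graph T)"
  shows "card (below_vertex v) = (\<Sum>c | c \<in> edges T \<and> start T c = v. card (below c))"
  unfolding below_start[OF assms] using finite_edges finite_below below_disjoint
  by (subst card_UN_disjoint) auto

text \<open>The number of half-lines below a point at distance \<open>x\<close>, just after (\<open>B\<close>) and just before (\<open>B'\<close>)
  a vertex that may sit there.\<close>

definition B :: "real \<Rightarrow> nat" where "B x = (\<Prod>i | i \<le> N \<and> x < t i. b i)"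

definition B' :: "real \<Rightarrow> nat" where "B' x = (\<Prod>i | i \<le> N \<and> x \<le> t i. b i)"

lemma finite_levels: "finite {i. i \<le> N \<and> P i}"
  by (rule finite_subset[of _ "{..N}"]) auto

lemma prod_b_mono: "S \<subseteq> S' \<Longrightarrow> S' \<subseteq> {..N} \<Longrightarrow> prod b S \<le> prod b S'"
proof -
  assume *: "S \<subseteq> S'" "S' \<subseteq> {..N}"
  then have fin: "finite S'" by (auto intro: finite_subset)
  have "prod b S' = prod b S * prod b (S' - S)"
    using * fin by (metis prod.subset_diff mult.commute)
  moreover have "1 \<le> prod b (S' - S)"
    using * b_pos by (intro prod_ge_1) (auto simp: Suc_leI)
  ultimately show ?thesis by simp
qed

lemma B'_le_B: "x < y \<Longrightarrow> B' y \<le> B x"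
  unfolding B_def B'_def by (intro prod_b_mono) auto

lemma B'_level: "k \<le> N \<Longrightarrow> B' (t k) = b k * B (t k)"
proof -
  assume k: "k \<le> N"
  have "{i. i \<le> N \<and> t k \<le> t i} = insert k {i. i \<le> N \<and> t k < t i}"
    using k t_eq_iff by (auto simp: le_less)
  then show ?thesis using finite_levels by (simp add: B_def B'_def)
qed

lemma B_pos: "0 < B x"
  unfolding B_def using b_pos by (intro prod_pos) auto

text \<open>Induction from the leaves towards the root, on the number of strictly deeper vertices.
  An edge that jumps over levels loses nothing, as the skipped branching numbers are at least 1;
  this is the inequality \<open>B'_le_B\<close>.\<close>

lemma card_below_le:
  assumes "v \<in> verts (graph T)"
  shows "card (below_vertex v) \<le> B' (depth T v)"
    and "\<And>c. c \<in> edges T \<Longrightarrow> start T c = v \<Longrightarrow> card (below c) \<le> B (depth T v)"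
proof -
  have *: "card (below_vertex v) \<le> B' (depth T v) \<and>
    (\<forall>c. c \<in> edges T \<longrightarrow> start T c = v \<longrightarrow> card (below c) \<le> B (depth T v))"
    using assms
  proof (induction "card {u \<in> verts (graph T). depth T v < depth T u}" arbitrary: v rule: less_induct)
    case less
    have le: "card (below c) \<le> B (depth T v)" if c: "c \<in> edges T" "start T c = v" for c
    proof (cases c)
      case (Inl e)
      then have e: "e \<in> arcs (graph T)" "tail (graph T) e = v" using c by (auto simp: edges_def)
      let ?u = "head (graph T) e"
      have d: "depth T v < depth T ?u" using depth_head[OF e(1)] len_pos[OF e(1)] e(2) by simp
      have "card {w \<in> verts (graph T). depth T ?u < depth T w} < card {w \<in> verts (graph T). depth T v < depth T w}"
      proof (rule psubset_card_mono)
        have "?u \<in> {w \<in> verts (graph T). depth T v < depth T w}" using d e(1) by simp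
        moreover have "?u \<notin> {w \<in> verts (graph T). depth T ?u < depth T w}" by simp
        moreover have "{w \<in> verts (graph T). depth T ?u < depth T w} \<subseteq> {w \<in> verts (graph T). depth T v < depth T w}"
          using d by (simp add: Collect_mono)
        ultimately show "{w \<in> verts (graph T). depth T ?u < depth T w} \<subset> {w \<in> verts (graph T). depth T v < depth T w}"
          by blast
      qed simp
      then have "card (below_vertex ?u) \<le> B' (depth T ?u)" using less.hyps[of ?u] G.head_in_verts[OF e(1)] by blast
      then show ?thesis using B'_le_B[OF d] Inl below_Inl_eq[OF e(1)] by simp
    next
      case (Inr h)
      then show ?thesis using c B_pos[of "depth T v"] by (auto simp: edges_def below_Inr Suc_le_eq)
    qed
    obtain k where k: "k \<le> N" "depth T v = t k" using level[OF less.prems] by blast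
    have "card (below_vertex v) \<le> (\<Sum>c | c \<in> edges T \<and> start T c = v. B (depth T v))"
      unfolding card_below_vertex[OF less.prems] using le by (intro sum_mono) auto
    also have "\<dots> = B' (depth T v)"
      using card_out[OF k(1) less.prems k(2)] k by (simp add: B'_level)
    finally show ?case using le by blast
  qed
  show "card (below_vertex v) \<le> B' (depth T v)" using * by blast
  show "card (below c) \<le> B (depth T v)" if "c \<in> edges T" "start T c = v" for c using * that by blast
qed

text \<open>The outgoing edges number \<open>b k\<close>, each has at most \<open>B\<close>
  half-lines beyond it, and the total is \<open>b k\<close> times \<open>B\<close>; hence no summand
  can be smaller.\<close>

lemma card_below_start:
  assumes v: "v \<in> verts (graph T)" and eq: "card (below_vertex v) = B' (depth T v)" and c: "c \<in> edges T" "start T c = v"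
  shows "card (below c) = B (depth T v)"
proof -
  obtain k where k: "k \<le> N" "depth T v = t k" using level[OF v] by blast
  let ?S = "{c. c \<in> edges T \<and> start T c = v}"
  have "(\<Sum>c\<in>?S. card (below c)) = (\<Sum>c\<in>?S. B (depth T v))"
    using card_below_vertex[OF v] eq card_out[OF k(1) v k(2)] k by (simp add: B'_level)
  then show ?thesis
    by (rule sum_mono_inv) (use card_below_le(2)[OF v] c finite_edges in auto)
qed

text \<open>At the root the upper bound of \<open>card_below_le\<close> is attained,
  \<open>m\<close> being both the number of half-lines and the product of the branching numbers.
  Equality then spreads outwards: along an arc the count at the head is \<open>B\<close> at the
  tail, which is at least \<open>B'\<close> at the head, the upper bound there.\<close>

lemma card_below_vertex_eq:
  assumes "v \<in> verts (graph T)"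
  shows "card (below_vertex v) = B' (depth T v)"
  using assms
proof (induction rule: vertex_induct)
  case root
  have "{i. i \<le> N \<and> 0 \<le> t i} = {..N}" using t_nonneg by auto
  then show ?case using m_card m_prod by (simp add: below_vertex_root depth_root B'_def)
next
  case (arc e)
  let ?u = "tail (graph T) e" and ?v = "head (graph T) e"
  have uv: "?u \<in> verts (graph T)" "?v \<in> verts (graph T)" using arc by auto
  have "card (below (Inl e)) = B (depth T ?u)"
    by (rule card_below_start[OF uv(1) arc.IH]) (use arc.hyps in \<open>auto simp: edges_def\<close>)
  then have "card (below_vertex ?v) = B (depth T ?u)" using below_Inl_eq[OF arc.hyps] by simp
  moreover have "B' (depth T ?v) \<le> B (depth T ?u)"
    using depth_head[OF arc.hyps] len_pos[OF arc.hyps] by (intro B'_le_B) simp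
  ultimately show ?case using card_below_le(1)[OF uv(2)] by simp
qed

text \<open>An edge may jump over levels, but as there are as many half-lines as possible, the branching
  numbers of these levels are 1.\<close>

lemma card_below:
  assumes c: "c \<in> edges T" and s: "s \<in> interior (edge_dom T c)"
  shows "card (below c) = B s"
proof -
  have v: "start T c \<in> verts (graph T)" by (rule start_in[OF c])
  have r: "card (below c) = B (depth T (start T c))"
    by (rule card_below_start[OF v card_below_vertex_eq[OF v] c refl])
  have "B s \<le> B (depth T (start T c))"
    unfolding B_def using s by (intro prod_b_mono) (cases c, auto simp: interior_real_atLeast)
  moreover have "B (depth T (start T c)) \<le> B s"
  proof (cases c)
    case (Inl e)
    then have e: "e \<in> arcs (graph T)" using c by (auto simp: edges_def)
    have "B' (depth T (head (graph T) e)) = card (below c)"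
      using card_below_vertex_eq[of "head (graph T) e"] below_Inl_eq[OF e] Inl e by simp
    moreover have "B' (depth T (head (graph T) e)) \<le> B s"
      using s Inl depth_head[OF e] by (intro B'_le_B) simp
    ultimately show ?thesis using r by simp
  next
    case (Inr h)
    then have "depth T (start T c) = t N" using c depth_foot by (auto simp: edges_def)
    then have "{i. i \<le> N \<and> depth T (start T c) < t i} = {}" using t_le_N by force
    then have "B (depth T (start T c)) = 1" by (simp only: B_def) simp
    then show ?thesis using B_pos[of s] by simp
  qed
  ultimately show ?thesis using r by simp
qed

subsection \<open>The growth function\<close>

lemma growth_eq: "growth T s = card {v \<in> verts (graph T). depth T v = s} + (\<Sum>c\<in>edges T. indicator (interior (edge_dom T c)) s)"
proof -
  let ?V = "Vertex ` {v \<in> verts (graph T). depth T v = s} :: ('v, 'e + 'h) point set"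
  let ?I = "(\<lambda>c. Inner c s) ` {c \<in> edges T. s \<in> interior (edge_dom T c)} :: ('v, 'e + 'h) point set"
  have "{x \<in> points T. root_dist T x = s} = ?V \<union> ?I"
    by (auto simp: points_def)
  then have "growth T s = card ?V + card ?I"
    unfolding growth_def using finite_edges by (simp only:) (intro card_Un_disjoint, auto)
  also have "card ?V = card {v \<in> verts (graph T). depth T v = s}" by (rule card_image) (auto simp: inj_on_def)
  also have "card ?I = card {c \<in> edges T. s \<in> interior (edge_dom T c)}" by (rule card_image) (auto simp: inj_on_def)
  also have "\<dots> = (\<Sum>c\<in>edges T. indicator (interior (edge_dom T c)) s)"
    using finite_edges by (simp add: indicator_def if_distrib sum.If_cases Int_def)
  finally show ?thesis .
qed

lemma hdom_iff: "c \<in> edges T \<Longrightarrow> s \<notin> t ` {..N} \<Longrightarrow> s \<in> hdom c \<longleftrightarrow> s \<in> interior (edge_dom T c)"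
  using level[OF start_in[of c]] by (cases c) (auto simp: interior_real_atLeast less_le)

text \<open>Double counting of the pairs of a half-line and an edge of its path containing distance
  \<open>s\<close>: every path has one such edge, and every such edge lies on \<open>B s\<close>
  paths. At a level itself \<open>growth\<close> counts vertices as well, hence the
  exclusion.\<close>

lemma growth_B:
  assumes s: "0 \<le> s" "s \<notin> t ` {..N}"
  shows "growth T s * B s = m"
proof -
  have V: "{v \<in> verts (graph T). depth T v = s} = {}" using level s by force
  have "growth T s * B s = (\<Sum>c\<in>edges T. indicator (interior (edge_dom T c)) s * B s)"
    by (simp only: growth_eq V) (simp add: sum_distrib_right)
  also have "\<dots> = (\<Sum>c\<in>edges T. \<Sum>h\<in>rays T. if c \<in> ray_way h then indicator (hdom c) s else 0)"
  proof (rule sum.cong[OF refl])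
    fix c assume c: "c \<in> edges T"
    have "(\<Sum>h\<in>rays T. if c \<in> ray_way h then indicator (hdom c) s else 0) = (card (below c) * indicator (hdom c) s :: nat)"
      using finite_rays by (simp add: below_def sum.If_cases Int_def)
    then show "indicator (interior (edge_dom T c)) s * B s
        = (\<Sum>h\<in>rays T. if c \<in> ray_way h then indicator (hdom c) s else 0)"
      using card_below[OF c, of s] hdom_iff[OF c s(2)] by (auto simp: indicator_def)
  qed
  also have "\<dots> = (\<Sum>h\<in>rays T. \<Sum>c\<in>edges T. if c \<in> ray_way h then indicator (hdom c) s else 0)"
    by (rule sum.swap)
  also have "\<dots> = (\<Sum>h\<in>rays T. 1)"
  proof (rule sum.cong[OF refl])
    fix h assume h: "h \<in> rays T"
    have "(\<Sum>c\<in>edges T. if c \<in> ray_way h then indicator (hdom c) s else 0) = (\<Sum>c\<in>ray_way h. indicator (hdom c) s)"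
      using ray_way_edges[OF h] finite_edges by (simp add: sum.inter_restrict[symmetric] Int_absorb1)
    also have "\<dots> = (1::nat)" using ray_tiling[OF h, of s, where 'r = nat] s(1) by simp
    finally show "(\<Sum>c\<in>edges T. if c \<in> ray_way h then indicator (hdom c) s else 0) = (1::nat)" .
  qed
  finally show ?thesis using m_card by simp
qed

lemma below_growth:
  assumes "c \<in> edges T" "s \<in> hdom c" "s \<notin> t ` {..N}"
  shows "card (below c) * growth T s = m"
proof -
  have s: "s \<in> interior (edge_dom T c)" using assms hdom_iff by simp
  then have "0 \<le> s" using depth_nonneg[OF start_in[OF assms(1)]] by (cases c) (auto simp: interior_real_atLeast)
  then show ?thesis using card_below[OF assms(1) s] growth_B[OF _ assms(3)] by (simp add: mult.commute)
qed

lemma growth_ge_1: "0 \<le> s \<Longrightarrow> 1 \<le> growth T s"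
proof -
  assume s: "0 \<le> s"
  obtain h where h: "h \<in> rays T" using rays_ne by blast
  have "(\<Sum>c\<in>ray_way h. indicator (hdom c) s) = (1::nat)" using ray_tiling[OF h, of s, where 'r = nat] s by simp
  then obtain c where "c \<in> ray_way h" "indicator (hdom c) s \<noteq> (0::nat)" by (metis sum.neutral zero_neq_one)
  then have c: "c \<in> edges T" "s \<in> hdom c"
    using ray_way_edges[OF h] by (blast, simp split: split_indicator_asm)
  show ?thesis
  proof (cases "s = depth T (start T c)")
    case True
    then have "start T c \<in> {v \<in> verts (graph T). depth T v = s}" using start_in[OF c(1)] by simp
    then have "0 < card {v \<in> verts (graph T). depth T v = s}" by (auto simp: card_gt_0_iff)
    then show ?thesis by (simp add: growth_eq)
  next
    case False
    then have "s \<in> interior (edge_dom T c)" using c(2) by (cases c) (auto simp: interior_real_atLeast)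
    then have "1 \<le> (\<Sum>c\<in>edges T. indicator (interior (edge_dom T c)) s :: nat)"
      using member_le_sum[of c "edges T" "\<lambda>c. indicator (interior (edge_dom T c)) s :: nat"] c(1) finite_edges by simp
    then show ?thesis by (simp add: growth_eq)
  qed
qed

lemma growth_le: "growth T s \<le> card (verts (graph T)) + card (edges T)"
proof -
  have "card {v \<in> verts (graph T). depth T v = s} \<le> card (verts (graph T))" by (intro card_mono) auto
  moreover have "(\<Sum>c\<in>edges T. indicator (interior (edge_dom T c)) s :: nat) \<le> (\<Sum>c\<in>edges T. 1)"
    by (intro sum_mono) (simp split: split_indicator)
  ultimately show ?thesis by (simp add: growth_eq)
qed

lemma growth_measurable: "(\<lambda>s. real (growth T s)) \<in> borel_measurable borel"
proof -
  have "card {v \<in> verts (graph T). depth T v = s} = (\<Sum>v\<in>verts (graph T). indicator {depth T v} s)" for s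
    by (simp add: indicator_def if_distrib sum.If_cases Int_def eq_commute[of s])
  then have "(\<lambda>s. real (growth T s)) = (\<lambda>s. (\<Sum>v\<in>verts (graph T). indicator {depth T v} s)
      + (\<Sum>c\<in>edges T. indicator (interior (edge_dom T c)) s))"
    by (auto simp: growth_eq indicator_def of_nat_sum intro!: sum.cong)
  then show ?thesis by simp
qed

subsection \<open>The measures\<close>

lemma edge_mu_weighted: "edge_mu T c = weighted (edge_dom T c) gauss"
  by (simp add: edge_mu_def weighted_def)

lemma weighted_edge:
  assumes "c \<in> edges T" "1 \<le> C"
  shows "weighted_interval (edge_dom T c) (depth T (start T c)) gauss C"
proof
  show "edge_dom T c = {depth T (start T c)..} \<or> (\<exists>b>depth T (start T c). edge_dom T c = {depth T (start T c)..b})"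
  proof (cases c)
    case (Inl e)
    then have "0 < len T e" using assms(1) len_pos by (auto simp: edges_def)
    then have "depth T (tail (graph T) e) < depth T (tail (graph T) e) + len T e" by simp
    then show ?thesis using Inl by auto
  qed simp
  show "0 \<le> depth T (start T c)" by (intro depth_nonneg start_in assms)
  show "gauss \<in> borel_measurable borel" by measurable
  show "gauss x \<le> C * gauss x" for x using assms(2) gauss_pos[of x] by simp
qed simp

lemma edge_dom_borel [measurable]: "edge_dom T c \<in> sets borel"
  by (cases c) auto

lemma edge_point_in: "c \<in> edges T \<Longrightarrow> s \<in> edge_dom T c \<Longrightarrow> edge_point T c s \<in> points T"
  by (cases c) (auto simp: points_def edges_def foot_in interior_real_atLeast)

lemma root_dist_edge_point: "c \<in> edges T \<Longrightarrow> s \<in> edge_dom T c \<Longrightarrow> root_dist T (edge_point T c s) = s"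
  by (cases c) (auto simp: edges_def depth_head)

definition tree_sets :: "('v, 'e + 'h) point set set" where
  "tree_sets = {B. B \<subseteq> points T \<and> (\<forall>c \<in> edges T. {s \<in> edge_dom T c. edge_point T c s \<in> B} \<in> sets lborel)}"

lemma tree_sigma_algebra: "sigma_algebra (points T) tree_sets"
  unfolding sigma_algebra_iff2
proof (intro conjI ballI allI impI)
  show "tree_sets \<subseteq> Pow (points T)" by (auto simp: tree_sets_def)
  show "{} \<in> tree_sets" by (auto simp: tree_sets_def)
  fix B assume B: "B \<in> tree_sets"
  have "{s \<in> edge_dom T c. edge_point T c s \<in> points T - B} = edge_dom T c - {s \<in> edge_dom T c. edge_point T c s \<in> B}"
    if "c \<in> edges T" for c using edge_point_in[OF that] by auto
  then show "points T - B \<in> tree_sets" using B edge_dom_borel by (auto simp: tree_sets_def)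
next
  fix B :: "nat \<Rightarrow> ('v, 'e + 'h) point set" assume B: "range B \<subseteq> tree_sets"
  have "{s \<in> edge_dom T c. edge_point T c s \<in> (\<Union>i. B i)} = (\<Union>i. {s \<in> edge_dom T c. edge_point T c s \<in> B i})" for c
    by auto
  then show "\<Union>(range B) \<in> tree_sets" using B by (auto simp: tree_sets_def intro!: sets.countable_UN)
qed

lemma space_tree_length: "space (tree_length T) = points T"
  unfolding tree_length_def by (rule space_measure_of) auto

lemma sets_tree_length: "sets (tree_length T) = tree_sets"
  unfolding tree_length_def tree_sets_def[symmetric]
  by (rule sigma_algebra.sets_measure_of_eq[OF tree_sigma_algebra])

lemma emeasure_tree_length:
  assumes X: "X \<in> tree_sets"
  shows "emeasure (tree_length T) X = (\<Sum>c\<in>edges T. emeasure lborel {s \<in> edge_dom T c. edge_point T c s \<in> X})"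
  unfolding tree_length_def
proof (rule emeasure_measure_of_sigma)
  show "sigma_algebra (points T) {X. X \<subseteq> points T \<and> (\<forall>c \<in> edges T. {s \<in> edge_dom T c. edge_point T c s \<in> X} \<in> sets lborel)}"
    using tree_sigma_algebra by (simp add: tree_sets_def)
  let ?\<mu> = "\<lambda>X. \<Sum>c\<in>edges T. emeasure lborel {s \<in> edge_dom T c. edge_point T c s \<in> X}"
  show "positive {X. X \<subseteq> points T \<and> (\<forall>c \<in> edges T. {s \<in> edge_dom T c. edge_point T c s \<in> X} \<in> sets lborel)} ?\<mu>"
    by (simp add: positive_def)
  show "countably_additive {X. X \<subseteq> points T \<and> (\<forall>c \<in> edges T. {s \<in> edge_dom T c. edge_point T c s \<in> X} \<in> sets lborel)} ?\<mu>"
  proof (rule countably_additiveI)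
    fix A :: "nat \<Rightarrow> ('v, 'e + 'h) point set"
    assume A: "range A \<subseteq> {X. X \<subseteq> points T \<and> (\<forall>c \<in> edges T. {s \<in> edge_dom T c. edge_point T c s \<in> X} \<in> sets lborel)}"
      and disj: "disjoint_family A"
    have "(\<Sum>i. ?\<mu> (A i)) = (\<Sum>c\<in>edges T. \<Sum>i. emeasure lborel {s \<in> edge_dom T c. edge_point T c s \<in> A i})"
      by (intro suminf_sum summableI)
    also have "\<dots> = ?\<mu> (\<Union>i. A i)"
    proof (rule sum.cong[OF refl])
      fix c assume c: "c \<in> edges T"
      have "(\<Sum>i. emeasure lborel {s \<in> edge_dom T c. edge_point T c s \<in> A i})
          = emeasure lborel (\<Union>i. {s \<in> edge_dom T c. edge_point T c s \<in> A i})"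
      proof (rule suminf_emeasure)
        show "range (\<lambda>i. {s \<in> edge_dom T c. edge_point T c s \<in> A i}) \<subseteq> sets lborel" using A c by auto
        show "disjoint_family (\<lambda>i. {s \<in> edge_dom T c. edge_point T c s \<in> A i})"
          using disj unfolding disjoint_family_on_def by blast
      qed
      also have "(\<Union>i. {s \<in> edge_dom T c. edge_point T c s \<in> A i}) = {s \<in> edge_dom T c. edge_point T c s \<in> (\<Union>i. A i)}"
        by auto
      finally show "(\<Sum>i. emeasure lborel {s \<in> edge_dom T c. edge_point T c s \<in> A i})
          = emeasure lborel {s \<in> edge_dom T c. edge_point T c s \<in> (\<Union>i. A i)}" .
    qed
    finally show "(\<Sum>i. ?\<mu> (A i)) = ?\<mu> (\<Union>i. A i)" .
  qed
  show "X \<in> {X. X \<subseteq> points T \<and> (\<forall>c \<in> edges T. {s \<in> edge_dom T c. edge_point T c s \<in> X} \<in> sets lborel)}"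
    using X by (simp add: tree_sets_def)
qed

lemma measurable_tree_length_iff:
  fixes f :: "('v, 'e + 'h) point \<Rightarrow> 'b::topological_space"
  shows "f \<in> borel_measurable (tree_length T) \<longleftrightarrow>
    (\<forall>c\<in>edges T. (\<lambda>s. f (edge_point T c s)) \<in> borel_measurable (restrict_space lborel (edge_dom T c)))"
proof -
  have "f -` S \<inter> points T \<in> tree_sets \<longleftrightarrow>
    (\<forall>c\<in>edges T. (\<lambda>s. f (edge_point T c s)) -` S \<inter> edge_dom T c \<in> sets (restrict_space lborel (edge_dom T c)))" for S
  proof -
    have "{s \<in> edge_dom T c. edge_point T c s \<in> f -` S \<inter> points T} = (\<lambda>s. f (edge_point T c s)) -` S \<inter> edge_dom T c"
      if "c \<in> edges T" for c using edge_point_in[OF that] by auto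
    then show ?thesis by (auto simp: tree_sets_def sets_restrict_space_iff)
  qed
  then show ?thesis
    unfolding measurable_def by (auto simp: space_tree_length sets_tree_length space_restrict_space)
qed

lemma nn_integral_tree_length:
  assumes "u \<in> borel_measurable (tree_length T)"
  shows "(\<integral>\<^sup>+x. u x \<partial>tree_length T) = (\<Sum>c\<in>edges T. \<integral>\<^sup>+s. u (edge_point T c s) \<partial>restrict_space lborel (edge_dom T c))"
  using assms
proof (induction rule: borel_measurable_induct)
  case (cong f g)
  have "(\<integral>\<^sup>+x. f x \<partial>tree_length T) = (\<integral>\<^sup>+x. g x \<partial>tree_length T)"
    using cong by (intro nn_integral_cong) auto
  moreover have "(\<integral>\<^sup>+s. f (edge_point T c s) \<partial>restrict_space lborel (edge_dom T c))
      = (\<integral>\<^sup>+s. g (edge_point T c s) \<partial>restrict_space lborel (edge_dom T c))" if "c \<in> edges T" for c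
    using cong(3) edge_point_in[OF that]
    by (intro nn_integral_cong) (auto simp: space_restrict_space space_tree_length)
  ultimately show ?case using cong by simp
next
  case (set A)
  have A: "A \<in> tree_sets" using set by (simp add: sets_tree_length)
  have "(\<integral>\<^sup>+s. indicator A (edge_point T c s) \<partial>restrict_space lborel (edge_dom T c))
      = emeasure lborel {s \<in> edge_dom T c. edge_point T c s \<in> A}" if c: "c \<in> edges T" for c
  proof -
    have "(\<integral>\<^sup>+s. indicator A (edge_point T c s) \<partial>restrict_space lborel (edge_dom T c))
        = (\<integral>\<^sup>+s. indicator {s \<in> edge_dom T c. edge_point T c s \<in> A} s \<partial>lborel)"
      by (subst nn_integral_restrict_space) (auto intro!: nn_integral_cong split: split_indicator)
    then show ?thesis using A c by (simp add: tree_sets_def)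
  qed
  then show ?case using set A by (simp add: emeasure_tree_length)
next
  case (mult u k)
  have [measurable]: "(\<lambda>s. u (edge_point T c s)) \<in> borel_measurable (restrict_space lborel (edge_dom T c))" if "c \<in> edges T" for c
    using mult(2) that measurable_tree_length_iff by blast
  show ?case using mult by (simp add: nn_integral_cmult sum_distrib_left)
next
  case (add u v)
  have [measurable]: "(\<lambda>s. u (edge_point T c s)) \<in> borel_measurable (restrict_space lborel (edge_dom T c))"
    "(\<lambda>s. v (edge_point T c s)) \<in> borel_measurable (restrict_space lborel (edge_dom T c))" if "c \<in> edges T" for c
    using add(1,3) that measurable_tree_length_iff by blast+
  have "(\<integral>\<^sup>+x. v x + u x \<partial>tree_length T) = (\<integral>\<^sup>+x. v x \<partial>tree_length T) + (\<integral>\<^sup>+x. u x \<partial>tree_length T)"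
    using add by (intro nn_integral_add) auto
  then show ?case using add by (simp add: nn_integral_add sum.distrib)
next
  case (seq U)
  have U: "U i \<in> borel_measurable (tree_length T)" for i using seq by simp
  have Um: "(\<lambda>s. U i (edge_point T c s)) \<in> borel_measurable (restrict_space lborel (edge_dom T c))" if "c \<in> edges T" for c i
    using U that measurable_tree_length_iff by blast
  have inc: "incseq (\<lambda>i s. U i (edge_point T c s))" for c using \<open>incseq U\<close> by (auto simp: incseq_def le_fun_def)
  have "(\<integral>\<^sup>+x. (SUP i. U i) x \<partial>tree_length T) = (SUP i. \<integral>\<^sup>+x. U i x \<partial>tree_length T)"
    using U \<open>incseq U\<close> by (simp add: nn_integral_monotone_convergence_SUP image_comp)
  also have "\<dots> = (SUP i. \<Sum>c\<in>edges T. \<integral>\<^sup>+s. U i (edge_point T c s) \<partial>restrict_space lborel (edge_dom T c))"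
    using seq by simp
  also have "\<dots> = (\<Sum>c\<in>edges T. SUP i. \<integral>\<^sup>+s. U i (edge_point T c s) \<partial>restrict_space lborel (edge_dom T c))"
    by (rule ennreal_SUP_sum) (use \<open>incseq U\<close> in \<open>auto simp: incseq_def le_fun_def intro!: nn_integral_mono\<close>)
  also have "\<dots> = (\<Sum>c\<in>edges T. \<integral>\<^sup>+s. (SUP i. U i) (edge_point T c s) \<partial>restrict_space lborel (edge_dom T c))"
  proof (rule sum.cong[OF refl])
    fix c assume "c \<in> edges T"
    then show "(SUP i. \<integral>\<^sup>+s. U i (edge_point T c s) \<partial>restrict_space lborel (edge_dom T c))
        = (\<integral>\<^sup>+s. (SUP i. U i) (edge_point T c s) \<partial>restrict_space lborel (edge_dom T c))"
      using nn_integral_monotone_convergence_SUP[OF inc Um] by (simp add: image_comp)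
  qed
  finally show ?case .
qed

lemma tree_mu_density: "(\<lambda>x. ennreal (gauss (root_dist T x))) \<in> borel_measurable (tree_length T)"
proof -
  have "(\<lambda>s. ennreal (gauss (root_dist T (edge_point T c s)))) \<in> borel_measurable (restrict_space lborel (edge_dom T c))"
    if c: "c \<in> edges T" for c
  proof -
    have "(\<lambda>s. ennreal (gauss s)) \<in> borel_measurable (restrict_space lborel (edge_dom T c))"
      by (rule measurable_restrict_space1) measurable
    then show ?thesis
      by (subst measurable_cong[where g = "\<lambda>s. ennreal (gauss s)"])
        (auto simp: space_restrict_space root_dist_edge_point[OF c])
  qed
  then show ?thesis by (simp add: measurable_tree_length_iff)
qed

lemma measurable_tree_mu_iff:
  fixes f :: "('v, 'e + 'h) point \<Rightarrow> complex"
  shows "f \<in> borel_measurable (tree_mu T) \<longleftrightarrow>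
    (\<forall>c\<in>edges T. (\<lambda>s. f (edge_point T c s)) \<in> borel_measurable (weighted (edge_dom T c) gauss))"
proof -
  have "borel_measurable (tree_mu T) = (borel_measurable (tree_length T) :: (('v, 'e + 'h) point \<Rightarrow> complex) set)"
    unfolding tree_mu_def by (rule measurable_cong_sets) auto
  moreover have "borel_measurable (weighted (edge_dom T c) gauss) =
      (borel_measurable (restrict_space lborel (edge_dom T c)) :: (real \<Rightarrow> complex) set)" for c
    unfolding weighted_def by (rule measurable_cong_sets) auto
  ultimately show ?thesis by (simp only: measurable_tree_length_iff)
qed

lemma nn_integral_tree_mu:
  assumes u: "u \<in> borel_measurable (tree_mu T)"
  shows "(\<integral>\<^sup>+x. u x \<partial>tree_mu T) = (\<Sum>c\<in>edges T. \<integral>\<^sup>+s. u (edge_point T c s) \<partial>weighted (edge_dom T c) gauss)"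
proof -
  have ul [measurable]: "u \<in> borel_measurable (tree_length T)" using u by (simp add: tree_mu_def)
  note tree_mu_density [measurable]
  have "(\<integral>\<^sup>+x. u x \<partial>tree_mu T) = (\<integral>\<^sup>+x. ennreal (gauss (root_dist T x)) * u x \<partial>tree_length T)"
    unfolding tree_mu_def by (rule nn_integral_density) measurable
  also have "\<dots> = (\<Sum>c\<in>edges T. \<integral>\<^sup>+s. ennreal (gauss (root_dist T (edge_point T c s))) * u (edge_point T c s) \<partial>restrict_space lborel (edge_dom T c))"
    by (rule nn_integral_tree_length) measurable
  also have "\<dots> = (\<Sum>c\<in>edges T. \<integral>\<^sup>+s. u (edge_point T c s) \<partial>weighted (edge_dom T c) gauss)"
  proof (rule sum.cong[OF refl])
    fix c assume c: "c \<in> edges T"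
    have um: "(\<lambda>s. u (edge_point T c s)) \<in> borel_measurable (restrict_space lborel (edge_dom T c))"
      using ul c measurable_tree_length_iff by blast
    have "(\<integral>\<^sup>+s. u (edge_point T c s) \<partial>weighted (edge_dom T c) gauss)
        = (\<integral>\<^sup>+s. ennreal (gauss s) * u (edge_point T c s) \<partial>restrict_space lborel (edge_dom T c))"
      unfolding weighted_def by (rule nn_integral_density[OF _ um]) (rule measurable_restrict_space1, measurable)
    also have "\<dots> = (\<integral>\<^sup>+s. ennreal (gauss (root_dist T (edge_point T c s))) * u (edge_point T c s) \<partial>restrict_space lborel (edge_dom T c))"
      by (intro nn_integral_cong) (auto simp: space_restrict_space root_dist_edge_point[OF c])
    finally show "(\<integral>\<^sup>+s. ennreal (gauss (root_dist T (edge_point T c s))) * u (edge_point T c s) \<partial>restrict_space lborel (edge_dom T c))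
        = (\<integral>\<^sup>+s. u (edge_point T c s) \<partial>weighted (edge_dom T c) gauss)" by simp
  qed
  finally show ?thesis .
qed

definition nu_density :: "real \<Rightarrow> real" where
  "nu_density s = real (growth T s) * gauss s"

lemma nu_density_measurable [measurable]: "nu_density \<in> borel_measurable borel"
  unfolding nu_density_def[abs_def] using growth_measurable by measurable

lemma nu_from_weighted:
  assumes "0 \<le> x"
  shows "nu_from T x = weighted {x..} nu_density"
proof (rule measure_eqI)
  have 1: "restrict_space (restrict_space lborel {0..}) {x..} = restrict_space lborel {x..}"
    using assms by (subst restrict_restrict_space) (auto simp: Int_absorb1 Int_absorb2)
  have nu: "nu T = density (restrict_space lborel {0..}) (\<lambda>s. ennreal (nu_density s))"
    by (simp add: nu_def nu_density_def)
  have "sets (nu_from T x) = sets (restrict_space (restrict_space lborel {0..}) {x..})"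
    unfolding nu_from_def nu by (intro sets_restrict_space_cong) simp
  then show S: "sets (nu_from T x) = sets (weighted {x..} nu_density)"
    by (simp add: 1 weighted_def)
  have m: "(\<lambda>s. ennreal (nu_density s)) \<in> borel_measurable (restrict_space lborel Y)" for Y
    by (rule measurable_restrict_space1) measurable
  fix A assume "A \<in> sets (nu_from T x)"
  then have "A \<in> sets (restrict_space lborel {x..})" using S by (simp add: weighted_def)
  then have A: "A \<in> sets borel" "A \<subseteq> {x..}" by (auto simp: sets_restrict_space_iff)
  have A0: "A \<in> sets (restrict_space lborel {0..})" using A assms by (auto simp: sets_restrict_space_iff)
  have "emeasure (nu_from T x) A = emeasure (nu T) A"
    unfolding nu_from_def using A assms
    by (intro emeasure_restrict_space) (auto simp: nu space_restrict_space sets_restrict_space_iff)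
  also have "\<dots> = (\<integral>\<^sup>+s. ennreal (nu_density s) * indicator A s \<partial>restrict_space lborel {0..})"
    unfolding nu by (rule emeasure_density[OF m A0])
  also have "\<dots> = (\<integral>\<^sup>+s. ennreal (nu_density s) * indicator A s \<partial>lborel)"
    using A assms by (subst nn_integral_restrict_space) (auto intro!: nn_integral_cong split: split_indicator)
  also have "\<dots> = (\<integral>\<^sup>+s. ennreal (nu_density s) * indicator A s \<partial>restrict_space lborel {x..})"
    using A by (subst nn_integral_restrict_space) (auto intro!: nn_integral_cong split: split_indicator)
  also have "\<dots> = emeasure (weighted {x..} nu_density) A"
    unfolding weighted_def using A by (intro emeasure_density[OF m, symmetric]) (auto simp: sets_restrict_space_iff)
  finally show "emeasure (nu_from T x) A = emeasure (weighted {x..} nu_density) A" .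
qed

text \<open>A crude bound for the growth that is valid at the levels too, where vertices are
  counted.\<close>

definition growth_max :: real where
  "growth_max = real (card (verts (graph T)) + card (edges T))"

lemma weighted_nu:
  assumes "0 \<le> x"
  shows "weighted_interval {x..} x nu_density growth_max"
proof
  fix y assume "y \<in> {x..}"
  then have y: "0 \<le> y" using assms by simp
  have "real 1 \<le> real (growth T y)" using growth_ge_1[OF y] by (simp only: of_nat_le_iff)
  then show "gauss y \<le> nu_density y" using gauss_pos[of y] by (simp add: nu_density_def)
  have "real (growth T y) \<le> growth_max" unfolding growth_max_def using growth_le by (simp only: of_nat_le_iff)
  then show "nu_density y \<le> growth_max * gauss y" using gauss_pos[of y] by (simp add: nu_density_def)
qed (use assms in auto)

end

section \<open>The tree and the reduced operators as networks\<close>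

context weighted_interval
begin

lemma L2_set_countable_change:
  assumes w: "w \<in> L2_set K" and X: "countable X" and eq: "\<And>x. x \<in> I - X \<Longrightarrow> v x = w x"
  shows "v \<in> L2_set K" "AE x in K. v x = w x"
proof -
  have "X \<in> null_sets lborel" using X by (rule countable_imp_null_set_lborel)
  then show ae: "AE x in K. v x = w x"
    unfolding AE_K_iff using AE_not_in eq by (force elim: eventually_mono)
  have "(\<lambda>x. indicator I x *\<^sub>R w x) \<in> borel_measurable lborel"
    using w by (simp add: L2_set_def measurable_K_iff)
  then have "(\<lambda>x. indicator I x *\<^sub>R v x) \<in> borel_measurable lborel"
    by (rule measurable_discrete_difference[OF _ X]) (use eq in \<open>auto split: split_indicator\<close>)
  then have vm: "v \<in> borel_measurable K" by (simp add: measurable_K_iff)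
  have "integrable K (\<lambda>x. (cmod (v x))\<^sup>2) \<longleftrightarrow> integrable K (\<lambda>x. (cmod (w x))\<^sup>2)"
    using vm w ae by (intro integrable_cong_AE) (auto simp: L2_set_def)
  then show "v \<in> L2_set K" using vm w by (auto simp: L2_set_def)
qed

end

context reg_tree
begin

abbreviation W where "W c \<equiv> weighted (edge_dom T c) gauss"

lemma W_interval: "c \<in> edges T \<Longrightarrow> weighted_interval (edge_dom T c) (depth T (start T c)) gauss 1"
  by (rule weighted_edge) auto

lemma edge_point_interior: "c \<in> edges T \<Longrightarrow> s \<in> interior (edge_dom T c) \<Longrightarrow> edge_point T c s = Inner c s"
  by (cases c) (auto simp: interior_real_atLeast)

lemma edge_point_start: "c \<in> edges T \<Longrightarrow> edge_point T c (depth T (start T c)) = Vertex (start T c)"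
  by (cases c) auto

lemma start_in_dom: "c \<in> edges T \<Longrightarrow> depth T (start T c) \<in> edge_dom T c"
  using len_pos by (cases c) (auto simp: edges_def intro: less_imp_le)

lemma edge_point_end: "e \<in> arcs (graph T) \<Longrightarrow> edge_point T (Inl e) (depth T (head (graph T) e)) = Vertex (head (graph T) e)"
  using len_pos[of e] by (simp add: depth_head)

lemma tree_H1_iff: "f \<in> tree_H1 T \<longleftrightarrow> (\<forall>c\<in>edges T. (\<lambda>s. f (edge_point T c s)) \<in> H1 (W c))"
  by (simp add: tree_H1_def edge_mu_weighted)

text \<open>The two derivatives can differ only at the end points of the edge: there
  \<open>tree_deriv\<close> is 0 by convention, while the chosen \<open>weak_deriv\<close> may be
  anything.\<close>

lemma tree_deriv_pull:
  assumes f: "f \<in> tree_H1 T" and c: "c \<in> edges T"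
  shows "(\<lambda>s. tree_deriv T f (edge_point T c s)) \<in> L2_set (W c)"
    "AE s in W c. tree_deriv T f (edge_point T c s) = weak_deriv (W c) (\<lambda>r. f (edge_point T c r)) s"
proof -
  interpret weighted_interval "edge_dom T c" "depth T (start T c)" gauss 1 by (rule W_interval[OF c])
  have wL: "weak_deriv (W c) (\<lambda>r. f (edge_point T c r)) \<in> L2_set (W c)"
    using f c by (intro H1_D) (simp add: tree_H1_iff)
  have eq: "tree_deriv T f (edge_point T c s) = weak_deriv (W c) (\<lambda>r. f (edge_point T c r)) s"
    if "s \<in> edge_dom T c - (edge_dom T c - interior (edge_dom T c))" for s
    using that edge_point_interior[OF c, of s] by (simp add: edge_mu_weighted)
  show "(\<lambda>s. tree_deriv T f (edge_point T c s)) \<in> L2_set (W c)"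
    by (rule L2_set_countable_change(1)[OF wL countable_boundary]) (rule eq)
  show "AE s in W c. tree_deriv T f (edge_point T c s) = weak_deriv (W c) (\<lambda>r. f (edge_point T c r)) s"
    by (rule L2_set_countable_change(2)[OF wL countable_boundary]) (rule eq)
qed

lemma tree_form_eq:
  assumes f: "f \<in> tree_H1 T" and h: "h \<in> tree_H1 T"
  shows "tree_form T f h = 1 / 2 * (\<Sum>c\<in>edges T. L2_inner (W c)
    (weak_deriv (W c) (\<lambda>s. f (edge_point T c s))) (weak_deriv (W c) (\<lambda>s. h (edge_point T c s))))"
proof -
  have meas: "tree_deriv T f \<in> borel_measurable (tree_mu T)" if "f \<in> tree_H1 T" for f
    using tree_deriv_pull(1)[OF that] by (auto simp: measurable_tree_mu_iff L2_set_def)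
  have "(LINT x|tree_mu T. tree_deriv T f x * cnj (tree_deriv T h x))
      = (\<Sum>c\<in>edges T. LINT s|W c. tree_deriv T f (edge_point T c s) * cnj (tree_deriv T h (edge_point T c s)))"
  proof (rule integral_eq_sum_if_nn_integral_eq_sum(2)[OF finite_edges])
    show "(\<lambda>x. tree_deriv T f x * cnj (tree_deriv T h x)) \<in> borel_measurable (tree_mu T)"
      by (intro borel_measurable_times borel_measurable_cnj meas f h)
    show "integrable (W c) (\<lambda>s. tree_deriv T f (edge_point T c s) * cnj (tree_deriv T h (edge_point T c s)))"
      if "c \<in> edges T" for c
      by (intro L2_mult_integrable tree_deriv_pull f h that)
  qed (rule nn_integral_tree_mu)
  also have "\<dots> = (\<Sum>c\<in>edges T. L2_inner (W c)
    (weak_deriv (W c) (\<lambda>s. f (edge_point T c s))) (weak_deriv (W c) (\<lambda>s. h (edge_point T c s))))"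
  proof (rule sum.cong[OF refl])
    fix c assume c: "c \<in> edges T"
    note F = tree_deriv_pull[OF f c] and H = tree_deriv_pull[OF h c]
    have wL: "weak_deriv (W c) (\<lambda>s. f (edge_point T c s)) \<in> L2_set (W c)" if "f \<in> tree_H1 T" for f
      using that c by (intro weighted_interval.H1_D(2)[OF W_interval[OF c]]) (simp add: tree_H1_iff)
    show "(LINT s|W c. tree_deriv T f (edge_point T c s) * cnj (tree_deriv T h (edge_point T c s)))
      = L2_inner (W c) (weak_deriv (W c) (\<lambda>s. f (edge_point T c s))) (weak_deriv (W c) (\<lambda>s. h (edge_point T c s)))"
      unfolding L2_inner_def
    proof (rule integral_cong_AE)
      show "AE s in W c. tree_deriv T f (edge_point T c s) * cnj (tree_deriv T h (edge_point T c s))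
        = weak_deriv (W c) (\<lambda>s. f (edge_point T c s)) s * cnj (weak_deriv (W c) (\<lambda>s. h (edge_point T c s)) s)"
        using F(2) H(2) by eventually_elim simp
    qed (intro borel_measurable_integrable L2_mult_integrable F(1) H(1) wL f h)+
  qed
  finally show ?thesis by (simp add: tree_form_def)
qed

text \<open>The set \<open>Z\<close> of prescribed zeros is a parameter, so that the Dirichlet and
  the Neumann case, with \<open>Z\<close> the root or empty, share all proofs.\<close>

definition tree_dom :: "('v, 'e + 'h) point set \<Rightarrow> (('v, 'e + 'h) point \<Rightarrow> complex) set" where
  "tree_dom Z = {f \<in> tree_H1 T. \<forall>z\<in>Z. f z = 0}"

definition red_dom :: "real \<Rightarrow> real set \<Rightarrow> (real \<Rightarrow> complex) set" where
  "red_dom x Z = {\<phi> \<in> H1 (nu_from T x). \<forall>z\<in>Z. \<phi> z = 0}"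

text \<open>The Dirichlet condition has to sit on an edge in order to be a boundary condition of a
  network; positivity of \<open>b 0\<close> supplies one.\<close>

lemma edge_at_root: "\<exists>c\<in>edges T. start T c = root T"
proof -
  have "card {c \<in> edges T. start T c = root T} = b 0"
    using card_out[of 0 "root T"] root_in depth_root t_0 by simp
  then have "0 < card {c \<in> edges T. start T c = root T}" using b_pos[of 0] by simp
  then have "{c \<in> edges T. start T c = root T} \<noteq> {}" by (metis card.empty less_irrefl)
  then show ?thesis by blast
qed

lemma tree_network:
  assumes Z: "Z \<subseteq> {Vertex (root T)}"
  shows "network (tree_mu T) (tree_dom Z) (tree_form T) (edges T) (edge_dom T) (\<lambda>c. depth T (start T c))
    (\<lambda>_. gauss) 1 (edge_point T) Z"
proof (rule network.intro)
  show "finite (edges T)" by (rule finite_edges)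
  show "weighted_interval (edge_dom T c) (depth T (start T c)) gauss 1" if "c \<in> edges T" for c
    using that by (rule W_interval)
  show "f \<in> borel_measurable (tree_mu T) \<longleftrightarrow> (\<forall>c\<in>edges T. (\<lambda>s. f (edge_point T c s)) \<in> borel_measurable (W c))"
    for f :: "('v, 'e + 'h) point \<Rightarrow> complex" by (rule measurable_tree_mu_iff)
  show "(\<integral>\<^sup>+x. u x \<partial>tree_mu T) = (\<Sum>c\<in>edges T. \<integral>\<^sup>+s. u (edge_point T c s) \<partial>W c)"
    if "u \<in> borel_measurable (tree_mu T)" for u using that by (rule nn_integral_tree_mu)
  show "\<exists>c\<in>edges T. \<exists>s\<in>edge_dom T c. z = edge_point T c s" if "z \<in> Z" for z
  proof -
    obtain c where c: "c \<in> edges T" "start T c = root T" using edge_at_root by blast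
    have "z = edge_point T c (depth T (start T c))" using edge_point_start[OF c(1)] c(2) that Z by auto
    then show ?thesis using start_in_dom[OF c(1)] c(1) by blast
  qed
  show "tree_dom Z = {f. (\<forall>c\<in>edges T. (\<lambda>s. f (edge_point T c s)) \<in> H1 (W c)) \<and> (\<forall>z\<in>Z. f z = 0)}"
    by (simp add: tree_dom_def tree_H1_iff)
  show "tree_form T f h = 1 / 2 * (\<Sum>c\<in>edges T. L2_inner (W c)
    (weak_deriv (W c) (\<lambda>s. f (edge_point T c s))) (weak_deriv (W c) (\<lambda>s. h (edge_point T c s))))"
    if "f \<in> tree_dom Z" "h \<in> tree_dom Z" for f h
    using that by (intro tree_form_eq) (auto simp: tree_dom_def)
qed

lemma red_network:
  assumes x: "0 \<le> x" and Z: "Z \<subseteq> {x}"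
  shows "network (nu_from T x) (red_dom x Z) (reduced_form T x) {()} (\<lambda>_. {x..}) (\<lambda>_. x)
    (\<lambda>_. nu_density) growth_max (\<lambda>_ s. s) Z"
proof (rule network.intro)
  show "weighted_interval {x..} x nu_density growth_max" by (rule weighted_nu[OF x])
  show "reduced_form T x f h = 1 / 2 * (\<Sum>c\<in>{()}. L2_inner (weighted {x..} nu_density)
    (weak_deriv (weighted {x..} nu_density) (\<lambda>s. f s)) (weak_deriv (weighted {x..} nu_density) (\<lambda>s. h s)))" for f h
    by (simp add: reduced_form_def L2_inner_def nu_from_weighted[OF x])
qed (use Z in \<open>auto simp: nu_from_weighted[OF x] red_dom_def\<close>)

section \<open>Functions along the paths to the half-lines\<close>

text \<open>The restriction to the path of \<open>h\<close>: at most one half-open edge of the path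
  contains \<open>s\<close>, so the sum has at most one nonzero term, and at a vertex the next edge
  of the path is used. The argument is a family over the edges, so that values and derivatives of a
  function on the tree can both be glued.\<close>

definition glue :: "('e + 'h \<Rightarrow> real \<Rightarrow> complex) \<Rightarrow> 'h \<Rightarrow> real \<Rightarrow> complex" where
  "glue v h s = (\<Sum>c\<in>ray_way h. if s \<in> hdom c then v c s else 0)"

lemma hdom_borel [measurable]: "hdom c \<in> sets borel"
  by (cases c) auto

lemma hdom_sub: "c \<in> edges T \<Longrightarrow> hdom c \<subseteq> edge_dom T c"
  by (cases c) auto

lemma hdom_ge0: "c \<in> edges T \<Longrightarrow> hdom c \<subseteq> {0..}"
  using depth_nonneg[OF start_in[of c]] by (cases c) auto

lemma ray_way_unique:
  assumes h: "h \<in> rays T" and c: "c \<in> ray_way h" "d \<in> ray_way h" "s \<in> hdom c" "s \<in> hdom d"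
  shows "c = d"
proof (rule ccontr)
  assume "c \<noteq> d"
  then have "(2::nat) = (\<Sum>x\<in>{c, d}. indicator (hdom x) s)" using c by simp
  also have "\<dots> \<le> (\<Sum>x\<in>ray_way h. indicator (hdom x) s)"
    using c finite_ray_way by (intro sum_mono2) auto
  also have "\<dots> \<le> 1" by (subst ray_tiling[OF h]) (simp split: split_indicator)
  finally show False by simp
qed

lemma ray_way_exists:
  assumes h: "h \<in> rays T" and s: "0 \<le> s"
  shows "\<exists>c\<in>ray_way h. s \<in> hdom c"
proof (rule ccontr)
  assume "\<not> ?thesis"
  then have "(\<Sum>x\<in>ray_way h. indicator (hdom x) s) = (0::nat)" by (intro sum.neutral) auto
  then show False using ray_tiling[OF h, of s, where 'r = nat] s by simp
qed

lemma sum_ray_way: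
  assumes h: "h \<in> rays T" and c: "c \<in> ray_way h" "s \<in> hdom c"
  shows "(\<Sum>d\<in>ray_way h. if s \<in> hdom d then F d else 0) = F c"
proof -
  have "(\<Sum>d\<in>ray_way h. if s \<in> hdom d then F d else 0) = (\<Sum>d\<in>ray_way h. if d = c then F d else 0)"
  proof (rule sum.cong[OF refl])
    fix d assume d: "d \<in> ray_way h"
    show "(if s \<in> hdom d then F d else 0) = (if d = c then F d else 0)"
    proof (cases "s \<in> hdom d")
      case True
      have "c = d" by (rule ray_way_unique[OF h c(1) d c(2) True])
      then show ?thesis using True by simp
    next
      case False
      then have "d \<noteq> c" using c(2) by blast
      then show ?thesis using False by simp
    qed
  qed
  then show ?thesis using c(1) finite_ray_way by simp
qed

abbreviation \<nu> where "\<nu> \<equiv> weighted {0..} nu_density"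

lemma \<nu>_interval: "weighted_interval {0..} 0 nu_density growth_max"
  by (rule weighted_nu) simp

lemma glue_measurable:
  assumes h: "h \<in> rays T" and v: "\<And>c. c \<in> edges T \<Longrightarrow> v c \<in> borel_measurable (W c)"
  shows "glue v h \<in> borel_measurable \<nu>"
proof -
  interpret \<nu>: weighted_interval "{0..}" 0 nu_density growth_max by (rule \<nu>_interval)
  have "(\<lambda>s. \<Sum>c\<in>ray_way h. indicator (hdom c) s *\<^sub>R (indicator (edge_dom T c) s *\<^sub>R v c s)) \<in> borel_measurable borel"
  proof (rule borel_measurable_sum)
    fix c assume "c \<in> ray_way h"
    then have c: "c \<in> edges T" using ray_way_edges[OF h] by auto
    have "(\<lambda>s. indicator (edge_dom T c) s *\<^sub>R v c s) \<in> borel_measurable borel"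
      using v[OF c] weighted_interval.measurable_K_iff[OF W_interval[OF c], of "v c"] by blast
    then show "(\<lambda>s. indicator (hdom c) s *\<^sub>R (indicator (edge_dom T c) s *\<^sub>R v c s)) \<in> borel_measurable borel"
      by (rule borel_measurable_scaleR[OF borel_measurable_indicator, rotated]) measurable
  qed
  moreover have "(\<Sum>c\<in>ray_way h. indicator (hdom c) s *\<^sub>R (indicator (edge_dom T c) s *\<^sub>R v c s))
      = indicator {0..} s *\<^sub>R glue v h s" for s
  proof (cases "0 \<le> s")
    case True
    have "(\<Sum>c\<in>ray_way h. indicator (hdom c) s *\<^sub>R (indicator (edge_dom T c) s *\<^sub>R v c s)) = glue v h s"
      unfolding glue_def
    proof (rule sum.cong[OF refl])
      fix c assume "c \<in> ray_way h"
      then have "hdom c \<subseteq> edge_dom T c" using ray_way_edges[OF h] hdom_sub by blast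
      then show "indicator (hdom c) s *\<^sub>R (indicator (edge_dom T c) s *\<^sub>R v c s) = (if s \<in> hdom c then v c s else 0)"
        by (auto split: split_indicator)
    qed
    then show ?thesis using True by simp
  next
    case False
    have "(\<Sum>c\<in>ray_way h. indicator (hdom c) s *\<^sub>R (indicator (edge_dom T c) s *\<^sub>R v c s)) = 0"
      using ray_way_edges[OF h] hdom_ge0 False by (intro sum.neutral) (auto split: split_indicator)
    then show ?thesis using False by simp
  qed
  ultimately show ?thesis by (simp add: \<nu>.measurable_K_iff)
qed

lemma AE_not_level: "AE s in lborel. s \<notin> t ` {..N}"
  by (intro AE_not_in countable_imp_null_set_lborel countable_finite) simp

text \<open>The gluing map is an isometry up to the factor \<open>m\<close>: an edge lies on \<open>card (below c)\<close>
  paths, and this number times the growth is \<open>m\<close>.\<close>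

lemma glue_isometry:
  assumes v: "\<And>c. c \<in> edges T \<Longrightarrow> v c \<in> L2_set (W c)"
  shows "\<And>h. h \<in> rays T \<Longrightarrow> glue v h \<in> L2_set \<nu>"
    "(\<Sum>h\<in>rays T. L2.nsq \<nu> (glue v h)) = real m * (\<Sum>c\<in>edges T. L2.nsq (W c) (v c))"
proof -
  interpret \<nu>: weighted_interval "{0..}" 0 nu_density growth_max by (rule \<nu>_interval)
  define n where "n c s = ennreal ((cmod (v c s))\<^sup>2)" for c s
  \<comment> \<open>The contribution of the edge \<open>c\<close> to the squared norm along one
    path. It is the same for all paths through \<open>c\<close>, so summation over the half-lines
    multiplies it by \<open>card (below c)\<close>.\<close>
  define Dn where "Dn c = (\<integral>\<^sup>+s. ennreal (nu_density s) * n c s * indicator (hdom c) s \<partial>lborel)" for c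
  have vm: "v c \<in> borel_measurable (W c)" if "c \<in> edges T" for c using v[OF that] by (simp add: L2_set_def)
  have nm: "(\<lambda>s. n c s * indicator (hdom c) s) \<in> borel_measurable borel" if c: "c \<in> edges T" for c
  proof -
    have [measurable]: "(\<lambda>s. indicator (edge_dom T c) s *\<^sub>R v c s) \<in> borel_measurable borel"
      using vm[OF c] weighted_interval.measurable_K_iff[OF W_interval[OF c], of "v c"] by blast
    have eq: "n c s * indicator (hdom c) s = ennreal ((cmod (indicator (edge_dom T c) s *\<^sub>R v c s))\<^sup>2) * indicator (hdom c) s" for s
      using hdom_sub[OF c] by (auto simp: n_def split: split_indicator)
    show ?thesis unfolding eq by measurable
  qed
  have below_Dn: "of_nat (card (below c)) * Dn c = of_nat m * ennreal (L2.nsq (W c) (v c))" if c: "c \<in> edges T" for c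
  proof -
    interpret Wc: weighted_interval "edge_dom T c" "depth T (start T c)" gauss 1 by (rule W_interval[OF c])
    have "of_nat (card (below c)) * Dn c
        = (\<integral>\<^sup>+s. of_nat (card (below c)) * (ennreal (nu_density s) * (n c s * indicator (hdom c) s)) \<partial>lborel)"
      unfolding Dn_def mult.assoc by (rule nn_integral_cmult[symmetric]) (use nm[OF c] in measurable)
    also have "\<dots> = (\<integral>\<^sup>+s. of_nat m * (ennreal (gauss s) * n c s * indicator (edge_dom T c) s) \<partial>lborel)"
    proof (rule nn_integral_cong_AE)
      show "AE s in lborel. of_nat (card (below c)) * (ennreal (nu_density s) * (n c s * indicator (hdom c) s))
          = of_nat m * (ennreal (gauss s) * n c s * indicator (edge_dom T c) s)"
        using AE_not_level Wc.AE_interior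
      proof eventually_elim
        case (elim s)
        show ?case
        proof (cases "s \<in> hdom c")
          case True
          have "real (card (below c)) * real (growth T s) = real m"
            using below_growth[OF c True elim(1)] by (metis of_nat_mult)
          then have "real (card (below c)) * nu_density s = real m * gauss s"
            unfolding nu_density_def by (simp add: mult.assoc[symmetric])
          then have "ennreal (real (card (below c)) * nu_density s) = ennreal (real m * gauss s)" by simp
          then have "of_nat (card (below c)) * ennreal (nu_density s) = of_nat m * ennreal (gauss s)"
            by (simp add: ennreal_mult' ennreal_of_nat_eq_real_of_nat)
          then show ?thesis using True hdom_sub[OF c] by (auto simp: mult.assoc[symmetric])
        next
          case False
          then have "s \<notin> edge_dom T c" using elim hdom_iff[OF c] by blast
          then show ?thesis using False by simp
        qed
      qed
    qed
    also have "\<dots> = of_nat m * (\<integral>\<^sup>+s. ennreal (gauss s) * n c s * indicator (edge_dom T c) s \<partial>lborel)"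
    proof (rule nn_integral_cmult)
      have [measurable]: "(\<lambda>s. indicator (edge_dom T c) s *\<^sub>R v c s) \<in> borel_measurable borel"
        using vm[OF c] Wc.measurable_K_iff by blast
      have eq: "ennreal (gauss s) * n c s * indicator (edge_dom T c) s
          = ennreal (gauss s) * ennreal ((cmod (indicator (edge_dom T c) s *\<^sub>R v c s))\<^sup>2)" for s
        by (auto simp: n_def split: split_indicator)
      show "(\<lambda>s. ennreal (gauss s) * n c s * indicator (edge_dom T c) s) \<in> borel_measurable lborel"
        unfolding eq by measurable
    qed
    also have "(\<integral>\<^sup>+s. ennreal (gauss s) * n c s * indicator (edge_dom T c) s \<partial>lborel) = ennreal (L2.nsq (W c) (v c))"
      unfolding L2_nn_integral[OF v[OF c], symmetric] n_def using vm[OF c] by (subst Wc.nn_integral_K) auto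
    finally show ?thesis .
  qed
  have glue_nn: "(\<integral>\<^sup>+s. ennreal ((cmod (glue v h s))\<^sup>2) \<partial>\<nu>) = (\<Sum>c\<in>ray_way h. Dn c)" if h: "h \<in> rays T" for h
  proof -
    have "(\<integral>\<^sup>+s. ennreal ((cmod (glue v h s))\<^sup>2) \<partial>\<nu>)
        = (\<integral>\<^sup>+s. ennreal (nu_density s) * ennreal ((cmod (glue v h s))\<^sup>2) * indicator {0..} s \<partial>lborel)"
      by (rule \<nu>.nn_integral_K) (use glue_measurable[OF h vm] in measurable)
    also have "\<dots> = (\<integral>\<^sup>+s. (\<Sum>c\<in>ray_way h. ennreal (nu_density s) * (n c s * indicator (hdom c) s)) \<partial>lborel)"
    proof (rule nn_integral_cong)
      fix s
      show "ennreal (nu_density s) * ennreal ((cmod (glue v h s))\<^sup>2) * indicator {0..} s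
          = (\<Sum>c\<in>ray_way h. ennreal (nu_density s) * (n c s * indicator (hdom c) s))"
      proof (cases "0 \<le> s")
        case True
        obtain c where c: "c \<in> ray_way h" "s \<in> hdom c" using ray_way_exists[OF h True] by blast
        have "(\<Sum>d\<in>ray_way h. ennreal (nu_density s) * (n d s * indicator (hdom d) s))
            = (\<Sum>d\<in>ray_way h. if s \<in> hdom d then ennreal (nu_density s) * n d s else 0)"
          by (intro sum.cong) auto
        also have "\<dots> = ennreal (nu_density s) * n c s" by (rule sum_ray_way[OF h c])
        finally show ?thesis using True sum_ray_way[OF h c, of "\<lambda>d. v d s"] by (simp add: glue_def n_def)
      next
        case False
        have "(\<Sum>c\<in>ray_way h. ennreal (nu_density s) * (n c s * indicator (hdom c) s)) = 0"
          using ray_way_edges[OF h] hdom_ge0 False by (intro sum.neutral) (auto split: split_indicator)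
        then show ?thesis using False by simp
      qed
    qed
    also have "\<dots> = (\<Sum>c\<in>ray_way h. \<integral>\<^sup>+s. ennreal (nu_density s) * (n c s * indicator (hdom c) s) \<partial>lborel)"
    proof (rule nn_integral_sum)
      fix c assume "c \<in> ray_way h"
      then have "c \<in> edges T" using ray_way_edges[OF h] by blast
      then show "(\<lambda>s. ennreal (nu_density s) * (n c s * indicator (hdom c) s)) \<in> borel_measurable lborel"
        using nm[of c] by measurable
    qed
    finally show ?thesis by (simp add: Dn_def mult.assoc)
  qed
  have Dn_fin: "Dn c < \<infinity>" if h: "h \<in> rays T" and ch: "c \<in> ray_way h" for c h
  proof -
    have c: "c \<in> edges T" using ray_way_edges[OF h] ch by auto
    have "h \<in> below c" using h ch by (simp add: below_def)
    then have "1 \<le> card (below c)" using finite_below(1)[of c] by (auto simp: Suc_le_eq card_gt_0_iff)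
    then have "(1::ennreal) \<le> of_nat (card (below c))" by (metis of_nat_1 of_nat_mono)
    then have "1 * Dn c \<le> of_nat (card (below c)) * Dn c" by (rule mult_right_mono) simp
    also have "\<dots> = ennreal (real m * L2.nsq (W c) (v c))"
      unfolding below_Dn[OF c] using L2.B_nonneg[OF v[OF c]]
      by (simp add: ennreal_mult' ennreal_of_nat_eq_real_of_nat)
    finally show ?thesis by (simp add: order_le_less_trans)
  qed
  show gL: "glue v h \<in> L2_set \<nu>" if h: "h \<in> rays T" for h
  proof -
    have "(\<integral>\<^sup>+s. ennreal ((cmod (glue v h s))\<^sup>2) \<partial>\<nu>) < \<infinity>"
      unfolding glue_nn[OF h] using Dn_fin[OF h] finite_ray_way by simp
    then show ?thesis
      using glue_measurable[OF h vm] by (auto simp: L2_set_def integrable_iff_bounded)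
  qed
  have "ennreal (\<Sum>h\<in>rays T. L2.nsq \<nu> (glue v h)) = (\<Sum>h\<in>rays T. ennreal (L2.nsq \<nu> (glue v h)))"
    using gL by (intro sum_ennreal[symmetric] L2.B_nonneg)
  also have "\<dots> = (\<Sum>h\<in>rays T. \<Sum>c\<in>edges T. if c \<in> ray_way h then Dn c else 0)"
  proof (rule sum.cong[OF refl])
    fix h assume h: "h \<in> rays T"
    have "(\<Sum>c\<in>edges T. if c \<in> ray_way h then Dn c else 0) = (\<Sum>c\<in>ray_way h. Dn c)"
      using ray_way_edges[OF h] finite_edges by (simp add: sum.inter_restrict[symmetric] Int_absorb1)
    then show "ennreal (L2.nsq \<nu> (glue v h)) = (\<Sum>c\<in>edges T. if c \<in> ray_way h then Dn c else 0)"
      using L2_nn_integral[OF gL[OF h]] glue_nn[OF h] by simp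
  qed
  also have "\<dots> = (\<Sum>c\<in>edges T. \<Sum>h\<in>rays T. if c \<in> ray_way h then Dn c else 0)" by (rule sum.swap)
  also have "\<dots> = (\<Sum>c\<in>edges T. of_nat m * ennreal (L2.nsq (W c) (v c)))"
  proof (rule sum.cong[OF refl])
    fix c assume c: "c \<in> edges T"
    have "(\<Sum>h\<in>rays T. if c \<in> ray_way h then Dn c else 0) = of_nat (card (below c)) * Dn c"
      using finite_rays by (simp add: below_def sum.If_cases Int_def)
    then show "(\<Sum>h\<in>rays T. if c \<in> ray_way h then Dn c else 0) = of_nat m * ennreal (L2.nsq (W c) (v c))"
      using below_Dn[OF c] by simp
  qed
  also have "\<dots> = ennreal (\<Sum>c\<in>edges T. real m * L2.nsq (W c) (v c))"
    using L2.B_nonneg[OF v] by (subst sum_ennreal[symmetric]) (auto simp: ennreal_mult ennreal_of_nat_eq_real_of_nat)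
  finally show "(\<Sum>h\<in>rays T. L2.nsq \<nu> (glue v h)) = real m * (\<Sum>c\<in>edges T. L2.nsq (W c) (v c))"
    using L2.B_nonneg[OF v] L2.B_nonneg[OF gL] by (simp add: sum_nonneg sum_distrib_left)
qed

section \<open>Regularity of functions along the paths\<close>

definition pull :: "(('v, 'e + 'h) point \<Rightarrow> complex) \<Rightarrow> 'e + 'h \<Rightarrow> real \<Rightarrow> complex" where
  "pull f c s = f (edge_point T c s)"

definition dpull :: "(('v, 'e + 'h) point \<Rightarrow> complex) \<Rightarrow> 'e + 'h \<Rightarrow> real \<Rightarrow> complex" where
  "dpull f c = weak_deriv (W c) (pull f c)"

lemma pull_H1: "f \<in> tree_H1 T \<Longrightarrow> c \<in> edges T \<Longrightarrow> pull f c \<in> H1 (W c)"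
  by (simp add: tree_H1_iff pull_def[abs_def])

lemma pull_L2: "f \<in> tree_H1 T \<Longrightarrow> c \<in> edges T \<Longrightarrow> pull f c \<in> L2_set (W c)"
  using weighted_interval.H1_D(1)[OF W_interval pull_H1] .

lemma dpull_L2: "f \<in> tree_H1 T \<Longrightarrow> c \<in> edges T \<Longrightarrow> dpull f c \<in> L2_set (W c)"
  unfolding dpull_def using weighted_interval.H1_D(2)[OF W_interval pull_H1] .

lemma pull_primitive: "f \<in> tree_H1 T \<Longrightarrow> c \<in> edges T \<Longrightarrow> primitive (edge_dom T c) (pull f c) (dpull f c)"
  unfolding dpull_def using weighted_interval.H1_D(3)[OF W_interval pull_H1] .

text \<open>The increment of \<open>f\<close> along the edge \<open>c\<close> as seen from distance
  \<open>s\<close>: zero before the edge, partial on it, complete and constant after it. Integrals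
  of glued derivatives are sums of these.\<close>

definition passed :: "(('v, 'e + 'h) point \<Rightarrow> complex) \<Rightarrow> 'e + 'h \<Rightarrow> real \<Rightarrow> complex" where
  "passed f c s = (LINT r:{0..s}|lborel. if r \<in> hdom c then dpull f c r else 0)"

text \<open>The common computation for distances on an edge and beyond it, with \<open>y\<close> the
  point of the edge that has been reached. The point \<open>y\<close> is exempted in
  \<open>dom\<close> because a half-open edge misses its end, which is a null set.\<close>

lemma passed_aux:
  assumes f: "f \<in> tree_H1 T" and c: "c \<in> edges T" and y: "y \<in> edge_dom T c" "y \<le> s"
    and dom: "\<And>r. r \<noteq> y \<Longrightarrow> r \<le> s \<and> r \<in> hdom c \<longleftrightarrow> r \<in> {depth T (start T c)..y}"
  shows "set_integrable lborel {0..s} (\<lambda>r. if r \<in> hdom c then dpull f c r else 0)"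
    "passed f c s = pull f c y - f (Vertex (start T c))"
proof -
  let ?x = "depth T (start T c)"
  have xy: "?x \<le> y" using y(1) by (cases c) auto
  have p: "set_integrable lborel {?x..y} (dpull f c)" "pull f c y - pull f c ?x = (LINT r:{?x..y}|lborel. dpull f c r)"
    using pull_primitive[OF f c] start_in_dom[OF c] y(1) xy unfolding primitive_def by blast+
  have i: "integrable lborel (\<lambda>r. indicator {?x..y} r *\<^sub>R dpull f c r)"
    using p(1) by (simp add: set_integrable_def)
  have eq: "indicator {?x..y} r *\<^sub>R dpull f c r = indicator {0..s} r *\<^sub>R (if r \<in> hdom c then dpull f c r else 0)"
    if "r \<notin> {y}" for r
    using dom[of r] hdom_ge0[OF c] that by (auto split: split_indicator)
  have int: "integrable lborel (\<lambda>r. indicator {0..s} r *\<^sub>R (if r \<in> hdom c then dpull f c r else 0))"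
    by (rule iffD1[OF integrable_discrete_difference[where X = "{y}"] i]) (use eq in auto)
  then show "set_integrable lborel {0..s} (\<lambda>r. if r \<in> hdom c then dpull f c r else 0)"
    by (simp add: set_integrable_def)
  have "passed f c s = (LINT r:{?x..y}|lborel. dpull f c r)"
    unfolding passed_def set_lebesgue_integral_def
    by (rule integral_discrete_difference[where X = "{y}", symmetric]) (use eq in auto)
  then show "passed f c s = pull f c y - f (Vertex (start T c))"
    using p(2) edge_point_start[OF c] by (simp add: pull_def)
qed

lemma passed_inside:
  assumes f: "f \<in> tree_H1 T" and c: "c \<in> edges T" and s: "s \<in> hdom c"
  shows "set_integrable lborel {0..s} (\<lambda>r. if r \<in> hdom c then dpull f c r else 0)"
    "passed f c s = pull f c s - f (Vertex (start T c))"
proof -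
  have d: "r \<le> s \<and> r \<in> hdom c \<longleftrightarrow> r \<in> {depth T (start T c)..s}" for r
    using s by (cases c) auto
  have "s \<in> edge_dom T c" using s hdom_sub[OF c] by auto
  from passed_aux[OF f c this order_refl d]
  show "set_integrable lborel {0..s} (\<lambda>r. if r \<in> hdom c then dpull f c r else 0)"
    "passed f c s = pull f c s - f (Vertex (start T c))" by auto
qed

lemma passed_before:
  assumes c: "c \<in> edges T" and s: "s < depth T (start T c)"
  shows "set_integrable lborel {0..s} (\<lambda>r. if r \<in> hdom c then dpull f c r else 0)" "passed f c s = 0"
proof -
  have "indicator {0..s} r *\<^sub>R (if r \<in> hdom c then dpull f c r else 0) = 0" for r
    using s by (cases c) (auto split: split_indicator)
  then show "set_integrable lborel {0..s} (\<lambda>r. if r \<in> hdom c then dpull f c r else 0)" "passed f c s = 0"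
    by (simp_all only: set_integrable_def passed_def set_lebesgue_integral_def) auto
qed

lemma passed_after:
  assumes f: "f \<in> tree_H1 T" and e: "e \<in> arcs (graph T)" and s: "depth T (head (graph T) e) \<le> s"
  shows "set_integrable lborel {0..s} (\<lambda>r. if r \<in> hdom (Inl e) then dpull f (Inl e) r else 0)"
    "passed f (Inl e) s = f (Vertex (head (graph T) e)) - f (Vertex (tail (graph T) e))"
proof -
  let ?y = "depth T (head (graph T) e)"
  have c: "Inl e \<in> edges T" using e by (auto simp: edges_def)
  have y: "?y \<in> edge_dom T (Inl e)" using depth_head[OF e] len_pos[OF e] by simp
  have d: "r \<le> s \<and> r \<in> hdom (Inl e) \<longleftrightarrow> r \<in> {depth T (start T (Inl e))..?y}" if "r \<noteq> ?y" for r
    using s that depth_head[OF e] by auto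
  show "set_integrable lborel {0..s} (\<lambda>r. if r \<in> hdom (Inl e) then dpull f (Inl e) r else 0)"
    by (rule passed_aux(1)[OF f c y s d])
  show "passed f (Inl e) s = f (Vertex (head (graph T) e)) - f (Vertex (tail (graph T) e))"
    using passed_aux(2)[OF f c y s d] edge_point_end[OF e] by (simp add: pull_def)
qed

lemma passed_integrable:
  assumes f: "f \<in> tree_H1 T" and c: "c \<in> edges T"
  shows "set_integrable lborel {0..s} (\<lambda>r. if r \<in> hdom c then dpull f c r else 0)"
proof -
  consider "s < depth T (start T c)" | "s \<in> hdom c"
    | e where "c = Inl e" "e \<in> arcs (graph T)" "depth T (head (graph T) e) \<le> s"
    using c depth_head by (cases c) (force simp: edges_def not_less)+
  then show ?thesis
    using passed_before(1)[OF c] passed_inside(1)[OF f c] passed_after(1)[OF f] by cases blast+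
qed

text \<open>Telescoping of increments. The two claims need each other in the induction: the vertex
  value reached at the tail is the initial value on the next edge. The step works because all edges
  at a vertex share the value of \<open>f\<close> there, and the second claim holds for every larger
  \<open>s\<close> because a completed increment stays constant.\<close>

lemma way_value:
  assumes f: "f \<in> tree_H1 T" and v: "v \<in> verts (graph T)"
  shows "(\<forall>s\<in>{0..<depth T v}. (\<Sum>c\<in>way v. if s \<in> hdom c then pull f c s else 0) = f (Vertex (root T)) + (\<Sum>c\<in>way v. passed f c s)) \<and>
    (\<forall>s\<ge>depth T v. f (Vertex v) = f (Vertex (root T)) + (\<Sum>c\<in>way v. passed f c s))"
  using v
proof (induction rule: vertex_induct)
  case root
  then show ?case by (simp add: way_root depth_root)
next
  case (arc e)
  let ?u = "tail (graph T) e" and ?v = "head (graph T) e"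
  have e: "e \<in> arcs (graph T)" by (rule arc.hyps)
  have c: "Inl e \<in> edges T" using e by (auto simp: edges_def)
  have u: "?u \<in> verts (graph T)" using e by simp
  have uv: "depth T ?u < depth T ?v" using depth_head[OF e] len_pos[OF e] by simp
  have hd: "hdom (Inl e) = {depth T ?u..<depth T ?v}" using depth_head[OF e] by simp
  have sum: "(\<Sum>c\<in>way ?v. F c) = F (Inl e) + (\<Sum>c\<in>way ?u. F c)" for F :: "_ \<Rightarrow> complex"
    using way_head[OF e] finite_way arc_notin_way[OF e] by simp
  show ?case
  proof (intro conjI ballI allI impI)
    fix s assume s: "s \<in> {0..<depth T ?v}"
    show "(\<Sum>c\<in>way ?v. if s \<in> hdom c then pull f c s else 0) = f (Vertex (root T)) + (\<Sum>c\<in>way ?v. passed f c s)"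
    proof (cases "s < depth T ?u")
      case True
      then have "(\<Sum>c\<in>way ?u. if s \<in> hdom c then pull f c s else 0) = f (Vertex (root T)) + (\<Sum>c\<in>way ?u. passed f c s)"
        using arc.IH s by simp
      moreover have "s \<notin> hdom (Inl e)" using True hd by simp
      moreover have "passed f (Inl e) s = 0" using passed_before(2)[OF c] True by simp
      ultimately show ?thesis by (simp only: sum) simp
    next
      case False
      then have "f (Vertex ?u) = f (Vertex (root T)) + (\<Sum>c\<in>way ?u. passed f c s)" using arc.IH by simp
      moreover have se: "s \<in> hdom (Inl e)" using False s hd by simp
      moreover have "passed f (Inl e) s = pull f (Inl e) s - f (Vertex ?u)" using passed_inside(2)[OF f c se] by simp
      moreover have "(\<Sum>c\<in>way ?u. if s \<in> hdom c then pull f c s else 0) = 0"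
        using way_hdom[OF u] False by (intro sum.neutral) force
      ultimately show ?thesis by (simp only: sum) simp
    qed
  next
    fix s assume s: "depth T ?v \<le> s"
    have "f (Vertex ?u) = f (Vertex (root T)) + (\<Sum>c\<in>way ?u. passed f c s)" using arc.IH s uv by simp
    moreover have "passed f (Inl e) s = f (Vertex ?v) - f (Vertex ?u)" by (rule passed_after(2)[OF f e s])
    ultimately show "f (Vertex ?v) = f (Vertex (root T)) + (\<Sum>c\<in>way ?v. passed f c s)" by (simp only: sum) simp
  qed
qed

lemma glue_value:
  assumes f: "f \<in> tree_H1 T" and h: "h \<in> rays T" and s: "0 \<le> s"
  shows "glue (pull f) h s = f (Vertex (root T)) + (LINT r:{0..s}|lborel. glue (dpull f) h r)"
    "set_integrable lborel {0..s} (glue (dpull f) h)"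
proof -
  let ?u = "foot T h"
  have c: "Inr h \<in> edges T" using h by (auto simp: edges_def)
  have u: "?u \<in> verts (graph T)" by (rule foot_in[OF h])
  have nin: "Inr h \<notin> way ?u" by (auto simp: way_def)
  have sum: "(\<Sum>c\<in>ray_way h. F c) = F (Inr h) + (\<Sum>c\<in>way ?u. F c)" for F :: "_ \<Rightarrow> complex"
    using nin finite_way by (simp add: ray_way_def)
  have int: "set_integrable lborel {0..s} (\<lambda>r. if r \<in> hdom c then dpull f c r else 0)" if "c \<in> ray_way h" for c
    using that ray_way_edges[OF h] by (intro passed_integrable f) auto
  have eq: "indicator {0..s} r *\<^sub>R glue (dpull f) h r
      = (\<Sum>c\<in>ray_way h. indicator {0..s} r *\<^sub>R (if r \<in> hdom c then dpull f c r else 0))" for r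
    by (simp add: glue_def scaleR_sum_right)
  show "set_integrable lborel {0..s} (glue (dpull f) h)"
    unfolding set_integrable_def eq using int by (intro Bochner_Integration.integrable_sum) (simp add: set_integrable_def)
  have "(LINT r:{0..s}|lborel. glue (dpull f) h r) = (\<Sum>c\<in>ray_way h. passed f c s)"
    unfolding set_lebesgue_integral_def eq passed_def using int
    by (intro Bochner_Integration.integral_sum) (simp add: set_integrable_def)
  moreover have "glue (pull f) h s = f (Vertex (root T)) + (\<Sum>c\<in>ray_way h. passed f c s)"
  proof (cases "s < depth T ?u")
    case True
    then have "(\<Sum>c\<in>way ?u. if s \<in> hdom c then pull f c s else 0) = f (Vertex (root T)) + (\<Sum>c\<in>way ?u. passed f c s)"
      using way_value[OF f u] s by simp
    moreover have "s \<notin> hdom (Inr h)" using True by simp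
    moreover have "passed f (Inr h) s = 0" using passed_before(2)[OF c] True by simp
    ultimately show ?thesis unfolding glue_def by (simp only: sum) simp
  next
    case False
    then have "f (Vertex ?u) = f (Vertex (root T)) + (\<Sum>c\<in>way ?u. passed f c s)" using way_value[OF f u] by simp
    moreover have se: "s \<in> hdom (Inr h)" using False by simp
    moreover have "passed f (Inr h) s = pull f (Inr h) s - f (Vertex ?u)" using passed_inside(2)[OF f c se] by simp
    moreover have "(\<Sum>c\<in>way ?u. if s \<in> hdom c then pull f c s else 0) = 0"
      using way_hdom[OF u] False by (intro sum.neutral) force
    ultimately show ?thesis unfolding glue_def by (simp only: sum) simp
  qed
  ultimately show "glue (pull f) h s = f (Vertex (root T)) + (LINT r:{0..s}|lborel. glue (dpull f) h r)" by simp
qed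

text \<open>The root value is the only constant in \<open>glue_value\<close> and cancels in
  differences, so no vertex on the path contributes a jump.\<close>

lemma glue_primitive:
  assumes f: "f \<in> tree_H1 T" and h: "h \<in> rays T"
  shows "primitive {0..} (glue (pull f) h) (glue (dpull f) h)"
  unfolding primitive_def
proof (intro ballI impI conjI)
  fix x y :: real assume xy: "x \<in> {0..}" "y \<in> {0..}" "x \<le> y"
  have x0: "0 \<le> x" and y0: "0 \<le> y" using xy by auto
  show "set_integrable lborel {x..y} (glue (dpull f) h)"
    using glue_value(2)[OF f h y0] by (rule set_integrable_subset) (use x0 in auto)
  show "glue (pull f) h y - glue (pull f) h x = (LINT s:{x..y}|lborel. glue (dpull f) h s)"
    using set_integral_combine[OF x0 xy(3) glue_value(2)[OF f h y0]]
    by (simp add: glue_value(1)[OF f h x0] glue_value(1)[OF f h y0])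
qed

lemma glue_H1:
  assumes f: "f \<in> tree_H1 T" and h: "h \<in> rays T"
  shows "glue (pull f) h \<in> H1 \<nu>" "L2.nsq \<nu> (weak_deriv \<nu> (glue (pull f) h)) = L2.nsq \<nu> (glue (dpull f) h)"
    "glue (pull f) h 0 = f (Vertex (root T))"
proof -
  interpret \<nu>: weighted_interval "{0..}" 0 nu_density growth_max by (rule \<nu>_interval)
  have L: "glue (pull f) h \<in> L2_set \<nu>" "glue (dpull f) h \<in> L2_set \<nu>"
    using glue_isometry(1)[of "pull f" h] glue_isometry(1)[of "dpull f" h] pull_L2[OF f] dpull_L2[OF f] h by auto
  note H = \<nu>.H1_I[OF L glue_primitive[OF f h]]
  show "glue (pull f) h \<in> H1 \<nu>" by (rule H(1))
  show "L2.nsq \<nu> (weak_deriv \<nu> (glue (pull f) h)) = L2.nsq \<nu> (glue (dpull f) h)"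
    by (rule \<nu>.nsq_cong_AE[OF \<nu>.H1_D(2)[OF H(1)] L(2) H(2)])
  show "glue (pull f) h 0 = f (Vertex (root T))" using glue_value(1)[OF f h order_refl] by simp
qed

end

section \<open>Bracketing\<close>

context reg_tree
begin

lemma tree_compact: "Z \<subseteq> {Vertex (root T)} \<Longrightarrow> compact_form (tree_mu T) (tree_dom Z) (tree_form T)"
  by (rule network.compact_form[OF tree_network])

lemma red_compact: "0 \<le> x \<Longrightarrow> Z \<subseteq> {x} \<Longrightarrow> compact_form (nu_from T x) (red_dom x Z) (reduced_form T x)"
  by (rule network.compact_form[OF red_network])

lemma tree_nsq:
  assumes "f \<in> tree_H1 T"
  shows "L2.nsq (tree_mu T) f = (\<Sum>c\<in>edges T. L2.nsq (W c) (pull f c))"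
    and "Re (tree_form T f f) = 1 / 2 * (\<Sum>c\<in>edges T. L2.nsq (W c) (dpull f c))"
proof -
  note nw = tree_network[OF empty_subsetI]
  have D: "f \<in> tree_dom {}" using assms by (simp add: tree_dom_def)
  have "f \<in> L2_set (tree_mu T)" using network.D_subset[OF nw] D by blast
  then show "L2.nsq (tree_mu T) f = (\<Sum>c\<in>edges T. L2.nsq (W c) (pull f c))"
    unfolding pull_def[abs_def] by (rule network.nsq_sum[OF nw])
  show "Re (tree_form T f f) = 1 / 2 * (\<Sum>c\<in>edges T. L2.nsq (W c) (dpull f c))"
    unfolding dpull_def pull_def[abs_def] by (rule network.nsq_a[OF nw D])
qed

lemma red_form_eq: "0 \<le> x \<Longrightarrow> Re (reduced_form T x \<phi> \<phi>)
    = 1 / 2 * L2.nsq (weighted {x..} nu_density) (weak_deriv (weighted {x..} nu_density) \<phi>)"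
  by (simp add: reduced_form_def L2_inner_def nu_from_weighted)

lemma glue_norms:
  assumes f: "f \<in> tree_H1 T"
  shows "(\<Sum>h\<in>rays T. L2.nsq (nu_from T 0) (glue (pull f) h)) = real m * L2.nsq (tree_mu T) f"
    "(\<Sum>h\<in>rays T. Re (reduced_form T 0 (glue (pull f) h) (glue (pull f) h))) = real m * Re (tree_form T f f)"
proof -
  show "(\<Sum>h\<in>rays T. L2.nsq (nu_from T 0) (glue (pull f) h)) = real m * L2.nsq (tree_mu T) f"
    using glue_isometry(2)[of "pull f"] pull_L2[OF f] by (simp add: tree_nsq(1)[OF f] nu_from_weighted)
  have "(\<Sum>h\<in>rays T. Re (reduced_form T 0 (glue (pull f) h) (glue (pull f) h)))
      = (\<Sum>h\<in>rays T. 1 / 2 * L2.nsq \<nu> (glue (dpull f) h))"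
    by (intro sum.cong refl) (simp only: red_form_eq[OF order_refl] glue_H1(2)[OF f])
  also have "\<dots> = 1 / 2 * (real m * (\<Sum>c\<in>edges T. L2.nsq (W c) (dpull f c)))"
    unfolding sum_distrib_left[symmetric] using glue_isometry(2)[of "dpull f"] dpull_L2[OF f] by simp
  finally show "(\<Sum>h\<in>rays T. Re (reduced_form T 0 (glue (pull f) h) (glue (pull f) h))) = real m * Re (tree_form T f f)"
    by (simp add: tree_nsq(2)[OF f])
qed

lemma glue_sum: "glue (pull (\<lambda>x. \<Sum>i\<in>I. c i * e i x)) h = (\<lambda>s. \<Sum>i\<in>I. c i * glue (pull (e i)) h s)"
proof
  fix s
  have "glue (pull (\<lambda>x. \<Sum>i\<in>I. c i * e i x)) h s
      = (\<Sum>d\<in>ray_way h. \<Sum>i\<in>I. c i * (if s \<in> hdom d then pull (e i) d s else 0))"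
    unfolding glue_def by (intro sum.cong refl) (simp add: pull_def)
  also have "\<dots> = (\<Sum>i\<in>I. \<Sum>d\<in>ray_way h. c i * (if s \<in> hdom d then pull (e i) d s else 0))"
    by (rule sum.swap)
  finally show "glue (pull (\<lambda>x. \<Sum>i\<in>I. c i * e i x)) h s = (\<Sum>i\<in>I. c i * glue (pull (e i)) h s)"
    by (simp add: glue_def sum_distrib_left)
qed

text \<open>Bounds the number of orthogonality conditions in both bracketing arguments. The strict
  inequality leaves out every index from \<open>k\<close> on, also those with the same
  eigenvalue.\<close>

lemma finite_index_below:
  assumes "mono_on {1..} (lam :: nat \<Rightarrow> real)" "1 \<le> k"
  shows "{i. 1 \<le> i \<and> lam i < lam k} \<subseteq> {1..<k}"
proof
  fix i assume i: "i \<in> {i. 1 \<le> i \<and> lam i < lam k}"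
  show "i \<in> {1..<k}"
  proof (rule ccontr)
    assume "i \<notin> {1..<k}"
    then have "lam k \<le> lam i" using i assms by (intro mono_onD[OF assms(1)]) auto
    then show False using i by simp
  qed
qed

text \<open>Lower bound: restricting to the paths embeds the form of the tree into \<open>m\<close> copies of the
  reduced one.\<close>

lemma lower_bound:
  assumes Z: "Z \<subseteq> {Vertex (root T)}" "Z' \<subseteq> {0}" "Z' = {} \<or> Z = {Vertex (root T)}"
    and lam: "eigenvalue_sequence (tree_mu T) (form_operator (tree_mu T) (tree_dom Z) (tree_form T)) lam"
    and red: "eigenvalue_sequence (nu_from T 0) (form_operator (nu_from T 0) (red_dom 0 Z') (reduced_form T 0)) red"
    and n: "1 \<le> n"
  shows "red n \<le> lam (m * (n - 1) + 1)"
proof -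
  interpret tr: compact_form "tree_mu T" "tree_dom Z" "tree_form T" by (rule tree_compact[OF Z(1)])
  interpret rd: compact_form "nu_from T 0" "red_dom 0 Z'" "reduced_form T 0" by (rule red_compact[OF order_refl Z(2)])
  have mono: "mono_on {1..} lam" "mono_on {1..} red"
    using lam red unfolding eigenvalue_sequence_def by blast+
  show ?thesis
  proof (rule tr.variational[OF lam], rule rd.variational[OF red])
    fix e \<epsilon>
    assume eD: "\<And>i. 1 \<le> i \<Longrightarrow> e i \<in> tree_dom Z"
      and e_le: "\<And>I c \<Lambda>. finite I \<Longrightarrow> (\<And>i. i \<in> I \<Longrightarrow> 1 \<le> i \<and> lam i \<le> \<Lambda>) \<Longrightarrow>
        tr.nsq (\<lambda>x. \<Sum>i\<in>I. c i * e i x) \<le> \<Lambda> * L2.nsq (tree_mu T) (\<lambda>x. \<Sum>i\<in>I. c i * e i x)"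
      and e_pos: "\<And>I c k. finite I \<Longrightarrow> (\<And>i. i \<in> I \<Longrightarrow> 1 \<le> i) \<Longrightarrow> k \<in> I \<Longrightarrow> c k \<noteq> 0 \<Longrightarrow>
        0 < L2.nsq (tree_mu T) (\<lambda>x. \<Sum>i\<in>I. c i * e i x)"
      and \<epsilon>D: "\<And>i. 1 \<le> i \<Longrightarrow> \<epsilon> i \<in> red_dom 0 Z'"
      and \<epsilon>_ge: "\<And>f \<Lambda>. finite {i. 1 \<le> i \<and> red i < \<Lambda>} \<Longrightarrow> f \<in> red_dom 0 Z' \<Longrightarrow>
        (\<And>i. 1 \<le> i \<Longrightarrow> red i < \<Lambda> \<Longrightarrow> rd.ip f (\<epsilon> i) = 0) \<Longrightarrow> \<Lambda> * L2.nsq (nu_from T 0) f \<le> rd.nsq f"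
    define k where "k = m * (n - 1) + 1"
    define I where "I = {1..k}"
    define J where "J = {i. 1 \<le> i \<and> red i < red n}"
    have J: "J \<subseteq> {1..<n}" unfolding J_def by (rule finite_index_below[OF mono(2) n])
    have finJ: "finite J" using J by (rule finite_subset) simp
    have "card J \<le> n - 1" using card_mono[OF _ J] by simp
    then have "card (rays T \<times> J) < card I"
      using m_card by (simp add: I_def k_def card_cartesian_product less_Suc_eq_le)
    \<comment> \<open>The unknowns are the coefficients of the first \<open>k\<close> eigenfunctions
      on the tree; there is one equation for every path and every reduced eigenfunction below
      \<open>red n\<close>.\<close>
    then obtain c where c: "\<exists>i\<in>I. c i \<noteq> 0"
      "\<And>h j. h \<in> rays T \<Longrightarrow> j \<in> J \<Longrightarrow> (\<Sum>i\<in>I. c i * rd.ip (glue (pull (e i)) h) (\<epsilon> j)) = 0"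
      using underdetermined_system[of "rays T \<times> J" I "\<lambda>(h, j) i. rd.ip (glue (pull (e i)) h) (\<epsilon> j)"]
        finite_rays finJ by (auto simp: I_def)
    define f where "f = (\<lambda>x. \<Sum>i\<in>I. c i * e i x)"
    have I1: "1 \<le> i" if "i \<in> I" for i using that by (simp add: I_def)
    have fD: "f \<in> tree_dom Z" unfolding f_def using eD I1 by (intro tr.sum_mem tr.scale) auto
    then have fH: "f \<in> tree_H1 T" by (simp add: tree_dom_def)
    \<comment> \<open>A Dirichlet condition at 0 on the reduced side must be inherited from the one
      at the root, whence the alternative in the assumption on \<open>Z'\<close> and
      \<open>Z\<close>.\<close>
    have glueD: "glue (pull g) h \<in> red_dom 0 Z'" if g: "g \<in> tree_dom Z" and h: "h \<in> rays T" for g h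
    proof -
      have "g \<in> tree_H1 T" "\<forall>z\<in>Z. g z = 0" using g by (auto simp: tree_dom_def)
      then show ?thesis using glue_H1(1)[of g h] glue_H1(3)[of g h] h Z(2,3) by (auto simp: red_dom_def nu_from_weighted)
    qed
    have low: "red n * L2.nsq (nu_from T 0) (glue (pull f) h) \<le> rd.nsq (glue (pull f) h)" if h: "h \<in> rays T" for h
    proof (rule \<epsilon>_ge)
      show "finite {i. 1 \<le> i \<and> red i < red n}" using finJ by (simp add: J_def)
      show "glue (pull f) h \<in> red_dom 0 Z'" by (rule glueD[OF fD h])
      fix j assume j: "1 \<le> j" "red j < red n"
      have "rd.ip (glue (pull f) h) (\<epsilon> j) = (\<Sum>i\<in>I. c i * rd.ip (glue (pull (e i)) h) (\<epsilon> j))"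
        unfolding f_def glue_sum using glueD[OF eD[OF I1] h] \<epsilon>D[OF j(1)] rd.D_L2
        by (subst L2.B_sum) (auto simp: L2.B_scale L2.scale subset_iff)
      then show "rd.ip (glue (pull f) h) (\<epsilon> j) = 0" using c(2)[OF h, of j] j by (simp add: J_def)
    qed
    have "real m * (red n * L2.nsq (tree_mu T) f) = (\<Sum>h\<in>rays T. red n * L2.nsq (nu_from T 0) (glue (pull f) h))"
      by (simp add: glue_norms(1)[OF fH] sum_distrib_left[symmetric])
    also have "\<dots> \<le> (\<Sum>h\<in>rays T. rd.nsq (glue (pull f) h))" by (intro sum_mono low)
    also have "\<dots> = real m * tr.nsq f" by (rule glue_norms(2)[OF fH])
    finally have "red n * L2.nsq (tree_mu T) f \<le> tr.nsq f" using m_pos by simp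
    also have "tr.nsq f \<le> lam k * L2.nsq (tree_mu T) f"
      unfolding f_def
    proof (rule e_le)
      show "1 \<le> i \<and> lam i \<le> lam k" if "i \<in> I" for i
        using that mono_onD[OF mono(1), of i k] by (auto simp: I_def)
    qed (simp add: I_def)
    finally have "red n * L2.nsq (tree_mu T) f \<le> lam k * L2.nsq (tree_mu T) f" .
    moreover obtain i where "i \<in> I" "c i \<noteq> 0" using c(1) by blast
    then have "0 < L2.nsq (tree_mu T) f"
      unfolding f_def using I1 by (intro e_pos[of I i c]) (auto simp: I_def)
    ultimately show ?thesis by (simp add: k_def)
  qed
qed

section \<open>Trial functions supported on half-lines\<close>

definition on_rays :: "('h \<Rightarrow> real \<Rightarrow> complex) \<Rightarrow> ('v, 'e + 'h) point \<Rightarrow> complex" where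
  "on_rays \<phi> x = (case x of Vertex v \<Rightarrow> 0 | Inner c s \<Rightarrow> (case c of Inl e \<Rightarrow> 0 | Inr h \<Rightarrow> \<phi> h s))"

abbreviation \<nu>\<^sub>N where "\<nu>\<^sub>N \<equiv> weighted {t N..} nu_density"

lemma tN_ge0: "0 \<le> t N" by (rule t_nonneg) simp

lemma \<nu>\<^sub>N_interval: "weighted_interval {t N..} (t N) nu_density growth_max"
  by (rule weighted_nu[OF tN_ge0])

lemma gauss_interval: "weighted_interval {t N..} (t N) gauss 1"
proof -
  obtain h where h: "h \<in> rays T" using rays_ne by blast
  then have "Inr h \<in> edges T" by (auto simp: edges_def)
  from W_interval[OF this] depth_foot[OF h] show ?thesis by simp
qed

lemma edge_dom_ray: "h \<in> rays T \<Longrightarrow> edge_dom T (Inr h) = {t N..}"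
  by (simp add: depth_foot)

text \<open>Beyond the last level only the half-lines are left, so the growth is constantly
  \<open>m\<close>. The level itself is excluded because \<open>growth\<close> counts the vertices
  there.\<close>

lemma nu_density_ray: "t N < s \<Longrightarrow> nu_density s = real m * gauss s"
proof -
  assume s: "t N < s"
  have "s \<notin> t ` {..N}" using s t_le_N by force
  moreover have "0 \<le> s" using s tN_ge0 by simp
  ultimately have "growth T s * B s = m" by (rule growth_B[rotated])
  moreover have "{i. i \<le> N \<and> s < t i} = {}" using s t_le_N by force
  then have "B s = 1" by (simp only: B_def) simp
  ultimately show ?thesis by (simp add: nu_density_def)
qed

lemma nu_ray_scaling:
  shows "f \<in> L2_set \<nu>\<^sub>N \<longleftrightarrow> f \<in> L2_set (weighted {t N..} gauss)"
    "f \<in> L2_set \<nu>\<^sub>N \<Longrightarrow> L2.nsq \<nu>\<^sub>N f = real m * L2.nsq (weighted {t N..} gauss) f"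
proof -
  interpret n: weighted_interval "{t N..}" "t N" nu_density growth_max by (rule \<nu>\<^sub>N_interval)
  interpret g: weighted_interval "{t N..}" "t N" gauss 1 by (rule gauss_interval)
  have meas: "h \<in> borel_measurable \<nu>\<^sub>N \<longleftrightarrow> h \<in> borel_measurable (weighted {t N..} gauss)" for h :: "real \<Rightarrow> 'z::real_normed_vector"
    by (simp add: n.measurable_K_iff g.measurable_K_iff)
  have nn: "(\<integral>\<^sup>+s. ennreal ((cmod (f s))\<^sup>2) \<partial>\<nu>\<^sub>N) = of_nat m * (\<integral>\<^sup>+s. ennreal ((cmod (f s))\<^sup>2) \<partial>weighted {t N..} gauss)"
    if fm: "f \<in> borel_measurable \<nu>\<^sub>N" for f
  proof -
    have [measurable]: "(\<lambda>s. indicator {t N..} s *\<^sub>R f s) \<in> borel_measurable borel"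
      using fm by (simp only: n.measurable_K_iff)
    have fg: "f \<in> borel_measurable (weighted {t N..} gauss)" using fm meas by blast
    have eq: "ennreal (gauss s) * ennreal ((cmod (f s))\<^sup>2) * indicator {t N..} s
        = ennreal (gauss s) * ennreal ((cmod (indicator {t N..} s *\<^sub>R f s))\<^sup>2)" for s
      by (auto split: split_indicator)
    have "(\<integral>\<^sup>+s. ennreal ((cmod (f s))\<^sup>2) \<partial>\<nu>\<^sub>N)
        = (\<integral>\<^sup>+s. ennreal (nu_density s) * ennreal ((cmod (f s))\<^sup>2) * indicator {t N..} s \<partial>lborel)"
      by (rule n.nn_integral_K) (use fm in measurable)
    also have "\<dots> = (\<integral>\<^sup>+s. of_nat m * (ennreal (gauss s) * ennreal ((cmod (f s))\<^sup>2) * indicator {t N..} s) \<partial>lborel)"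
    proof (rule nn_integral_cong_AE)
      have "ennreal (nu_density s) * ennreal ((cmod (f s))\<^sup>2) * indicator {t N..} s
          = of_nat m * (ennreal (gauss s) * ennreal ((cmod (f s))\<^sup>2) * indicator {t N..} s)" if "s \<noteq> t N" for s
      proof (cases "t N < s")
        case True
        then show ?thesis
          using gauss_pos[of s] by (simp add: nu_density_ray ennreal_mult ennreal_of_nat_eq_real_of_nat mult.assoc)
      qed (use that in simp)
      then show "AE s in lborel. ennreal (nu_density s) * ennreal ((cmod (f s))\<^sup>2) * indicator {t N..} s
          = of_nat m * (ennreal (gauss s) * ennreal ((cmod (f s))\<^sup>2) * indicator {t N..} s)"
        using AE_lborel_singleton[of "t N"] by (auto elim: eventually_mono)
    qed
    also have "\<dots> = of_nat m * (\<integral>\<^sup>+s. ennreal (gauss s) * ennreal ((cmod (f s))\<^sup>2) * indicator {t N..} s \<partial>lborel)"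
      unfolding eq by (rule nn_integral_cmult) measurable
    also have "(\<integral>\<^sup>+s. ennreal (gauss s) * ennreal ((cmod (f s))\<^sup>2) * indicator {t N..} s \<partial>lborel)
        = (\<integral>\<^sup>+s. ennreal ((cmod (f s))\<^sup>2) \<partial>weighted {t N..} gauss)"
      by (rule g.nn_integral_K[symmetric]) (use fg in measurable)
    finally show ?thesis .
  qed
  show iff: "f \<in> L2_set \<nu>\<^sub>N \<longleftrightarrow> f \<in> L2_set (weighted {t N..} gauss)"
  proof (cases "f \<in> borel_measurable \<nu>\<^sub>N")
    case True
    have fg: "f \<in> borel_measurable (weighted {t N..} gauss)" using True meas by blast
    have "(\<integral>\<^sup>+s. ennreal ((cmod (f s))\<^sup>2) \<partial>\<nu>\<^sub>N) < \<infinity> \<longleftrightarrow> (\<integral>\<^sup>+s. ennreal ((cmod (f s))\<^sup>2) \<partial>weighted {t N..} gauss) < \<infinity>"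
      unfolding nn[OF True] using m_pos by (auto simp: ennreal_mult_less_top ennreal_of_nat_eq_real_of_nat)
    then show ?thesis using True fg by (auto simp: L2_set_def integrable_iff_bounded)
  next
    case False
    then show ?thesis using meas by (auto simp: L2_set_def)
  qed
  assume f: "f \<in> L2_set \<nu>\<^sub>N"
  have fg: "f \<in> L2_set (weighted {t N..} gauss)" using f iff by blast
  have "ennreal (L2.nsq \<nu>\<^sub>N f) = ennreal (real m * L2.nsq (weighted {t N..} gauss) f)"
    using nn[of f] f L2_nn_integral[OF f] L2_nn_integral[OF fg] L2.B_nonneg[OF fg]
    by (simp add: L2_set_def ennreal_mult ennreal_of_nat_eq_real_of_nat)
  then show "L2.nsq \<nu>\<^sub>N f = real m * L2.nsq (weighted {t N..} gauss) f"
    using L2.B_nonneg[OF f] L2.B_nonneg[OF fg] by simp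
qed

lemma weak_deriv_nu_ray: "weak_deriv \<nu>\<^sub>N f = weak_deriv (weighted {t N..} gauss) f"
  unfolding weak_deriv_def
  using weighted_interval.space_K[OF \<nu>\<^sub>N_interval] weighted_interval.space_K[OF gauss_interval] by simp

lemma H1_nu_ray: "f \<in> H1 \<nu>\<^sub>N \<longleftrightarrow> f \<in> H1 (weighted {t N..} gauss)"
  unfolding H1_def
  using weighted_interval.space_K[OF \<nu>\<^sub>N_interval] weighted_interval.space_K[OF gauss_interval]
  by (auto simp: nu_ray_scaling(1))

text \<open>Vanishing at \<open>t N\<close> is what makes the extension by 0 continuous at the feet;
  this forces the Dirichlet condition on the reduced operator of the upper bound.\<close>

lemma pull_on_rays:
  assumes \<phi>: "\<And>h. h \<in> rays T \<Longrightarrow> \<phi> h (t N) = 0"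
  shows "pull (on_rays \<phi>) (Inl e) = (\<lambda>s. 0)" "h \<in> rays T \<Longrightarrow> pull (on_rays \<phi>) (Inr h) = \<phi> h"
  using \<phi>[of h] depth_foot[of h] by (auto simp: pull_def on_rays_def)

text \<open>The factor \<open>m\<close> is the constant growth beyond the last level: the reduced
  operator weights one half-line with \<open>m\<close> times its Gaussian weight in the
  tree.\<close>

lemma on_rays_H1:
  assumes \<phi>: "\<And>h. h \<in> rays T \<Longrightarrow> \<phi> h \<in> red_dom (t N) {t N}"
  shows "on_rays \<phi> \<in> tree_H1 T"
    "real m * L2.nsq (tree_mu T) (on_rays \<phi>) = (\<Sum>h\<in>rays T. L2.nsq (nu_from T (t N)) (\<phi> h))"
    "real m * Re (tree_form T (on_rays \<phi>) (on_rays \<phi>)) = (\<Sum>h\<in>rays T. Re (reduced_form T (t N) (\<phi> h) (\<phi> h)))"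
proof -
  have \<phi>H: "\<phi> h \<in> H1 \<nu>\<^sub>N" and \<phi>0: "\<phi> h (t N) = 0" if "h \<in> rays T" for h
    using \<phi>[OF that] by (auto simp: red_dom_def nu_from_weighted[OF tN_ge0])
  have pl: "pull (on_rays \<phi>) (Inl e) = (\<lambda>s. 0)" "h \<in> rays T \<Longrightarrow> pull (on_rays \<phi>) (Inr h) = \<phi> h" for e h
    by (rule pull_on_rays, erule \<phi>0, assumption?)+
  have Wr: "W (Inr h) = weighted {t N..} gauss" if "h \<in> rays T" for h
    using edge_dom_ray[OF that] by simp
  have "pull (on_rays \<phi>) c \<in> H1 (W c)" if c: "c \<in> edges T" for c
  proof (cases c)
    case (Inl e)
    then show ?thesis using weighted_interval.H1_zero[OF W_interval[OF c]] by (simp add: pl(1))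
  next
    case (Inr h)
    then have h: "h \<in> rays T" using c by (auto simp: edges_def)
    show ?thesis using \<phi>H[OF h] H1_nu_ray unfolding Inr pl(2)[OF h] Wr[OF h] by blast
  qed
  then show H: "on_rays \<phi> \<in> tree_H1 T" by (simp add: tree_H1_iff pull_def[abs_def])
  have sum: "(\<Sum>c\<in>edges T. F c) = (\<Sum>e\<in>arcs (graph T). F (Inl e)) + (\<Sum>h\<in>rays T. F (Inr h))" for F :: "_ \<Rightarrow> real"
    unfolding edges_def using finite_rays by (subst sum.Plus) auto
  have zero: "L2.nsq (W (Inl e)) (\<lambda>s. 0) = 0" for e by (simp add: L2_inner_def)
  \<comment> \<open>Needs an argument because \<open>weak_deriv\<close> of the zero function is an
    arbitrary choice and vanishes only almost everywhere.\<close>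
  have dzero: "L2.nsq (W (Inl e)) (weak_deriv (W (Inl e)) (\<lambda>s. 0)) = 0" if e: "e \<in> arcs (graph T)" for e
  proof -
    have c: "Inl e \<in> edges T" using e by (auto simp: edges_def)
    note W = weighted_interval.H1_zero[OF W_interval[OF c]]
    have "L2.nsq (W (Inl e)) (weak_deriv (W (Inl e)) (\<lambda>s. 0)) = L2.nsq (W (Inl e)) (\<lambda>s. 0)"
      by (intro weighted_interval.nsq_cong_AE[OF W_interval[OF c]] weighted_interval.H1_D(2)[OF W_interval[OF c] W] L2.zero
          weighted_interval.H1_I(2)[OF W_interval[OF c]]) (auto simp: L2.zero primitive_def set_integrable_def)
    then show ?thesis using zero by simp
  qed
  have hL: "\<phi> h \<in> L2_set \<nu>\<^sub>N" "weak_deriv \<nu>\<^sub>N (\<phi> h) \<in> L2_set \<nu>\<^sub>N" if "h \<in> rays T" for h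
    using weighted_interval.H1_D(1,2)[OF \<nu>\<^sub>N_interval \<phi>H[OF that]] by auto
  show "real m * L2.nsq (tree_mu T) (on_rays \<phi>) = (\<Sum>h\<in>rays T. L2.nsq (nu_from T (t N)) (\<phi> h))"
  proof -
    have "L2.nsq (tree_mu T) (on_rays \<phi>) = (\<Sum>h\<in>rays T. L2.nsq (weighted {t N..} gauss) (\<phi> h))"
      unfolding tree_nsq(1)[OF H] sum pl(1) zero by (simp add: pl(2) Wr del: edge_dom.simps)
    then show ?thesis
      using nu_ray_scaling(2)[OF hL(1)] by (simp add: sum_distrib_left nu_from_weighted[OF tN_ge0])
  qed
  show "real m * Re (tree_form T (on_rays \<phi>) (on_rays \<phi>)) = (\<Sum>h\<in>rays T. Re (reduced_form T (t N) (\<phi> h) (\<phi> h)))"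
  proof -
    have "(\<Sum>e\<in>arcs (graph T). L2.nsq (W (Inl e)) (dpull (on_rays \<phi>) (Inl e))) = 0"
      unfolding dpull_def pl(1) by (intro sum.neutral ballI dzero)
    then have "Re (tree_form T (on_rays \<phi>) (on_rays \<phi>))
        = 1 / 2 * (\<Sum>h\<in>rays T. L2.nsq (weighted {t N..} gauss) (weak_deriv (weighted {t N..} gauss) (\<phi> h)))"
      unfolding tree_nsq(2)[OF H] sum by (simp add: dpull_def pl(2) Wr del: edge_dom.simps)
    then show ?thesis
      using nu_ray_scaling(2)[OF hL(2)]
      by (simp add: sum_distrib_left red_form_eq[OF tN_ge0] weak_deriv_nu_ray mult.left_commute)
  qed
qed

text \<open>Upper bound: trial functions supported on single half-lines.\<close>

lemma upper_bound:
  assumes Z: "Z \<subseteq> {Vertex (root T)}"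
    and lam: "eigenvalue_sequence (tree_mu T) (form_operator (tree_mu T) (tree_dom Z) (tree_form T)) lam"
    and red: "eigenvalue_sequence (nu_from T (t N))
      (form_operator (nu_from T (t N)) (red_dom (t N) {t N}) (reduced_form T (t N))) red"
    and n: "1 \<le> n"
  shows "lam (m * n) \<le> red n"
proof -
  interpret tr: compact_form "tree_mu T" "tree_dom Z" "tree_form T" by (rule tree_compact[OF Z])
  interpret rd: compact_form "nu_from T (t N)" "red_dom (t N) {t N}" "reduced_form T (t N)"
    by (rule red_compact[OF tN_ge0 order_refl])
  have mono: "mono_on {1..} lam" "mono_on {1..} red"
    using lam red unfolding eigenvalue_sequence_def by blast+
  show ?thesis
  proof (rule tr.variational[OF lam], rule rd.variational[OF red])
    fix e \<epsilon>
    assume \<epsilon>D: "\<And>i. 1 \<le> i \<Longrightarrow> \<epsilon> i \<in> red_dom (t N) {t N}"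
      and \<epsilon>_le: "\<And>I c \<Lambda>. finite I \<Longrightarrow> (\<And>i. i \<in> I \<Longrightarrow> 1 \<le> i \<and> red i \<le> \<Lambda>) \<Longrightarrow>
        rd.nsq (\<lambda>x. \<Sum>i\<in>I. c i * \<epsilon> i x) \<le> \<Lambda> * L2.nsq (nu_from T (t N)) (\<lambda>x. \<Sum>i\<in>I. c i * \<epsilon> i x)"
      and \<epsilon>_pos: "\<And>I c k. finite I \<Longrightarrow> (\<And>i. i \<in> I \<Longrightarrow> 1 \<le> i) \<Longrightarrow> k \<in> I \<Longrightarrow> c k \<noteq> 0 \<Longrightarrow>
        0 < L2.nsq (nu_from T (t N)) (\<lambda>x. \<Sum>i\<in>I. c i * \<epsilon> i x)"
      and eD: "\<And>i. 1 \<le> i \<Longrightarrow> e i \<in> tree_dom Z"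
      and e_ge: "\<And>f \<Lambda>. finite {i. 1 \<le> i \<and> lam i < \<Lambda>} \<Longrightarrow> f \<in> tree_dom Z \<Longrightarrow>
        (\<And>i. 1 \<le> i \<Longrightarrow> lam i < \<Lambda> \<Longrightarrow> tr.ip f (e i) = 0) \<Longrightarrow> \<Lambda> * L2.nsq (tree_mu T) f \<le> tr.nsq f"
    define k where "k = m * n"
    have k1: "1 \<le> k" using m_pos n by (simp add: k_def Suc_le_eq)
    define J where "J = {i. 1 \<le> i \<and> lam i < lam k}"
    have J: "J \<subseteq> {1..<k}" unfolding J_def by (rule finite_index_below[OF mono(1) k1])
    have finJ: "finite J" using J by (rule finite_subset) simp
    have "card J \<le> k - 1" using card_mono[OF _ J] by simp
    then have "card J < k" using k1 by linarith
    \<comment> \<open>One unknown for each pair of a half-line and one of the first \<open>n\<close>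
      reduced eigenfunctions, against one condition for each eigenfunction on the tree strictly
      below \<open>lam k\<close>.\<close>
    then have card: "card J < card (rays T \<times> {1..n})"
      using m_card by (simp add: card_cartesian_product k_def)
    define U where "U p = on_rays (\<lambda>h. if h = fst p then \<epsilon> (snd p) else (\<lambda>s. 0))" for p :: "'h \<times> nat"
    have UD: "U p \<in> tree_dom Z" if "p \<in> rays T \<times> {1..n}" for p
    proof -
      have "U p \<in> tree_H1 T"
        unfolding U_def using that \<epsilon>D rd.zero by (intro on_rays_H1(1)) auto
      moreover have "U p z = 0" if "z \<in> Z" for z using that Z by (auto simp: U_def on_rays_def)
      ultimately show ?thesis by (simp add: tree_dom_def)
    qed
    obtain c where c: "\<exists>p\<in>rays T \<times> {1..n}. c p \<noteq> 0"
      "\<And>j. j \<in> J \<Longrightarrow> (\<Sum>p\<in>rays T \<times> {1..n}. c p * tr.ip (U p) (e j)) = 0"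
      using underdetermined_system[of J "rays T \<times> {1..n}" "\<lambda>j p. tr.ip (U p) (e j)"] finite_rays finJ card by auto
    define \<phi> where "\<phi> h = (\<lambda>s. \<Sum>i\<in>{1..n}. c (h, i) * \<epsilon> i s)" for h
    define u where "u = on_rays \<phi>"
    have \<phi>D: "\<phi> h \<in> red_dom (t N) {t N}" for h
      unfolding \<phi>_def using \<epsilon>D by (intro rd.sum_mem rd.scale) auto
    \<comment> \<open>Equality is restricted to points of the tree: at
      \<open>Inner (Inr h) s\<close> with \<open>h\<close> outside \<open>rays T\<close> the left
      side may be nonzero, whereas the sum is not.\<close>
    have u_eq: "u x = (\<Sum>p\<in>rays T \<times> {1..n}. c p * U p x)" if x: "x \<in> points T" for x
    proof (cases "\<exists>h s. x = Inner (Inr h) s")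
      case True
      then obtain h s where x': "x = Inner (Inr h) s" by blast
      then have h: "h \<in> rays T" using x by (auto simp: points_def edges_def)
      have "(\<Sum>p\<in>rays T \<times> {1..n}. c p * U p x)
          = (\<Sum>h'\<in>rays T. \<Sum>i\<in>{1..n}. if h' = h then c (h', i) * \<epsilon> i s else 0)"
        unfolding sum.cartesian_product by (intro sum.cong) (auto simp: U_def on_rays_def x')
      also have "\<dots> = (\<Sum>h'\<in>rays T. if h' = h then (\<Sum>i\<in>{1..n}. c (h', i) * \<epsilon> i s) else 0)"
        by (intro sum.cong) auto
      also have "\<dots> = (\<Sum>i\<in>{1..n}. c (h, i) * \<epsilon> i s)" using h finite_rays by simp
      finally show ?thesis by (simp add: u_def on_rays_def x' \<phi>_def)
    next
      case False
      then have "on_rays \<psi> x = 0" for \<psi> by (auto simp: on_rays_def split: point.split sum.split)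
      then show ?thesis by (simp add: u_def U_def)
    qed
    have uH: "u \<in> tree_H1 T" unfolding u_def by (rule on_rays_H1(1)[OF \<phi>D])
    have uD: "u \<in> tree_dom Z" using uH Z by (auto simp: tree_dom_def u_def on_rays_def)
    have norm: "real m * L2.nsq (tree_mu T) u = (\<Sum>h\<in>rays T. L2.nsq (nu_from T (t N)) (\<phi> h))"
      unfolding u_def by (rule on_rays_H1(2)[OF \<phi>D])
    have "lam k * L2.nsq (tree_mu T) u \<le> tr.nsq u"
    proof (rule e_ge)
      show "finite {i. 1 \<le> i \<and> lam i < lam k}" using finJ by (simp add: J_def)
      show "u \<in> tree_dom Z" by (rule uD)
      fix j assume j: "1 \<le> j" "lam j < lam k"
      have sp: "space (tree_mu T) = points T" by (simp add: tree_mu_def space_tree_length)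
      have "tr.ip u (e j) = tr.ip (\<lambda>x. \<Sum>p\<in>rays T \<times> {1..n}. c p * U p x) (e j)"
        by (rule L2_inner_cong) (simp_all add: sp u_eq)
      also have "\<dots> = (\<Sum>p\<in>rays T \<times> {1..n}. c p * tr.ip (U p) (e j))"
        using UD eD[OF j(1)] tr.D_L2 by (subst L2.B_sum) (auto simp: L2.B_scale L2.scale subset_iff)
      also have "\<dots> = 0" using j by (intro c(2)) (simp add: J_def)
      finally show "tr.ip u (e j) = 0" .
    qed
    then have "real m * (lam k * L2.nsq (tree_mu T) u) \<le> real m * tr.nsq u"
      by (rule mult_left_mono) simp
    also have "\<dots> = (\<Sum>h\<in>rays T. rd.nsq (\<phi> h))" unfolding u_def by (rule on_rays_H1(3)[OF \<phi>D])
    also have "\<dots> \<le> (\<Sum>h\<in>rays T. red n * L2.nsq (nu_from T (t N)) (\<phi> h))"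
    proof (rule sum_mono)
      fix h
      show "rd.nsq (\<phi> h) \<le> red n * L2.nsq (nu_from T (t N)) (\<phi> h)"
        unfolding \<phi>_def
      proof (rule \<epsilon>_le)
        show "1 \<le> i \<and> red i \<le> red n" if "i \<in> {1..n}" for i
          using that mono_onD[OF mono(2), of i n] by auto
      qed simp
    qed
    also have "\<dots> = red n * (real m * L2.nsq (tree_mu T) u)" unfolding norm by (simp add: sum_distrib_left)
    finally have "lam k * (real m * L2.nsq (tree_mu T) u) \<le> red n * (real m * L2.nsq (tree_mu T) u)"
      by (simp add: mult_ac)
    \<comment> \<open>A nonzero coefficient \<open>c (h, i)\<close> makes \<open>\<phi> h\<close>
      nonzero by independence of the reduced eigenfunctions, and the contributions of different
      half-lines add up without cancellation.\<close>
    moreover have "0 < real m * L2.nsq (tree_mu T) u"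
    proof -
      obtain h i where hi: "h \<in> rays T" "i \<in> {1..n}" "c (h, i) \<noteq> 0" using c(1) by auto
      have "0 < L2.nsq (nu_from T (t N)) (\<phi> h)"
        unfolding \<phi>_def by (rule \<epsilon>_pos[of "{1..n}" i "\<lambda>i. c (h, i)"]) (use hi in auto)
      also have "\<dots> \<le> (\<Sum>h\<in>rays T. L2.nsq (nu_from T (t N)) (\<phi> h))"
        using hi(1) finite_rays \<phi>D rd.D_L2 by (intro member_le_sum) (auto intro!: L2.B_nonneg)
      finally show ?thesis by (simp only: norm)
    qed
    ultimately have "lam k \<le> red n" by (rule mult_right_le_imp_le)
    then show ?thesis by (simp add: k_def)
  qed
qed

end

theorem proposition4p14:
  fixes T :: "('v, 'e, 'h) tree_data"
    and N :: nat and t :: "nat \<Rightarrow> real" and b :: "nat \<Rightarrow> nat" and m :: nat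
    and lamD lamN :: "nat \<Rightarrow> real"
    and redD redN :: "nat \<Rightarrow> nat \<Rightarrow> real"
  assumes "regular_tree T N t b"
    and "m = card (rays T)" and "m = (\<Prod>k\<le>N. b k)"
    and "eigenvalue_sequence (tree_mu T) (OU_D T) lamD"
    and "eigenvalue_sequence (tree_mu T) (OU_N T) lamN"
    and "eigenvalue_sequence (nu_from T (t 0)) (reduced_D T (t 0)) (redD 0)"
    and "eigenvalue_sequence (nu_from T (t 0)) (reduced_N T (t 0)) (redN 0)"
    and "eigenvalue_sequence (nu_from T (t N)) (reduced_D T (t N)) (redD N)"
  shows "\<forall>n\<ge>1.
      (redD 0 n \<le> lamD (m * (n - 1) + 1) \<and>
       (\<forall>j \<in> {m * (n - 1) + 1 ..< m * n}. lamD j \<le> lamD (j + 1)) \<and>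
       lamD (m * n) \<le> redD N n) \<and>
      (redN 0 n \<le> lamN (m * (n - 1) + 1) \<and>
       (\<forall>j \<in> {m * (n - 1) + 1 ..< m * n}. lamN j \<le> lamN (j + 1)) \<and>
       lamN (m * n) \<le> redD N n)"
proof -
  interpret reg_tree T N t b m using assms(1-3) by unfold_locales
  have ops: "OU_D T = form_operator (tree_mu T) (tree_dom {Vertex (root T)}) (tree_form T)"
    "OU_N T = form_operator (tree_mu T) (tree_dom {}) (tree_form T)"
    "reduced_D T x = form_operator (nu_from T x) (red_dom x {x}) (reduced_form T x)"
    "reduced_N T x = form_operator (nu_from T x) (red_dom x {}) (reduced_form T x)" for x
    by (simp_all add: OU_D_def OU_N_def reduced_D_def reduced_N_def tree_dom_def tree_H1_0_def red_dom_def)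
  note eig = assms(4-8)[unfolded ops t_0]
  have step: "lam j \<le> lam (j + 1)" if "eigenvalue_sequence M A lam" "1 \<le> j"
    for M :: "'z measure" and A lam and j :: nat
    using that by (auto simp: eigenvalue_sequence_def intro: mono_onD)
  show ?thesis
  proof (intro allI impI conjI ballI)
    fix n :: nat assume n: "1 \<le> n"
    show "redD 0 n \<le> lamD (m * (n - 1) + 1)"
      by (rule lower_bound[OF _ _ _ eig(1,3) n]) auto
    show "redN 0 n \<le> lamN (m * (n - 1) + 1)"
      by (rule lower_bound[OF _ _ _ eig(2,4) n]) auto
    show "lamD (m * n) \<le> redD N n"
      by (rule upper_bound[OF _ eig(1,5) n]) auto
    \<comment> \<open>The trial functions vanish at the feet of the half-lines and everywhere below
      them, whatever is required at the root; so the reduced Dirichlet operator bounds the Neumann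
      eigenvalues too.\<close>
    show "lamN (m * n) \<le> redD N n"
      by (rule upper_bound[OF _ eig(2,5) n]) auto
    show "lamD j \<le> lamD (j + 1)" if "j \<in> {m * (n - 1) + 1 ..< m * n}" for j
      using step[OF assms(4), of j] that by simp
    show "lamN j \<le> lamN (j + 1)" if "j \<in> {m * (n - 1) + 1 ..< m * n}" for j
      using step[OF assms(5), of j] that by simp
  qed
qed

end
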